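(* Let $\delta>0$, $S>0$, $U_0\in H^2_*(\Omega)$, $V_0\in L^2(\Omega)$ and $F\in L^2(\Omega)$ (time-independent). If $0\le P\le\Lambda_1$, then the weak solution $U$ on $[0,\infty)$ of the plate problem with data $(\delta,S,P,F,U_0,V_0)$ satisfies $U(t)\to\overline U$ in $H^2_*(\Omega)$ and $U'(t)\to0$ in $L^2(\Omega)$ as $t\to\infty$, where $\overline U\in H^2_*(\Omega)$ is the unique solution of the stationary problem.
   Context: Let $0<\sigma<\frac12$, $l>0$ and $\Omega=(0,\pi)\times(-l,l)$. Let $H^2_*(\Omega)=\{U\in H^2(\Omega): U=0 \text{ on } \{0,\pi\}\times[-l,l]\}$, equipped with the inner product $(U,V)_2=\int_\Omega\big(\Delta U\Delta V-(1-\sigma)(U_{xx}V_{yy}+U_{yy}V_{xx}-2U_{xy}V_{xy})\big)$ and norm $\|\cdot\|_2$. Let $(\cdot,\cdot)_0,\|\cdot\|_0$ be the inner product and norm of $L^2(\Omega)$, $\mathcal{H}$ the dual space of $H^2_*(\Omega)$ and $\langle\cdot,\cdot\rangle$ the duality $\mathcal{H}\times H^2_*(\Omega)$ (with $L^2(\Omega)\subset\mathcal H$ via $\langle f,V\rangle=(f,V)_0$). Primes denote time derivatives. Put $\phi(U)=-P+S\int_\Omega U_x^2$. The plate problem is $U_{tt}+\delta U_t+\Delta^2U-\phi(U)U_{xx}=F$ in $\Omega\times(0,\infty)$, with $U=U_{xx}=0$ on $\{0,\pi\}\times[-l,l]$, $U_{yy}+\sigma U_{xx}=U_{yyy}+(2-\sigma)U_{xxy}=0$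 on $[0,\pi]\times\{-l,l\}$, $U(\cdot,0)=U_0$, $U_t(\cdot,0)=V_0$. A weak solution on $[0,T]$ is a function $U\in\mathcal{C}^0([0,T],H^2_*(\Omega))\cap\mathcal{C}^1([0,T],L^2(\Omega))\cap\mathcal{C}^2([0,T],\mathcal{H})$ with $U(0)=U_0$, $U'(0)=V_0$ and $\langle U'',V\rangle+\delta(U',V)_0+(U,V)_2+\phi(U)(U_x,V_x)_0=(F,V)_0$ for all $t\in[0,T]$, $V\in H^2_*(\Omega)$; a weak solution on $[0,\infty)$ is one on every $[0,T]$ (it exists and is unique). The stationary problem is $\Delta^2U-\phi(U)U_{xx}=F$ in $\Omega$ with the same boundary conditions, understood weakly: $U\in H^2_*(\Omega)$ and $(U,V)_2+\phi(U)(U_x,V_x)_0=(F,V)_0$ for all $V\in H^2_*(\Omega)$. $\Lambda_1$ is the least eigenvalue $\Lambda$ of the buckling problem $\Delta^2w+\Lambda w_{xx}=0$ in $\Omega$ with the same boundary conditions, i.e. $(w,z)_2=\Lambda(w_x,z_x)_0$ for all $z\in H^2_*(\Omega)$. *)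

theory Defs
  imports "HOL-Analysis.Analysis"
begin

text \<open>
  Elements of function spaces over the plate are represented by total functions on the plane.
  They are identified when they agree almost everywhere on the plate, so the norms below are
  seminorms on representatives, and equality of elements is written with \<open>AE\<close>.
\<close>

type_synonym plane_fun = "real \<times> real \<Rightarrow> real"

definition plate :: "real \<Rightarrow> (real \<times> real) set" where
  "plate l = {0<..<pi} \<times> {-l<..<l}"

definition L2 :: "real \<Rightarrow> plane_fun set" where
  "L2 l = {f. f \<in> borel_measurable (lebesgue_on (plate l)) \<and>
              integrable (lebesgue_on (plate l)) (\<lambda>z. (f z)\<^sup>2)}"

definition inner0 :: "real \<Rightarrow> plane_fun \<Rightarrow> plane_fun \<Rightarrow> real" where
  "inner0 l f g = (LINT z|lebesgue_on (plate l). f z * g z)"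

definition norm0 :: "real \<Rightarrow> plane_fun \<Rightarrow> real" where
  "norm0 l f = sqrt (inner0 l f f)"


subsection \<open>Weak derivatives and the space of admissible displacements\<close>

definition dir_deriv :: "real \<times> real \<Rightarrow> plane_fun \<Rightarrow> plane_fun" where
  "dir_deriv v f z = frechet_derivative f (at z) v"

text \<open>\<open>partial_deriv a b\<close> is classical: \<open>a\<close> derivatives in \<open>x\<close> and \<open>b\<close> derivatives in \<open>y\<close>.\<close>

definition partial_deriv :: "nat \<Rightarrow> nat \<Rightarrow> plane_fun \<Rightarrow> plane_fun" where
  "partial_deriv a b f = (dir_deriv (1, 0) ^^ a) ((dir_deriv (0, 1) ^^ b) f)"

fun C_k :: "nat \<Rightarrow> plane_fun \<Rightarrow> bool" where
  "C_k 0 f \<longleftrightarrow> continuous_on UNIV f"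
| "C_k (Suc k) f \<longleftrightarrow>
     (\<forall>z. f differentiable (at z)) \<and> C_k k (dir_deriv (1, 0) f) \<and> C_k k (dir_deriv (0, 1) f)"

definition test_functions :: "real \<Rightarrow> plane_fun set" where
  "test_functions l = {\<psi>. (\<forall>k. C_k k \<psi>) \<and> compact (closure {z. \<psi> z \<noteq> 0}) \<and>
                            closure {z. \<psi> z \<noteq> 0} \<subseteq> plate l}"

definition is_weak_deriv :: "real \<Rightarrow> nat \<Rightarrow> nat \<Rightarrow> plane_fun \<Rightarrow> plane_fun \<Rightarrow> bool" where
  "is_weak_deriv l a b f g \<longleftrightarrow> g \<in> L2 l \<and>
     (\<forall>\<psi>\<in>test_functions l. inner0 l f (partial_deriv a b \<psi>) = (-1) ^ (a + b) * inner0 l g \<psi>)"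

text \<open>The chosen representative is determined up to a null set of the plate.\<close>

definition weak_deriv :: "real \<Rightarrow> nat \<Rightarrow> nat \<Rightarrow> plane_fun \<Rightarrow> plane_fun" where
  "weak_deriv l a b f = (SOME g. is_weak_deriv l a b f g)"

definition H2 :: "real \<Rightarrow> plane_fun set" where
  "H2 l = {f \<in> L2 l. \<forall>a b. a + b \<le> 2 \<longrightarrow> (\<exists>g. is_weak_deriv l a b f g)}"

text \<open>
  In dimension two \<open>H\<^sup>2\<close> embeds into the continuous functions on the closed rectangle; the
  boundary values of a class are those of its continuous representative.
\<close>

definition H2_star :: "real \<Rightarrow> plane_fun set" where
  "H2_star l = {f \<in> H2 l. \<exists>u. continuous_on (closure (plate l)) u \<and>
                  (AE z in lebesgue_on (plate l). f z = u z) \<and>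
                  (\<forall>z \<in> {0, pi} \<times> {-l..l}. u z = 0)}"

definition inner2 :: "real \<Rightarrow> real \<Rightarrow> plane_fun \<Rightarrow> plane_fun \<Rightarrow> real" where
  "inner2 l \<sigma> f g = (LINT z|lebesgue_on (plate l).
      (weak_deriv l 2 0 f z + weak_deriv l 0 2 f z) * (weak_deriv l 2 0 g z + weak_deriv l 0 2 g z)
      - (1 - \<sigma>) * (weak_deriv l 2 0 f z * weak_deriv l 0 2 g z
                   + weak_deriv l 0 2 f z * weak_deriv l 2 0 g z
                   - 2 * weak_deriv l 1 1 f z * weak_deriv l 1 1 g z))"

definition norm2 :: "real \<Rightarrow> real \<Rightarrow> plane_fun \<Rightarrow> real" where
  "norm2 l \<sigma> f = sqrt (inner2 l \<sigma> f f)"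


subsection \<open>The dual space\<close>

text \<open>
  Functionals are total functions on representatives, but only their values on \<open>H2_star\<close>
  matter. Linearity and boundedness make them constant on a.e.-classes.
\<close>

definition dual_space :: "real \<Rightarrow> real \<Rightarrow> (plane_fun \<Rightarrow> real) set" where
  "dual_space l \<sigma> = {\<Phi>.
     (\<forall>f\<in>H2_star l. \<forall>g\<in>H2_star l. \<forall>a b. \<Phi> (\<lambda>z. a * f z + b * g z) = a * \<Phi> f + b * \<Phi> g) \<and>
     (\<exists>C. \<forall>f\<in>H2_star l. \<bar>\<Phi> f\<bar> \<le> C * norm2 l \<sigma> f)}"

definition dual_norm :: "real \<Rightarrow> real \<Rightarrow> (plane_fun \<Rightarrow> real) \<Rightarrow> real" where
  "dual_norm l \<sigma> \<Phi> = (SUP f\<in>{f \<in> H2_star l. norm2 l \<sigma> f \<le> 1}. \<bar>\<Phi> f\<bar>)"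


subsection \<open>Curves in a seminormed space of real-valued functions\<close>

text \<open>
  \<open>X\<close> is the carrier and \<open>N\<close> the seminorm. Both plane functions and functionals on them are
  real-valued functions, so the same notions serve for \<open>H2_star\<close>, \<open>L2\<close> and the dual.
\<close>

definition continuous_curve ::
  "('a \<Rightarrow> real) set \<Rightarrow> (('a \<Rightarrow> real) \<Rightarrow> real) \<Rightarrow> real set \<Rightarrow> (real \<Rightarrow> 'a \<Rightarrow> real) \<Rightarrow> bool" where
  "continuous_curve X N I c \<longleftrightarrow>
     (\<forall>t\<in>I. c t \<in> X \<and> ((\<lambda>s. N (\<lambda>z. c s z - c t z)) \<longlongrightarrow> 0) (at t within I))"

definition curve_derivative ::
  "('a \<Rightarrow> real) set \<Rightarrow> (('a \<Rightarrow> real) \<Rightarrow> real) \<Rightarrow> real set \<Rightarrow>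
   (real \<Rightarrow> 'a \<Rightarrow> real) \<Rightarrow> (real \<Rightarrow> 'a \<Rightarrow> real) \<Rightarrow> bool" where
  "curve_derivative X N I c c' \<longleftrightarrow>
     (\<forall>t\<in>I. c t \<in> X \<and> c' t \<in> X \<and>
        ((\<lambda>s. N (\<lambda>z. (c s z - c t z) / (s - t) - c' t z)) \<longlongrightarrow> 0) (at t within I))"


subsection \<open>The plate problem\<close>

definition nonlocal_coeff :: "real \<Rightarrow> real \<Rightarrow> real \<Rightarrow> plane_fun \<Rightarrow> real" where
  "nonlocal_coeff l S P f = - P + S * (LINT z|lebesgue_on (plate l). (weak_deriv l 1 0 f z)\<^sup>2)"

text \<open>
  \<open>U'\<close> is the derivative of \<open>U\<close> in \<open>L2\<close>; \<open>U''\<close> is the derivative of \<open>U'\<close> in the dual space,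
  where \<open>f\<close> in \<open>L2\<close> is the functional \<open>inner0 l f\<close>. Since this embedding is continuous, \<open>U'\<close> is
  also the first derivative of \<open>U\<close> in the dual space.
\<close>

definition weak_solution_upto ::
  "real \<Rightarrow> real \<Rightarrow> real \<Rightarrow> real \<Rightarrow> real \<Rightarrow> plane_fun \<Rightarrow> plane_fun \<Rightarrow> plane_fun \<Rightarrow>
   real \<Rightarrow> (real \<Rightarrow> plane_fun) \<Rightarrow> bool" where
  "weak_solution_upto l \<sigma> \<delta> S P F U0 V0 T U \<longleftrightarrow>
     continuous_curve (H2_star l) (norm2 l \<sigma>) {0..T} U \<and>
     (\<exists>U' U''.
        curve_derivative (L2 l) (norm0 l) {0..T} U U' \<and>
        continuous_curve (L2 l) (norm0 l) {0..T} U' \<and>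
        curve_derivative (dual_space l \<sigma>) (dual_norm l \<sigma>) {0..T} (\<lambda>t. inner0 l (U' t)) U'' \<and>
        continuous_curve (dual_space l \<sigma>) (dual_norm l \<sigma>) {0..T} U'' \<and>
        (AE z in lebesgue_on (plate l). U 0 z = U0 z) \<and>
        (AE z in lebesgue_on (plate l). U' 0 z = V0 z) \<and>
        (\<forall>t\<in>{0..T}. \<forall>V\<in>H2_star l.
           U'' t V + \<delta> * inner0 l (U' t) V + inner2 l \<sigma> (U t) V
           + nonlocal_coeff l S P (U t) * inner0 l (weak_deriv l 1 0 (U t)) (weak_deriv l 1 0 V)
           = inner0 l F V))"

definition weak_solution ::
  "real \<Rightarrow> real \<Rightarrow> real \<Rightarrow> real \<Rightarrow> real \<Rightarrow> plane_fun \<Rightarrow> plane_fun \<Rightarrow> plane_fun \<Rightarrow>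
   (real \<Rightarrow> plane_fun) \<Rightarrow> bool" where
  "weak_solution l \<sigma> \<delta> S P F U0 V0 U \<longleftrightarrow>
     (\<forall>T>0. weak_solution_upto l \<sigma> \<delta> S P F U0 V0 T U)"

definition stationary_solution ::
  "real \<Rightarrow> real \<Rightarrow> real \<Rightarrow> real \<Rightarrow> plane_fun \<Rightarrow> plane_fun \<Rightarrow> bool" where
  "stationary_solution l \<sigma> S P F W \<longleftrightarrow> W \<in> H2_star l \<and>
     (\<forall>V\<in>H2_star l.
        inner2 l \<sigma> W V
        + nonlocal_coeff l S P W * inner0 l (weak_deriv l 1 0 W) (weak_deriv l 1 0 V)
        = inner0 l F V)"

definition buckling_eigenvalue :: "real \<Rightarrow> real \<Rightarrow> real \<Rightarrow> bool" where
  "buckling_eigenvalue l \<sigma> \<Lambda> \<longleftrightarrow>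
     (\<exists>w\<in>H2_star l. \<not> (AE z in lebesgue_on (plate l). w z = 0) \<and>
        (\<forall>v\<in>H2_star l.
           inner2 l \<sigma> w v = \<Lambda> * inner0 l (weak_deriv l 1 0 w) (weak_deriv l 1 0 v)))"

definition Lambda1 :: "real \<Rightarrow> real \<Rightarrow> real" where
  "Lambda1 l \<sigma> = (LEAST \<Lambda>. buckling_eigenvalue l \<sigma> \<Lambda>)"

end

theory Submission imports Defs "HOL-Complex_Analysis.Great_Picard" begin

text \<open>
  Write \<open>a\<close> for the bending form \<open>(\<cdot>,\<cdot>)\<^sub>2\<close>,
  \<open>b(u,v) = (u\<^sub>x,v\<^sub>x)\<^sub>0\<close>, and \<open>J(u) = a(u,u)/2 - (P/2)
  b(u,u) + (S/4) b(u,u)\<^sup>2 - (F,u)\<^sub>0\<close>. Stationary solutions are the critical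
  points of \<open>J\<close>, and the plate problem is a damped second-order equation with
  potential \<open>J\<close>.

  The infimum of \<open>a(u,u)/b(u,u)\<close> is attained and is the least buckling eigenvalue, so
  \<open>P \<le> \<Lambda>\<^sub>1\<close> means that \<open>a - P b\<close> is positive
  semidefinite (\<open>rayleigh_minimiser\<close>, \<open>Lambda1_bound\<close>). For a critical
  point \<open>W\<close> and \<open>w = u - W\<close> there is the exact identity \<open>J(u) -
  J(W) = (a(w,w) - P b(w,w))/2 + (S/4) (b(u,u) - b(W,W))\<^sup>2 + (S/2) b(W,W) b(w,w)\<close>
  with three nonnegative terms (\<open>potential_excess\<close>). Hence \<open>W\<close>
  minimises \<open>J\<close> and is unique, and \<open>J(u) \<longrightarrow> J(W)\<close>
  forces \<open>u \<longrightarrow> W\<close> in the bending norm even when \<open>a - P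
  b\<close> degenerates, because the quartic term controls \<open>b(w,w)\<close>
  (\<open>potential_limit_imp_convergence\<close>). A minimiser exists because minimising
  sequences are Cauchy (\<open>exists_minimiser\<close>).

  Along a trajectory let \<open>e = |u'|\<^sup>2/2 + J(u) - J(W)\<close>. Then \<open>e' = -
  \<delta> |u'|\<^sup>2\<close>; since \<open>u'\<close> lies only in \<open>L\<^sup>2\<close>,
  this is proved with central difference quotients as test functions
  (\<open>energy_derivative\<close>). Testing the equation with \<open>w = u - W\<close> and
  using convexity gives \<open>((u',w)\<^sub>0 + (\<delta>/2) |w|\<^sup>2)' \<le> (3/2)
  |u'|\<^sup>2 - e\<close>. So the nonnegative function \<open>Y = (u',w)\<^sub>0 + (\<delta>/2)
  |w|\<^sup>2 + (3/(2\<delta>)) e\<close> satisfies \<open>Y' \<le> - e\<close>. As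
  \<open>e\<close> decreases, \<open>(t - 1) e(t) \<le> Y(1)\<close>, and \<open>e
  \<longrightarrow> 0\<close> gives both limits (\<open>damped_trajectory_converges\<close>).

  This argument needs of \<open>H\<^sup>2\<^sub>*\<close> only that it is complete, that bounded
  sequences have subsequences that are Cauchy in the norm of \<open>b\<close>, the Poincare
  inequalities, and \<open>b(u,v) = - (u\<^sub>x\<^sub>x,v)\<^sub>0\<close>. All four are
  obtained by duality with finite sums of products \<open>\<alpha>(x) \<beta>(y)\<close> of
  smooth functions. Such a product may be integrated in one variable, and the hinged sides
  permit \<open>\<alpha>\<close> to be arbitrary at \<open>x = 0\<close> and \<open>x =
  \<pi>\<close>. Products that approximate point masses yield a Hoelder estimate for the
  continuous representative (\<open>H2_star_hoelder\<close>), from which completeness follows,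
  and compactness by the theorem of Arzela and Ascoli.
\<close>

section \<open>Semi-inner product spaces of functions\<close>

text \<open>
  The first-order condition at a minimum, used both for orthogonality and for Euler equations.
\<close>

lemma linear_coefficient_zero:
  assumes "\<And>t::real. 0 \<le> 2 * t * p + t\<^sup>2 * q" and "q \<ge> 0"
  shows "p = 0"
proof (rule ccontr)
  assume "p \<noteq> 0"
  define r where "r = 1 / (q + 1)"
  have r: "r > 0" "r * q = 1 - r" using assms(2) by (auto simp: r_def field_simps)
  have "0 \<le> 2 * (- p * r) * p + (- p * r)\<^sup>2 * q" by (rule assms)
  also have "\<dots> = p\<^sup>2 * r * (r * q - 2)" by (simp add: power2_eq_square algebra_simps)
  also have "\<dots> < 0" using \<open>p \<noteq> 0\<close> r by (intro mult_pos_neg) auto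
  finally show False by simp
qed

text \<open>
  Elements are functions, not classes modulo null vectors, so the form is only semidefinite and
  the linear operations are pointwise.
\<close>

locale semi_inner =
  fixes X :: "('a \<Rightarrow> real) set" and ip :: "('a \<Rightarrow> real) \<Rightarrow> ('a \<Rightarrow> real) \<Rightarrow> real"
  assumes zero_mem: "(\<lambda>_. 0) \<in> X"
    and comb_mem: "f \<in> X \<Longrightarrow> g \<in> X \<Longrightarrow> (\<lambda>z. a * f z + b * g z) \<in> X"
    and ip_comb: "f \<in> X \<Longrightarrow> g \<in> X \<Longrightarrow> k \<in> X \<Longrightarrow> ip (\<lambda>z. a * f z + b * g z) k = a * ip f k + b * ip g k"
    and ip_sym: "f \<in> X \<Longrightarrow> g \<in> X \<Longrightarrow> ip f g = ip g f"
    and ip_nonneg: "f \<in> X \<Longrightarrow> 0 \<le> ip f f"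
begin

definition nrm :: "('a \<Rightarrow> real) \<Rightarrow> real" where "nrm f = sqrt (ip f f)"

lemma scale_mem: "f \<in> X \<Longrightarrow> (\<lambda>z. c * f z) \<in> X"
  using comb_mem[of f f c 0] by simp

lemma add_mem: "f \<in> X \<Longrightarrow> g \<in> X \<Longrightarrow> (\<lambda>z. f z + g z) \<in> X"
  using comb_mem[of f g 1 1] by simp

lemma diff_mem: "f \<in> X \<Longrightarrow> g \<in> X \<Longrightarrow> (\<lambda>z. f z - g z) \<in> X"
  using comb_mem[of f g 1 "-1"] by simp

lemma ip_comb_right:
  "f \<in> X \<Longrightarrow> g \<in> X \<Longrightarrow> k \<in> X \<Longrightarrow> ip k (\<lambda>z. a * f z + b * g z) = a * ip k f + b * ip k g"
  using ip_comb[of f g k a b] ip_sym[OF comb_mem[of f g a b], of k] ip_sym[of f k] ip_sym[of g k] by simp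

lemma ip_diff: "f \<in> X \<Longrightarrow> g \<in> X \<Longrightarrow> k \<in> X \<Longrightarrow> ip (\<lambda>z. f z - g z) k = ip f k - ip g k"
  using ip_comb[of f g k 1 "-1"] by simp

lemma ip_diff_right: "f \<in> X \<Longrightarrow> g \<in> X \<Longrightarrow> k \<in> X \<Longrightarrow> ip k (\<lambda>z. f z - g z) = ip k f - ip k g"
  using ip_comb_right[of f g k 1 "-1"] by simp

lemma ip_scale: "f \<in> X \<Longrightarrow> k \<in> X \<Longrightarrow> ip (\<lambda>z. c * f z) k = c * ip f k"
  using ip_comb[of f f k c 0] by simp

lemma ip_scale_right: "f \<in> X \<Longrightarrow> k \<in> X \<Longrightarrow> ip k (\<lambda>z. c * f z) = c * ip k f"
  using ip_comb_right[of f f k c 0] by simp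

lemma ip_square_comb:
  assumes "f \<in> X" "g \<in> X"
  shows "ip (\<lambda>z. a * f z + b * g z) (\<lambda>z. a * f z + b * g z) = a\<^sup>2 * ip f f + 2 * a * b * ip f g + b\<^sup>2 * ip g g"
  using assms by (simp add: ip_comb ip_comb_right comb_mem ip_sym[of g f] power2_eq_square algebra_simps)

lemma ip_square_diff:
  assumes "f \<in> X" "g \<in> X"
  shows "ip (\<lambda>z. f z - g z) (\<lambda>z. f z - g z) = ip f f - 2 * ip f g + ip g g"
  using ip_square_comb[OF assms, of 1 "-1"] by simp

lemma nrm_nonneg [simp]: "f \<in> X \<Longrightarrow> 0 \<le> nrm f"
  by (simp add: nrm_def ip_nonneg)

lemma nrm_square: "f \<in> X \<Longrightarrow> (nrm f)\<^sup>2 = ip f f"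
  by (simp add: nrm_def ip_nonneg)

lemma nrm_diff_commute: "f \<in> X \<Longrightarrow> g \<in> X \<Longrightarrow> nrm (\<lambda>z. f z - g z) = nrm (\<lambda>z. g z - f z)"
  unfolding nrm_def using ip_sym[of f g] by (simp add: ip_square_diff)

lemma cauchy_schwarz:
  assumes f: "f \<in> X" and g: "g \<in> X"
  shows "\<bar>ip f g\<bar> \<le> nrm f * nrm g"
proof -
  have q: "0 \<le> ip f f + 2 * c * ip f g + c\<^sup>2 * ip g g" for c
    using ip_nonneg[OF comb_mem[OF f g, of 1 c]] ip_square_comb[OF f g, of 1 c] by simp
  have "(ip f g)\<^sup>2 \<le> ip f f * ip g g"
  proof (cases "ip g g = 0")
    case True
    have "ip f g = 0"
    proof (rule ccontr)
      assume ne: "ip f g \<noteq> 0"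
      have "0 \<le> ip f f + 2 * (- (ip f f + 1) / (2 * ip f g)) * ip f g"
        using q[of "- (ip f f + 1) / (2 * ip f g)"] True by simp
      also have "\<dots> = -1" using ne by (simp add: field_simps)
      finally show False by simp
    qed
    then show ?thesis using True by simp
  next
    case False
    then have pos: "ip g g > 0" using ip_nonneg[OF g] by simp
    have "0 \<le> ip f f - (ip f g)\<^sup>2 / ip g g"
      using q[of "- ip f g / ip g g"] False by (simp add: field_simps power2_eq_square)
    then show ?thesis using pos by (simp add: field_simps)
  qed
  then have "\<bar>ip f g\<bar> \<le> sqrt (ip f f * ip g g)"
    by (metis real_sqrt_abs real_sqrt_le_mono)
  then show ?thesis by (simp add: nrm_def real_sqrt_mult)
qed

lemma nrm_triangle:
  assumes f: "f \<in> X" and g: "g \<in> X"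
  shows "nrm (\<lambda>z. f z + g z) \<le> nrm f + nrm g"
proof -
  have "(nrm (\<lambda>z. f z + g z))\<^sup>2 = ip f f + 2 * ip f g + ip g g"
    using ip_square_comb[OF f g, of 1 1] f g by (simp add: nrm_square add_mem)
  also have "\<dots> \<le> (nrm f + nrm g)\<^sup>2"
    using cauchy_schwarz[OF f g] f g by (simp add: power2_sum nrm_square)
  finally show ?thesis by (rule power2_le_imp_le) (simp add: f g)
qed

lemma nrm_triangle_diff:
  assumes "f \<in> X" "g \<in> X" "k \<in> X"
  shows "nrm (\<lambda>z. f z - k z) \<le> nrm (\<lambda>z. f z - g z) + nrm (\<lambda>z. g z - k z)"
  using nrm_triangle[OF diff_mem[OF assms(1,2)] diff_mem[OF assms(2,3)]] by simp

lemma nrm_le_add_diff: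
  assumes "f \<in> X" "g \<in> X"
  shows "nrm f \<le> nrm g + nrm (\<lambda>z. f z - g z)"
  using nrm_triangle[OF assms(2) diff_mem[OF assms]] by simp

lemma nrm_eq_0_ip: "f \<in> X \<Longrightarrow> g \<in> X \<Longrightarrow> nrm f = 0 \<Longrightarrow> ip f g = 0"
  using cauchy_schwarz[of f g] by simp

lemma ip_tendsto:
  assumes "\<forall>\<^sub>F s in \<F>. f s \<in> X" "\<forall>\<^sub>F s in \<F>. g s \<in> X" and f0: "f0 \<in> X" and g0: "g0 \<in> X"
    and lf: "((\<lambda>s. nrm (\<lambda>z. f s z - f0 z)) \<longlongrightarrow> 0) \<F>"
    and lg: "((\<lambda>s. nrm (\<lambda>z. g s z - g0 z)) \<longlongrightarrow> 0) \<F>"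
  shows "((\<lambda>s. ip (f s) (g s)) \<longlongrightarrow> ip f0 g0) \<F>"
proof -
  let ?m = "\<lambda>s. nrm (\<lambda>z. f s z - f0 z)" and ?n = "\<lambda>s. nrm (\<lambda>z. g s z - g0 z)"
  have "((\<lambda>s. ip (f s) (g s) - ip f0 g0) \<longlongrightarrow> 0) \<F>"
  proof (rule Lim_null_comparison)
    have "((\<lambda>s. ?m s * ?n s + ?m s * nrm g0 + nrm f0 * ?n s) \<longlongrightarrow> 0 * 0 + 0 * nrm g0 + nrm f0 * 0) \<F>"
      by (intro tendsto_intros lf lg)
    then show "((\<lambda>s. ?m s * ?n s + ?m s * nrm g0 + nrm f0 * ?n s) \<longlongrightarrow> 0) \<F>" by simp
    show "\<forall>\<^sub>F s in \<F>. norm (ip (f s) (g s) - ip f0 g0) \<le> ?m s * ?n s + ?m s * nrm g0 + nrm f0 * ?n s"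
      using assms(1,2)
    proof eventually_elim
      case (elim s)
      have "ip (f s) (g s) - ip f0 g0 = ip (\<lambda>z. f s z - f0 z) (\<lambda>z. g s z - g0 z)
          + ip (\<lambda>z. f s z - f0 z) g0 + ip f0 (\<lambda>z. g s z - g0 z)"
        using elim f0 g0 by (simp add: ip_diff ip_diff_right diff_mem)
      moreover have "\<bar>ip (\<lambda>z. f s z - f0 z) (\<lambda>z. g s z - g0 z)\<bar> \<le> ?m s * ?n s"
        "\<bar>ip (\<lambda>z. f s z - f0 z) g0\<bar> \<le> ?m s * nrm g0" "\<bar>ip f0 (\<lambda>z. g s z - g0 z)\<bar> \<le> nrm f0 * ?n s"
        using elim f0 g0 by (simp_all add: cauchy_schwarz diff_mem)
      ultimately show ?case by (simp add: abs_le_iff)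
    qed
  qed
  then show ?thesis by (simp add: LIM_zero_cancel)
qed

lemma tendsto_const_curve: "f \<in> X \<Longrightarrow> ((\<lambda>s. nrm (\<lambda>z. f z - f z)) \<longlongrightarrow> 0) \<F>"
  using ip_square_diff[of f f] by (simp add: nrm_def)

lemma comb_tendsto:
  assumes "\<forall>\<^sub>F s in \<F>. f s \<in> X" "\<forall>\<^sub>F s in \<F>. g s \<in> X" and f0: "f0 \<in> X" and g0: "g0 \<in> X"
    and lf: "((\<lambda>s. nrm (\<lambda>z. f s z - f0 z)) \<longlongrightarrow> 0) \<F>"
    and lg: "((\<lambda>s. nrm (\<lambda>z. g s z - g0 z)) \<longlongrightarrow> 0) \<F>"
    and a: "(a \<longlongrightarrow> a0) \<F>"
  shows "((\<lambda>s. nrm (\<lambda>z. (f s z + a s * g s z) - (f0 z + a0 * g0 z))) \<longlongrightarrow> 0) \<F>"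
proof (rule Lim_null_comparison)
  let ?m = "\<lambda>s. nrm (\<lambda>z. f s z - f0 z)" and ?n = "\<lambda>s. nrm (\<lambda>z. g s z - g0 z)"
  have "((\<lambda>s. ?m s + \<bar>a s\<bar> * ?n s + \<bar>a s - a0\<bar> * nrm g0) \<longlongrightarrow> 0 + \<bar>a0\<bar> * 0 + \<bar>a0 - a0\<bar> * nrm g0) \<F>"
    by (intro tendsto_intros lf lg a)
  then show "((\<lambda>s. ?m s + \<bar>a s\<bar> * ?n s + \<bar>a s - a0\<bar> * nrm g0) \<longlongrightarrow> 0) \<F>" by simp
  show "\<forall>\<^sub>F s in \<F>. norm (nrm (\<lambda>z. (f s z + a s * g s z) - (f0 z + a0 * g0 z))) \<le> ?m s + \<bar>a s\<bar> * ?n s + \<bar>a s - a0\<bar> * nrm g0"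
    using assms(1,2)
  proof eventually_elim
    case (elim s)
    have sc: "nrm (\<lambda>z. c * k z) = \<bar>c\<bar> * nrm k" if "k \<in> X" for c k
      using that by (simp add: nrm_def ip_scale ip_scale_right scale_mem real_sqrt_mult mult.assoc[symmetric])
    note d = diff_mem[OF elim(1) f0] diff_mem[OF elim(2) g0]
    note d' = scale_mem[OF d(2), of "a s"] scale_mem[OF g0, of "a s - a0"]
    have "(\<lambda>z. (f s z + a s * g s z) - (f0 z + a0 * g0 z)) = (\<lambda>z. (f s z - f0 z) + a s * (g s z - g0 z) + (a s - a0) * g0 z)"
      by (auto simp: algebra_simps)
    moreover have "nrm (\<lambda>z. (f s z - f0 z) + a s * (g s z - g0 z) + (a s - a0) * g0 z) \<le> ?m s + \<bar>a s\<bar> * ?n s + \<bar>a s - a0\<bar> * nrm g0"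
      using nrm_triangle[OF add_mem[OF d(1) d'(1)] d'(2)] nrm_triangle[OF d(1) d'(1)]
      by (simp add: sc[OF d(2)] sc[OF g0])
    moreover have "0 \<le> nrm (\<lambda>z. (f s z - f0 z) + a s * (g s z - g0 z) + (a s - a0) * g0 z)"
      by (intro nrm_nonneg add_mem d d')
    ultimately show ?case by simp
  qed
qed

definition complete :: bool where
  "complete \<longleftrightarrow> (\<forall>s. (\<forall>n::nat. s n \<in> X) \<longrightarrow>
     (\<forall>e>0. \<exists>N. \<forall>m\<ge>N. \<forall>n\<ge>N. nrm (\<lambda>z. s m z - s n z) < e) \<longrightarrow>
     (\<exists>f\<in>X. (\<lambda>n. nrm (\<lambda>z. s n z - f z)) \<longlonglongrightarrow> 0))"

text \<open>
  Minimising sequences are shown to converge through this criterion: the gap to the infimum of the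
  \<open>n\<close>-th term is below \<open>r n\<close>, and \<open>G\<close> converts a gap into
  a bound for the squared distance.
\<close>

lemma cauchy_criterion:
  assumes s: "\<And>n::nat. s n \<in> X" and r: "r \<longlonglongrightarrow> 0"
    and le: "\<And>m n. ip (\<lambda>z. s m z - s n z) (\<lambda>z. s m z - s n z) \<le> G (r m + r n)"
    and G: "(G \<longlongrightarrow> 0) (at_right 0)" and rpos: "\<And>n. r n > (0::real)"
    and e: "e > 0"
  shows "\<exists>N. \<forall>m\<ge>N. \<forall>n\<ge>N. nrm (\<lambda>z. s m z - s n z) < e"
proof -
  have "\<forall>\<^sub>F x in at_right 0. G x < e\<^sup>2"
    using G e by (intro order_tendstoD(2)[where y=0]) auto
  then obtain d where d: "d > 0" "\<And>x. 0 < x \<Longrightarrow> x < d \<Longrightarrow> G x < e\<^sup>2"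
    unfolding eventually_at_right_field by auto
  have "\<forall>\<^sub>F n in sequentially. r n < d / 2" using r d by (intro order_tendstoD(2)[where y=0]) auto
  then obtain N where N: "\<And>n. n \<ge> N \<Longrightarrow> r n < d / 2" unfolding eventually_sequentially by auto
  have "nrm (\<lambda>z. s m z - s n z) < e" if "m \<ge> N" "n \<ge> N" for m n
  proof -
    have "ip (\<lambda>z. s m z - s n z) (\<lambda>z. s m z - s n z) < e\<^sup>2"
      using le[of m n] d(2)[of "r m + r n"] N[OF that(1)] N[OF that(2)] rpos[of m] rpos[of n] by linarith
    then show ?thesis unfolding nrm_def using e by (metis real_sqrt_less_mono real_sqrt_abs abs_of_pos)
  qed
  then show ?thesis by blast
qed

text \<open>
  The projection theorem. A sequence in \<open>K\<close> minimising the distance to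
  \<open>f\<close> is Cauchy by the parallelogram law, and \<open>f\<close> minus its limit is
  orthogonal to \<open>K\<close>, hence null.
\<close>

theorem dense_if_orthogonal_trivial:
  assumes compl: "complete" and KX: "K \<subseteq> X" and K0: "(\<lambda>_. 0) \<in> K"
    and Kcomb: "\<And>f g a b. f \<in> K \<Longrightarrow> g \<in> K \<Longrightarrow> (\<lambda>z. a * f z + b * g z) \<in> K"
    and orth: "\<And>f. f \<in> X \<Longrightarrow> (\<And>k. k \<in> K \<Longrightarrow> ip f k = 0) \<Longrightarrow> nrm f = 0"
    and f: "f \<in> X" and e: "e > 0"
  shows "\<exists>k\<in>K. nrm (\<lambda>z. f z - k z) < e"
proof -
  define Z where "Z = (\<lambda>k. ip (\<lambda>z. f z - k z) (\<lambda>z. f z - k z))"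
  define d where "d = Inf (Z ` K)"
  have Z0: "0 \<le> Z k" if "k \<in> K" for k using that KX f by (auto simp: Z_def intro!: ip_nonneg diff_mem)
  have bdd: "bdd_below (Z ` K)" using Z0 by (auto intro!: bdd_belowI)
  have d_le: "d \<le> Z k" if "k \<in> K" for k using that bdd by (auto simp: d_def intro: cInf_lower)
  have "\<exists>k\<in>K. Z k < d + 1 / real (Suc n)" for n
    using cInf_lessD[of "Z ` K" "d + 1 / real (Suc n)"] K0 by (auto simp: d_def)
  then obtain s where s: "\<And>n. s n \<in> K" "\<And>n. Z (s n) < d + 1 / real (Suc n)" by metis
  have sX: "s n \<in> X" for n using s KX by auto
  have mid: "ip (\<lambda>z. s m z - s n z) (\<lambda>z. s m z - s n z) \<le> 2 * (1 / real (Suc m) + 1 / real (Suc n))" for m n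
  proof -
    have "d \<le> Z (\<lambda>z. 1/2 * s m z + 1/2 * s n z)" by (intro d_le Kcomb s)
    also have "\<dots> = ip (\<lambda>z. 1/2 * (f z - s m z) + 1/2 * (f z - s n z)) (\<lambda>z. 1/2 * (f z - s m z) + 1/2 * (f z - s n z))"
    proof -
      have "(\<lambda>z. f z - (1/2 * s m z + 1/2 * s n z)) = (\<lambda>z. 1/2 * (f z - s m z) + 1/2 * (f z - s n z))"
        by (rule ext) (simp add: algebra_simps)
      then show ?thesis unfolding Z_def by simp
    qed
    also have "\<dots> = (Z (s m) + 2 * ip (\<lambda>z. f z - s m z) (\<lambda>z. f z - s n z) + Z (s n)) / 4"
      by (subst ip_square_comb) (auto simp: Z_def power2_eq_square intro!: diff_mem f sX)
    finally have 1: "4 * d \<le> Z (s m) + 2 * ip (\<lambda>z. f z - s m z) (\<lambda>z. f z - s n z) + Z (s n)" by simp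
    have "ip (\<lambda>z. s m z - s n z) (\<lambda>z. s m z - s n z)
       = ip (\<lambda>z. (f z - s n z) - (f z - s m z)) (\<lambda>z. (f z - s n z) - (f z - s m z))" by simp
    also have "\<dots> = Z (s n) - 2 * ip (\<lambda>z. f z - s n z) (\<lambda>z. f z - s m z) + Z (s m)"
      unfolding Z_def by (rule ip_square_diff) (auto intro!: diff_mem f sX)
    also have "\<dots> \<le> 2 * (1 / real (Suc m) + 1 / real (Suc n))"
      using 1 s(2)[of m] s(2)[of n] ip_sym[OF diff_mem[OF f sX[of n]] diff_mem[OF f sX[of m]]]
      by simp
    finally show ?thesis .
  qed
  have null: "(\<lambda>n. 1 / real (Suc n)) \<longlonglongrightarrow> 0" using LIMSEQ_inverse_real_of_nat by (simp add: inverse_eq_divide)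
  have G: "((\<lambda>x. 2 * x) \<longlongrightarrow> 0) (at_right (0::real))" by (auto intro!: tendsto_eq_intros)
  have "\<exists>N. \<forall>m\<ge>N. \<forall>n\<ge>N. nrm (\<lambda>z. s m z - s n z) < e" if "e > 0" for e
    by (rule cauchy_criterion[OF sX null mid G _ that]) simp
  then obtain p where p: "p \<in> X" "(\<lambda>n. nrm (\<lambda>z. s n z - p z)) \<longlonglongrightarrow> 0"
    using compl sX unfolding complete_def by blast
  have shift: "(\<lambda>n. nrm (\<lambda>z. (f z - (c * k z + s n z)) - ((f z - p z) - c * k z))) \<longlonglongrightarrow> 0" for c k
  proof -
    have "(\<lambda>z. (f z - (c * k z + s n z)) - ((f z - p z) - c * k z)) = (\<lambda>z. p z - s n z)" for n
      by (simp add: fun_eq_iff)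
    then show ?thesis using p(2) nrm_diff_commute[OF sX p(1)] by simp
  qed
  have far: "d \<le> ip (\<lambda>z. (f z - p z) - c * k z) (\<lambda>z. (f z - p z) - c * k z)" if "k \<in> K" for c k
  proof (rule tendsto_lowerbound)
    have kX: "k \<in> X" using that KX by auto
    have m: "(\<lambda>z. f z - (c * k z + s n z)) \<in> X" for n
      using comb_mem[OF kX sX[of n], of c 1] f by (intro diff_mem) auto
    have m': "(\<lambda>z. (f z - p z) - c * k z) \<in> X" by (intro diff_mem f p scale_mem kX)
    show "(\<lambda>n. ip (\<lambda>z. f z - (c * k z + s n z)) (\<lambda>z. f z - (c * k z + s n z)))
       \<longlonglongrightarrow> ip (\<lambda>z. (f z - p z) - c * k z) (\<lambda>z. (f z - p z) - c * k z)"
      using m m' shift by (intro ip_tendsto) auto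
    show "\<forall>\<^sub>F n in sequentially. d \<le> ip (\<lambda>z. f z - (c * k z + s n z)) (\<lambda>z. f z - (c * k z + s n z))"
      using d_le[OF Kcomb[OF that s(1), of c 1]] by (simp add: Z_def)
  qed simp
  have lim: "(\<lambda>n. Z (s n)) \<longlonglongrightarrow> ip (\<lambda>z. f z - p z) (\<lambda>z. f z - p z)"
    unfolding Z_def using shift[of 0 "\<lambda>_. 0"]
    by (intro ip_tendsto always_eventually allI) (simp_all add: diff_mem f sX p(1))
  have "(\<lambda>n. d + 1 / real (Suc n)) \<longlonglongrightarrow> d + 0" by (intro tendsto_intros null)
  then have ZL: "ip (\<lambda>z. f z - p z) (\<lambda>z. f z - p z) \<le> d"
    using s(2) by (intro LIMSEQ_le[OF lim]) (auto intro: less_imp_le)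
  have fp: "(\<lambda>z. f z - p z) \<in> X" by (intro diff_mem f p)
  have "nrm (\<lambda>z. f z - p z) = 0"
  proof (rule orth[OF fp])
    fix k assume k: "k \<in> K"
    then have kX: "k \<in> X" using KX by auto
    show "ip (\<lambda>z. f z - p z) k = 0"
    proof (rule linear_coefficient_zero)
      fix t
      show "0 \<le> 2 * t * ip (\<lambda>z. f z - p z) k + t\<^sup>2 * ip k k"
        using far[OF k, of "-t"] ZL ip_square_comb[OF fp kX, of 1 t] by simp
    qed (simp add: ip_nonneg kX)
  qed
  then have "nrm (\<lambda>z. f z - s n z) = nrm (\<lambda>z. p z - s n z)" for n
    using nrm_triangle_diff[OF f p(1) sX[of n]] nrm_triangle_diff[OF p(1) f sX[of n]]
      nrm_diff_commute[OF f p(1)] by simp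
  moreover have "\<forall>\<^sub>F n in sequentially. nrm (\<lambda>z. s n z - p z) < e"
    using p(2) e by (intro order_tendstoD(2)[where y=0]) auto
  ultimately have "\<forall>\<^sub>F n in sequentially. nrm (\<lambda>z. f z - s n z) < e"
    using nrm_diff_commute[OF p(1) sX] by simp
  then obtain n where "nrm (\<lambda>z. f z - s n z) < e"
    using eventually_happens by fastforce
  then show ?thesis using s(1) by blast
qed

end

section \<open>Convexity of the potential energy\<close>

text \<open>
  The setting of the evolution and of the stationary problem: \<open>V\<close> with the bending
  form \<open>a\<close> and the stretching form \<open>b\<close>, and \<open>H\<close> with the
  inner product \<open>h\<close> of \<open>L\<^sup>2\<close>. The operator \<open>D\<close> is
  the second x-derivative; \<open>b_D\<close> extends \<open>b u\<close> from \<open>V\<close>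
  to \<open>H\<close>, so that the nonlocal term is a force in \<open>H\<close>.
\<close>

locale plate_forms = A: semi_inner V a + B: semi_inner V b + H: semi_inner H h
  for V :: "('a \<Rightarrow> real) set" and a b :: "('a \<Rightarrow> real) \<Rightarrow> ('a \<Rightarrow> real) \<Rightarrow> real"
    and H :: "('a \<Rightarrow> real) set" and h :: "('a \<Rightarrow> real) \<Rightarrow> ('a \<Rightarrow> real) \<Rightarrow> real" +
  fixes D :: "('a \<Rightarrow> real) \<Rightarrow> 'a \<Rightarrow> real" and Cb Ch Cd :: real
  assumes V_H: "V \<subseteq> H"
    and C_nonneg: "0 \<le> Cb" "0 \<le> Ch" "0 \<le> Cd"
    and b_le: "u \<in> V \<Longrightarrow> b u u \<le> Cb * a u u"
    and h_le: "u \<in> V \<Longrightarrow> h u u \<le> Ch * b u u"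
    and D_mem: "u \<in> V \<Longrightarrow> D u \<in> H"
    and b_D: "u \<in> V \<Longrightarrow> v \<in> V \<Longrightarrow> b u v = - h (D u) v"
    and D_le: "u \<in> V \<Longrightarrow> v \<in> V \<Longrightarrow>
      h (\<lambda>z. D u z - D v z) (\<lambda>z. D u z - D v z) \<le> Cd * a (\<lambda>z. u z - v z) (\<lambda>z. u z - v z)"
    and V_complete: "A.complete"
    and V_compact: "(\<And>n::nat. s n \<in> V) \<Longrightarrow> (\<And>n. a (s n) (s n) \<le> M) \<Longrightarrow>
      \<exists>r::nat \<Rightarrow> nat. strict_mono r \<and>
        (\<forall>e>0. \<exists>N. \<forall>m\<ge>N. \<forall>n\<ge>N. B.nrm (\<lambda>z. s (r m) z - s (r n) z) < e)"
begin

lemma in_H: "u \<in> V \<Longrightarrow> u \<in> H" using V_H by auto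

lemma B_nrm_le: "u \<in> V \<Longrightarrow> B.nrm u \<le> sqrt Cb * A.nrm u"
  unfolding A.nrm_def B.nrm_def real_sqrt_mult[symmetric] by (intro real_sqrt_le_mono b_le)

lemma H_nrm_le: "u \<in> V \<Longrightarrow> H.nrm u \<le> sqrt Ch * B.nrm u"
  unfolding H.nrm_def B.nrm_def real_sqrt_mult[symmetric] by (intro real_sqrt_le_mono h_le)

lemma D_nrm_le: "u \<in> V \<Longrightarrow> v \<in> V \<Longrightarrow> H.nrm (\<lambda>z. D u z - D v z) \<le> sqrt Cd * A.nrm (\<lambda>z. u z - v z)"
  unfolding H.nrm_def A.nrm_def real_sqrt_mult[symmetric] by (intro real_sqrt_le_mono D_le)

lemma B_lim:
  assumes "\<forall>\<^sub>F s in \<F>. f s \<in> V" "f0 \<in> V" "((\<lambda>s. A.nrm (\<lambda>z. f s z - f0 z)) \<longlongrightarrow> 0) \<F>"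
  shows "((\<lambda>s. B.nrm (\<lambda>z. f s z - f0 z)) \<longlongrightarrow> 0) \<F>"
proof (rule Lim_null_comparison)
  show "((\<lambda>s. sqrt Cb * A.nrm (\<lambda>z. f s z - f0 z)) \<longlongrightarrow> 0) \<F>" using tendsto_mult_right_zero[OF assms(3)] by simp
  show "\<forall>\<^sub>F s in \<F>. norm (B.nrm (\<lambda>z. f s z - f0 z)) \<le> sqrt Cb * A.nrm (\<lambda>z. f s z - f0 z)"
    using assms(1) by eventually_elim (simp add: assms(2) A.diff_mem B_nrm_le)
qed

lemma H_lim:
  assumes "\<forall>\<^sub>F s in \<F>. f s \<in> V" "f0 \<in> V" "((\<lambda>s. A.nrm (\<lambda>z. f s z - f0 z)) \<longlongrightarrow> 0) \<F>"
  shows "((\<lambda>s. H.nrm (\<lambda>z. f s z - f0 z)) \<longlongrightarrow> 0) \<F>"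
proof (rule Lim_null_comparison)
  show "((\<lambda>s. sqrt Ch * B.nrm (\<lambda>z. f s z - f0 z)) \<longlongrightarrow> 0) \<F>"
    using tendsto_mult_right_zero[OF B_lim[OF assms]] by simp
  show "\<forall>\<^sub>F s in \<F>. norm (H.nrm (\<lambda>z. f s z - f0 z)) \<le> sqrt Ch * B.nrm (\<lambda>z. f s z - f0 z)"
    using assms(1) by eventually_elim (simp add: assms(2) A.diff_mem H_nrm_le in_H)
qed

lemma D_lim:
  assumes "\<forall>\<^sub>F s in \<F>. f s \<in> V" "f0 \<in> V" "((\<lambda>s. A.nrm (\<lambda>z. f s z - f0 z)) \<longlongrightarrow> 0) \<F>"
  shows "((\<lambda>s. H.nrm (\<lambda>z. D (f s) z - D f0 z)) \<longlongrightarrow> 0) \<F>"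
proof (rule Lim_null_comparison)
  show "((\<lambda>s. sqrt Cd * A.nrm (\<lambda>z. f s z - f0 z)) \<longlongrightarrow> 0) \<F>" using tendsto_mult_right_zero[OF assms(3)] by simp
  show "\<forall>\<^sub>F s in \<F>. norm (H.nrm (\<lambda>z. D (f s) z - D f0 z)) \<le> sqrt Cd * A.nrm (\<lambda>z. f s z - f0 z)"
    using assms(1) by eventually_elim (simp add: assms(2) D_mem H.diff_mem D_nrm_le)
qed

lemma b_zero_imp_h_zero: "u \<in> V \<Longrightarrow> b u u = 0 \<Longrightarrow> h u u = 0"
  using h_le[of u] H.ip_nonneg[OF in_H] by (simp add: antisym)

definition potential :: "real \<Rightarrow> real \<Rightarrow> ('a \<Rightarrow> real) \<Rightarrow> ('a \<Rightarrow> real) \<Rightarrow> real" where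
  "potential S P F u = a u u / 2 - P / 2 * b u u + S / 4 * (b u u)\<^sup>2 - h F u"

definition residual :: "real \<Rightarrow> real \<Rightarrow> ('a \<Rightarrow> real) \<Rightarrow> ('a \<Rightarrow> real) \<Rightarrow> ('a \<Rightarrow> real) \<Rightarrow> real" where
  "residual S P F u v = a u v + (- P + S * b u u) * b u v - h F v"

definition critical :: "real \<Rightarrow> real \<Rightarrow> ('a \<Rightarrow> real) \<Rightarrow> ('a \<Rightarrow> real) \<Rightarrow> bool" where
  "critical S P F u \<longleftrightarrow> u \<in> V \<and> (\<forall>v\<in>V. residual S P F u v = 0)"

text \<open>
  The square of \<open>b\<close> is expanded in powers of the increment of \<open>b\<close> and
  not in powers of \<open>w\<close>; the terms after the residual are then \<open>a - P
  b\<close>, a square and a product of nonnegative factors.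
\<close>

lemma potential_expansion:
  assumes u: "u \<in> V" and w: "w \<in> V" and F: "F \<in> H"
  shows "potential S P F (\<lambda>z. u z + w z) - potential S P F u = residual S P F u w
     + (a w w - P * b w w) / 2 + S / 4 * (b (\<lambda>z. u z + w z) (\<lambda>z. u z + w z) - b u u)\<^sup>2 + S / 2 * b u u * b w w"
proof -
  have "a (\<lambda>z. u z + w z) (\<lambda>z. u z + w z) = a u u + 2 * a u w + a w w"
    using A.ip_square_comb[OF u w, of 1 1] by simp
  moreover have "b (\<lambda>z. u z + w z) (\<lambda>z. u z + w z) = b u u + 2 * b u w + b w w"
    using B.ip_square_comb[OF u w, of 1 1] by simp
  moreover have "h F (\<lambda>z. u z + w z) = h F u + h F w"
    using H.ip_comb_right[OF in_H[OF u] in_H[OF w] F, of 1 1] by simp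
  ultimately show ?thesis
    unfolding potential_def residual_def by (simp add: field_simps power2_eq_square)
qed

lemma potential_tendsto:
  assumes "\<forall>\<^sub>F s in \<F>. f s \<in> V" "u \<in> V" "F \<in> H" "((\<lambda>s. A.nrm (\<lambda>z. f s z - u z)) \<longlongrightarrow> 0) \<F>"
  shows "((\<lambda>s. potential S P F (f s)) \<longlongrightarrow> potential S P F u) \<F>"
  unfolding potential_def
proof (intro tendsto_intros)
  show "((\<lambda>s. a (f s) (f s)) \<longlongrightarrow> a u u) \<F>" by (intro A.ip_tendsto assms)
  show "((\<lambda>s. b (f s) (f s)) \<longlongrightarrow> b u u) \<F>" by (intro B.ip_tendsto B_lim assms)
  then show "((\<lambda>s. b (f s) (f s)) \<longlongrightarrow> b u u) \<F>" .
  show "((\<lambda>s. h F (f s)) \<longlongrightarrow> h F u) \<F>"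
    using assms by (intro H.ip_tendsto H_lim H.tendsto_const_curve) (auto intro: in_H elim: eventually_mono)
qed simp_all

context
  fixes S P :: real and F :: "'a \<Rightarrow> real"
  assumes S: "0 < S" and P: "0 \<le> P" and F: "F \<in> H"
    and P_le: "\<And>u. u \<in> V \<Longrightarrow> P * b u u \<le> a u u"
begin

text \<open>
  The quadratic part is nonnegative, and the load is at most linear in the norm of
  \<open>b\<close>, so the quartic term dominates it.
\<close>

lemma potential_bounded_below: "bdd_below (potential S P F ` V)"
proof (rule bdd_belowI2)
  fix u assume u: "u \<in> V"
  define K where "K = H.nrm F * sqrt Ch"
  have K: "0 \<le> K" unfolding K_def using F C_nonneg by simp
  define r where "r = B.nrm u"
  have r: "0 \<le> r" "b u u = r\<^sup>2" using u by (simp_all add: r_def B.nrm_square)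
  have "\<bar>h F u\<bar> \<le> H.nrm F * H.nrm u" using H.cauchy_schwarz[OF F in_H[OF u]] .
  also have "\<dots> \<le> K * r" unfolding K_def r_def mult.assoc by (intro mult_left_mono H_nrm_le u) (simp add: F)
  finally have 1: "h F u \<le> K * r" by simp
  have "K * r \<le> K * (1 + r\<^sup>2)"
  proof (intro mult_left_mono K)
    have "0 \<le> (r - 1)\<^sup>2" by simp
    then show "r \<le> 1 + r\<^sup>2" using r(1) by (simp add: power2_diff)
  qed
  \<comment> \<open>the square is chosen so that its cross term is \<open>K r\<^sup>2\<close>, to be absorbed by the quartic term\<close>
  moreover have "0 \<le> (S / 2 * r\<^sup>2 - K)\<^sup>2 / S" using S by simp
  then have "K * r\<^sup>2 \<le> S / 4 * (r\<^sup>2)\<^sup>2 + K\<^sup>2 / S" using S by (simp add: power2_diff field_simps power2_eq_square)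
  ultimately show "- K - K\<^sup>2 / S \<le> potential S P F u"
    using 1 P_le[OF u] r unfolding potential_def by (simp add: algebra_simps)
qed

text \<open>
  Uniform convexity. The quartic term contributes a multiple of the fourth power of the stretching
  distance, which compensates the possible degeneracy of \<open>a - P b\<close>.
\<close>

lemma potential_midpoint:
  assumes u: "u \<in> V" and v: "v \<in> V"
  defines "d \<equiv> \<lambda>z. u z - v z"
  shows "potential S P F (\<lambda>z. 1/2 * u z + 1/2 * v z) + (a d d - P * b d d) / 8 + S / 64 * (b d d)\<^sup>2
     \<le> (potential S P F u + potential S P F v) / 2"
proof -
  have ad: "a d d = a u u - 2 * a u v + a v v" unfolding d_def by (rule A.ip_square_diff[OF u v])
  have bd: "b d d = b u u - 2 * b u v + b v v" unfolding d_def by (rule B.ip_square_diff[OF u v])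
  define p where "p = (b u u + b v v) / 2"
  define q where "q = b d d / 4"
  have q0: "0 \<le> q" using B.ip_nonneg[OF B.diff_mem[OF u v]] by (simp add: q_def d_def)
  have am: "a (\<lambda>z. 1/2 * u z + 1/2 * v z) (\<lambda>z. 1/2 * u z + 1/2 * v z) = (a u u + 2 * a u v + a v v) / 4"
    using A.ip_square_comb[OF u v, of "1/2" "1/2"] by (simp add: power2_eq_square)
  have bm: "b (\<lambda>z. 1/2 * u z + 1/2 * v z) (\<lambda>z. 1/2 * u z + 1/2 * v z) = p - q"
    using B.ip_square_comb[OF u v, of "1/2" "1/2"] bd by (simp add: power2_eq_square p_def q_def field_simps)
  have hm: "h F (\<lambda>z. 1/2 * u z + 1/2 * v z) = (h F u + h F v) / 2"
    using H.ip_comb_right[OF in_H[OF u] in_H[OF v] F, of "1/2" "1/2"] by simp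
  have "0 \<le> p - q" using B.ip_nonneg[OF B.comb_mem[OF u v, of "1/2" "1/2"]] bm by simp
  then have "q\<^sup>2 \<le> q * (2 * p - q)" using q0 unfolding power2_eq_square by (intro mult_left_mono) auto
  moreover have "(b u u)\<^sup>2 + (b v v)\<^sup>2 = 2 * p\<^sup>2 + (b u u - b v v)\<^sup>2 / 2"
    unfolding p_def by (simp add: power2_eq_square field_simps)
  then have "2 * p\<^sup>2 \<le> (b u u)\<^sup>2 + (b v v)\<^sup>2" by simp
  ultimately have "(p - q)\<^sup>2 + q\<^sup>2 \<le> ((b u u)\<^sup>2 + (b v v)\<^sup>2) / 2"
    by (simp add: power2_eq_square algebra_simps)
  then have "S / 4 * ((p - q)\<^sup>2 + q\<^sup>2) \<le> S / 4 * (((b u u)\<^sup>2 + (b v v)\<^sup>2) / 2)"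
    using S by (intro mult_left_mono) auto
  moreover have "q\<^sup>2 = (b d d)\<^sup>2 / 16" by (simp add: q_def power2_eq_square)
  moreover have "P * b d d = P * (b u u) - 2 * (P * b u v) + P * (b v v)" by (simp add: bd algebra_simps)
  moreover have "P * (p - q) = (P * b u u + 2 * (P * b u v) + P * b v v) / 4"
    by (simp add: p_def q_def bd field_simps)
  ultimately show ?thesis
    unfolding potential_def am bm hm ad by (simp add: algebra_simps diff_divide_distrib add_divide_distrib)
qed

text \<open>
  By \<open>potential_midpoint\<close> a minimising sequence is Cauchy with respect to \<open>a -
  P b\<close> and to \<open>b\<close>, hence with respect to \<open>a\<close>.
\<close>

lemma exists_minimiser: "\<exists>u\<in>V. \<forall>v\<in>V. potential S P F u \<le> potential S P F v"
proof -
  let ?J = "potential S P F"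
  define m where "m = Inf (?J ` V)"
  have m_le: "m \<le> ?J u" if "u \<in> V" for u
    using that potential_bounded_below by (auto simp: m_def intro: cInf_lower)
  have "\<exists>u\<in>V. ?J u < m + 1 / real (Suc n)" for n
    using cInf_lessD[of "?J ` V" "m + 1 / real (Suc n)"] A.zero_mem by (auto simp: m_def)
  then obtain s where s: "\<And>n. s n \<in> V" "\<And>n. ?J (s n) < m + 1 / real (Suc n)" by metis
  \<comment> \<open>the midpoint inequality bounds \<open>a - P b\<close> by the first summand and \<open>b\<close> by the square root\<close>
  define G where "G = (\<lambda>x. 4 * x + P * sqrt (32 / S * x))"
  have est: "a (\<lambda>z. s j z - s k z) (\<lambda>z. s j z - s k z) \<le> G (1 / real (Suc j) + 1 / real (Suc k))" for j k
  proof -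
    define d where "d = (\<lambda>z. s j z - s k z)"
    define x where "x = 1 / real (Suc j) + 1 / real (Suc k)"
    have d: "d \<in> V" unfolding d_def by (intro A.diff_mem s)
    have "m \<le> ?J (\<lambda>z. 1/2 * s j z + 1/2 * s k z)" by (intro m_le A.comb_mem s)
    then have le: "(a d d - P * b d d) / 8 + S / 64 * (b d d)\<^sup>2 \<le> x / 2"
      using potential_midpoint[OF s(1)[of j] s(1)[of k]] s(2)[of j] s(2)[of k]
      unfolding d_def[symmetric] x_def by argo
    have Q: "0 \<le> a d d - P * b d d" using P_le[OF d] by simp
    have "S / 64 * (b d d)\<^sup>2 \<le> x / 2" using le Q by argo
    then have "(b d d)\<^sup>2 \<le> 32 / S * x" using S by (simp add: field_simps)
    then have "b d d \<le> sqrt (32 / S * x)" by (rule real_le_rsqrt)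
    then have "P * b d d \<le> P * sqrt (32 / S * x)" using P by (intro mult_left_mono)
    moreover have "0 \<le> S / 64 * (b d d)\<^sup>2" using S by simp
    then have "a d d - P * b d d \<le> 4 * x" using le by argo
    ultimately show ?thesis unfolding G_def d_def x_def by linarith
  qed
  have null: "(\<lambda>n. 1 / real (Suc n)) \<longlonglongrightarrow> 0" using LIMSEQ_inverse_real_of_nat by (simp add: inverse_eq_divide)
  have G: "(G \<longlongrightarrow> 0) (at_right 0)"
    unfolding G_def using S by (auto intro!: tendsto_eq_intros)
  have "\<exists>N. \<forall>m\<ge>N. \<forall>n\<ge>N. A.nrm (\<lambda>z. s m z - s n z) < e" if "e > 0" for e
    by (rule A.cauchy_criterion[OF s(1) null est G _ that]) simp
  then obtain u where u: "u \<in> V" "(\<lambda>n. A.nrm (\<lambda>z. s n z - u z)) \<longlonglongrightarrow> 0"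
    using V_complete s(1) unfolding A.complete_def by blast
  have "(\<lambda>n. ?J (s n)) \<longlonglongrightarrow> ?J u" using s(1) by (intro potential_tendsto u F) simp
  moreover have "(\<lambda>n. m + 1 / real (Suc n)) \<longlonglongrightarrow> m + 0" by (intro tendsto_intros null)
  ultimately have "?J u \<le> m + 0"
    using s(2) by (intro LIMSEQ_le) (auto intro: less_imp_le)
  then show ?thesis using u(1) m_le by (auto intro!: bexI[of _ u] intro: order_trans)
qed

lemma exists_critical: "\<exists>u. critical S P F u"
proof -
  obtain u where u: "u \<in> V" and min: "\<And>v. v \<in> V \<Longrightarrow> potential S P F u \<le> potential S P F v"
    using exists_minimiser by blast
  have "residual S P F u v = 0" if v: "v \<in> V" for v
  proof -
    define p where "p = (\<lambda>t. t * residual S P F u v + t\<^sup>2 * ((a v v - P * b v v) / 2)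
       + S / 4 * (2 * t * b u v + t\<^sup>2 * b v v)\<^sup>2 + t\<^sup>2 * (S / 2 * b u u * b v v))"
    have p: "0 \<le> p t" for t
    proof -
      have tv: "(\<lambda>z. t * v z) \<in> V" by (rule A.scale_mem[OF v])
      have 1: "residual S P F u (\<lambda>z. t * v z) = t * residual S P F u v"
        using u v F by (simp add: residual_def A.ip_scale_right B.ip_scale_right H.ip_scale_right in_H algebra_simps)
      have 2: "a (\<lambda>z. t * v z) (\<lambda>z. t * v z) = t\<^sup>2 * a v v" "b (\<lambda>z. t * v z) (\<lambda>z. t * v z) = t\<^sup>2 * b v v"
        using v by (simp_all add: A.ip_scale_right A.ip_scale A.scale_mem B.ip_scale B.ip_scale_right power2_eq_square)
      have 3: "b (\<lambda>z. u z + t * v z) (\<lambda>z. u z + t * v z) = b u u + 2 * t * b u v + t\<^sup>2 * b v v"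
        using B.ip_square_comb[OF u v, of 1 t] by simp
      have "potential S P F (\<lambda>z. u z + t * v z) - potential S P F u = p t"
        unfolding potential_expansion[OF u tv F] p_def 1 2 3 by (simp add: algebra_simps)
      then show ?thesis using min[OF A.add_mem[OF u tv]] by simp
    qed
    have "(p has_real_derivative residual S P F u v) (at 0)"
      unfolding p_def by (auto intro!: derivative_eq_intros)
    moreover have "p 0 = 0" by (simp add: p_def)
    ultimately show ?thesis using p by (intro DERIV_local_min[of p _ 0 1]) auto
  qed
  then show ?thesis unfolding critical_def using u by blast
qed

text \<open>
  All three terms are nonnegative; uniqueness and convergence are both read off from them.
\<close>

lemma potential_excess:
  assumes W: "critical S P F W" and u: "u \<in> V"
  defines "w \<equiv> \<lambda>z. u z - W z"
  shows "potential S P F u - potential S P F W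
     = (a w w - P * b w w) / 2 + S / 4 * (b u u - b W W)\<^sup>2 + S / 2 * b W W * b w w"
proof -
  have W': "W \<in> V" "w \<in> V" using W u A.diff_mem unfolding critical_def w_def by auto
  have "(\<lambda>z. W z + w z) = u" by (simp add: w_def)
  then show ?thesis
    using potential_expansion[OF W' F, of S P] W W'(2) unfolding critical_def by simp
qed

lemma potential_ge_critical:
  assumes W: "critical S P F W" and u: "u \<in> V"
  shows "potential S P F W \<le> potential S P F u"
proof -
  have W': "W \<in> V" using W by (simp add: critical_def)
  have w: "(\<lambda>z. u z - W z) \<in> V" by (intro A.diff_mem u W')
  have "0 \<le> S / 2 * b W W * b (\<lambda>z. u z - W z) (\<lambda>z. u z - W z)"
    using S by (intro mult_nonneg_nonneg B.ip_nonneg w W') auto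
  moreover have "0 \<le> S / 4 * (b u u - b W W)\<^sup>2" using S by simp
  ultimately show ?thesis using potential_excess[OF W u] P_le[OF w] by argo
qed

text \<open>
  Convexity: along the segment to \<open>W\<close> the potential drops at first order by at least
  its excess.
\<close>

lemma residual_ge_excess:
  assumes u: "u \<in> V" and W: "W \<in> V"
  shows "potential S P F u - potential S P F W \<le> residual S P F u (\<lambda>z. u z - W z)"
proof -
  define w where "w = (\<lambda>z. W z - u z)"
  have w: "w \<in> V" unfolding w_def by (intro A.diff_mem u W)
  have "(\<lambda>z. u z + w z) = W" by (simp add: w_def)
  then have e: "potential S P F W - potential S P F u = residual S P F u w
     + (a w w - P * b w w) / 2 + S / 4 * (b W W - b u u)\<^sup>2 + S / 2 * b u u * b w w"
    using potential_expansion[OF u w F, of S P] by simp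
  have "0 \<le> S / 2 * b u u * b w w"
    using S by (intro mult_nonneg_nonneg B.ip_nonneg w u) auto
  moreover have "0 \<le> S / 4 * (b W W - b u u)\<^sup>2" using S by simp
  moreover have "residual S P F u (\<lambda>z. u z - W z) = - residual S P F u w"
    unfolding residual_def w_def using u W F
    by (simp add: A.ip_diff_right B.ip_diff_right H.ip_diff_right in_H algebra_simps)
  ultimately show ?thesis using e P_le[OF w] by argo
qed

text \<open>
  If \<open>b W W > 0\<close>, the last term of \<open>potential_excess\<close> controls \<open>b
  w w\<close>. If \<open>b W W = 0\<close>, then \<open>W\<close> is null for \<open>b\<close>
  and the middle term does. In both cases \<open>b w w\<close> tends to 0, and then so does
  \<open>a w w\<close>.
\<close>

theorem potential_limit_imp_convergence:
  assumes W: "critical S P F W" and f: "\<forall>\<^sub>F s in \<F>. f s \<in> V"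
    and lim: "((\<lambda>s. potential S P F (f s)) \<longlongrightarrow> potential S P F W) \<F>"
  shows "((\<lambda>s. A.nrm (\<lambda>z. f s z - W z)) \<longlongrightarrow> 0) \<F>"
proof -
  have W': "W \<in> V" using W by (simp add: critical_def)
  define w where "w = (\<lambda>s z. f s z - W z)"
  define E where "E = (\<lambda>s. potential S P F (f s) - potential S P F W)"
  have E0: "(E \<longlongrightarrow> 0) \<F>" unfolding E_def using lim by (simp add: LIM_zero)
  have parts: "\<forall>\<^sub>F s in \<F>. w s \<in> V \<and> 0 \<le> b (w s) (w s) \<and> 0 \<le> a (w s) (w s) \<and>
     a (w s) (w s) - P * b (w s) (w s) \<le> 2 * E s \<and> 
     (b (f s) (f s) - b W W)\<^sup>2 \<le> 4 / S * E s \<and> b W W * b (w s) (w s) \<le> 2 / S * E s"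
    using f
  proof eventually_elim
    case (elim s)
    have w: "w s \<in> V" unfolding w_def by (intro A.diff_mem elim W')
    have e: "E s = (a (w s) (w s) - P * b (w s) (w s)) / 2 + S / 4 * (b (f s) (f s) - b W W)\<^sup>2 
        + S / 2 * (b W W * b (w s) (w s))"
      unfolding E_def w_def using potential_excess[OF W elim] by simp
    have n: "0 \<le> a (w s) (w s) - P * b (w s) (w s)" "0 \<le> S / 4 * (b (f s) (f s) - b W W)\<^sup>2"
      "0 \<le> S / 2 * (b W W * b (w s) (w s))"
      using P_le[OF w] S B.ip_nonneg[OF w] B.ip_nonneg[OF W'] by auto
    have "S / 4 * (b (f s) (f s) - b W W)\<^sup>2 \<le> E s" "S / 2 * (b W W * b (w s) (w s)) \<le> E s"
      using e n by argo+
    then have "(b (f s) (f s) - b W W)\<^sup>2 \<le> 4 / S * E s" "b W W * b (w s) (w s) \<le> 2 / S * E s"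
      using S by (auto simp: field_simps)
    moreover have "a (w s) (w s) - P * b (w s) (w s) \<le> 2 * E s" using e n by argo
    ultimately show ?case using w B.ip_nonneg[OF w] A.ip_nonneg[OF w] by blast
  qed
  have b0: "((\<lambda>s. b (w s) (w s)) \<longlongrightarrow> 0) \<F>"
  proof (cases "b W W = 0")
    case False
    then have pos: "b W W > 0" using B.ip_nonneg[OF W'] by simp
    show ?thesis
    proof (rule Lim_null_comparison)
      show "((\<lambda>s. 2 / S * E s / b W W) \<longlongrightarrow> 0) \<F>"
        using E0 S by (auto intro!: tendsto_eq_intros simp: False)
      show "\<forall>\<^sub>F s in \<F>. norm (b (w s) (w s)) \<le> 2 / S * E s / b W W"
        using parts by eventually_elim (use pos in \<open>simp only: pos_le_divide_eq real_norm_def abs_of_nonneg mult.commute[of _ "b W W"]\<close>)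
    qed
  next
    case True
    show ?thesis
    proof (rule Lim_null_comparison)
      show "((\<lambda>s. sqrt (4 / S * E s)) \<longlongrightarrow> 0) \<F>"
        using E0 S by (auto intro!: tendsto_eq_intros)
      show "\<forall>\<^sub>F s in \<F>. norm (b (w s) (w s)) \<le> sqrt (4 / S * E s)"
        using parts f
      proof eventually_elim
        case (elim s)
        have "b W (f s) = 0" using B.nrm_eq_0_ip[OF W' elim(2)] True by (simp add: B.nrm_def)
        then have "b (w s) (w s) = b (f s) (f s)"
          unfolding w_def B.ip_square_diff[OF elim(2) W'] using True B.ip_sym[OF W' elim(2)] by simp
        then have "(b (w s) (w s))\<^sup>2 \<le> 4 / S * E s" using elim True by simp
        then have "b (w s) (w s) \<le> sqrt (4 / S * E s)" by (rule real_le_rsqrt)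
        then show ?case using elim by simp
      qed
    qed
  qed
  have "((\<lambda>s. a (w s) (w s)) \<longlongrightarrow> 0) \<F>"
  proof (rule Lim_null_comparison)
    show "((\<lambda>s. 2 * E s + P * b (w s) (w s)) \<longlongrightarrow> 0) \<F>"
      using E0 b0 by (auto intro!: tendsto_eq_intros)
    show "\<forall>\<^sub>F s in \<F>. norm (a (w s) (w s)) \<le> 2 * E s + P * b (w s) (w s)"
      using parts by eventually_elim auto
  qed
  then have "((\<lambda>s. sqrt (a (w s) (w s))) \<longlongrightarrow> sqrt 0) \<F>" by (intro tendsto_intros)
  then show ?thesis by (simp add: A.nrm_def w_def)
qed

lemma critical_unique:
  assumes W: "critical S P F W" and W2: "critical S P F W2"
  shows "A.nrm (\<lambda>z. W2 z - W z) = 0"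
proof -
  have V2: "W \<in> V" "W2 \<in> V" using W W2 by (auto simp: critical_def)
  have "potential S P F W = potential S P F W2"
    using potential_ge_critical[OF W V2(2)] potential_ge_critical[OF W2 V2(1)] by simp
  then have "((\<lambda>s::nat. A.nrm (\<lambda>z. W2 z - W z)) \<longlonglongrightarrow> 0)"
    by (intro potential_limit_imp_convergence[OF W]) (simp_all add: V2)
  then show ?thesis by (simp add: LIMSEQ_const_iff)
qed

end

section \<open>The least buckling load\<close>

text \<open>
  A minimising sequence normalised by \<open>b = 1\<close> has a subsequence that is Cauchy for
  \<open>b\<close>. Applying the lower bound of the quotient to sums, the parallelogram law
  makes it Cauchy for \<open>a\<close> as well.
\<close>

theorem rayleigh_minimiser:
  assumes "u0 \<in> V" "b u0 u0 \<noteq> 0"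
  shows "\<exists>K w. w \<in> V \<and> b w w = 1 \<and> (\<forall>v\<in>V. a w v = K * b w v) \<and> (\<forall>u\<in>V. K * b u u \<le> a u u)"
proof -
  define N where "N = {u \<in> V. b u u = 1}"
  define L where "L = Inf ((\<lambda>u. a u u) ` N)"
  have normalise: "(\<lambda>z. 1 / B.nrm u * u z) \<in> N" "a (\<lambda>z. 1 / B.nrm u * u z) (\<lambda>z. 1 / B.nrm u * u z) = a u u / b u u"
    if "u \<in> V" "b u u \<noteq> 0" for u
  proof -
    have sq: "(1 / B.nrm u)\<^sup>2 = 1 / b u u" by (simp add: power_one_over B.nrm_square that)
    have *: "a (\<lambda>z. c * u z) (\<lambda>z. c * u z) = c\<^sup>2 * a u u" "b (\<lambda>z. c * u z) (\<lambda>z. c * u z) = c\<^sup>2 * b u u" for c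
      using that by (simp_all add: A.ip_scale_right A.ip_scale A.scale_mem B.ip_scale B.ip_scale_right power2_eq_square)
    show "(\<lambda>z. 1 / B.nrm u * u z) \<in> N" unfolding N_def mem_Collect_eq *(2) sq by (rule conjI[OF A.scale_mem[OF that(1)]]) (simp add: that)
    show "a (\<lambda>z. 1 / B.nrm u * u z) (\<lambda>z. 1 / B.nrm u * u z) = a u u / b u u" unfolding * sq by simp
  qed
  have bdd: "bdd_below ((\<lambda>u. a u u) ` N)" by (intro bdd_belowI2[of _ 0]) (auto simp: N_def A.ip_nonneg)
  have L_le: "L * b u u \<le> a u u" if "u \<in> V" for u
  proof (cases "b u u = 0")
    case False
    then have "L \<le> a u u / b u u"
      using normalise[OF that False] bdd unfolding L_def by (metis (no_types, lifting) cInf_lower image_eqI)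
    moreover have "b u u > 0" using False B.ip_nonneg[OF that] by simp
    ultimately show ?thesis by (simp add: field_simps)
  qed (simp add: A.ip_nonneg that)
  have ne: "N \<noteq> {}" using normalise[OF assms] by auto
  have "\<exists>u\<in>N. a u u < L + 1 / real (Suc n)" for n
    using cInf_lessD[of "(\<lambda>u. a u u) ` N" "L + 1 / real (Suc n)"] ne by (auto simp: L_def)
  then obtain s where s: "\<And>n. s n \<in> N" "\<And>n. a (s n) (s n) < L + 1 / real (Suc n)" by metis
  have sV: "s n \<in> V" "b (s n) (s n) = 1" for n using s(1)[of n] by (auto simp: N_def)
  have "a (s n) (s n) \<le> L + 1" for n using s(2)[of n] by (smt (verit) divide_le_eq_1 of_nat_0_less_iff of_nat_Suc of_nat_less_0_iff)
  then obtain r :: "nat \<Rightarrow> nat" where r: "strict_mono r"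
    and rC: "\<And>e. e > 0 \<Longrightarrow> \<exists>N. \<forall>m\<ge>N. \<forall>n\<ge>N. B.nrm (\<lambda>z. s (r m) z - s (r n) z) < e"
    using V_compact[of s "L + 1"] sV(1) by blast
  have L0: "0 \<le> L" using ne unfolding L_def by (intro cInf_greatest) (auto simp: N_def A.ip_nonneg)
  have null: "(\<lambda>n. 1 / real (Suc (r n))) \<longlonglongrightarrow> 0"
    using LIMSEQ_subseq_LIMSEQ[OF LIMSEQ_inverse_real_of_nat r] by (simp add: inverse_eq_divide o_def)
  \<comment> \<open>parallelogram law for a, then the lower bound on the Rayleigh quotient of the sum\<close>
  have est: "a (\<lambda>z. s i z - s j z) (\<lambda>z. s i z - s j z)
     \<le> 2 * (1 / real (Suc i) + 1 / real (Suc j)) + L * b (\<lambda>z. s i z - s j z) (\<lambda>z. s i z - s j z)" for i j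
  proof -
    have "L * b (\<lambda>z. s i z + s j z) (\<lambda>z. s i z + s j z) \<le> a (\<lambda>z. s i z + s j z) (\<lambda>z. s i z + s j z)"
      by (intro L_le A.add_mem sV)
    then have "L * (2 + 2 * b (s i) (s j)) \<le> a (s i) (s i) + 2 * a (s i) (s j) + a (s j) (s j)"
      using A.ip_square_comb[OF sV(1)[of i] sV(1)[of j], of 1 1] B.ip_square_comb[OF sV(1)[of i] sV(1)[of j], of 1 1]
      by (simp add: sV(2))
    then show ?thesis
      unfolding A.ip_square_diff[OF sV(1)[of i] sV(1)[of j]] B.ip_square_diff[OF sV(1)[of i] sV(1)[of j]]
      using s(2)[of i] s(2)[of j] by (simp add: sV(2) algebra_simps)
  qed
  have "\<exists>N. \<forall>m\<ge>N. \<forall>n\<ge>N. A.nrm (\<lambda>z. s (r m) z - s (r n) z) < e" if e: "e > 0" for e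
  proof -
    define d where "d = e / sqrt (2 * (L + 1))"
    have d: "d > 0" "L * d\<^sup>2 \<le> e\<^sup>2 / 2"
      using e L0 by (auto simp: d_def power_divide field_simps)
    obtain N1 where N1: "\<And>m n. m \<ge> N1 \<Longrightarrow> n \<ge> N1 \<Longrightarrow> B.nrm (\<lambda>z. s (r m) z - s (r n) z) < d"
      using rC[OF d(1)] by blast
    have "\<forall>\<^sub>F n in sequentially. 1 / real (Suc (r n)) < e\<^sup>2 / 8" using null e by (intro order_tendstoD(2)[where y=0]) auto
    then obtain N2 where N2: "\<And>n. n \<ge> N2 \<Longrightarrow> 1 / real (Suc (r n)) < e\<^sup>2 / 8" unfolding eventually_sequentially by blast
    have "A.nrm (\<lambda>z. s (r m) z - s (r n) z) < e" if "m \<ge> max N1 N2" "n \<ge> max N1 N2" for m n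
    proof -
      have "(B.nrm (\<lambda>z. s (r m) z - s (r n) z))\<^sup>2 \<le> d\<^sup>2"
        using N1[of m n] that by (intro power_mono) (auto intro!: B.nrm_nonneg B.diff_mem sV)
      then have "b (\<lambda>z. s (r m) z - s (r n) z) (\<lambda>z. s (r m) z - s (r n) z) \<le> d\<^sup>2"
        by (subst (asm) B.nrm_square) (auto intro!: B.diff_mem sV)
      then have "L * b (\<lambda>z. s (r m) z - s (r n) z) (\<lambda>z. s (r m) z - s (r n) z) \<le> e\<^sup>2 / 2"
        using L0 d(2) by (meson mult_left_mono order_trans)
      then have "a (\<lambda>z. s (r m) z - s (r n) z) (\<lambda>z. s (r m) z - s (r n) z) < e\<^sup>2"
        using est[of "r m" "r n"] N2[of m] N2[of n] that by simp
      then show ?thesis unfolding A.nrm_def using e by (metis real_sqrt_less_mono real_sqrt_abs abs_of_pos)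
    qed
    then show ?thesis by blast
  qed
  then obtain w where w: "w \<in> V" "(\<lambda>n. A.nrm (\<lambda>z. s (r n) z - w z)) \<longlonglongrightarrow> 0"
    using V_complete[unfolded A.complete_def, rule_format, of "\<lambda>n. s (r n)"] sV(1) by blast
  have "(\<lambda>n. b (s (r n)) (s (r n))) \<longlonglongrightarrow> b w w"
    by (intro B.ip_tendsto B_lim w) (simp_all add: sV)
  then have bw: "b w w = 1" by (simp add: sV(2) LIMSEQ_const_iff)
  have "(\<lambda>n. a (s (r n)) (s (r n))) \<longlonglongrightarrow> a w w"
    by (intro A.ip_tendsto w) (simp_all add: sV)
  moreover have "(\<lambda>n. L + 1 / real (Suc (r n))) \<longlonglongrightarrow> L + 0" by (intro tendsto_intros null)
  ultimately have "a w w \<le> L + 0" using s(2) by (intro LIMSEQ_le) (auto intro: less_imp_le)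
  then have aw: "a w w = L" using L_le[OF w(1)] bw by simp
  have "a w v = L * b w v" if v: "v \<in> V" for v
  proof -
    have "a w v - L * b w v = 0"
    proof (rule linear_coefficient_zero)
      fix t
      have "L * b (\<lambda>z. 1 * w z + t * v z) (\<lambda>z. 1 * w z + t * v z) \<le> a (\<lambda>z. 1 * w z + t * v z) (\<lambda>z. 1 * w z + t * v z)"
        by (intro L_le A.comb_mem w v)
      then show "0 \<le> 2 * t * (a w v - L * b w v) + t\<^sup>2 * (a v v - L * b v v)"
        unfolding A.ip_square_comb[OF w(1) v] B.ip_square_comb[OF w(1) v] aw bw by (simp add: algebra_simps)
    next
      show "0 \<le> a v v - L * b v v" using L_le[OF v] by simp
    qed
    then show ?thesis by simp
  qed
  then show ?thesis using w(1) bw L_le by blast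
qed

end

section \<open>Trajectories and the energy identity\<close>

lemma eventually_at_pos: "0 < t \<Longrightarrow> \<forall>\<^sub>F s in at t. 0 < (s::real)"
  using order_tendstoD(1)[OF tendsto_ident_at] by auto

lemma isCont_null: "(f \<longlongrightarrow> 0) (at t) \<Longrightarrow> f t = 0 \<Longrightarrow> (x \<longlongrightarrow> t) G \<Longrightarrow> ((\<lambda>k. f (x k)) \<longlongrightarrow> 0) G"
  for f :: "real \<Rightarrow> real"
  using isCont_tendsto_compose[of t f x G] by (simp add: isCont_def)

context plate_forms
begin

text \<open>
  A product rule in which \<open>v\<close> is differentiable only as a functional on
  \<open>V\<close>. It is compensated by continuity of \<open>z\<close> in \<open>V\<close>,
  while the derivative of \<open>z\<close> need exist only in \<open>H\<close>.
\<close>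

lemma pairing_derivative:
  assumes v: "\<forall>\<^sub>F s in at t. v s \<in> H" "v t \<in> H"
    and z: "\<forall>\<^sub>F s in at t. z s \<in> V" "z t \<in> V" "((\<lambda>s. A.nrm (\<lambda>x. z s x - z t x)) \<longlongrightarrow> 0) (at t)"
    and z': "z' \<in> H" "((\<lambda>s. H.nrm (\<lambda>x. (z s x - z t x) / (s - t) - z' x)) \<longlongrightarrow> 0) (at t)"
    and gu: "g \<in> H" "u \<in> V" and m: "(m \<longlongrightarrow> 0) (at t)"
    and weak: "\<forall>\<^sub>F s in at t. \<forall>y\<in>V. \<bar>(h (v s) y - h (v t) y) / (s - t) - (h g y - a u y)\<bar> \<le> m s * A.nrm y"
  shows "((\<lambda>s. h (v s) (z s)) has_real_derivative (h g (z t) - a u (z t) + h (v t) z')) (at t)"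
proof -
  let ?q = "\<lambda>s. (h (v s) (z s) - h (v t) (z s)) / (s - t)"
  let ?zq = "\<lambda>s x. (z s x - z t x) / (s - t)"
  have Hlim: "((\<lambda>s. H.nrm (\<lambda>x. z s x - z t x)) \<longlongrightarrow> 0) (at t)" by (intro H_lim z)
  have zH: "\<forall>\<^sub>F s in at t. z s \<in> H" using z(1) by eventually_elim (rule in_H)
  have lim_gu: "((\<lambda>s. h g (z s) - a u (z s)) \<longlongrightarrow> h g (z t) - a u (z t)) (at t)"
    by (intro tendsto_intros H.ip_tendsto A.ip_tendsto H.tendsto_const_curve A.tendsto_const_curve Hlim z zH)
       (simp_all add: gu in_H z)
  have "((\<lambda>s. sqrt (a (z s) (z s))) \<longlongrightarrow> sqrt (a (z t) (z t))) (at t)"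
    by (intro tendsto_intros A.ip_tendsto z)
  then have mn: "((\<lambda>s. m s * A.nrm (z s)) \<longlongrightarrow> 0 * A.nrm (z t)) (at t)"
    unfolding A.nrm_def by (intro tendsto_mult m)
  have "((\<lambda>s. ?q s - (h g (z s) - a u (z s))) \<longlongrightarrow> 0) (at t)"
  proof (rule Lim_null_comparison)
    show "((\<lambda>s. m s * A.nrm (z s)) \<longlongrightarrow> 0) (at t)" using mn by simp
    show "\<forall>\<^sub>F s in at t. norm (?q s - (h g (z s) - a u (z s))) \<le> m s * A.nrm (z s)"
      using weak z(1) by eventually_elim simp
  qed
  from tendsto_add[OF this lim_gu]
  have q: "(?q \<longlongrightarrow> h g (z t) - a u (z t)) (at t)" by simp
  have zqH: "\<forall>\<^sub>F s in at t. ?zq s \<in> H"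
    using zH
  proof eventually_elim
    case (elim s)
    have "(\<lambda>x. 1 / (s - t) * (z s x - z t x)) \<in> H" by (intro H.scale_mem H.diff_mem elim in_H z)
    then show ?case by simp
  qed
  have r: "((\<lambda>s. h (v t) (?zq s)) \<longlongrightarrow> h (v t) z') (at t)"
    by (intro H.ip_tendsto H.tendsto_const_curve zqH z' v) (simp add: v)
  have "((\<lambda>s. (h (v s) (z s) - h (v t) (z t)) / (s - t)) \<longlongrightarrow> h g (z t) - a u (z t) + h (v t) z') (at t)"
  proof (rule Lim_transform_eventually[OF tendsto_add[OF q r]])
    show "\<forall>\<^sub>F s in at t. ?q s + h (v t) (?zq s) = (h (v s) (z s) - h (v t) (z t)) / (s - t)"
      using v(1) zH
    proof eventually_elim
      case (elim s)
      have "h (v t) (?zq s) = h (v t) (\<lambda>x. 1 / (s - t) * z s x + (- 1 / (s - t)) * z t x)"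
        by (simp add: diff_divide_distrib)
      also have "\<dots> = 1 / (s - t) * h (v t) (z s) + (- 1 / (s - t)) * h (v t) (z t)"
        by (intro H.ip_comb_right elim v in_H z)
      finally have e: "h (v t) (?zq s) = (h (v t) (z s) - h (v t) (z t)) / (s - t)" by (simp add: diff_divide_distrib)
      show ?case unfolding e by (simp add: diff_divide_distrib)
    qed
  qed
  then show ?thesis by (simp add: has_field_derivative_iff)
qed

end

text \<open>
  A solution \<open>u\<close> of \<open>u'' + A u = g\<close> with velocity \<open>v\<close>. In
  \<open>weak_eq\<close>, the second derivative is that of \<open>v\<close> in the dual of
  \<open>V\<close>; the function \<open>m\<close> is a bound for the dual norm of the error of
  the difference quotient.
\<close>

locale trajectory = plate_forms +
  fixes u v g :: "real \<Rightarrow> 'a \<Rightarrow> real"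
  assumes u_mem: "0 < t \<Longrightarrow> u t \<in> V" and v_mem: "0 < t \<Longrightarrow> v t \<in> H" and g_mem: "0 < t \<Longrightarrow> g t \<in> H"
    and u_cont: "0 < t \<Longrightarrow> ((\<lambda>s. A.nrm (\<lambda>x. u s x - u t x)) \<longlongrightarrow> 0) (at t)"
    and u_deriv: "0 < t \<Longrightarrow> ((\<lambda>s. H.nrm (\<lambda>x. (u s x - u t x) / (s - t) - v t x)) \<longlongrightarrow> 0) (at t)"
    and v_cont: "0 < t \<Longrightarrow> ((\<lambda>s. H.nrm (\<lambda>x. v s x - v t x)) \<longlongrightarrow> 0) (at t)"
    and g_cont: "0 < t \<Longrightarrow> ((\<lambda>s. H.nrm (\<lambda>x. g s x - g t x)) \<longlongrightarrow> 0) (at t)"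
    and weak_eq: "0 < t \<Longrightarrow> \<exists>m. (m \<longlongrightarrow> 0) (at t) \<and>
      (\<forall>\<^sub>F s in at t. \<forall>y\<in>V. \<bar>(h (v s) y - h (v t) y) / (s - t) - (h (g t) y - a (u t) y)\<bar> \<le> m s * A.nrm y)"
begin

lemma ev_u: "0 < t \<Longrightarrow> \<forall>\<^sub>F s in at t. u s \<in> V"
  and ev_v: "0 < t \<Longrightarrow> \<forall>\<^sub>F s in at t. v s \<in> H"
  by (drule eventually_at_pos, erule eventually_mono, simp add: u_mem v_mem)+

lemma u_lim:
  assumes "0 < t" "(x \<longlongrightarrow> t) G"
  shows "((\<lambda>k. A.nrm (\<lambda>y. u (x k) y - u t y)) \<longlongrightarrow> 0) G"
  using isCont_null[OF u_cont[OF assms(1)] _ assms(2)] A.ip_square_diff[OF u_mem u_mem, of t t] assms(1)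
  by (simp add: A.nrm_def)

lemma v_lim:
  assumes "0 < t" "(x \<longlongrightarrow> t) G"
  shows "((\<lambda>k. H.nrm (\<lambda>y. v (x k) y - v t y)) \<longlongrightarrow> 0) G"
  using isCont_null[OF v_cont[OF assms(1)] _ assms(2)] H.ip_square_diff[OF v_mem v_mem, of t t] assms(1)
  by (simp add: H.nrm_def)

lemma ev_pos_lim: "0 < t \<Longrightarrow> (x \<longlongrightarrow> t) G \<Longrightarrow> \<forall>\<^sub>F k in G. 0 < (x k :: real)"
  using order_tendstoD(1) by blast

lemma h_u_derivative:
  assumes "0 < t" "y \<in> H"
  shows "((\<lambda>s. h (u s) y) has_real_derivative h (v t) y) (at t)"
proof -
  let ?q = "\<lambda>s x. (u s x - u t x) / (s - t)"
  have e: "h (?q s) y = (h (u s) y - h (u t) y) / (s - t)" "?q s \<in> H" if "u s \<in> V" for s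
  proof -
    have q: "?q s = (\<lambda>x. 1 / (s - t) * u s x + (- 1 / (s - t)) * u t x)" by (simp add: diff_divide_distrib)
    show "?q s \<in> H" unfolding q by (intro H.comb_mem in_H that u_mem assms(1))
    have "h (?q s) y = 1 / (s - t) * h (u s) y + (- 1 / (s - t)) * h (u t) y"
      unfolding q by (intro H.ip_comb in_H that u_mem assms)
    then show "h (?q s) y = (h (u s) y - h (u t) y) / (s - t)" by (simp add: diff_divide_distrib)
  qed
  have "((\<lambda>s. h (?q s) y) \<longlongrightarrow> h (v t) y) (at t)"
    using ev_u[OF assms(1)] by (intro H.ip_tendsto u_deriv assms H.tendsto_const_curve v_mem) (auto simp: assms elim: eventually_mono intro: e)
  then show ?thesis unfolding has_field_derivative_iff
    by (rule Lim_transform_eventually) (use ev_u[OF assms(1)] in eventually_elim, simp add: e)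
qed

definition central_quotient :: "real \<Rightarrow> real \<Rightarrow> 'a \<Rightarrow> real" where
  "central_quotient k t = (\<lambda>x. 1 / (2 * k) * u (t + k) x + (- 1 / (2 * k)) * u (t - k) x)"

lemma central_quotient_mem: "0 < k \<Longrightarrow> k < t \<Longrightarrow> central_quotient k t \<in> V"
  unfolding central_quotient_def by (intro A.comb_mem u_mem) auto

text \<open>
  The mean value theorem, tested against the difference itself, makes the central difference
  quotients converge to the velocity locally uniformly.
\<close>

lemma central_quotient_near_velocity:
  assumes t: "0 < t" and k: "0 < k" "d \<le> t" "\<bar>s - t\<bar> + k < d"
    and near: "\<And>r. \<bar>r - t\<bar> < d \<Longrightarrow> H.nrm (\<lambda>x. v r x - v t x) \<le> \<rho>"
  shows "H.nrm (\<lambda>x. central_quotient k s x - v t x) \<le> \<rho>"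
proof -
  define y where "y = (\<lambda>x. central_quotient k s x - v t x)"
  have s: "k < s" using k by auto
  have y: "y \<in> H" unfolding y_def by (intro H.diff_mem v_mem t in_H central_quotient_mem k s)
  obtain r where r: "s - k < r" "r < s + k" "h (u (s + k)) y - h (u (s - k)) y = ((s + k) - (s - k)) * h (v r) y"
    using MVT2[of "s - k" "s + k" "\<lambda>r. h (u r) y" "\<lambda>r. h (v r) y"] k s h_u_derivative[OF _ y] by auto
  have r': "\<bar>r - t\<bar> < d" using r k by auto
  have rpos: "0 < r" using r s by auto
  have "h (central_quotient k s) y = h (v r) y"
    unfolding central_quotient_def using r(3) k(1) s y
    by (subst H.ip_comb) (auto intro!: in_H u_mem simp: field_simps)
  then have "h y y = h (\<lambda>x. v r x - v t x) y"
    using H.ip_diff[OF in_H[OF central_quotient_mem[OF k(1) s]] v_mem[OF t] y] H.ip_diff[OF v_mem[OF rpos] v_mem[OF t] y]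
    by (simp add: y_def)
  also have "\<dots> \<le> H.nrm (\<lambda>x. v r x - v t x) * H.nrm y"
    using H.cauchy_schwarz[OF H.diff_mem[OF v_mem[OF rpos] v_mem[OF t]] y] by simp
  also have "\<dots> \<le> \<rho> * H.nrm y" using near[OF r'] y by (intro mult_right_mono) auto
  finally have "H.nrm y * H.nrm y \<le> \<rho> * H.nrm y" using H.nrm_square[OF y] by (simp add: power2_eq_square)
  moreover have "0 \<le> \<rho>" using near[OF r'] H.nrm_nonneg[OF H.diff_mem[OF v_mem[OF rpos] v_mem[OF t]]] by linarith
  ultimately show ?thesis unfolding y_def[symmetric] using H.nrm_nonneg[OF y]
    by (cases "H.nrm y = 0") auto
qed

lemma central_quotient_tendsto:
  assumes t: "0 < t"
  shows "((\<lambda>k. H.nrm (\<lambda>x. central_quotient k t x - v t x)) \<longlongrightarrow> 0) (at_right 0)"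
proof (rule tendstoI)
  fix e :: real assume e: "0 < e"
  have "\<forall>\<^sub>F r in at t. H.nrm (\<lambda>x. v r x - v t x) < e / 2"
    using v_cont[OF t] e by (intro order_tendstoD(2)[where y=0]) auto
  then obtain d0 where d0: "d0 > 0" "\<And>r. r \<noteq> t \<Longrightarrow> \<bar>r - t\<bar> < d0 \<Longrightarrow> H.nrm (\<lambda>x. v r x - v t x) < e / 2"
    unfolding eventually_at dist_real_def by auto
  have t0: "H.nrm (\<lambda>x. v t x - v t x) = 0" using H.ip_square_diff[OF v_mem v_mem, of t t] t by (simp add: H.nrm_def)
  have near: "H.nrm (\<lambda>x. v r x - v t x) \<le> e / 2" if "\<bar>r - t\<bar> < min d0 t" for r
    using d0(2)[of r] that t0 e by (cases "r = t") auto
  have "dist (H.nrm (\<lambda>x. central_quotient k t x - v t x)) 0 < e" if k: "0 < k" "k < min d0 t" for k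
    using central_quotient_near_velocity[OF t k(1) _ _ near, of "min d0 t" t] k e
      H.nrm_nonneg[OF H.diff_mem[OF in_H[OF central_quotient_mem[OF k(1), of t]] v_mem[OF t]]] by auto
  then show "\<forall>\<^sub>F k in at_right 0. dist (H.nrm (\<lambda>x. central_quotient k t x - v t x)) 0 < e"
    unfolding eventually_at_right_field using d0(1) t by (intro exI[of _ "min d0 t"]) auto
qed

definition correlation :: "real \<Rightarrow> real \<Rightarrow> real" where
  "correlation k t = h (v t) (v (t + k)) - a (u t) (u (t + k))"

lemma correlation_tendsto:
  assumes t: "0 < t" and x: "(x \<longlongrightarrow> t) G" and k: "((\<lambda>i. x i + k i) \<longlongrightarrow> t') G" and t': "0 < t'"
  shows "((\<lambda>i. correlation (k i) (x i)) \<longlongrightarrow> h (v t) (v t') - a (u t) (u t')) G"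
  unfolding correlation_def
  using ev_pos_lim[OF t x] ev_pos_lim[OF t' k]
  by (intro tendsto_intros H.ip_tendsto A.ip_tendsto v_lim u_lim t x k t' v_mem u_mem)
     (auto elim: eventually_mono intro: u_mem v_mem)

lemma correlation_continuous:
  assumes "0 \<le> k"
  shows "continuous_on {0<..} (correlation k)"
  unfolding continuous_on_def
proof
  fix t :: real assume t: "t \<in> {0<..}"
  have "((\<lambda>i. i + k) \<longlongrightarrow> t + k) (at t within {0<..})" by (intro tendsto_intros)
  then show "(correlation k \<longlongrightarrow> correlation k t) (at t within {0<..})"
    using correlation_tendsto[of t "\<lambda>i. i" "at t within {0<..}" "\<lambda>_. k" "t + k"] assms t
    unfolding correlation_def[of k t] by simp
qed

text \<open>
  By symmetry of both forms, the terms with \<open>v\<close> and \<open>u\<close> combine into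
  values of one function of time, shifted by \<open>k\<close>.
\<close>

lemma central_quotient_pairing_derivative:
  assumes k: "0 < k" "k < t"
  shows "((\<lambda>s. h (v s) (central_quotient k s)) has_real_derivative
     (h (g t) (central_quotient k t) + (correlation k t - correlation k (t - k)) / (2 * k))) (at t)"
proof -
  have t: "0 < t" and tp: "0 < t + k" and tm: "0 < t - k" using k by auto
  let ?D = "\<lambda>x. 1 / (2 * k) * v (t + k) x + (- 1 / (2 * k)) * v (t - k) x"
  obtain m where m: "(m \<longlongrightarrow> 0) (at t)"
    "\<forall>\<^sub>F s in at t. \<forall>y\<in>V. \<bar>(h (v s) y - h (v t) y) / (s - t) - (h (g t) y - a (u t) y)\<bar> \<le> m s * A.nrm y"
    using weak_eq[OF t] by blast
  have ev: "\<forall>\<^sub>F s in at t. k < s" using order_tendstoD(1)[OF tendsto_ident_at k(2)] .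
  have sh: "((\<lambda>s. s + k) \<longlongrightarrow> t + k) (at t)" "((\<lambda>s. s - k) \<longlongrightarrow> t - k) (at t)"
    by (auto intro!: tendsto_eq_intros)
  have "((\<lambda>s. h (v s) (central_quotient k s)) has_real_derivative (h (g t) (central_quotient k t) - a (u t) (central_quotient k t) + h (v t) ?D)) (at t)"
  proof (rule pairing_derivative[OF ev_v[OF t] v_mem[OF t] _ _ _ _ _ g_mem[OF t] u_mem[OF t] m])
    show evs: "\<forall>\<^sub>F s in at t. central_quotient k s \<in> V" using ev by eventually_elim (intro central_quotient_mem k)
    show st: "central_quotient k t \<in> V" by (intro central_quotient_mem k)
    show D: "?D \<in> H" by (intro H.comb_mem v_mem tp tm)
    show "((\<lambda>s. A.nrm (\<lambda>x. central_quotient k s x - central_quotient k t x)) \<longlongrightarrow> 0) (at t)"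
    proof (rule Lim_null_comparison)
      let ?p = "\<lambda>s. 1 / (2 * k) * (A.nrm (\<lambda>x. u (s + k) x - u (t + k) x) + A.nrm (\<lambda>x. u (s - k) x - u (t - k) x))"
      have "(?p \<longlongrightarrow> 1 / (2 * k) * (0 + 0)) (at t)"
        by (intro tendsto_intros u_lim sh tp tm)
      then show "(?p \<longlongrightarrow> 0) (at t)" by simp
      show "\<forall>\<^sub>F s in at t. norm (A.nrm (\<lambda>x. central_quotient k s x - central_quotient k t x)) \<le> ?p s"
        using ev evs
      proof eventually_elim
        case (elim s)
        have 1: "(\<lambda>x. 1 / (2 * k) * (u (s + k) x - u (t + k) x)) \<in> V"
           "(\<lambda>x. 1 / (2 * k) * (u (t - k) x - u (s - k) x)) \<in> V"
          "(\<lambda>x. u (s + k) x - u (t + k) x) \<in> V" "(\<lambda>x. u (t - k) x - u (s - k) x) \<in> V"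
          by (intro A.scale_mem A.diff_mem u_mem; use elim k in simp)+
        have sc: "A.nrm (\<lambda>x. c * f x) = c * A.nrm f" if "f \<in> V" "c > 0" for c f
          using that by (simp add: A.nrm_def A.ip_scale A.ip_scale_right A.scale_mem real_sqrt_mult)
        have "(\<lambda>x. central_quotient k s x - central_quotient k t x)
           = (\<lambda>x. 1 / (2 * k) * (u (s + k) x - u (t + k) x) + 1 / (2 * k) * (u (t - k) x - u (s - k) x))"
          unfolding central_quotient_def by (rule ext) (simp add: algebra_simps add_divide_distrib diff_divide_distrib)
        then have "A.nrm (\<lambda>x. central_quotient k s x - central_quotient k t x) \<le>
            1 / (2 * k) * A.nrm (\<lambda>x. u (s + k) x - u (t + k) x) + 1 / (2 * k) * A.nrm (\<lambda>x. u (t - k) x - u (s - k) x)"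
          using A.nrm_triangle[OF 1(1,2)] sc[OF 1(3), of "1 / (2*k)"] sc[OF 1(4), of "1/(2*k)"] k by simp
        moreover have "A.nrm (\<lambda>x. u (t - k) x - u (s - k) x) = A.nrm (\<lambda>x. u (s - k) x - u (t - k) x)"
          using elim k by (intro A.nrm_diff_commute u_mem) auto
        ultimately show ?case using A.nrm_nonneg[OF A.diff_mem[OF elim(2) st]] by (simp add: algebra_simps)
      qed
    qed
    show "((\<lambda>s. H.nrm (\<lambda>x. (central_quotient k s x - central_quotient k t x) / (s - t) - ?D x)) \<longlongrightarrow> 0) (at t)"
    proof (rule Lim_null_comparison)
      let ?e = "\<lambda>r s x. (u (s + r) x - u (t + r) x) / ((s + r) - (t + r)) - v (t + r) x"
      let ?p = "\<lambda>s. 1 / (2 * k) * (H.nrm (?e k s) + H.nrm (?e (-k) s))"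
      have sh': "((\<lambda>s. H.nrm (?e r s)) \<longlongrightarrow> 0) (at t)" if "0 < t + r" for r
        using filterlim_at_to_0[THEN iffD1, OF u_deriv[OF that]] 
        by (subst filterlim_at_to_0) (simp add: algebra_simps)
      have "(?p \<longlongrightarrow> 1 / (2 * k) * (0 + 0)) (at t)"
        by (intro tendsto_intros sh') (use tp tm in auto)
      then show "(?p \<longlongrightarrow> 0) (at t)" by simp
      show "\<forall>\<^sub>F s in at t. norm (H.nrm (\<lambda>x. (central_quotient k s x - central_quotient k t x) / (s - t) - ?D x)) \<le> ?p s"
        using ev evs
      proof eventually_elim
        case (elim s)
        have eH: "?e r s \<in> H" if "0 < s + r" "0 < t + r" for r
        proof -
          have "(\<lambda>x. 1 / (s - t) * (u (s + r) x - u (t + r) x)) \<in> H"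
            using that by (intro H.scale_mem H.diff_mem in_H u_mem)
          then show ?thesis using H.diff_mem[OF _ v_mem[OF that(2)]] by simp
        qed
        have 1: "?e k s \<in> H" "?e (-k) s \<in> H" using elim k by (intro eH; simp)+
        have "(\<lambda>x. (central_quotient k s x - central_quotient k t x) / (s - t) - ?D x)
           = (\<lambda>x. 1 / (2 * k) * ?e k s x + - 1 / (2 * k) * ?e (-k) s x)" (is "?l = ?r")
          unfolding central_quotient_def by (rule ext) (simp add: diff_divide_distrib add_divide_distrib algebra_simps)
        have sc: "H.nrm (\<lambda>x. c * f x) = \<bar>c\<bar> * H.nrm f" if "f \<in> H" for c f
          using that by (simp add: H.nrm_def H.ip_scale H.ip_scale_right H.scale_mem real_sqrt_mult mult.assoc[symmetric])
        have "H.nrm ?r \<le> 1 / (2 * k) * H.nrm (?e k s) + 1 / (2 * k) * H.nrm (?e (-k) s)"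
          using H.nrm_triangle[OF H.scale_mem[OF 1(1), of "1/(2*k)"] H.scale_mem[OF 1(2), of "- 1/(2*k)"]] 
            sc[OF 1(1), of "1 / (2*k)"] sc[OF 1(2), of "- 1/(2*k)"] k by simp
        moreover have "0 \<le> H.nrm ?r" by (intro H.nrm_nonneg H.comb_mem 1)
        ultimately show ?case unfolding \<open>?l = ?r\<close> by (simp add: algebra_simps)
      qed
    qed
  qed
  moreover have "h (v t) ?D - a (u t) (central_quotient k t) = (correlation k t - correlation k (t - k)) / (2 * k)"
  proof -
    have "h (v t) ?D = 1 / (2 * k) * h (v t) (v (t + k)) + (- 1 / (2 * k)) * h (v t) (v (t - k))"
      by (intro H.ip_comb_right v_mem t tp tm)
    moreover have "a (u t) (central_quotient k t) = 1 / (2 * k) * a (u t) (u (t + k)) + (- 1 / (2 * k)) * a (u t) (u (t - k))"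
      unfolding central_quotient_def by (intro A.ip_comb_right u_mem t tp tm)
    moreover have "h (v t) (v (t - k)) = h (v (t - k)) (v t)" by (intro H.ip_sym v_mem t tm)
    moreover have "a (u t) (u (t - k)) = a (u (t - k)) (u t)" by (intro A.ip_sym u_mem t tm)
    ultimately show ?thesis unfolding correlation_def by (simp add: diff_divide_distrib)
  qed
  ultimately show ?thesis by (simp add: algebra_simps)
qed

definition energy :: "real \<Rightarrow> real" where "energy t = (h (v t) (v t) + a (u t) (u t)) / 2"

text \<open>
  The energy identity of the linear equation. The velocity is not an admissible test function, but
  the central difference quotient of \<open>u\<close> is. Tested with it, the equation turns the
  symmetric terms into a difference of \<open>correlation k\<close> at two times, which is the
  derivative of half the mean of \<open>correlation k\<close> over an interval of length
  \<open>k\<close>. As \<open>k\<close> tends to 0 this mean tends to \<open>h v v - a u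
  u\<close>.
\<close>

theorem energy_derivative:
  assumes t: "0 < t"
  shows "(energy has_real_derivative h (g t) (v t)) (at t)"
proof -
  let ?r0 = "h (g t) (v t)"
  \<comment> \<open>all times used lie above \<open>t/2 - t/4\<close>, away from 0, where nothing is known of the curve\<close>
  define \<Phi> where "\<Phi> = (\<lambda>k x. integral {t/4..x} (correlation k))"
  have \<Phi>: "(\<Phi> k has_real_derivative correlation k x) (at x)" if "0 < k" "t/4 < x" "x < 2 * t" for k x
  proof -
    have "(\<Phi> k has_real_derivative correlation k x) (at x within {t/4..2*t})"
      unfolding \<Phi>_def using that t
      by (intro integral_has_real_derivative continuous_on_subset[OF correlation_continuous]) auto
    then show ?thesis using at_within_Icc_at[of "t/4" x "2*t"] that by simp
  qed
  define E where "E = (\<lambda>k s. h (v s) (central_quotient k s) - (\<Phi> k s - \<Phi> k (s - k)) / (2 * k))"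
  have E': "(E k has_real_derivative h (g s) (central_quotient k s)) (at s)" if "0 < k" "k < t/4" "t/2 < s" "s < 2 * t" for k s
    unfolding E_def using that t
    by (auto intro!: derivative_eq_intros central_quotient_pairing_derivative \<Phi> DERIV_chain2[OF \<Phi>] simp: field_simps)
  have E_lim: "((\<lambda>k. E k s) \<longlongrightarrow> energy s) (at_right 0)" if s: "t/2 < s" "s < 2 * t" for s
  proof -
    have spos: "0 < s" using s t by simp
    \<comment> \<open>the mean over an interval of length \<open>k\<close> is a value of \<open>correlation k\<close> inside it\<close>
    have "\<exists>x. 0 < k \<and> k < t/4 \<longrightarrow> s - k < x \<and> x < s \<and> \<Phi> k s - \<Phi> k (s - k) = k * correlation k x" for k
    proof (cases "0 < k \<and> k < t/4")
      case True
      then have "\<exists>z>s - k. z < s \<and> \<Phi> k s - \<Phi> k (s - k) = (s - (s - k)) * correlation k z"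
        using s by (intro MVT2 \<Phi>) auto
      then show ?thesis by auto
    qed auto
    then obtain x where x: "\<And>k. 0 < k \<Longrightarrow> k < t/4 \<Longrightarrow> s - k < x k \<and> x k < s \<and> \<Phi> k s - \<Phi> k (s - k) = k * correlation k (x k)"
      by metis
    have small: "\<forall>\<^sub>F k in at_right 0. 0 < k \<and> k < t/4"
      unfolding eventually_at_right_field using t by (intro exI[of _ "t/4"]) auto
    have xs: "(x \<longlongrightarrow> s) (at_right 0)"
    proof (rule tendsto_sandwich)
      show "\<forall>\<^sub>F k in at_right 0. s - k \<le> x k" "\<forall>\<^sub>F k in at_right 0. x k \<le> s"
        using small by (eventually_elim, use x in force)+
    qed (auto intro!: tendsto_eq_intros)
    have "((\<lambda>k. x k + k) \<longlongrightarrow> s + 0) (at_right 0)" by (intro tendsto_intros xs)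
    then have c: "((\<lambda>k. correlation k (x k)) \<longlongrightarrow> h (v s) (v s) - a (u s) (u s)) (at_right 0)"
      by (intro correlation_tendsto spos xs) simp
    have p: "((\<lambda>k. h (v s) (central_quotient k s)) \<longlongrightarrow> h (v s) (v s)) (at_right 0)"
    proof (rule H.ip_tendsto)
      show "\<forall>\<^sub>F k in at_right 0. central_quotient k s \<in> H"
        using small by eventually_elim (use s in \<open>auto intro!: in_H central_quotient_mem\<close>)
    qed (use spos in \<open>simp_all add: v_mem H.tendsto_const_curve[OF v_mem, simplified] central_quotient_tendsto\<close>)
    have "((\<lambda>k. h (v s) (central_quotient k s) - correlation k (x k) / 2) \<longlongrightarrow> h (v s) (v s) - (h (v s) (v s) - a (u s) (u s)) / 2) (at_right 0)"
      by (intro tendsto_intros p c) simp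
    moreover have "h (v s) (v s) - (h (v s) (v s) - a (u s) (u s)) / 2 = energy s" by (simp add: energy_def field_simps)
    moreover have "\<forall>\<^sub>F k in at_right 0. h (v s) (central_quotient k s) - correlation k (x k) / 2 = E k s"
      using small by eventually_elim (use x in \<open>simp add: E_def\<close>)
    ultimately show ?thesis using Lim_transform_eventually by simp
  qed
  have "((\<lambda>s. (energy s - energy t) / (s - t)) \<longlongrightarrow> ?r0) (at t)"
  proof (rule tendstoI)
    fix \<epsilon>' :: real assume "0 < \<epsilon>'"
    define \<epsilon> where "\<epsilon> = \<epsilon>' / 2"
    have \<epsilon>: "0 < \<epsilon>" using \<open>0 < \<epsilon>'\<close> by (simp add: \<epsilon>_def)
    have "((\<lambda>\<rho>. \<rho> * (H.nrm (v t) + \<rho>) + H.nrm (g t) * \<rho>) \<longlongrightarrow> 0 * (H.nrm (v t) + 0) + H.nrm (g t) * 0) (at_right 0)"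
      by (intro tendsto_intros)
    then have "\<forall>\<^sub>F \<rho> in at_right 0. \<rho> * (H.nrm (v t) + \<rho>) + H.nrm (g t) * \<rho> < \<epsilon> \<and> 0 < \<rho>"
      using \<epsilon> by (intro eventually_conj order_tendstoD(2)[where y=0] eventually_at_right_less) auto
    then obtain \<rho> where \<rho>: "0 < \<rho>" "\<rho> * (H.nrm (v t) + \<rho>) + H.nrm (g t) * \<rho> < \<epsilon>"
      using eventually_happens'[of "at_right (0::real)"] by (auto simp: trivial_limit_at_right_real)
    have "\<forall>\<^sub>F s in at t. H.nrm (\<lambda>x. v s x - v t x) < \<rho> \<and> H.nrm (\<lambda>x. g s x - g t x) < \<rho>"
      using v_cont[OF t] g_cont[OF t] \<rho> by (intro eventually_conj order_tendstoD(2)[where y=0]) auto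
    then obtain d1 where d1: "d1 > 0" "\<And>s. s \<noteq> t \<Longrightarrow> \<bar>s - t\<bar> < d1 \<Longrightarrow> 
        H.nrm (\<lambda>x. v s x - v t x) < \<rho> \<and> H.nrm (\<lambda>x. g s x - g t x) < \<rho>"
      unfolding eventually_at dist_real_def by auto
    define d where "d = min d1 (t/2)"
    have d: "0 < d" "d \<le> t/2" "d \<le> d1" using d1 t by (auto simp: d_def)
    have near: "H.nrm (\<lambda>x. v s x - v t x) \<le> \<rho>" "H.nrm (\<lambda>x. g s x - g t x) \<le> \<rho>" if "\<bar>s - t\<bar> < d" for s
      using d1(2)[of s] that \<rho>(1) d H.ip_square_diff[OF v_mem v_mem, of t t] H.ip_square_diff[OF g_mem g_mem, of t t] t
      by (cases "s = t"; simp add: H.nrm_def less_imp_le)+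
    have r: "\<bar>h (g s) (central_quotient k s) - ?r0\<bar> \<le> \<epsilon>" if s: "\<bar>s - t\<bar> < d / 2" and k: "0 < k" "k < d / 2" for s k
    proof -
      have sp: "0 < s" "k < s" using s k d t by linarith+
      note mem = in_H[OF central_quotient_mem[OF k(1) sp(2)]] v_mem[OF t] g_mem[OF sp(1)] g_mem[OF t]
      have 1: "H.nrm (\<lambda>x. central_quotient k s x - v t x) \<le> \<rho>"
        using s k d t by (intro central_quotient_near_velocity[of t k d] near) auto
      have 2: "H.nrm (central_quotient k s) \<le> H.nrm (v t) + \<rho>"
        using H.nrm_le_add_diff[OF mem(1,2)] 1 by simp
      have 3: "H.nrm (\<lambda>x. g s x - g t x) \<le> \<rho>" using s d by (intro near) auto
      have "h (g s) (central_quotient k s) - ?r0 = h (\<lambda>x. g s x - g t x) (central_quotient k s) + h (g t) (\<lambda>x. central_quotient k s x - v t x)"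
        by (simp add: H.ip_diff H.ip_diff_right mem)
      moreover have "\<bar>h (\<lambda>x. g s x - g t x) (central_quotient k s)\<bar> \<le> \<rho> * (H.nrm (v t) + \<rho>)"
        by (rule order_trans[OF H.cauchy_schwarz]) (auto intro!: mult_mono H.diff_mem mem 2 3 H.nrm_nonneg less_imp_le[OF \<rho>(1)])
      moreover have "\<bar>h (g t) (\<lambda>x. central_quotient k s x - v t x)\<bar> \<le> H.nrm (g t) * \<rho>"
        by (rule order_trans[OF H.cauchy_schwarz]) (auto intro!: mult_left_mono H.diff_mem mem 1 H.nrm_nonneg)
      ultimately show ?thesis using \<rho>(2) by linarith
    qed
    \<comment> \<open>mean value theorem for \<open>E k\<close> with a bound independent of \<open>k\<close>, then \<open>k\<close> tends to 0\<close>
    have main: "\<bar>energy s - energy t - (s - t) * ?r0\<bar> \<le> \<epsilon> * \<bar>s - t\<bar>" if s: "s \<noteq> t" "\<bar>s - t\<bar> < d / 2" for s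
    proof (rule tendsto_upperbound)
      have st: "t/2 < s" "s < 2 * t" "t/2 < t" "t < 2 * t" using s d t by linarith+
      show "((\<lambda>k. \<bar>E k s - E k t - (s - t) * ?r0\<bar>) \<longlongrightarrow> \<bar>energy s - energy t - (s - t) * ?r0\<bar>) (at_right 0)"
        by (intro tendsto_intros E_lim st)
      have "\<bar>E k s - E k t - (s - t) * ?r0\<bar> \<le> \<epsilon> * \<bar>s - t\<bar>" if k: "0 < k" "k < d / 2" for k
      proof -
        have kt: "k < t/4" using k d by auto
        have "\<exists>z. \<bar>z - t\<bar> < d / 2 \<and> E k s - E k t = (s - t) * h (g z) (central_quotient k z)"
        proof (cases "s < t")
          case True
          then have "\<exists>z>s. z < t \<and> E k t - E k s = (t - s) * h (g z) (central_quotient k z)"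
            using s st t by (intro MVT2 E' k kt) auto
          then obtain z where "s < z" "z < t" "E k t - E k s = (t - s) * h (g z) (central_quotient k z)" by blast
          then show ?thesis using s True by (intro exI[of _ z]) (auto simp: algebra_simps)
        next
          case False
          then have "\<exists>z>t. z < s \<and> E k s - E k t = (s - t) * h (g z) (central_quotient k z)"
            using s st t by (intro MVT2 E' k kt) auto
          then obtain z where "t < z" "z < s" "E k s - E k t = (s - t) * h (g z) (central_quotient k z)" by blast
          then show ?thesis using s False by (intro exI[of _ z]) auto
        qed
        then obtain z where z: "\<bar>z - t\<bar> < d / 2" "E k s - E k t = (s - t) * h (g z) (central_quotient k z)" by blast
        have "\<bar>E k s - E k t - (s - t) * ?r0\<bar> = \<bar>s - t\<bar> * \<bar>h (g z) (central_quotient k z) - ?r0\<bar>"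
          unfolding z(2) by (simp add: abs_mult[symmetric] algebra_simps)
        also have "\<dots> \<le> \<bar>s - t\<bar> * \<epsilon>" using r[OF z(1) k] by (intro mult_left_mono) auto
        finally show ?thesis by (simp add: mult.commute)
      qed
      then show "\<forall>\<^sub>F k in at_right 0. \<bar>E k s - E k t - (s - t) * ?r0\<bar> \<le> \<epsilon> * \<bar>s - t\<bar>"
        unfolding eventually_at_right_field using d(1) by (intro exI[of _ "d/2"]) auto
    qed (simp add: trivial_limit_at_right_real)
    have "dist ((energy s - energy t) / (s - t)) ?r0 < \<epsilon>'" if s: "s \<noteq> t" "\<bar>s - t\<bar> < d / 2" for s
    proof -
      have "(energy s - energy t) / (s - t) - ?r0 = (energy s - energy t - (s - t) * ?r0) / (s - t)"
        using s by (simp add: field_simps)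
      then have "\<bar>(energy s - energy t) / (s - t) - ?r0\<bar> \<le> \<epsilon>"
        using main[OF s] s by (simp add: abs_divide divide_le_eq)
      then show ?thesis using \<epsilon> by (simp add: dist_real_def \<epsilon>_def)
    qed
    then show "\<forall>\<^sub>F s in at t. dist ((energy s - energy t) / (s - t)) ?r0 < \<epsilon>'"
      unfolding eventually_at dist_real_def using d(1) by (intro exI[of _ "d/2"]) auto
  qed
  then show ?thesis by (simp add: has_field_derivative_iff)
qed

text \<open>
  The curve \<open>u\<close> is differentiable only in \<open>H\<close>. This suffices since
  \<open>b_D\<close> makes \<open>b (u t)\<close> continuous on \<open>H\<close>.
\<close>

lemma b_derivative:
  assumes t: "0 < t"
  shows "((\<lambda>s. b (u s) (u s)) has_real_derivative - 2 * h (D (u t)) (v t)) (at t)"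
proof -
  let ?q = "\<lambda>s x. (u s x - u t x) / (s - t)"
  have q: "?q s \<in> V" if "u s \<in> V" for s
    using A.scale_mem[OF A.diff_mem[OF that u_mem[OF t]], of "1 / (s - t)"] by simp
  have evq: "\<forall>\<^sub>F s in at t. ?q s \<in> H" using ev_u[OF t] by eventually_elim (intro in_H q)
  have evD: "\<forall>\<^sub>F s in at t. D (u s) \<in> H" using ev_u[OF t] by eventually_elim (rule D_mem)
  note mem = u_mem[OF t] v_mem[OF t] D_mem[OF u_mem[OF t]]
  have "((\<lambda>s. - h (D (u s)) (?q s) - h (D (u t)) (?q s)) \<longlongrightarrow> - h (D (u t)) (v t) - h (D (u t)) (v t)) (at t)"
    by (intro tendsto_intros H.ip_tendsto u_deriv D_lim ev_u u_cont t mem H.tendsto_const_curve evq evD) (simp add: mem)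
  moreover have "\<forall>\<^sub>F s in at t. - h (D (u s)) (?q s) - h (D (u t)) (?q s) = (b (u s) (u s) - b (u t) (u t)) / (s - t)"
    using ev_u[OF t]
  proof eventually_elim
    case (elim s)
    have d: "(\<lambda>x. u s x - u t x) \<in> V" by (intro A.diff_mem elim mem)
    have "h (D (u r)) (?q s) = 1 / (s - t) * h (D (u r)) (\<lambda>x. u s x - u t x)" if "u r \<in> V" for r
      using H.ip_scale_right[OF in_H[OF d] D_mem[OF that], of "1 / (s - t)"] by simp
    then have "- h (D (u s)) (?q s) - h (D (u t)) (?q s) = (b (u s) (\<lambda>x. u s x - u t x) + b (u t) (\<lambda>x. u s x - u t x)) / (s - t)"
      using elim mem d by (simp add: b_D add_divide_distrib diff_divide_distrib)
    also have "\<dots> = (b (u s) (u s) - b (u t) (u t)) / (s - t)"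
      using elim mem B.ip_sym[of "u s" "u t"] by (simp add: B.ip_diff_right)
    finally show ?case .
  qed
  ultimately have "((\<lambda>s. (b (u s) (u s) - b (u t) (u t)) / (s - t)) \<longlongrightarrow> - h (D (u t)) (v t) - h (D (u t)) (v t)) (at t)"
    by (rule Lim_transform_eventually)
  then show ?thesis by (simp add: has_field_derivative_iff)
qed

text \<open>
  The total energy \<open>e\<close> decreases at the rate \<open>\<delta> h v v\<close>. Testing
  with \<open>w\<close> gives a second identity whose right side is at most \<open>3/2 h v v -
  e\<close> by convexity; the multiple \<open>3 / (2 \<delta>)\<close> of \<open>e\<close> in
  \<open>Y\<close> absorbs \<open>3/2 h v v\<close>, so that \<open>Y\<close> decreases at least
  at the rate \<open>e\<close>.
\<close>

theorem damped_trajectory_converges: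
  assumes S: "0 < S" and P: "0 \<le> P" and F: "F \<in> H" and \<delta>: "0 < \<delta>"
    and P_le: "\<And>u. u \<in> V \<Longrightarrow> P * b u u \<le> a u u"
    and W: "critical S P F W"
    and g: "\<And>t. 0 < t \<Longrightarrow> g t = (\<lambda>x. F x - \<delta> * v t x + (- P + S * b (u t) (u t)) * D (u t) x)"
  shows "((\<lambda>t. A.nrm (\<lambda>x. u t x - W x)) \<longlongrightarrow> 0) at_top" "((\<lambda>t. H.nrm (v t)) \<longlongrightarrow> 0) at_top"
proof -
  let ?J = "potential S P F"
  have W': "W \<in> V" using W by (simp add: critical_def)
  define w where "w = (\<lambda>t x. u t x - W x)"
  define e where "e = (\<lambda>t. h (v t) (v t) / 2 + (?J (u t) - ?J W))"
  define Y where "Y = (\<lambda>t. h (v t) (w t) + \<delta> / 2 * h (w t) (w t) + 3 / (2 * \<delta>) * e t)"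
  have w: "w t \<in> V" if "0 < t" for t unfolding w_def by (intro A.diff_mem u_mem that W')
  have g_inner: "h (g t) y = h F y - \<delta> * h (v t) y + (- P + S * b (u t) (u t)) * h (D (u t)) y"
    if t: "0 < t" and y: "y \<in> H" for t y
  proof -
    note mem = v_mem[OF t] D_mem[OF u_mem[OF t]] F
    have "h (g t) y = h (\<lambda>x. 1 * F x + (- \<delta>) * v t x) y + (- P + S * b (u t) (u t)) * h (D (u t)) y"
      unfolding g[OF t] using H.ip_comb[OF H.comb_mem[OF mem(3,1), of 1 "- \<delta>"] mem(2) y, of 1] by simp
    then show ?thesis by (subst (asm) H.ip_comb) (simp_all add: mem y)
  qed
  have e_deriv: "(e has_real_derivative - \<delta> * h (v t) (v t)) (at t)" if t: "0 < t" for t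
  proof -
    have "e = (\<lambda>t. energy t - P / 2 * b (u t) (u t) + S / 4 * (b (u t) (u t))\<^sup>2 - h (u t) F - ?J W)"
      if "\<And>t. h F (u t) = h (u t) F"
      unfolding e_def energy_def potential_def that by (simp add: fun_eq_iff add_divide_distrib)
    have "((\<lambda>t. energy t - P / 2 * b (u t) (u t) + S / 4 * (b (u t) (u t))\<^sup>2 - h (u t) F - ?J W)
        has_real_derivative - \<delta> * h (v t) (v t)) (at t)"
      by (auto intro!: derivative_eq_intros energy_derivative b_derivative h_u_derivative t F
          simp: g_inner v_mem t H.ip_sym[OF F v_mem[OF t]] algebra_simps)
    then show ?thesis
    proof (rule has_field_derivative_transform_within_open[where S = "{0<..}"])
      fix r :: real assume "r \<in> {0<..}"
      then have "h F (u r) = h (u r) F" by (intro H.ip_sym F in_H u_mem) simp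
      then show "energy r - P / 2 * b (u r) (u r) + S / 4 * (b (u r) (u r))\<^sup>2 - h (u r) F - ?J W = e r"
        by (simp add: e_def energy_def potential_def add_divide_distrib)
    qed (use t in auto)
  qed
  have vw_deriv: "((\<lambda>t. h (v t) (w t)) has_real_derivative
      (h (v t) (v t) - \<delta> * h (v t) (w t) - residual S P F (u t) (w t))) (at t)" if t: "0 < t" for t
  proof -
    obtain m where m: "(m \<longlongrightarrow> 0) (at t)"
      "\<forall>\<^sub>F s in at t. \<forall>y\<in>V. \<bar>(h (v s) y - h (v t) y) / (s - t) - (h (g t) y - a (u t) y)\<bar> \<le> m s * A.nrm y"
      using weak_eq[OF t] by blast
    have "((\<lambda>t. h (v t) (w t)) has_real_derivative (h (g t) (w t) - a (u t) (w t) + h (v t) (v t))) (at t)"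
    proof (rule pairing_derivative[where z = w and v = v and t = t, OF ev_v[OF t] v_mem[OF t] _ w[OF t] _ v_mem[OF t] _ g_mem[OF t] u_mem[OF t] m])
      show "\<forall>\<^sub>F s in at t. w s \<in> V" using eventually_at_pos[OF t] by eventually_elim (rule w)
      show "((\<lambda>s. A.nrm (\<lambda>x. w s x - w t x)) \<longlongrightarrow> 0) (at t)" unfolding w_def using u_cont[OF t] by simp
      show "((\<lambda>s. H.nrm (\<lambda>x. (w s x - w t x) / (s - t) - v t x)) \<longlongrightarrow> 0) (at t)"
        unfolding w_def using u_deriv[OF t] by simp
    qed
    moreover have "h (g t) (w t) - a (u t) (w t) = - \<delta> * h (v t) (w t) - residual S P F (u t) (w t)"
      unfolding g_inner[OF t in_H[OF w[OF t]]] residual_def b_D[OF u_mem[OF t] w[OF t]] by (simp add: algebra_simps)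
    ultimately show ?thesis by (simp add: algebra_simps)
  qed
  have ww_deriv: "((\<lambda>t. h (w t) (w t)) has_real_derivative 2 * h (v t) (w t)) (at t)" if t: "0 < t" for t
  proof -
    let ?q = "\<lambda>s x. (u s x - u t x) / (s - t)"
    have q: "?q s \<in> V" if "u s \<in> V" for s
      using A.scale_mem[OF A.diff_mem[OF that u_mem[OF t]], of "1 / (s - t)"] by simp
    have ev: "\<forall>\<^sub>F s in at t. w s \<in> H" using eventually_at_pos[OF t] by eventually_elim (intro in_H w)
    have evq: "\<forall>\<^sub>F s in at t. ?q s \<in> H" using ev_u[OF t] by eventually_elim (intro in_H q)
    have "((\<lambda>s. H.nrm (\<lambda>x. u s x - u t x)) \<longlongrightarrow> 0) (at t)" by (intro H_lim ev_u u_cont u_mem t)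
    then have wl: "((\<lambda>s. H.nrm (\<lambda>x. w s x - w t x)) \<longlongrightarrow> 0) (at t)" unfolding w_def by simp
    have "((\<lambda>s. h (?q s) (w s) + h (?q s) (w t)) \<longlongrightarrow> h (v t) (w t) + h (v t) (w t)) (at t)"
      by (intro tendsto_intros H.ip_tendsto u_deriv H.tendsto_const_curve evq ev wl t v_mem in_H[OF w[OF t]]) (simp add: in_H w t)
    moreover have "\<forall>\<^sub>F s in at t. h (?q s) (w s) + h (?q s) (w t) = (h (w s) (w s) - h (w t) (w t)) / (s - t)"
      using ev evq
    proof eventually_elim
      case (elim s)
      note m = elim in_H[OF w[OF t]]
      have eq: "?q s = (\<lambda>x. 1 / (s - t) * w s x + (- 1 / (s - t)) * w t x)"
        by (rule ext) (simp add: w_def diff_divide_distrib)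
      have "h (?q s) y = 1 / (s - t) * h (w s) y + (- 1 / (s - t)) * h (w t) y" if "y \<in> H" for y
        unfolding eq by (intro H.ip_comb m that)
      then show ?case using m H.ip_sym[OF m(1,3)] by (simp add: diff_divide_distrib)
    qed
    ultimately have "((\<lambda>s. (h (w s) (w s) - h (w t) (w t)) / (s - t)) \<longlongrightarrow> h (v t) (w t) + h (v t) (w t)) (at t)"
      by (rule Lim_transform_eventually)
    then show ?thesis by (simp add: has_field_derivative_iff)
  qed
  have Y_deriv: "(Y has_real_derivative - (h (v t) (v t) / 2 + residual S P F (u t) (w t))) (at t)" if t: "0 < t" for t
    unfolding Y_def using \<delta>
    by (auto intro!: derivative_eq_intros vw_deriv ww_deriv e_deriv t simp: field_simps)
  have res: "e t \<le> h (v t) (v t) / 2 + residual S P F (u t) (w t)" if "0 < t" for t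
    unfolding e_def w_def using residual_ge_excess[OF S P F P_le u_mem[OF that] W'] by simp
  have excess: "0 \<le> ?J (u t) - ?J W" if "0 < t" for t
    using potential_ge_critical[OF S P F P_le W u_mem[OF that]] by simp
  have e_ge: "h (v t) (v t) / 2 \<le> e t" if "0 < t" for t
    unfolding e_def using excess[OF that] by simp
  have e0: "0 \<le> e t" if "0 < t" for t using e_ge[OF that] H.ip_nonneg[OF v_mem[OF that]] by simp
  have Y0: "0 \<le> Y t" if t: "0 < t" for t
  proof -
    have m: "v t \<in> H" "w t \<in> H" using v_mem in_H w t by auto
    \<comment> \<open>completing the square costs \<open>h v v / (2 \<delta>)\<close>, which is at most \<open>e / \<delta>\<close>\<close>
    have "0 \<le> h (\<lambda>x. 1 * v t x + \<delta> * w t x) (\<lambda>x. 1 * v t x + \<delta> * w t x)"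
      by (intro H.ip_nonneg H.comb_mem m)
    then have "0 \<le> (h (v t) (v t) + 2 * \<delta> * h (v t) (w t) + \<delta>\<^sup>2 * h (w t) (w t)) / (2 * \<delta>)"
      using \<delta> unfolding H.ip_square_comb[OF m] by simp
    also have "\<dots> = h (v t) (w t) + \<delta> / 2 * h (w t) (w t) + 1 / \<delta> * (h (v t) (v t) / 2)"
      using \<delta> by (simp add: field_simps power2_eq_square)
    also have "\<dots> \<le> Y t"
    proof -
      have "1 / \<delta> * (h (v t) (v t) / 2) \<le> 1 / \<delta> * e t" using e_ge[OF t] \<delta> by (intro mult_left_mono) auto
      also have "\<dots> \<le> 3 / (2 * \<delta>) * e t" using e0[OF t] \<delta> by (intro mult_right_mono) (auto simp: field_simps)
      finally show ?thesis unfolding Y_def by simp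
    qed
    finally show ?thesis .
  qed
  have e_decr: "e t \<le> e s" if "0 < s" "s \<le> t" for s t
  proof (rule DERIV_nonpos_imp_nonincreasing[OF that(2)])
    fix x assume "s \<le> x" "x \<le> t"
    then have "0 < x" using that by simp
    then show "\<exists>y. (e has_real_derivative y) (at x) \<and> y \<le> 0"
      using e_deriv[of x] \<delta> H.ip_nonneg[OF v_mem[of x]] by (intro exI[of _ "- \<delta> * h (v x) (v x)"]) auto
  qed
  have e_le: "e t \<le> Y 1 / (t - 1)" if t: "1 < t" for t
  proof -
    \<comment> \<open>on \<open>[1, t]\<close> the derivative of \<open>Y\<close> is at most \<open>- e t\<close>, since \<open>e\<close> decreases\<close>
    have "\<exists>z>1. z < t \<and> Y t - Y 1 = (t - 1) * - (h (v z) (v z) / 2 + residual S P F (u z) (w z))"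
      by (intro MVT2 Y_deriv t) simp
    then obtain z where z: "1 < z" "z < t" "Y t - Y 1 = (t - 1) * - (h (v z) (v z) / 2 + residual S P F (u z) (w z))"
      by blast
    have "e t \<le> h (v z) (v z) / 2 + residual S P F (u z) (w z)" using e_decr[of z t] res[of z] z by simp
    then have "(t - 1) * e t \<le> (t - 1) * (h (v z) (v z) / 2 + residual S P F (u z) (w z))"
      using t by (intro mult_left_mono) auto
    also have "\<dots> = Y 1 - Y t" using z(3) by (simp only: mult_minus_right)
    finally have "(t - 1) * e t \<le> Y 1" using Y0[of t] t by simp
    then show ?thesis using t by (simp add: field_simps)
  qed
  have big: "\<forall>\<^sub>F t in at_top. (1::real) < t" by (rule eventually_gt_at_top)
  have e_lim: "(e \<longlongrightarrow> 0) at_top"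
  proof (rule Lim_null_comparison)
    show "((\<lambda>t. Y 1 / (t - 1)) \<longlongrightarrow> 0) at_top"
      using filterlim_tendsto_add_at_top[of "\<lambda>_. -1" "-1::real" at_top "\<lambda>x. x"]
      by (intro tendsto_divide_0[OF tendsto_const] filterlim_at_top_imp_at_infinity) (simp add: filterlim_ident)
    show "\<forall>\<^sub>F t in at_top. norm (e t) \<le> Y 1 / (t - 1)"
      using big by eventually_elim (use e_le e0 in auto)
  qed
  have "((\<lambda>t. ?J (u t) - ?J W) \<longlongrightarrow> 0) at_top"
  proof (rule Lim_null_comparison[OF _ e_lim])
    show "\<forall>\<^sub>F t in at_top. norm (?J (u t) - ?J W) \<le> e t"
      using big by eventually_elim (use excess in \<open>simp add: e_def H.ip_nonneg v_mem\<close>)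
  qed
  then have "((\<lambda>t. ?J (u t)) \<longlongrightarrow> ?J W) at_top" by (rule LIM_zero_cancel)
  moreover have "\<forall>\<^sub>F t in at_top. u t \<in> V" using big by eventually_elim (simp add: u_mem)
  ultimately show "((\<lambda>t. A.nrm (\<lambda>x. u t x - W x)) \<longlongrightarrow> 0) at_top"
    by (intro potential_limit_imp_convergence[OF S P F P_le W])
  have "((\<lambda>t. h (v t) (v t)) \<longlongrightarrow> 0) at_top"
  proof (rule Lim_null_comparison)
    show "((\<lambda>t. 2 * e t) \<longlongrightarrow> 0) at_top" using tendsto_mult_right_zero[OF e_lim] by simp
    show "\<forall>\<^sub>F t in at_top. norm (h (v t) (v t)) \<le> 2 * e t"
      using big
    proof eventually_elim
      case (elim t)
      then have "0 < t" by simp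
      from e_ge[OF this] H.ip_nonneg[OF v_mem[OF this]] show ?case by simp
    qed
  qed
  then have "((\<lambda>t. sqrt (h (v t) (v t))) \<longlongrightarrow> sqrt 0) at_top" by (intro tendsto_intros)
  then show "((\<lambda>t. H.nrm (v t)) \<longlongrightarrow> 0) at_top" by (simp add: H.nrm_def)
qed

end

section \<open>Smooth functions of one variable\<close>

text \<open>
  Regularity is defined by recursion on the derivative, as for functions on the plane, so that
  closure properties follow by induction.
\<close>

fun Ck1 :: "nat \<Rightarrow> (real \<Rightarrow> real) \<Rightarrow> bool" where
  "Ck1 0 f \<longleftrightarrow> continuous_on UNIV f"
| "Ck1 (Suc k) f \<longleftrightarrow> (\<forall>x. f differentiable (at x)) \<and> Ck1 k (deriv f)"

definition smooth1 :: "(real \<Rightarrow> real) \<Rightarrow> bool" where "smooth1 f \<longleftrightarrow> (\<forall>k. Ck1 k f)"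

lemma Ck1_SucI:
  assumes "\<And>x. (f has_real_derivative f' x) (at x)" "Ck1 k f'"
  shows "Ck1 (Suc k) f"
proof -
  have "deriv f = f'" using assms(1) by (auto intro: DERIV_imp_deriv)
  moreover have "f differentiable (at x)" for x using assms(1)[of x] by (auto simp: real_differentiable_def)
  ultimately show ?thesis using assms by simp
qed

lemma Ck1_Suc_DERIV: "Ck1 (Suc k) f \<Longrightarrow> (f has_real_derivative deriv f x) (at x)"
  by (simp add: DERIV_deriv_iff_real_differentiable)

lemma Ck1_SucD: "Ck1 (Suc k) f \<Longrightarrow> Ck1 k f"
proof (induction k arbitrary: f)
  case 0
  then show ?case by (auto simp: continuous_on_eq_continuous_at intro: differentiable_imp_continuous_within)
qed auto

lemma Ck1_add: "Ck1 k f \<Longrightarrow> Ck1 k g \<Longrightarrow> Ck1 k (\<lambda>x. f x + g x)"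
proof (induction k arbitrary: f g)
  case 0 then show ?case by (simp add: continuous_on_add)
next
  case (Suc k)
  show ?case
    by (rule Ck1_SucI[where f' = "\<lambda>x. deriv f x + deriv g x"])
       (use Suc in \<open>auto intro!: derivative_eq_intros Ck1_Suc_DERIV\<close>)
qed

lemma Ck1_mult: "Ck1 k f \<Longrightarrow> Ck1 k g \<Longrightarrow> Ck1 k (\<lambda>x. f x * g x)"
proof (induction k arbitrary: f g)
  case 0 then show ?case by (simp add: continuous_on_mult)
next
  case (Suc k)
  show ?case
  proof (rule Ck1_SucI)
    show "((\<lambda>x. f x * g x) has_real_derivative (deriv f x * g x + f x * deriv g x)) (at x)" for x
      using Suc.prems by (auto intro!: derivative_eq_intros Ck1_Suc_DERIV)
    show "Ck1 k (\<lambda>x. deriv f x * g x + f x * deriv g x)"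
      using Suc.prems by (intro Ck1_add Suc.IH) (auto intro: Ck1_SucD[of k])
  qed
qed

lemma Ck1_const: "Ck1 k (\<lambda>x. c)"
proof (induction k arbitrary: c)
  case (Suc k)
  show ?case by (rule Ck1_SucI[where f' = "\<lambda>_. 0"]) (auto intro: Suc)
qed simp

lemma Ck1_affine: "Ck1 k f \<Longrightarrow> Ck1 k (\<lambda>x. f (c * x + d))"
proof (induction k arbitrary: f)
  case 0
  then show ?case by (auto intro!: continuous_intros continuous_on_compose2[of UNIV f])
next
  case (Suc k)
  show ?case
  proof (rule Ck1_SucI)
    show "((\<lambda>x. f (c * x + d)) has_real_derivative (deriv f (c * x + d) * c)) (at x)" for x
      by (rule DERIV_chain2[OF Ck1_Suc_DERIV[OF Suc.prems]]) (auto intro!: derivative_eq_intros)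
    show "Ck1 k (\<lambda>x. deriv f (c * x + d) * c)"
      using Suc by (intro Ck1_mult Ck1_const Suc.IH) auto
  qed
qed

lemma smooth1_DERIV: "smooth1 f \<Longrightarrow> (f has_real_derivative deriv f x) (at x)"
  unfolding smooth1_def using Ck1_Suc_DERIV by blast

lemma smooth1_deriv: "smooth1 f \<Longrightarrow> smooth1 (deriv f)"
  unfolding smooth1_def by (metis Ck1.simps(2))

lemma smooth1_continuous: "smooth1 f \<Longrightarrow> continuous_on UNIV f"
  unfolding smooth1_def by (metis Ck1.simps(1))

lemma smooth1_continuous_on: "smooth1 f \<Longrightarrow> continuous_on S f"
  by (rule continuous_on_subset[OF smooth1_continuous]) auto

lemma smooth1_iff_deriv:
  assumes "\<And>x. (f has_real_derivative f' x) (at x)" "smooth1 f'"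
  shows "smooth1 f"
  unfolding smooth1_def
proof
  fix k show "Ck1 k f" using Ck1_SucI[OF assms(1), of k] assms(2) Ck1_SucD by (auto simp: smooth1_def)
qed

lemma smooth1_add: "smooth1 f \<Longrightarrow> smooth1 g \<Longrightarrow> smooth1 (\<lambda>x. f x + g x)"
  and smooth1_mult: "smooth1 f \<Longrightarrow> smooth1 g \<Longrightarrow> smooth1 (\<lambda>x. f x * g x)"
  and smooth1_const: "smooth1 (\<lambda>x. c)"
  and smooth1_affine: "smooth1 f \<Longrightarrow> smooth1 (\<lambda>x. f (c * x + d))"
  by (simp_all add: smooth1_def Ck1_add Ck1_mult Ck1_const Ck1_affine)

lemma smooth1_cmult: "smooth1 f \<Longrightarrow> smooth1 (\<lambda>x. c * f x)"
  by (intro smooth1_mult smooth1_const)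

lemma smooth1_diff: "smooth1 f \<Longrightarrow> smooth1 g \<Longrightarrow> smooth1 (\<lambda>x. f x - g x)"
  using smooth1_add[OF _ smooth1_cmult[of g "-1"], of f] by simp

lemma deriv_mult1: "smooth1 f \<Longrightarrow> smooth1 g \<Longrightarrow> deriv (\<lambda>x. f x * g x) = (\<lambda>x. deriv f x * g x + f x * deriv g x)"
  by (rule ext, rule DERIV_imp_deriv) (auto intro!: derivative_eq_intros smooth1_DERIV)

section \<open>Bumps\<close>

text \<open>
  The functions \<open>x\<^sup>-\<^sup>n exp (- 1/x)\<close>, continued by 0, are closed under
  differentiation up to linear combinations; this makes the classical flat function smooth.
\<close>

definition flat :: "nat \<Rightarrow> real \<Rightarrow> real" where
  "flat n x = (if x \<le> 0 then 0 else inverse x ^ n * exp (- inverse x))"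

lemma flat_lim: "((\<lambda>x. inverse x ^ n * exp (- inverse x)) \<longlongrightarrow> 0) (at_right (0::real))"
proof -
  have "((\<lambda>x. inverse x ^ n / exp (inverse x)) \<longlongrightarrow> 0) (at_right (0::real))"
    by (rule filterlim_compose[OF tendsto_power_div_exp_0 filterlim_inverse_at_top_right])
  then show ?thesis by (simp add: exp_minus divide_inverse)
qed

lemma flat_DERIV: "(flat n has_real_derivative (flat (n + 2) x - real n * flat (n + 1) x)) (at x)"
proof -
  consider "x < 0" | "x = 0" | "x > 0" by linarith
  then show ?thesis
  proof cases
    case 1
    have "((\<lambda>_. 0) has_real_derivative 0) (at x)" by simp
    then have "(flat n has_real_derivative 0) (at x)"
      by (rule has_field_derivative_transform_within_open[where S = "{..<0}"]) (use 1 in \<open>auto simp: flat_def\<close>)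
    then show ?thesis using 1 by (simp add: flat_def)
  next
    case 2
    have "((\<lambda>h. flat n h / h) \<longlongrightarrow> 0) (at_left 0)"
      by (rule Lim_transform_eventually[OF tendsto_const]) (auto simp: eventually_at_left_field flat_def intro!: exI[of _ "-1"])
    moreover have "((\<lambda>h. flat n h / h) \<longlongrightarrow> 0) (at_right 0)"
      by (rule Lim_transform_eventually[OF flat_lim[of "Suc n"]])
         (auto simp: eventually_at_right_field flat_def field_simps intro!: exI[of _ "1"])
    ultimately have "((\<lambda>h. flat n h / h) \<longlongrightarrow> 0) (at 0)" by (rule filterlim_split_at)
    then show ?thesis using 2 by (simp add: has_field_derivative_iff flat_def)
  next
    case 3
    have "((\<lambda>x. inverse x ^ n * exp (- inverse x)) has_real_derivative
        (real n * inverse x ^ (n - 1) * (- (inverse x)\<^sup>2) * exp (- inverse x) + inverse x ^ n * (exp (- inverse x) * (inverse x)\<^sup>2))) (at x)"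
      using 3 by (auto intro!: derivative_eq_intros simp: power2_eq_square)
    moreover have "real n * inverse x ^ (n - 1) * (- (inverse x)\<^sup>2) * exp (- inverse x) + inverse x ^ n * (exp (- inverse x) * (inverse x)\<^sup>2)
       = flat (n + 2) x - real n * flat (n + 1) x"
      using 3 by (cases n) (auto simp: flat_def power2_eq_square algebra_simps)
    ultimately have "((\<lambda>x. inverse x ^ n * exp (- inverse x)) has_real_derivative (flat (n + 2) x - real n * flat (n + 1) x)) (at x)"
      by simp
    then show ?thesis
      by (rule has_field_derivative_transform_within_open[where S = "{0<..}"]) (use 3 in \<open>auto simp: flat_def\<close>)
  qed
qed

lemma Ck1_flat: "Ck1 k (flat n)"
proof (induction k arbitrary: n)
  case 0
  then show ?case using flat_DERIV by (auto simp: continuous_on_eq_continuous_at intro!: DERIV_isCont)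
next
  case (Suc k)
  have "Ck1 k (\<lambda>x. flat (n + 2) x + (- real n) * flat (n + 1) x)"
    by (intro Ck1_add Ck1_mult Ck1_const Suc)
  then show ?case using Ck1_SucI[OF flat_DERIV] by simp
qed

lemma exists_unit_bump:
  assumes "a < b"
  shows "\<exists>\<rho>. smooth1 \<rho> \<and> (\<forall>x. 0 \<le> \<rho> x) \<and> (\<forall>x. x \<notin> {a..b} \<longrightarrow> \<rho> x = 0) \<and> integral {a..b} \<rho> = 1"
proof -
  define r where "r = (\<lambda>x. flat 0 (1 * x + (- a)) * flat 0 ((-1) * x + b))"
  have sm: "smooth1 r" unfolding r_def
    by (intro smooth1_mult smooth1_affine) (simp_all add: smooth1_def Ck1_flat)
  have pos: "0 \<le> r x" for x by (simp add: r_def flat_def)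
  have int: "r integrable_on {a..b}" by (intro integrable_continuous_real smooth1_continuous_on sm)
  have I: "integral {a..b} r > 0"
  proof -
    have "integral {a..b} r \<noteq> 0"
    proof
      assume "integral {a..b} r = 0"
      then have "r ((a + b) / 2) = 0"
        using integral_eq_0_iff[of a b r] assms pos smooth1_continuous_on[OF sm] by auto
      then show False using assms by (simp add: r_def flat_def split: if_splits)
    qed
    moreover have "integral {a..b} r \<ge> 0" using int pos by (intro integral_nonneg) auto
    ultimately show ?thesis by simp
  qed
  have "smooth1 (\<lambda>x. inverse (integral {a..b} r) * r x)" by (intro smooth1_cmult sm)
  then show ?thesis using I pos
    by (intro exI[of _ "\<lambda>x. inverse (integral {a..b} r) * r x"]) (auto simp: r_def flat_def)
qed

definition prim :: "real \<Rightarrow> (real \<Rightarrow> real) \<Rightarrow> real \<Rightarrow> real" where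
  "prim c f x = integral {c..x} f"

lemma prim_DERIV:
  assumes f: "continuous_on UNIV f" and z: "\<And>x. x \<le> c \<Longrightarrow> f x = 0"
  shows "(prim c f has_real_derivative f x) (at x)"
proof -
  define c' where "c' = min c x - 1"
  have int: "f integrable_on {p..q}" for p q
    by (intro integrable_continuous_real continuous_on_subset[OF f]) auto
  have eq: "prim c f y = integral {c'..y} f" if "c' \<le> y" for y
  proof (cases "c \<le> y")
    case True
    have "integral {c'..c} f + integral {c..y} f = integral {c'..y} f"
      using True int by (intro Henstock_Kurzweil_Integration.integral_combine) (auto simp: c'_def)
    moreover have "integral {c'..c} f = 0"
      using integral_cong[of "{c'..c}" f "\<lambda>_. 0"] z by simp
    ultimately show ?thesis by (simp add: prim_def)
  next
    case False
    then have "integral {c'..y} f = 0" using integral_cong[of "{c'..y}" f "\<lambda>_. 0"] z by simp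
    then show ?thesis using False by (simp add: prim_def)
  qed
  have "((\<lambda>y. integral {c'..y} f) has_real_derivative f x) (at x within {c'..x + 1})"
    by (intro integral_has_real_derivative continuous_on_subset[OF f]) (auto simp: c'_def)
  then have "((\<lambda>y. integral {c'..y} f) has_real_derivative f x) (at x)"
    using at_within_Icc_at[of c' x "x + 1"] by (simp add: c'_def)
  then show ?thesis
    by (rule has_field_derivative_transform_within_open[where S = "{c'<..}"]) (auto simp: c'_def eq)
qed

lemma prim_smooth: "smooth1 f \<Longrightarrow> (\<And>x. x \<le> c \<Longrightarrow> f x = 0) \<Longrightarrow> smooth1 (prim c f)"
  by (rule smooth1_iff_deriv[OF prim_DERIV]) (auto intro: smooth1_continuous)

lemma deriv_prim: "continuous_on UNIV f \<Longrightarrow> (\<And>x. x \<le> c \<Longrightarrow> f x = 0) \<Longrightarrow> deriv (prim c f) = f"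
  by (rule ext, rule DERIV_imp_deriv, rule prim_DERIV)

definition bump :: "real \<Rightarrow> real \<Rightarrow> (real \<Rightarrow> real) set" where
  "bump a b = {f. smooth1 f \<and> (\<exists>p q. a < p \<and> q < b \<and> (\<forall>x. x \<notin> {p..q} \<longrightarrow> f x = 0))}"

lemma bump_smooth: "f \<in> bump a b \<Longrightarrow> smooth1 f" by (simp add: bump_def)

lemma bumpE:
  assumes "f \<in> bump a b" "a < b"
  obtains p q where "a < p" "p \<le> q" "q < b" "\<And>x. x \<notin> {p..q} \<Longrightarrow> f x = 0"
proof -
  obtain p q where pq: "a < p" "q < b" "\<And>x. x \<notin> {p..q} \<Longrightarrow> f x = 0" using assms by (auto simp: bump_def)
  show ?thesis
  proof (cases "p \<le> q")
    case True then show ?thesis using pq that by blast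
  next
    case False
    then have "f x = 0" for x using pq(3)[of x] by auto
    then show ?thesis using assms(2) by (intro that[of "(a+b)/2" "(a+b)/2"]) auto
  qed
qed

lemma bump_comb:
  assumes "f \<in> bump a b" "g \<in> bump a b"
  shows "(\<lambda>x. c * f x + d * g x) \<in> bump a b"
proof -
  obtain p q where "a < p" "q < b" "\<forall>x. x \<notin> {p..q} \<longrightarrow> f x = 0" using assms(1) by (auto simp: bump_def)
  moreover obtain p' q' where "a < p'" "q' < b" "\<forall>x. x \<notin> {p'..q'} \<longrightarrow> g x = 0" using assms(2) by (auto simp: bump_def)
  ultimately have "a < min p p'" "max q q' < b" "\<forall>x. x \<notin> {min p p'..max q q'} \<longrightarrow> c * f x + d * g x = 0"
    by (auto simp: min_le_iff_disj le_max_iff_disj)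
  moreover have "smooth1 (\<lambda>x. c * f x + d * g x)" using assms by (intro smooth1_add smooth1_cmult bump_smooth)
  ultimately show ?thesis unfolding bump_def by blast
qed

lemma bump_mult: "smooth1 g \<Longrightarrow> f \<in> bump a b \<Longrightarrow> (\<lambda>x. g x * f x) \<in> bump a b"
  unfolding bump_def by (auto intro!: smooth1_mult)

lemma bump_mono: "f \<in> bump a b \<Longrightarrow> a' \<le> a \<Longrightarrow> b \<le> b' \<Longrightarrow> f \<in> bump a' b'"
  unfolding bump_def by (smt (verit) mem_Collect_eq)

lemma bump_deriv:
  assumes "f \<in> bump a b"
  shows "deriv f \<in> bump a b"
proof -
  obtain p q where pq: "a < p" "q < b" "\<And>x. x \<notin> {p..q} \<Longrightarrow> f x = 0" and sm: "smooth1 f" using assms by (auto simp: bump_def)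
  have "deriv f x = 0" if "x \<notin> {p..q}" for x
  proof (rule DERIV_imp_deriv)
    have "((\<lambda>_. 0) has_real_derivative 0) (at x)" by simp
    then show "(f has_real_derivative 0) (at x)"
      by (rule has_field_derivative_transform_within_open[where S = "- {p..q}"]) (use that pq in auto)
  qed
  then show ?thesis using pq smooth1_deriv[OF sm] unfolding bump_def by blast
qed

text \<open>
  A bump of zero mass is the derivative of a bump.
\<close>

lemma bump_prim:
  assumes f: "f \<in> bump a b" and ab: "a < b" and I: "integral {a..b} f = 0"
  shows "prim a f \<in> bump a b" "deriv (prim a f) = f"
proof -
  obtain p q where pq: "a < p" "p \<le> q" "q < b" "\<And>x. x \<notin> {p..q} \<Longrightarrow> f x = 0" using bumpE[OF f ab] by blast
  have sm: "smooth1 f" using f by (rule bump_smooth)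
  have za: "f x = 0" if "x \<le> a" for x using that pq by simp
  show "deriv (prim a f) = f" by (intro deriv_prim smooth1_continuous sm za)
  have int: "f integrable_on {x..y}" for x y
    by (intro integrable_continuous_real smooth1_continuous_on sm)
  have zero: "integral {x..y} f = 0" if "\<And>z. z \<in> {x..y} \<Longrightarrow> z \<notin> {p..q}" for x y
    using integral_cong[of "{x..y}" f "\<lambda>_. 0"] pq(4) that by simp
  have Iq: "integral {a..q} f = 0"
  proof -
    have "integral {a..(q+b)/2} f + integral {(q+b)/2..b} f = integral {a..b} f" "integral {a..q} f + integral {q..(q+b)/2} f = integral {a..(q+b)/2} f"
      using pq int by (intro Henstock_Kurzweil_Integration.integral_combine; simp)+
    moreover have "integral {(q+b)/2..b} f = 0" using pq by (intro zero) auto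
    moreover have "integral {q..(q+b)/2} f = integral {q<..<(q+b)/2} f" by (simp add: integral_open_interval_real)
    moreover have "integral {q<..<(q+b)/2} f = 0"
      using integral_cong[of "{q<..<(q+b)/2}" f "\<lambda>_. 0"] pq(4) by simp
    ultimately show ?thesis using I by simp
  qed
  have "prim a f x = 0" if "x \<notin> {p..q}" for x
  proof (cases "x < p")
    case True then show ?thesis unfolding prim_def by (intro zero) auto
  next
    case False
    then have x: "q < x" using that by auto
    then have "integral {a..q} f + integral {q..x} f = integral {a..x} f"
      using pq int by (intro Henstock_Kurzweil_Integration.integral_combine) auto
    moreover have "integral {q..x} f = integral {q<..<x} f" by (simp add: integral_open_interval_real)
    moreover have "integral {q<..<x} f = 0"
      using integral_cong[of "{q<..<x}" f "\<lambda>_. 0"] pq(4) by simp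
    ultimately show ?thesis using Iq by (simp add: prim_def)
  qed
  then show "prim a f \<in> bump a b" unfolding bump_def using prim_smooth[OF sm za] pq by blast
qed

lemma integral_support:
  fixes f :: "real \<Rightarrow> real"
  assumes "continuous_on UNIV f" "a \<le> p" "q \<le> b" "p \<le> q" "\<And>x. x \<notin> {p..q} \<Longrightarrow> f x = 0"
  shows "integral {a..b} f = integral {p..q} f"
proof (rule integral_unique, rule has_integral_on_superset)
  show "(f has_integral integral {p..q} f) {p..q}"
    using integrable_integral[OF integrable_continuous_real[OF continuous_on_subset[OF assms(1)], of p q]] by simp
qed (use assms in auto)

text \<open>
  The primitive of the difference of two unit bumps. Its derivative has total mass at most 2
  however narrow the transition is.
\<close>

lemma exists_plateau:
  assumes "a < p" "p < q" "q < b"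
  shows "\<exists>\<alpha>\<in>bump a b. (\<forall>x. 0 \<le> \<alpha> x \<and> \<alpha> x \<le> 1) \<and> (\<forall>x\<in>{p..q}. \<alpha> x = 1 \<and> deriv \<alpha> x = 0) \<and>
     integral {a..b} (\<lambda>x. \<bar>deriv \<alpha> x\<bar>) \<le> 2"
proof -
  define a1 where "a1 = (2 * a + p) / 3"
  define a2 where "a2 = (a + 2 * p) / 3"
  define b1 where "b1 = (2 * q + b) / 3"
  define b2 where "b2 = (q + 2 * b) / 3"
  have ord: "a < a1" "a1 < a2" "a2 < p" "q < b1" "b1 < b2" "b2 < b"
    using assms by (auto simp: a1_def a2_def b1_def b2_def)
  obtain r where r: "smooth1 r" "\<And>x. 0 \<le> r x" "\<And>x. x \<notin> {a1..a2} \<Longrightarrow> r x = 0" "integral {a1..a2} r = 1"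
    using exists_unit_bump[OF ord(2)] by blast
  obtain s where s: "smooth1 s" "\<And>x. 0 \<le> s x" "\<And>x. x \<notin> {b1..b2} \<Longrightarrow> s x = 0" "integral {b1..b2} s = 1"
    using exists_unit_bump[OF ord(5)] by blast
  have ints: "r integrable_on {x..y}" "s integrable_on {x..y}" for x y
    by (intro integrable_continuous_real smooth1_continuous_on r s)+
  have I: "integral {a..b} r = 1" "integral {a..b} s = 1"
    using integral_support[OF smooth1_continuous[OF r(1)], of a a1 a2 b] integral_support[OF smooth1_continuous[OF s(1)], of a b1 b2 b] ord r(3,4) s(3,4) assms by auto
  have le1: "integral {a..x} r \<le> 1" "integral {a..x} s \<le> 1" for x
  proof -
    have "integral {a..x} r \<le> integral {a..max x b} r" "integral {a..x} s \<le> integral {a..max x b} s"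
      using ints r(2) s(2) by (intro integral_subset_le; auto)+
    moreover have "integral {a..max x b} r = 1" "integral {a..max x b} s = 1"
      using integral_support[OF smooth1_continuous[OF r(1)], of a a1 a2 "max x b"] integral_support[OF smooth1_continuous[OF s(1)], of a b1 b2 "max x b"] ord r(3,4) s(3,4) assms by auto
    ultimately show "integral {a..x} r \<le> 1" "integral {a..x} s \<le> 1" by auto
  qed
  define f where "f = (\<lambda>x. r x - s x)"
  have fb: "f \<in> bump a b" unfolding bump_def f_def mem_Collect_eq
    by (intro conjI smooth1_diff r s exI[of _ a1] exI[of _ b2]) (use ord assms r(3) s(3) in auto)
  have If: "integral {x..y} f = integral {x..y} r - integral {x..y} s" for x y
    unfolding f_def by (intro integral_diff ints)
  define \<alpha> where "\<alpha> = prim a f"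
  have \<alpha>: "\<alpha> \<in> bump a b" "deriv \<alpha> = f"
    unfolding \<alpha>_def using bump_prim[OF fb] I assms by (auto simp: If)
  have r1: "integral {a..x} r = 1" if "p \<le> x" for x
    using integral_support[OF smooth1_continuous[OF r(1)], of a a1 a2 x] ord r(3,4) that assms by auto
  have s0: "integral {a..x} s = 0" if "x \<le> q" for x
    using integral_cong[of "{a..x}" s "\<lambda>_. 0"] s(3) ord that by auto
  have nn: "0 \<le> integral {a..x} r" "0 \<le> integral {a..x} s" for x
    using ints r(2) s(2) by (intro integral_nonneg; auto)+
  have bnd: "0 \<le> \<alpha> x \<and> \<alpha> x \<le> 1" for x
    unfolding \<alpha>_def prim_def If using le1[of x] nn[of x] r1[of x] s0[of x] assms by (cases "x \<le> q") auto
  have one: "\<alpha> x = 1 \<and> deriv \<alpha> x = 0" if "x \<in> {p..q}" for x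
  proof
    show "\<alpha> x = 1" using r1[of x] s0[of x] that by (simp add: \<alpha>_def prim_def If)
    show "deriv \<alpha> x = 0" using that ord r(3)[of x] s(3)[of x] by (simp add: \<alpha>(2) f_def)
  qed
  have "integral {a..b} (\<lambda>x. \<bar>deriv \<alpha> x\<bar>) \<le> integral {a..b} (\<lambda>x. r x + s x)"
  proof (rule integral_le)
    show "(\<lambda>x. \<bar>deriv \<alpha> x\<bar>) integrable_on {a..b}" unfolding \<alpha>(2)
      by (intro integrable_continuous_real continuous_intros smooth1_continuous_on bump_smooth[OF fb])
    show "\<bar>deriv \<alpha> x\<bar> \<le> r x + s x" for x using r(2)[of x] s(2)[of x] by (simp add: \<alpha>(2) f_def)
  qed (intro integrable_add ints)
  also have "\<dots> = 2" using I ints by (simp add: integral_add)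
  finally show ?thesis using \<alpha>(1) bnd one by blast
qed

lemma bump_approx_indicator:
  assumes "a < b"
  shows "\<exists>\<alpha>. \<forall>n::nat. \<alpha> n \<in> bump a b \<and> (\<forall>x. 0 \<le> \<alpha> n x \<and> \<alpha> n x \<le> 1) \<and> (\<forall>x. (\<lambda>n. \<alpha> n x) \<longlonglongrightarrow> indicator {a<..<b} x)"
proof -
  define e where "e n = (b - a) / (real n + 3)" for n :: nat
  have e: "e n > 0" "2 * e n < b - a" for n
  proof -
    show "e n > 0" using assms by (simp add: e_def)
    have "2 * (b - a) < (real n + 3) * (b - a)" using assms by (intro mult_strict_right_mono) auto
    then show "2 * e n < b - a" by (simp add: e_def divide_less_eq mult.commute)
  qed
  have e0: "e \<longlonglongrightarrow> 0" unfolding e_def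
    using filterlim_tendsto_add_at_top[OF tendsto_const[of 3] filterlim_real_sequentially]
    by (intro tendsto_divide_0[OF tendsto_const] filterlim_at_top_imp_at_infinity) (simp add: add.commute)
  have "\<exists>\<alpha>\<in>bump a b. (\<forall>x. 0 \<le> \<alpha> x \<and> \<alpha> x \<le> 1) \<and> (\<forall>x\<in>{a + e n..b - e n}. \<alpha> x = 1)" for n
    using exists_plateau[of a "a + e n" "b - e n" b] e[of n] by auto
  then obtain \<alpha> where \<alpha>: "\<And>n. \<alpha> n \<in> bump a b" "\<And>n x. 0 \<le> \<alpha> n x \<and> \<alpha> n x \<le> 1" "\<And>n x. x \<in> {a + e n..b - e n} \<Longrightarrow> \<alpha> n x = 1"
    by metis
  have "(\<lambda>n. \<alpha> n x) \<longlonglongrightarrow> indicator {a<..<b} x" for x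
  proof (cases "a < x \<and> x < b")
    case True
    have "\<forall>\<^sub>F n in sequentially. e n < min (x - a) (b - x)" using e0 True by (intro order_tendstoD(2)[where y=0]) auto
    then have "\<forall>\<^sub>F n in sequentially. indicator {a<..<b} x = \<alpha> n x"
      by eventually_elim (use True \<alpha>(3) in \<open>auto simp: indicator_def\<close>)
    then show ?thesis by (rule Lim_transform_eventually[OF tendsto_const])
  next
    case False
    have "\<alpha> n x = 0" for n
    proof -
      obtain p q where "a < p" "q < b" "\<And>x. x \<notin> {p..q} \<Longrightarrow> \<alpha> n x = 0" using bumpE[OF \<alpha>(1) assms] by metis
      then show ?thesis using False by auto
    qed
    then show ?thesis using False by (auto simp: indicator_def)
  qed
  then show ?thesis using \<alpha> by blast
qed

section \<open>Square-integrable functions on the plate\<close>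

abbreviation plate_measure :: "real \<Rightarrow> (real \<times> real) measure" where
  "plate_measure l \<equiv> lebesgue_on (plate l)"

lemma plate_box: "plate l = box (0, -l) (pi, l)"
  by (auto simp: plate_def mem_box Basis_prod_def)

lemma open_plate: "open (plate l)" and bounded_plate: "bounded (plate l)"
  by (simp_all add: plate_box bounded_box open_box)

lemma plate_lebesgue: "plate l \<in> sets lebesgue" "plate l \<in> sets borel"
  using open_plate by auto

lemma plate_subset_cbox: "plate l \<subseteq> cbox (0, -l) (pi, l)"
  unfolding plate_box by (rule box_subset_cbox)

lemma finite_plate_measure: "finite_measure (plate_measure l)"
  by (intro finite_measure_lebesgue_on bounded_set_imp_lmeasurable bounded_plate plate_lebesgue)

lemma continuous_plate_measurable: "continuous_on UNIV f \<Longrightarrow> f \<in> borel_measurable (plate_measure l)"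
  for f :: "real \<times> real \<Rightarrow> real"
  by (intro measurable_restrict_space1 measurable_completion) (simp add: borel_measurable_continuous_onI)

lemma continuous_plate_bounded:
  assumes "continuous_on UNIV (f :: real \<times> real \<Rightarrow> real)"
  obtains B where "B > 0" "\<And>z. z \<in> plate l \<Longrightarrow> \<bar>f z\<bar> \<le> B"
proof -
  have "bounded (f ` cbox (0, -l) (pi, l))"
    by (intro compact_imp_bounded compact_continuous_image continuous_on_subset[OF assms]) auto
  then obtain B where "B > 0" "\<forall>z\<in>cbox (0, -l) (pi, l). \<bar>f z\<bar> \<le> B" unfolding bounded_pos by auto
  then show ?thesis using that plate_subset_cbox by blast
qed

lemma continuous_plate_integrable:
  assumes "continuous_on UNIV (f :: real \<times> real \<Rightarrow> real)"
  shows "integrable (plate_measure l) f"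
proof -
  interpret finite_measure "plate_measure l" by (rule finite_plate_measure)
  obtain B where "\<And>z. z \<in> plate l \<Longrightarrow> \<bar>f z\<bar> \<le> B" using continuous_plate_bounded[OF assms] by metis
  then show ?thesis
    by (intro integrable_const_bound[of _ B] continuous_plate_measurable assms) (auto intro!: AE_I2)
qed

lemma continuous_L2: "continuous_on UNIV f \<Longrightarrow> f \<in> L2 l"
  unfolding L2_def by (auto intro!: continuous_plate_measurable continuous_plate_integrable continuous_intros)

lemma L2_integrable_mult:
  assumes "f \<in> L2 l" "g \<in> L2 l"
  shows "integrable (plate_measure l) (\<lambda>z. f z * g z)"
proof (rule Bochner_Integration.integrable_bound)
  show "integrable (plate_measure l) (\<lambda>z. (f z)\<^sup>2 + (g z)\<^sup>2)" using assms by (simp add: L2_def)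
  show "(\<lambda>z. f z * g z) \<in> borel_measurable (plate_measure l)" using assms by (auto simp: L2_def)
  have "\<bar>f z * g z\<bar> \<le> (f z)\<^sup>2 + (g z)\<^sup>2" for z
  proof -
    have "0 \<le> (\<bar>f z\<bar> - \<bar>g z\<bar>)\<^sup>2" by simp
    then have "2 * (\<bar>f z\<bar> * \<bar>g z\<bar>) \<le> (f z)\<^sup>2 + (g z)\<^sup>2" by (simp add: power2_diff)
    moreover have "0 \<le> \<bar>f z\<bar> * \<bar>g z\<bar>" by simp
    ultimately show ?thesis unfolding abs_mult by linarith
  qed
  then show "AE z in plate_measure l. norm (f z * g z) \<le> norm ((f z)\<^sup>2 + (g z)\<^sup>2)" by (intro AE_I2) auto
qed

lemma L2_integrable: "f \<in> L2 l \<Longrightarrow> integrable (plate_measure l) f"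
  using L2_integrable_mult[of f l "\<lambda>_. 1"] continuous_L2[of "\<lambda>_. 1" l] by simp

lemma L2_measurable: "f \<in> L2 l \<Longrightarrow> f \<in> borel_measurable (plate_measure l)" by (simp add: L2_def)

lemma L2_comb:
  assumes "f \<in> L2 l" "g \<in> L2 l"
  shows "(\<lambda>z. a * f z + b * g z) \<in> L2 l"
proof -
  have "(\<lambda>z. (a * f z + b * g z)\<^sup>2) = (\<lambda>z. a\<^sup>2 * (f z * f z) + (2 * a * b) * (f z * g z) + b\<^sup>2 * (g z * g z))"
    by (auto simp: power2_eq_square algebra_simps)
  moreover have "integrable (plate_measure l) (\<lambda>z. a\<^sup>2 * (f z * f z) + (2 * a * b) * (f z * g z) + b\<^sup>2 * (g z * g z))"
    by (intro Bochner_Integration.integrable_add integrable_mult_right L2_integrable_mult assms)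
  moreover have "(\<lambda>z. a * f z + b * g z) \<in> borel_measurable (plate_measure l)"
    using assms[THEN L2_measurable] by measurable
  ultimately show ?thesis by (simp add: L2_def)
qed

interpretation L2: semi_inner "L2 l" "inner0 l" for l
proof
  show "(\<lambda>_. 0) \<in> L2 l" by (simp add: L2_def)
  fix f g k a b assume fg: "f \<in> L2 l" "g \<in> L2 l"
  then show "(\<lambda>z. a * f z + b * g z) \<in> L2 l" by (rule L2_comb)
  show "inner0 l f g = inner0 l g f" by (simp add: inner0_def mult.commute)
  show "0 \<le> inner0 l f f" by (simp add: inner0_def)
  assume k: "k \<in> L2 l"
  show "inner0 l (\<lambda>z. a * f z + b * g z) k = a * inner0 l f k + b * inner0 l g k"
    using L2_integrable_mult[OF fg(1) k] L2_integrable_mult[OF fg(2) k]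
    by (simp add: inner0_def algebra_simps)
qed

lemma norm0_eq: "norm0 l = L2.nrm l" by (simp add: fun_eq_iff norm0_def L2.nrm_def)

lemma inner0_cong:
  assumes "f \<in> L2 l" "g \<in> L2 l" "f' \<in> L2 l" "g' \<in> L2 l"
    and "AE z in plate_measure l. f z = f' z" "AE z in plate_measure l. g z = g' z"
  shows "inner0 l f g = inner0 l f' g'"
  unfolding inner0_def using assms(5,6) assms(1-4)[THEN L2_measurable]
  by (intro integral_cong_AE borel_measurable_times) auto

lemma inner0_self_eq_0_iff:
  assumes "f \<in> L2 l"
  shows "inner0 l f f = 0 \<longleftrightarrow> (AE z in plate_measure l. f z = 0)"
  unfolding inner0_def using integral_nonneg_eq_0_iff_AE[OF L2_integrable_mult[OF assms assms]] by simp

text \<open>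
  On a finite measure space an \<open>L\<^sup>2\<close>-Cauchy sequence is
  \<open>L\<^sup>1\<close>-Cauchy, so a subsequence converges almost everywhere; Fatou's lemma
  bounds the distance to its limit.
\<close>

theorem L2_complete: "L2.complete l"
  unfolding L2.complete_def
proof (intro allI impI)
  fix s assume s: "\<forall>n::nat. s n \<in> L2 l"
    and C: "\<forall>e>0. \<exists>N. \<forall>m\<ge>N. \<forall>n\<ge>N. L2.nrm l (\<lambda>z. s m z - s n z) < e"
  let ?M = "plate_measure l"
  have [measurable]: "s n \<in> borel_measurable ?M" for n using s L2_measurable by blast
  have one: "(\<lambda>_. 1) \<in> L2 l" by (intro continuous_L2 continuous_intros)
  have abs: "(\<lambda>z. \<bar>f z\<bar>) \<in> L2 l" "L2.nrm l (\<lambda>z. \<bar>f z\<bar>) = L2.nrm l f" if "f \<in> L2 l" for f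
    using that by (auto simp: L2_def L2.nrm_def inner0_def)
  have L1: "LINT z|?M. \<bar>s m z - s n z\<bar> \<le> L2.nrm l (\<lambda>z. s m z - s n z) * L2.nrm l (\<lambda>_. 1)" for m n
    using L2.cauchy_schwarz[OF abs(1)[OF L2.diff_mem] one, of "s m" "s n"] s
    by (simp add: abs L2.diff_mem) (simp add: inner0_def)
  have "\<exists>N. \<forall>i\<ge>N. \<forall>j\<ge>N. LINT x|?M. norm (s i x - s j x) < e" if e: "e > 0" for e
  proof -
    let ?c = "L2.nrm l (\<lambda>_. 1) + 1"
    have c: "?c > 0" using L2.nrm_nonneg[OF one] by linarith
    then obtain N where N: "\<And>m n. m \<ge> N \<Longrightarrow> n \<ge> N \<Longrightarrow> L2.nrm l (\<lambda>z. s m z - s n z) < e / ?c"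
      using C[rule_format, of "e / ?c"] e by auto
    have "LINT x|?M. norm (s i x - s j x) < e" if "i \<ge> N" "j \<ge> N" for i j
    proof -
      have "L2.nrm l (\<lambda>z. s i z - s j z) * L2.nrm l (\<lambda>_. 1) \<le> L2.nrm l (\<lambda>z. s i z - s j z) * ?c"
        using s by (intro mult_left_mono L2.nrm_nonneg L2.diff_mem) auto
      also have "\<dots> < e" using N[OF that] c by (simp add: pos_less_divide_eq)
      finally show ?thesis using L1[of i j] by simp
    qed
    then show ?thesis by blast
  qed
  then obtain r where r: "strict_mono r" "AE x in ?M. Cauchy (\<lambda>i. s (r i) x)"
    using cauchy_L1_AE_cauchy_subseq[of ?M s] s L2_integrable by blast
  define f where "f = (\<lambda>z. lim (\<lambda>i. s (r i) z))"
  have [measurable]: "f \<in> borel_measurable ?M" unfolding f_def by measurable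
  have conv: "AE z in ?M. (\<lambda>i. s (r i) z) \<longlonglongrightarrow> f z"
    using r(2) by eventually_elim (simp add: f_def convergent_LIMSEQ_iff[symmetric] Cauchy_convergent_iff)
  have bound: "(\<integral>\<^sup>+z. ennreal ((s m z - f z)\<^sup>2) \<partial>?M) \<le> ennreal (e\<^sup>2)"
    if m: "m \<ge> N" and N: "\<And>m n. m \<ge> N \<Longrightarrow> n \<ge> N \<Longrightarrow> L2.nrm l (\<lambda>z. s m z - s n z) < e" for m N e
  proof -
    have "(\<integral>\<^sup>+z. ennreal ((s m z - f z)\<^sup>2) \<partial>?M) = (\<integral>\<^sup>+z. liminf (\<lambda>i. ennreal ((s m z - s (r i) z)\<^sup>2)) \<partial>?M)"
    proof (rule nn_integral_cong_AE)
      show "AE z in ?M. ennreal ((s m z - f z)\<^sup>2) = liminf (\<lambda>i. ennreal ((s m z - s (r i) z)\<^sup>2))"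
        using conv
      proof eventually_elim
        case (elim z)
        have "(\<lambda>i. ennreal ((s m z - s (r i) z)\<^sup>2)) \<longlonglongrightarrow> ennreal ((s m z - f z)\<^sup>2)"
          by (intro tendsto_intros elim)
        then show ?case by (simp only: lim_imp_Liminf[OF trivial_limit_sequentially])
      qed
    qed
    also have "\<dots> \<le> liminf (\<lambda>i. \<integral>\<^sup>+z. ennreal ((s m z - s (r i) z)\<^sup>2) \<partial>?M)"
      by (rule nn_integral_liminf) measurable
    also have "\<dots> \<le> limsup (\<lambda>i. \<integral>\<^sup>+z. ennreal ((s m z - s (r i) z)\<^sup>2) \<partial>?M)"
      by (rule Liminf_le_Limsup) simp
    also have "\<dots> \<le> ennreal (e\<^sup>2)"
    proof (rule Limsup_bounded)
      show "\<forall>\<^sub>F i in sequentially. (\<integral>\<^sup>+z. ennreal ((s m z - s (r i) z)\<^sup>2) \<partial>?M) \<le> ennreal (e\<^sup>2)"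
        unfolding eventually_sequentially
      proof (intro exI[of _ N] allI impI)
        fix i assume "N \<le> i"
        then have "N \<le> r i" using strict_mono_imp_increasing[OF r(1), of i] by simp
        have d: "(\<lambda>z. s m z - s (r i) z) \<in> L2 l" using s by (simp add: L2.diff_mem)
        have "(\<integral>\<^sup>+z. ennreal ((s m z - s (r i) z)\<^sup>2) \<partial>?M) = ennreal (LINT z|?M. (s m z - s (r i) z)\<^sup>2)"
          using d by (intro nn_integral_eq_integral) (auto simp: L2_def)
        also have "(LINT z|?M. (s m z - s (r i) z)\<^sup>2) = (L2.nrm l (\<lambda>z. s m z - s (r i) z))\<^sup>2"
          unfolding L2.nrm_square[OF d] by (simp add: inner0_def power2_eq_square)
        also have "\<dots> \<le> e\<^sup>2" using N[OF m \<open>N \<le> r i\<close>] L2.nrm_nonneg[OF d] by (intro power_mono) auto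
        finally show "(\<integral>\<^sup>+z. ennreal ((s m z - s (r i) z)\<^sup>2) \<partial>?M) \<le> ennreal (e\<^sup>2)" by (simp add: ennreal_leI)
      qed
    qed
    finally show ?thesis .
  qed
  have diff_L2: "(\<lambda>z. s m z - f z) \<in> L2 l \<and> L2.nrm l (\<lambda>z. s m z - f z) \<le> e"
    if "m \<ge> N" "e > 0" "\<And>m n. m \<ge> N \<Longrightarrow> n \<ge> N \<Longrightarrow> L2.nrm l (\<lambda>z. s m z - s n z) < e" for m N e
  proof -
    note b = bound[OF that(1,3)]
    have int: "integrable ?M (\<lambda>z. (s m z - f z)\<^sup>2)"
      using b by (intro integrableI_nonneg) (auto simp: le_less_trans)
    then have mem: "(\<lambda>z. s m z - f z) \<in> L2 l" by (simp add: L2_def)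
    have "ennreal (LINT z|?M. (s m z - f z)\<^sup>2) \<le> ennreal (e\<^sup>2)"
      using b nn_integral_eq_integral[OF int] by simp
    then have "inner0 l (\<lambda>z. s m z - f z) (\<lambda>z. s m z - f z) \<le> e\<^sup>2"
      by (simp add: inner0_def power2_eq_square[symmetric])
    then have "L2.nrm l (\<lambda>z. s m z - f z) \<le> sqrt (e\<^sup>2)" unfolding L2.nrm_def by (rule real_sqrt_le_mono)
    then show ?thesis using mem that(2) by simp
  qed
  obtain N1 where "\<And>m n. m \<ge> N1 \<Longrightarrow> n \<ge> N1 \<Longrightarrow> L2.nrm l (\<lambda>z. s m z - s n z) < 1" using C[rule_format, of 1] by auto
  then have "(\<lambda>z. s N1 z - f z) \<in> L2 l" using diff_L2[of N1 N1 1] by auto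
  with s have "(\<lambda>z. s N1 z - (s N1 z - f z)) \<in> L2 l" using L2.diff_mem[of "s N1" l "\<lambda>z. s N1 z - f z"] by blast
  then have fL: "f \<in> L2 l" by simp
  have "(\<lambda>n. L2.nrm l (\<lambda>z. s n z - f z)) \<longlonglongrightarrow> 0"
  proof (rule LIMSEQ_I)
    fix e :: real assume e: "0 < e"
    then have "e / 2 > 0" by simp
    then obtain N where N: "\<And>m n. m \<ge> N \<Longrightarrow> n \<ge> N \<Longrightarrow> L2.nrm l (\<lambda>z. s m z - s n z) < e / 2" using C by blast
    have "norm (L2.nrm l (\<lambda>z. s n z - f z) - 0) < e" if "n \<ge> N" for n
      using diff_L2[OF that _ N] e L2.nrm_nonneg[of "\<lambda>z. s n z - f z" l] by fastforce
    then show "\<exists>no. \<forall>n\<ge>no. norm (L2.nrm l (\<lambda>z. s n z - f z) - 0) < e" by blast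
  qed
  then show "\<exists>f\<in>L2 l. (\<lambda>n. L2.nrm l (\<lambda>z. s n z - f z)) \<longlonglongrightarrow> 0" using fL by blast
qed

section \<open>Tensor products\<close>

definition tens :: "(real \<Rightarrow> real) \<Rightarrow> (real \<Rightarrow> real) \<Rightarrow> real \<times> real \<Rightarrow> real" where
  "tens \<alpha> \<beta> = (\<lambda>z. \<alpha> (fst z) * \<beta> (snd z))"

lemma tens_continuous:
  assumes "continuous_on UNIV \<alpha>" "continuous_on UNIV \<beta>"
  shows "continuous_on UNIV (tens \<alpha> \<beta>)"
  unfolding tens_def
  using continuous_on_compose2[OF assms(1) continuous_on_fst[OF continuous_on_id]]
    continuous_on_compose2[OF assms(2) continuous_on_snd[OF continuous_on_id]]
  by (intro continuous_on_mult) auto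

lemma tens_L2: "continuous_on UNIV \<alpha> \<Longrightarrow> continuous_on UNIV \<beta> \<Longrightarrow> tens \<alpha> \<beta> \<in> L2 l"
  by (intro continuous_L2 tens_continuous)

lemma tens_smooth_L2: "smooth1 \<alpha> \<Longrightarrow> smooth1 \<beta> \<Longrightarrow> tens \<alpha> \<beta> \<in> L2 l"
  by (intro tens_L2 smooth1_continuous)

lemma tens_has_derivative:
  assumes "smooth1 \<alpha>" "smooth1 \<beta>"
  shows "(tens \<alpha> \<beta> has_derivative (\<lambda>h. deriv \<alpha> (fst z) * fst h * \<beta> (snd z) + \<alpha> (fst z) * (deriv \<beta> (snd z) * snd h))) (at z)"
proof -
  have "((\<lambda>z. \<alpha> (fst z)) has_derivative (\<lambda>h. deriv \<alpha> (fst z) * fst h)) (at z)"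
    by (rule has_derivative_compose[of fst fst, OF has_derivative_fst[OF has_derivative_ident], simplified])
       (use smooth1_DERIV[OF assms(1)] in \<open>simp add: has_field_derivative_def\<close>)
  moreover have "((\<lambda>z. \<beta> (snd z)) has_derivative (\<lambda>h. deriv \<beta> (snd z) * snd h)) (at z)"
    by (rule has_derivative_compose[of snd snd, OF has_derivative_snd[OF has_derivative_ident], simplified])
       (use smooth1_DERIV[OF assms(2)] in \<open>simp add: has_field_derivative_def\<close>)
  ultimately show ?thesis unfolding tens_def
    by (rule has_derivative_eq_rhs[OF has_derivative_mult]) (auto simp: algebra_simps)
qed

lemma dir_deriv_tens:
  assumes "smooth1 \<alpha>" "smooth1 \<beta>"
  shows "dir_deriv (1, 0) (tens \<alpha> \<beta>) = tens (deriv \<alpha>) \<beta>" "dir_deriv (0, 1) (tens \<alpha> \<beta>) = tens \<alpha> (deriv \<beta>)"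
  unfolding dir_deriv_def frechet_derivative_at[OF tens_has_derivative[OF assms], symmetric]
  by (auto simp: tens_def)

lemma C_k_tens: "smooth1 \<alpha> \<Longrightarrow> smooth1 \<beta> \<Longrightarrow> C_k k (tens \<alpha> \<beta>)"
proof (induction k arbitrary: \<alpha> \<beta>)
  case 0
  then show ?case by (simp add: tens_continuous smooth1_continuous)
next
  case (Suc k)
  have "tens \<alpha> \<beta> differentiable (at z)" for z
    using tens_has_derivative[OF Suc.prems] unfolding differentiable_def by blast
  then show ?case using Suc by (simp add: dir_deriv_tens smooth1_deriv)
qed

lemma partial_deriv_tens:
  assumes "smooth1 \<alpha>" "smooth1 \<beta>"
  shows "partial_deriv a b (tens \<alpha> \<beta>) = tens ((deriv ^^ a) \<alpha>) ((deriv ^^ b) \<beta>)"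
proof -
  have sm: "smooth1 ((deriv ^^ n) f)" if "smooth1 f" for n f
    using that by (induction n) (auto intro: smooth1_deriv)
  have y: "(dir_deriv (0, 1) ^^ b) (tens \<alpha> \<beta>) = tens \<alpha> ((deriv ^^ b) \<beta>)"
    using assms by (induction b) (auto simp: dir_deriv_tens sm)
  have "(dir_deriv (1, 0) ^^ a) (tens \<alpha> \<gamma>) = tens ((deriv ^^ a) \<alpha>) \<gamma>" if "smooth1 \<gamma>" for \<gamma>
    using assms(1) that by (induction a) (auto simp: dir_deriv_tens sm)
  then show ?thesis unfolding partial_deriv_def y using sm[OF assms(2)] by simp
qed

lemma tens_test:
  assumes \<alpha>: "\<alpha> \<in> bump 0 pi" and \<beta>: "\<beta> \<in> bump (-l) l"
  shows "tens \<alpha> \<beta> \<in> test_functions l"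
proof -
  obtain p q where pq: "0 < p" "q < pi" "\<And>x. x \<notin> {p..q} \<Longrightarrow> \<alpha> x = 0" using \<alpha> by (auto simp: bump_def)
  obtain r s where rs: "-l < r" "s < l" "\<And>x. x \<notin> {r..s} \<Longrightarrow> \<beta> x = 0" using \<beta> by (auto simp: bump_def)
  let ?K = "cbox (p, r) (q, s)"
  have "{z. tens \<alpha> \<beta> z \<noteq> 0} \<subseteq> ?K"
    using pq(3) rs(3) by (auto simp: tens_def mem_box Basis_prod_def) (meson atLeastAtMost_iff)+
  then have sub: "closure {z. tens \<alpha> \<beta> z \<noteq> 0} \<subseteq> ?K" by (rule closure_minimal) (rule closed_cbox)
  moreover have "?K \<subseteq> plate l" using pq rs by (auto simp: plate_def mem_box Basis_prod_def)
  moreover have "compact (closure {z. tens \<alpha> \<beta> z \<noteq> 0})"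
    using sub by (meson bounded_cbox bounded_subset closed_closure compact_eq_bounded_closed)
  ultimately show ?thesis
    using \<alpha> \<beta> by (auto simp: test_functions_def C_k_tens bump_smooth)
qed

lemma integral_plate_continuous:
  assumes "continuous_on UNIV (f :: real \<times> real \<Rightarrow> real)"
  shows "(LINT z|plate_measure l. f z) = integral {0..pi} (\<lambda>x. integral {-l..l} (\<lambda>y. f (x, y)))"
proof -
  have "(LINT z|plate_measure l. f z) = integral (plate l) f"
    by (intro lebesgue_integral_eq_integral continuous_plate_integrable assms plate_lebesgue)
  also have "\<dots> = integral (cbox (0, -l) (pi, l)) f" unfolding plate_box by (rule integral_open_interval)
  also have "\<dots> = integral {0..pi} (\<lambda>x. integral {-l..l} (\<lambda>y. f (x, y)))"
    by (subst integral_prod_continuous) (auto intro: continuous_on_subset[OF assms])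
  finally show ?thesis .
qed

lemma integral_tens:
  assumes "continuous_on UNIV \<alpha>" "continuous_on UNIV \<beta>"
  shows "(LINT z|plate_measure l. tens \<alpha> \<beta> z) = integral {0..pi} \<alpha> * integral {-l..l} \<beta>"
  unfolding integral_plate_continuous[OF tens_continuous[OF assms]] by (simp add: tens_def)

lemma inner0_tens:
  assumes "continuous_on UNIV \<alpha>" "continuous_on UNIV \<beta>" "continuous_on UNIV \<alpha>'" "continuous_on UNIV \<beta>'"
  shows "inner0 l (tens \<alpha> \<beta>) (tens \<alpha>' \<beta>') = integral {0..pi} (\<lambda>x. \<alpha> x * \<alpha>' x) * integral {-l..l} (\<lambda>y. \<beta> y * \<beta>' y)"
proof -
  have "(\<lambda>z. tens \<alpha> \<beta> z * tens \<alpha>' \<beta>' z) = tens (\<lambda>x. \<alpha> x * \<alpha>' x) (\<lambda>y. \<beta> y * \<beta>' y)"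
    by (auto simp: tens_def)
  then show ?thesis unfolding inner0_def using assms by (simp add: integral_tens continuous_intros)
qed

section \<open>The fundamental lemma of the calculus of variations\<close>

text \<open>
  Bumps approximate indicators of intervals, so \<open>f\<close> has integral 0 over boxes. Boxes
  are stable under intersection and generate the Borel sets, whence the same for all measurable
  sets.
\<close>

theorem fundamental_lemma:
  assumes f: "f \<in> L2 l" and l: "l > 0"
    and orth: "\<And>\<alpha> \<beta>. \<alpha> \<in> bump 0 pi \<Longrightarrow> \<beta> \<in> bump (-l) l \<Longrightarrow> inner0 l f (tens \<alpha> \<beta>) = 0"
  shows "AE z in plate_measure l. f z = 0"
proof -
  let ?M = "plate_measure l"
  have [measurable]: "f \<in> borel_measurable ?M" using f by (rule L2_measurable)
  have fint: "integrable ?M f" using f by (rule L2_integrable)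
  have rect: "(LINT z|?M. f z * (indicator {a<..<b} (fst z) * indicator {c<..<d} (snd z))) = 0"
    if ab: "0 \<le> a" "a < b" "b \<le> pi" and cd: "-l \<le> c" "c < d" "d \<le> l" for a b c d
  proof -
    obtain \<alpha> where \<alpha>: "\<And>n::nat. \<alpha> n \<in> bump a b" "\<And>n x. 0 \<le> \<alpha> n x \<and> \<alpha> n x \<le> 1" "\<And>x. (\<lambda>n. \<alpha> n x) \<longlonglongrightarrow> indicator {a<..<b} x"
      using bump_approx_indicator[OF ab(2)] by blast
    obtain \<beta> where \<beta>: "\<And>n::nat. \<beta> n \<in> bump c d" "\<And>n x. 0 \<le> \<beta> n x \<and> \<beta> n x \<le> 1" "\<And>x. (\<lambda>n. \<beta> n x) \<longlonglongrightarrow> indicator {c<..<d} x"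
      using bump_approx_indicator[OF cd(2)] by blast
    have tc: "continuous_on UNIV (tens (\<alpha> n) (\<beta> n))" for n
      by (intro tens_continuous smooth1_continuous bump_smooth[OF \<alpha>(1)] bump_smooth[OF \<beta>(1)])
    have [measurable]: "tens (\<alpha> n) (\<beta> n) \<in> borel_measurable ?M" for n by (intro continuous_plate_measurable tc)
    have lim: "(\<lambda>n. tens (\<alpha> n) (\<beta> n) z) \<longlonglongrightarrow> indicator {a<..<b} (fst z) * indicator {c<..<d} (snd z)" for z
      unfolding tens_def by (intro tendsto_intros \<alpha> \<beta>)
    have "(\<lambda>n. LINT z|?M. f z * tens (\<alpha> n) (\<beta> n) z) \<longlonglongrightarrow> (LINT z|?M. f z * (indicator {a<..<b} (fst z) * indicator {c<..<d} (snd z)))"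
    proof (rule integral_dominated_convergence[where w = "\<lambda>z. \<bar>f z\<bar>"])
      show "(\<lambda>z. f z * (indicator {a<..<b} (fst z) * indicator {c<..<d} (snd z))) \<in> borel_measurable ?M"
        by (intro borel_measurable_times borel_measurable_LIMSEQ_real[OF lim]) measurable
      show "AE z in ?M. norm (f z * tens (\<alpha> n) (\<beta> n) z) \<le> \<bar>f z\<bar>" for n
      proof (rule AE_I2)
        fix z
        have "\<alpha> n (fst z) * \<beta> n (snd z) \<le> 1 * 1" using \<alpha>(2)[of n "fst z"] \<beta>(2)[of n "snd z"] by (intro mult_mono) auto
        moreover have "0 \<le> \<alpha> n (fst z) * \<beta> n (snd z)" using \<alpha>(2)[of n "fst z"] \<beta>(2)[of n "snd z"] by simp
        ultimately have "\<bar>tens (\<alpha> n) (\<beta> n) z\<bar> \<le> 1" by (simp add: tens_def)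
        then show "norm (f z * tens (\<alpha> n) (\<beta> n) z) \<le> \<bar>f z\<bar>" by (simp add: abs_mult mult_left_le)
      qed
    qed (use fint lim in \<open>auto intro!: tendsto_intros\<close>)
    moreover have "(LINT z|?M. f z * tens (\<alpha> n) (\<beta> n) z) = 0" for n
      using orth[of "\<alpha> n" "\<beta> n"] bump_mono[OF \<alpha>(1)] bump_mono[OF \<beta>(1)] ab cd by (simp add: inner0_def)
    ultimately show ?thesis by (simp add: LIMSEQ_const_iff)
  qed
  \<comment> \<open>a box meets the plate in a box\<close>
  have box0: "(LINT z:B \<inter> plate l|?M. f z) = 0" if B: "B \<in> range (\<lambda>(a, b). box a b)" for B
  proof -
    obtain p1 p2 q1 q2 where Beq: "B = box (p1, p2) (q1, q2)" using B by auto
    have eq: "B \<inter> plate l = {max 0 p1<..<min pi q1} \<times> {max (-l) p2<..<min l q2}"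
      unfolding Beq plate_def by (auto simp: mem_box Basis_prod_def)
    show ?thesis
    proof (cases "max 0 p1 < min pi q1 \<and> max (-l) p2 < min l q2")
      case True
      have "(LINT z:B \<inter> plate l|?M. f z) = (LINT z|?M. f z * (indicator {max 0 p1<..<min pi q1} (fst z) * indicator {max (-l) p2<..<min l q2} (snd z)))"
        unfolding set_lebesgue_integral_def eq by (intro Bochner_Integration.integral_cong) (auto simp: indicator_def)
      then show ?thesis using rect True by simp
    next
      case False
      then have "B \<inter> plate l = {}" unfolding eq by auto
      then show ?thesis by (simp add: set_lebesgue_integral_def)
    qed
  qed
  have msr: "A \<inter> plate l \<in> sets ?M" if "A \<in> sets borel" for A
    using that by (auto simp: sets_restrict_space)
  have setint: "set_integrable ?M A f" if "A \<in> sets ?M" for A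
    unfolding set_integrable_def using that fint by (intro integrable_mult_indicator) auto
  have "plate l = box (0, -l) (pi, l) \<inter> plate l" by (simp add: plate_box)
  then have whole: "(LINT z:plate l|?M. f z) = 0" using box0[of "box (0, -l) (pi, l)"] by auto
  have borel0: "(LINT z:A \<inter> plate l|?M. f z) = 0" if A: "A \<in> sets borel" for A
  proof -
    have A': "A \<in> sigma_sets UNIV (range (\<lambda>(a, b). box a b :: (real \<times> real) set))"
      using A unfolding borel_eq_box by simp
    have sb: "S \<in> sets borel" if "S \<in> sigma_sets UNIV (range (\<lambda>(a, b). box a b :: (real \<times> real) set))" for S
      using that unfolding borel_eq_box by simp
    have st: "Int_stable (range (\<lambda>(a, b). box a b :: (real \<times> real) set))"
      by (auto simp: Int_stable_def box_Int_box)
    have sub: "range (\<lambda>(a, b). box a b :: (real \<times> real) set) \<subseteq> Pow UNIV" by simp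
    show ?thesis
      using st sub A'
    proof (induction rule: sigma_sets_induct_disjoint)
      case (basic A) then show ?case by (rule box0)
    next
      case empty then show ?case by (simp add: set_lebesgue_integral_def)
    next
      case (compl A)
      have "(LINT z:plate l|?M. f z) = (LINT z:(A \<inter> plate l) \<union> ((UNIV - A) \<inter> plate l)|?M. f z)"
        by (rule arg_cong[where f = "\<lambda>S. LINT z:S|?M. f z"]) auto
      also have "\<dots> = (LINT z:A \<inter> plate l|?M. f z) + (LINT z:(UNIV - A) \<inter> plate l|?M. f z)"
        using sb[OF compl(1)] by (intro set_integral_Un setint msr) auto
      finally show ?case using compl whole by simp
    next
      case (union A)
      have Ab: "A i \<in> sets borel" for i using union(2) by (intro sb) auto
      have "(LINT z:(\<Union>i. A i) \<inter> plate l|?M. f z) = (LINT z:(\<Union>i. A i \<inter> plate l)|?M. f z)" by simp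
      also have "\<dots> = (\<Sum>i. (LINT z:A i \<inter> plate l|?M. f z))"
        using union(1) Ab by (intro lebesgue_integral_countable_add setint msr sets.countable_UN)
          (auto simp: disjoint_family_on_def intro!: msr)
      finally show ?case using union by simp
    qed
  qed
  interpret finite_measure ?M by (rule finite_plate_measure)
  show ?thesis
  proof (rule density_zero[OF fint])
    fix A assume A: "A \<in> sets ?M"
    then have "A \<in> sets lebesgue" "A \<subseteq> plate l" using plate_lebesgue(1)
      by (auto simp: sets_restrict_space_iff dest: sets.sets_into_space)
    \<comment> \<open>a Lebesgue set differs from a Borel set by a null set\<close>
    then obtain S N N' where S: "A = S \<union> N" "N \<subseteq> N'" "N' \<in> null_sets lborel" "S \<in> sets lborel"
      by (auto elim: sets_completionE)
    have "AE z in lborel. z \<notin> N'" using S(3) by (rule AE_not_in)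
    then have "AE z in lebesgue. z \<notin> N'" by (rule AE_completion)
    then have "AE z in ?M. z \<notin> N'" using plate_lebesgue(1) by (auto simp: AE_restrict_space_iff elim: eventually_mono)
    then have "AE z in ?M. indicator A z *\<^sub>R f z = indicator (S \<inter> plate l) z *\<^sub>R f z"
      using \<open>A \<subseteq> plate l\<close> S by (auto simp: indicator_def elim!: eventually_mono)
    then have "(LINT z:A|?M. f z) = (LINT z:S \<inter> plate l|?M. f z)"
      unfolding set_lebesgue_integral_def using A msr[of S] S(4)
      by (intro integral_cong_AE borel_measurable_scaleR borel_measurable_indicator) auto
    then show "(LINT z:A|?M. f z) = 0" using borel0[of S] S(4) by simp
  qed
qed

section \<open>Density of tensor sums\<close>

inductive_set tensor_sums :: "real \<Rightarrow> (real \<times> real \<Rightarrow> real) set" for l where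
  zero: "(\<lambda>_. 0) \<in> tensor_sums l"
| add: "k \<in> tensor_sums l \<Longrightarrow> \<alpha> \<in> bump 0 pi \<Longrightarrow> \<beta> \<in> bump (-l) l \<Longrightarrow> (\<lambda>z. k z + tens \<alpha> \<beta> z) \<in> tensor_sums l"

lemma bump_continuous: "f \<in> bump a b \<Longrightarrow> continuous_on UNIV f"
  by (intro smooth1_continuous bump_smooth)

lemma tensor_sums_continuous: "k \<in> tensor_sums l \<Longrightarrow> continuous_on UNIV k"
  by (induction rule: tensor_sums.induct) (auto intro!: continuous_on_add tens_continuous bump_continuous)

lemma tensor_sums_L2: "k \<in> tensor_sums l \<Longrightarrow> k \<in> L2 l"
  by (intro continuous_L2 tensor_sums_continuous)

lemma tensor_sums_tens: "\<alpha> \<in> bump 0 pi \<Longrightarrow> \<beta> \<in> bump (-l) l \<Longrightarrow> tens \<alpha> \<beta> \<in> tensor_sums l"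
  using tensor_sums.add[OF tensor_sums.zero] by auto

lemma tensor_sums_add:
  assumes "k \<in> tensor_sums l" "k' \<in> tensor_sums l"
  shows "(\<lambda>z. k z + k' z) \<in> tensor_sums l"
  using assms(2)
proof induction
  case (add k' \<alpha> \<beta>)
  then show ?case using tensor_sums.add[OF add(4,2,3)] by (simp add: add.assoc)
qed (use assms(1) in simp)

lemma tensor_sums_scale: "k \<in> tensor_sums l \<Longrightarrow> (\<lambda>z. c * k z) \<in> tensor_sums l"
proof (induction rule: tensor_sums.induct)
  case (add k \<alpha> \<beta>)
  have "(\<lambda>x. c * \<alpha> x) \<in> bump 0 pi" using bump_comb[OF add(2,2), of c 0] by simp
  from tensor_sums.add[OF add(4) this add(3)] show ?case by (simp add: tens_def algebra_simps)
qed (auto intro: tensor_sums.zero)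

text \<open>
  The fundamental lemma says that only null functions are orthogonal to all tensor sums.
\<close>

theorem tensor_sums_dense:
  assumes l: "l > 0" and f: "f \<in> L2 l" and e: "e > 0"
  shows "\<exists>k\<in>tensor_sums l. L2.nrm l (\<lambda>z. f z - k z) < e"
proof (rule L2.dense_if_orthogonal_trivial[OF L2_complete _ tensor_sums.zero _ _ f e])
  show "tensor_sums l \<subseteq> L2 l" using tensor_sums_L2 by auto
  show "(\<lambda>z. a * f z + b * g z) \<in> tensor_sums l" if "f \<in> tensor_sums l" "g \<in> tensor_sums l" for f g a b
    by (intro tensor_sums_add tensor_sums_scale that)
  fix g assume g: "g \<in> L2 l" "\<And>k. k \<in> tensor_sums l \<Longrightarrow> inner0 l g k = 0"
  then have "AE z in plate_measure l. g z = 0"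
    by (intro fundamental_lemma[OF g(1) l]) (auto intro: tensor_sums_tens)
  then show "L2.nrm l g = 0" using inner0_self_eq_0_iff[OF g(1)] by (simp add: L2.nrm_def)
qed

text \<open>
  The source of the norm estimates below: a bound on the pairings with tensor sums, for which
  derivatives and primitives are elementary, is a bound on the norm.
\<close>

lemma nrm_le_by_duality:
  assumes l: "l > 0" and f: "f \<in> L2 l" and C: "0 \<le> C"
    and le: "\<And>k. k \<in> tensor_sums l \<Longrightarrow> \<bar>inner0 l f k\<bar> \<le> C * L2.nrm l k"
  shows "L2.nrm l f \<le> C"
proof -
  let ?n = "L2.nrm l f"
  have n: "0 \<le> ?n" by (rule L2.nrm_nonneg[OF f])
  have est: "?n * ?n \<le> C * ?n + (?n + C) * e" if e: "e > 0" for e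
  proof -
    obtain k where k: "k \<in> tensor_sums l" "L2.nrm l (\<lambda>z. f z - k z) < e" using tensor_sums_dense[OF l f e] by blast
    have kL: "k \<in> L2 l" by (rule tensor_sums_L2[OF k(1)])
    have "?n * ?n = inner0 l f f" using L2.nrm_square[OF f] by (simp add: power2_eq_square)
    also have "\<dots> = inner0 l f (\<lambda>z. f z - k z) + inner0 l f k" by (simp add: L2.ip_diff_right f kL)
    also have "\<dots> \<le> ?n * L2.nrm l (\<lambda>z. f z - k z) + C * L2.nrm l k"
      using L2.cauchy_schwarz[OF f L2.diff_mem[OF f kL]] le[OF k(1)] by linarith
    also have "\<dots> \<le> ?n * e + C * (?n + e)"
    proof (intro add_mono mult_left_mono n C)
      show "L2.nrm l k \<le> ?n + e" using L2.nrm_le_add_diff[OF kL f] L2.nrm_diff_commute[OF kL f] k(2) by simp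
    qed (use k(2) in simp)
    finally show ?thesis by (simp add: algebra_simps)
  qed
  have "((\<lambda>e. C * ?n + (?n + C) * e) \<longlongrightarrow> C * ?n + (?n + C) * 0) (at_right 0)" by (intro tendsto_intros)
  then have "?n * ?n \<le> C * ?n + (?n + C) * 0"
    by (rule tendsto_lowerbound) (auto simp: eventually_at_right_field intro!: exI[of _ 1] est)
  then show ?thesis using n C by (cases "?n = 0") auto
qed

section \<open>Operators acting in the first variable\<close>

definition ip1 :: "real \<Rightarrow> real \<Rightarrow> (real \<Rightarrow> real) \<Rightarrow> (real \<Rightarrow> real) \<Rightarrow> real" where
  "ip1 a b f g = integral {a..b} (\<lambda>x. f x * g x)"

interpretation C1: semi_inner "{f. continuous_on UNIV f}" "ip1 a b" for a b
proof
  fix f g k :: "real \<Rightarrow> real" and c d :: real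
  assume fg: "f \<in> {f. continuous_on UNIV f}" "g \<in> {f. continuous_on UNIV f}"
  then show "(\<lambda>z. c * f z + d * g z) \<in> {f. continuous_on UNIV f}" by (auto intro!: continuous_intros)
  show "ip1 a b f g = ip1 a b g f" by (simp add: ip1_def mult.commute)
  have int: "(\<lambda>x. p x * q x) integrable_on {a..b}" if "continuous_on UNIV p" "continuous_on UNIV q" for p q :: "real \<Rightarrow> real"
    by (intro integrable_continuous_real continuous_on_mult continuous_on_subset[OF that(1)] continuous_on_subset[OF that(2)]) auto
  show "0 \<le> ip1 a b f f" unfolding ip1_def using int[of f f] fg by (intro integral_nonneg) auto
  assume k: "k \<in> {f. continuous_on UNIV f}"
  show "ip1 a b (\<lambda>z. c * f z + d * g z) k = c * ip1 a b f k + d * ip1 a b g k"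
  proof -
    have "(\<lambda>x. (c * f x + d * g x) * k x) = (\<lambda>x. c * (f x * k x) + d * (g x * k x))" by (auto simp: algebra_simps)
    moreover have "(\<lambda>x. c * (f x * k x)) integrable_on {a..b}" "(\<lambda>x. d * (g x * k x)) integrable_on {a..b}"
      using int[of f k] int[of g k] fg k by (auto intro: integrable_on_mult_right)
    ultimately show ?thesis by (simp add: ip1_def integral_add)
  qed
qed simp

lemma slice_continuous:
  assumes "continuous_on UNIV (k :: real \<times> real \<Rightarrow> real)"
  shows "continuous_on UNIV (\<lambda>s. k (s, y))" "continuous_on UNIV (\<lambda>y. k (s, y))"
  by (rule continuous_on_compose2[OF assms], auto intro!: continuous_intros)+

text \<open>
  Integrate the pointwise bound over the plate and exchange the order of integration.
\<close>

lemma norm_slice_bound: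
  assumes p: "continuous_on UNIV p" and k: "continuous_on UNIV k" and C: "0 \<le> C"
    and le: "\<And>x y. 0 \<le> x \<Longrightarrow> x \<le> pi \<Longrightarrow> (p (x, y))\<^sup>2 \<le> C * integral {0..pi} (\<lambda>s. (k (s, y))\<^sup>2)"
  shows "L2.nrm l p \<le> sqrt (C * pi) * L2.nrm l k"
proof -
  have pk: "continuous_on UNIV (\<lambda>z. (p z)\<^sup>2)" "continuous_on UNIV (\<lambda>z. (k z)\<^sup>2)" using p k by (auto intro!: continuous_intros)
  have c2: "continuous_on (cbox (0, -l) (pi, l)) (\<lambda>(x, y). (k (x, y))\<^sup>2)"
    using continuous_on_subset[OF pk(2)] by auto
  define Q where "Q = (\<lambda>y. integral {0..pi} (\<lambda>s. (k (s, y))\<^sup>2))"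
  have Qc: "continuous_on {-l..l} Q"
  proof -
    have "continuous_on ({-l..l} \<times> cbox 0 pi) (\<lambda>(y, s). (k (s, y))\<^sup>2)"
      unfolding case_prod_unfold by (intro continuous_intros continuous_on_compose2[OF k]) auto
    from integral_continuous_on_param[OF this] show ?thesis unfolding Q_def by simp
  qed
  have kk: "inner0 l k k = integral {-l..l} Q"
  proof -
    have "inner0 l k k = integral {0..pi} (\<lambda>x. integral {-l..l} (\<lambda>y. (k (x, y))\<^sup>2))"
      unfolding inner0_def power2_eq_square[symmetric] by (rule integral_plate_continuous[OF pk(2)])
    also have "\<dots> = integral {-l..l} Q"
      unfolding Q_def using integral_swap_continuous[OF c2] by simp
    finally show ?thesis .
  qed
  have "inner0 l p p = integral {0..pi} (\<lambda>x. integral {-l..l} (\<lambda>y. (p (x, y))\<^sup>2))"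
    unfolding inner0_def power2_eq_square[symmetric] by (rule integral_plate_continuous[OF pk(1)])
  also have "\<dots> \<le> integral {0..pi} (\<lambda>x. C * integral {-l..l} Q)"
  proof (rule integral_le)
    show "(\<lambda>x. integral {-l..l} (\<lambda>y. (p (x, y))\<^sup>2)) integrable_on {0..pi}"
    proof -
      have "continuous_on ({0..pi} \<times> cbox (-l) l) (\<lambda>(x, y). (p (x, y))\<^sup>2)"
        unfolding case_prod_unfold by (intro continuous_intros continuous_on_compose2[OF p]) auto
      from integral_continuous_on_param[OF this] show ?thesis by (intro integrable_continuous_real) simp
    qed
    fix x assume x: "x \<in> {0..pi}"
    have "integral {-l..l} (\<lambda>y. (p (x, y))\<^sup>2) \<le> integral {-l..l} (\<lambda>y. C * Q y)"
    proof (rule integral_le)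
      show "(\<lambda>y. (p (x, y))\<^sup>2) integrable_on {-l..l}"
        by (intro integrable_continuous_real continuous_on_subset[OF slice_continuous(2)[OF pk(1)]]) auto
      show "(\<lambda>y. C * Q y) integrable_on {-l..l}" by (intro integrable_continuous_real continuous_intros Qc)
      show "(p (x, y))\<^sup>2 \<le> C * Q y" for y unfolding Q_def using le x by simp
    qed
    then show "integral {-l..l} (\<lambda>y. (p (x, y))\<^sup>2) \<le> C * integral {-l..l} Q" by simp
  qed (rule integrable_continuous_real, rule continuous_on_const)
  also have "\<dots> = (C * pi) * inner0 l k k" using kk by simp
  finally have "sqrt (inner0 l p p) \<le> sqrt ((C * pi) * inner0 l k k)" by (rule real_sqrt_le_mono)
  then show ?thesis by (simp add: L2.nrm_def real_sqrt_mult)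
qed

definition prim_x :: "(real \<times> real \<Rightarrow> real) \<Rightarrow> real \<times> real \<Rightarrow> real" where
  "prim_x k = (\<lambda>z. integral {0..fst z} (\<lambda>s. k (s, snd z)))"

definition weight_x :: "(real \<Rightarrow> real) \<Rightarrow> (real \<times> real \<Rightarrow> real) \<Rightarrow> real \<times> real \<Rightarrow> real" where
  "weight_x \<kappa> k = (\<lambda>z. integral {0..pi} (\<lambda>s. \<kappa> s * k (s, snd z)))"

lemma prim_x_tens: "prim_x (tens \<alpha> \<beta>) = tens (prim 0 \<alpha>) \<beta>"
  by (simp add: prim_x_def tens_def prim_def)

lemma weight_x_tens: "weight_x \<kappa> (tens \<alpha> \<beta>) = tens (\<lambda>_. integral {0..pi} (\<lambda>s. \<kappa> s * \<alpha> s)) \<beta>"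
proof -
  have "integral {0..pi} (\<lambda>s. \<kappa> s * (\<alpha> s * c)) = integral {0..pi} (\<lambda>s. \<kappa> s * \<alpha> s) * c" for c
    using integral_mult_left[of "{0..pi}" "\<lambda>s. \<kappa> s * \<alpha> s" c] by (simp add: mult.assoc)
  then show ?thesis by (simp add: weight_x_def tens_def)
qed

lemma prim_x_add:
  assumes "continuous_on UNIV k" "continuous_on UNIV k'"
  shows "prim_x (\<lambda>z. k z + k' z) = (\<lambda>z. prim_x k z + prim_x k' z)"
  unfolding prim_x_def
  by (intro ext integral_add integrable_continuous_real continuous_on_subset[OF slice_continuous(1)] assms) auto

lemma weight_x_add:
  assumes "continuous_on UNIV k" "continuous_on UNIV k'" "continuous_on UNIV \<kappa>"
  shows "weight_x \<kappa> (\<lambda>z. k z + k' z) = (\<lambda>z. weight_x \<kappa> k z + weight_x \<kappa> k' z)"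
  unfolding weight_x_def distrib_left
  by (intro ext integral_add integrable_continuous_real continuous_on_mult continuous_on_subset[OF slice_continuous(1)]
      continuous_on_subset[OF assms(3)] assms) auto

lemma prim_bump_smooth:
  assumes "\<alpha> \<in> bump 0 b" "0 < b"
  shows "smooth1 (prim 0 \<alpha>)" "deriv (prim 0 \<alpha>) = \<alpha>"
proof -
  obtain p q where "0 < p" "\<And>x. x \<notin> {p..q} \<Longrightarrow> \<alpha> x = 0" using assms(1) by (auto simp: bump_def)
  then have z: "\<alpha> x = 0" if "x \<le> 0" for x using that by auto
  show "smooth1 (prim 0 \<alpha>)" by (rule prim_smooth[OF bump_smooth[OF assms(1)] z])
  show "deriv (prim 0 \<alpha>) = \<alpha>" by (rule deriv_prim[OF bump_continuous[OF assms(1)] z])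
qed

lemma prim_x_tens_continuous:
  assumes "\<alpha> \<in> bump 0 pi" "\<beta> \<in> bump (-l) l"
  shows "continuous_on UNIV (tens (prim 0 \<alpha>) \<beta>)"
  by (intro tens_continuous smooth1_continuous[OF prim_bump_smooth(1)[OF assms(1) pi_gt_zero]] bump_continuous[OF assms(2)])

lemma prim_x_continuous: "k \<in> tensor_sums l \<Longrightarrow> continuous_on UNIV (prim_x k)"
proof (induction rule: tensor_sums.induct)
  case (add k \<alpha> \<beta>)
  have "prim_x (\<lambda>z. k z + tens \<alpha> \<beta> z) = (\<lambda>z. prim_x k z + tens (prim 0 \<alpha>) \<beta> z)"
    unfolding prim_x_tens[symmetric]
    by (intro prim_x_add tensor_sums_continuous[OF add(1)] tens_continuous bump_continuous[OF add(2)] bump_continuous[OF add(3)])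
  then show ?case using add(4) prim_x_tens_continuous[OF add(2,3)] by (simp add: continuous_on_add)
qed (simp add: prim_x_def)

lemma weight_x_continuous:
  assumes \<kappa>: "continuous_on UNIV \<kappa>" and k: "k \<in> tensor_sums l"
  shows "continuous_on UNIV (weight_x \<kappa> k)"
  using k
proof induction
  case (add k \<alpha> \<beta>)
  have "weight_x \<kappa> (\<lambda>z. k z + tens \<alpha> \<beta> z) = (\<lambda>z. weight_x \<kappa> k z + weight_x \<kappa> (tens \<alpha> \<beta>) z)"
    by (intro weight_x_add tensor_sums_continuous[OF add(1)] tens_continuous bump_continuous[OF add(2)] bump_continuous[OF add(3)] \<kappa>)
  moreover have "continuous_on UNIV (weight_x \<kappa> (tens \<alpha> \<beta>))"
    unfolding weight_x_tens by (intro tens_continuous continuous_on_const bump_continuous[OF add(3)])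
  ultimately show ?case using add(4) by (simp add: continuous_on_add)
qed (simp add: weight_x_def)

lemma prim_x_norm:
  assumes "k \<in> tensor_sums l"
  shows "L2.nrm l (prim_x k) \<le> pi * L2.nrm l k"
proof -
  have kc: "continuous_on UNIV k" using assms by (rule tensor_sums_continuous)
  have "L2.nrm l (prim_x k) \<le> sqrt (pi * pi) * L2.nrm l k"
  proof (rule norm_slice_bound[OF prim_x_continuous[OF assms] kc])
    fix x y :: real assume x: "0 \<le> x" "x \<le> pi"
    let ?g = "\<lambda>s. k (s, y)"
    have g: "?g \<in> {f. continuous_on UNIV f}" "(\<lambda>_. 1) \<in> {f :: real \<Rightarrow> real. continuous_on UNIV f}"
      using slice_continuous(1)[OF kc] by auto
    have gi: "(\<lambda>s. (k (s, y))\<^sup>2) integrable_on {a..b}" for a b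
      by (intro integrable_continuous_real continuous_intros continuous_on_subset[OF slice_continuous(1)[OF kc]]) auto
    have "(prim_x k (x, y))\<^sup>2 = (ip1 0 x ?g (\<lambda>_. 1))\<^sup>2" by (simp add: prim_x_def ip1_def)
    also have "\<dots> \<le> (C1.nrm 0 x ?g * C1.nrm 0 x (\<lambda>_. 1))\<^sup>2"
      using C1.cauchy_schwarz[OF g, of 0 x] by (metis abs_ge_zero power2_abs power_mono)
    also have "\<dots> = integral {0..x} (\<lambda>s. (k (s, y))\<^sup>2) * x"
      unfolding power_mult_distrib C1.nrm_square[OF g(1)] C1.nrm_square[OF g(2)] using x
      by (simp add: ip1_def power2_eq_square)
    also have "\<dots> \<le> integral {0..pi} (\<lambda>s. (k (s, y))\<^sup>2) * pi"
      using x gi by (intro mult_mono integral_subset_le integral_nonneg) auto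
    finally show "(prim_x k (x, y))\<^sup>2 \<le> pi * integral {0..pi} (\<lambda>s. (k (s, y))\<^sup>2)" by (simp add: mult.commute)
  qed simp
  then show ?thesis by simp
qed

lemma weight_x_norm:
  assumes k: "k \<in> tensor_sums l" and \<kappa>: "continuous_on UNIV \<kappa>"
  shows "L2.nrm l (weight_x \<kappa> k) \<le> sqrt (ip1 0 pi \<kappa> \<kappa> * pi) * L2.nrm l k"
proof -
  have kc: "continuous_on UNIV k" using k by (rule tensor_sums_continuous)
  show ?thesis
  proof (rule norm_slice_bound[OF weight_x_continuous[OF \<kappa> k] kc])
    show "0 \<le> ip1 0 pi \<kappa> \<kappa>" using \<kappa> by (intro C1.ip_nonneg) simp
    fix x y :: real
    let ?g = "\<lambda>s. k (s, y)"
    have g: "?g \<in> {f. continuous_on UNIV f}" "\<kappa> \<in> {f. continuous_on UNIV f}"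
      using slice_continuous(1)[OF kc] \<kappa> by auto
    have "(weight_x \<kappa> k (x, y))\<^sup>2 = (ip1 0 pi \<kappa> ?g)\<^sup>2" by (simp add: weight_x_def ip1_def)
    also have "\<dots> \<le> (C1.nrm 0 pi \<kappa> * C1.nrm 0 pi ?g)\<^sup>2"
      using C1.cauchy_schwarz[OF g(2,1), of 0 pi] by (metis abs_ge_zero power2_abs power_mono)
    also have "\<dots> = ip1 0 pi \<kappa> \<kappa> * integral {0..pi} (\<lambda>s. (k (s, y))\<^sup>2)"
      unfolding power_mult_distrib C1.nrm_square[OF g(1)] C1.nrm_square[OF g(2)]
      by (simp add: ip1_def power2_eq_square)
    finally show "(weight_x \<kappa> k (x, y))\<^sup>2 \<le> ip1 0 pi \<kappa> \<kappa> * integral {0..pi} (\<lambda>s. (k (s, y))\<^sup>2)" .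
  qed
qed

section \<open>Functions vanishing on the hinged sides\<close>

definition x_deriv :: "real \<Rightarrow> (real \<times> real \<Rightarrow> real) \<Rightarrow> (real \<times> real \<Rightarrow> real) \<Rightarrow> bool" where
  "x_deriv l w q \<longleftrightarrow> w \<in> L2 l \<and> q \<in> L2 l \<and> (\<forall>\<alpha>\<in>bump 0 pi. \<forall>\<beta>\<in>bump (-l) l.
     inner0 l w (tens (deriv \<alpha>) \<beta>) = - inner0 l q (tens \<alpha> \<beta>))"

text \<open>
  The factor \<open>\<alpha>\<close> is not required to vanish at \<open>x = 0\<close> and
  \<open>x = \<pi>\<close>. The identity therefore expresses, in addition to \<open>p\<close>
  being the weak x-derivative of \<open>u\<close>, that \<open>u\<close> vanishes on the hinged
  sides.
\<close>

definition hinged_x_deriv :: "real \<Rightarrow> (real \<times> real \<Rightarrow> real) \<Rightarrow> (real \<times> real \<Rightarrow> real) \<Rightarrow> bool" where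
  "hinged_x_deriv l u p \<longleftrightarrow> u \<in> L2 l \<and> p \<in> L2 l \<and> (\<forall>\<alpha> \<beta>. smooth1 \<alpha> \<longrightarrow> \<beta> \<in> bump (-l) l \<longrightarrow>
     inner0 l u (tens (deriv \<alpha>) \<beta>) = - inner0 l p (tens \<alpha> \<beta>))"

lemma hinged_comb:
  assumes "hinged_x_deriv l u p" "hinged_x_deriv l v q"
  shows "hinged_x_deriv l (\<lambda>z. a * u z + b * v z) (\<lambda>z. a * p z + b * q z)"
  using assms unfolding hinged_x_deriv_def
  by (auto simp: L2.ip_comb L2.comb_mem tens_smooth_L2 smooth1_deriv bump_smooth algebra_simps)

text \<open>
  A tensor sum \<open>k\<close> is the x-derivative of \<open>prim_x k\<close>, which is
  admissible in \<open>hinged_x_deriv\<close> although it need not vanish at \<open>x =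
  \<pi>\<close>. So \<open>u\<close> pairs with \<open>k\<close> as \<open>-p\<close> pairs with
  \<open>prim_x k\<close>.
\<close>

lemma hinged_poincare:
  assumes l: "l > 0" and u: "hinged_x_deriv l u p"
  shows "L2.nrm l u \<le> pi * L2.nrm l p"
proof (rule nrm_le_by_duality[OF l])
  have uL: "u \<in> L2 l" "p \<in> L2 l" using u by (auto simp: hinged_x_deriv_def)
  then show "u \<in> L2 l" "0 \<le> pi * L2.nrm l p" by auto
  fix k assume k: "k \<in> tensor_sums l"
  then have "inner0 l u k = - inner0 l p (prim_x k)"
  proof induction
    case zero then show ?case by (simp add: inner0_def prim_x_def)
  next
    case (add k \<alpha> \<beta>)
    have t: "inner0 l u (tens \<alpha> \<beta>) = - inner0 l p (tens (prim 0 \<alpha>) \<beta>)"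
      using u prim_bump_smooth[OF add(2) pi_gt_zero] add(3) unfolding hinged_x_deriv_def by metis
    have kL: "k \<in> L2 l" "prim_x k \<in> L2 l" "tens \<alpha> \<beta> \<in> L2 l" "tens (prim 0 \<alpha>) \<beta> \<in> L2 l"
      by (intro tensor_sums_L2[OF add(1)] continuous_L2 prim_x_continuous[OF add(1)] tens_continuous
          bump_continuous[OF add(2)] bump_continuous[OF add(3)] smooth1_continuous[OF prim_bump_smooth(1)[OF add(2) pi_gt_zero]])+
    have "prim_x (\<lambda>z. k z + tens \<alpha> \<beta> z) = (\<lambda>z. prim_x k z + tens (prim 0 \<alpha>) \<beta> z)"
      unfolding prim_x_tens[symmetric]
      by (intro prim_x_add tensor_sums_continuous[OF add(1)] tens_continuous bump_continuous[OF add(2)] bump_continuous[OF add(3)])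
    then show ?case
      using L2.ip_comb_right[OF kL(1,3) uL(1), of 1 1] L2.ip_comb_right[OF kL(2,4) uL(2), of 1 1] add.IH t by simp
  qed
  then have "\<bar>inner0 l u k\<bar> \<le> L2.nrm l p * L2.nrm l (prim_x k)"
    using L2.cauchy_schwarz[OF uL(2) continuous_L2[OF prim_x_continuous[OF k]]] by simp
  also have "\<dots> \<le> L2.nrm l p * (pi * L2.nrm l k)"
    by (intro mult_left_mono prim_x_norm k L2.nrm_nonneg uL)
  finally show "\<bar>inner0 l u k\<bar> \<le> pi * L2.nrm l p * L2.nrm l k" by (simp add: mult_ac)
qed

lemma bump_hinged:
  assumes "\<alpha> \<in> bump 0 pi" "\<beta> \<in> bump (-l) l"
  shows "hinged_x_deriv l (tens \<alpha> \<beta>) (tens (deriv \<alpha>) \<beta>)"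
  unfolding hinged_x_deriv_def
proof (intro conjI allI impI)
  have sm: "smooth1 \<alpha>" "smooth1 \<beta>" using assms by (auto intro: bump_smooth)
  show "tens \<alpha> \<beta> \<in> L2 l" "tens (deriv \<alpha>) \<beta> \<in> L2 l" using sm by (auto intro!: tens_smooth_L2 smooth1_deriv)
  fix \<gamma> \<delta> assume g: "smooth1 \<gamma>" "\<delta> \<in> bump (-l) l"
  note cont = sm[THEN smooth1_continuous] g(1)[THEN smooth1_continuous] bump_continuous[OF g(2)]
    smooth1_continuous[OF smooth1_deriv[OF sm(1)]] smooth1_continuous[OF smooth1_deriv[OF g(1)]]
  obtain p q where pq: "0 < p" "q < pi" "\<And>x. x \<notin> {p..q} \<Longrightarrow> \<alpha> x = 0" using assms(1) by (auto simp: bump_def)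
  have ends: "\<alpha> 0 = 0" "\<alpha> pi = 0" using pq by auto
  have "((\<lambda>x. \<alpha> x * deriv \<gamma> x + deriv \<alpha> x * \<gamma> x) has_integral \<alpha> pi * \<gamma> pi - \<alpha> 0 * \<gamma> 0) {0..pi}"
    by (rule fundamental_theorem_of_calculus)
       (auto intro!: derivative_eq_intros has_vector_derivative_at_within DERIV_subset[OF smooth1_DERIV] sm g
         simp: has_real_derivative_iff_has_vector_derivative[symmetric])
  moreover have "(\<lambda>x. \<alpha> x * deriv \<gamma> x) integrable_on {0..pi}"
    by (rule integrable_continuous_real, rule continuous_on_subset[OF _ subset_UNIV]) (intro continuous_on_mult cont)
  moreover have "(\<lambda>x. deriv \<alpha> x * \<gamma> x) integrable_on {0..pi}"
    by (rule integrable_continuous_real, rule continuous_on_subset[OF _ subset_UNIV]) (intro continuous_on_mult cont)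
  ultimately have "integral {0..pi} (\<lambda>x. \<alpha> x * deriv \<gamma> x) = - integral {0..pi} (\<lambda>x. deriv \<alpha> x * \<gamma> x)"
    using ends by (simp add: integral_add[symmetric] integral_unique eq_neg_iff_add_eq_0)
  then show "inner0 l (tens \<alpha> \<beta>) (tens (deriv \<gamma>) \<delta>) = - inner0 l (tens (deriv \<alpha>) \<beta>) (tens \<gamma> \<delta>)"
    by (subst (1 2) inner0_tens) (auto intro: cont)
qed

text \<open>
  Subtracting from a tensor sum \<open>g\<close> the part \<open>r\<close> carried by a fixed
  profile \<open>\<kappa>\<close> of unit mass makes its integrals over horizontal lines vanish,
  so what remains is the x-derivative of a tensor sum. The last clause says that
  \<open>r\<close> depends on \<open>g\<close> only through those integrals.
\<close>

lemma tensor_sums_decompose: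
  assumes \<kappa>: "\<kappa> \<in> bump 0 pi" "integral {0..pi} \<kappa> = 1" and g: "g \<in> tensor_sums l"
  shows "\<exists>\<psi> r. \<psi> \<in> L2 l \<and> r \<in> L2 l \<and> hinged_x_deriv l \<psi> (\<lambda>z. g z - r z) \<and>
     (\<forall>w q. x_deriv l w q \<longrightarrow> inner0 l w (\<lambda>z. g z - r z) = - inner0 l q \<psi>) \<and>
     (\<forall>k\<in>tensor_sums l. inner0 l r k = inner0 l g (weight_x \<kappa> k))"
  using g
proof induction
  case zero
  show ?case
    by (intro exI[of _ "\<lambda>_. 0"]) (auto simp: inner0_def hinged_x_deriv_def L2.zero_mem)
next
  case (add g \<alpha> \<beta>)
  obtain \<psi> r where IH: "\<psi> \<in> L2 l" "r \<in> L2 l" "hinged_x_deriv l \<psi> (\<lambda>z. g z - r z)"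
    "\<And>w q. x_deriv l w q \<Longrightarrow> inner0 l w (\<lambda>z. g z - r z) = - inner0 l q \<psi>"
    "\<And>k. k \<in> tensor_sums l \<Longrightarrow> inner0 l r k = inner0 l g (weight_x \<kappa> k)"
    using add.IH by blast
  define c where "c = integral {0..pi} \<alpha>"
  define f where "f = (\<lambda>x. 1 * \<alpha> x + (- c) * \<kappa> x)"
  have f: "f \<in> bump 0 pi" unfolding f_def by (intro bump_comb add \<kappa>)
  have If: "integral {0..pi} f = 0"
  proof -
    have "\<alpha> integrable_on {0..pi}" "\<kappa> integrable_on {0..pi}"
      using continuous_on_subset[OF bump_continuous[OF add(2)]] continuous_on_subset[OF bump_continuous[OF \<kappa>(1)]]
      by (auto intro!: integrable_continuous_real)
    moreover from this have "(\<lambda>x. - (c * \<kappa> x)) integrable_on {0..pi}" by (auto intro: integrable_neg integrable_on_mult_right)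
    ultimately show ?thesis unfolding f_def using \<kappa>(2) by (subst integral_add) (auto simp: c_def)
  qed
  define \<phi> where "\<phi> = prim 0 f"
  have \<phi>: "\<phi> \<in> bump 0 pi" "deriv \<phi> = f" unfolding \<phi>_def using bump_prim[OF f pi_gt_zero If] by auto
  note cont = bump_continuous[OF add(2)] bump_continuous[OF add(3)] bump_continuous[OF \<kappa>(1)] bump_continuous[OF f] bump_continuous[OF \<phi>(1)]
  have TL: "tens \<alpha> \<beta> \<in> L2 l" "tens \<kappa> \<beta> \<in> L2 l" "tens f \<beta> \<in> L2 l" "tens \<phi> \<beta> \<in> L2 l" by (intro tens_L2 cont)+
  have gL: "g \<in> L2 l" by (intro tensor_sums_L2 add)
  let ?\<psi> = "\<lambda>z. 1 * \<psi> z + 1 * tens \<phi> \<beta> z" and ?r = "\<lambda>z. 1 * r z + c * tens \<kappa> \<beta> z"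
  have split: "(\<lambda>z. (g z + tens \<alpha> \<beta> z) - ?r z) = (\<lambda>z. 1 * (g z - r z) + 1 * tens f \<beta> z)"
    by (auto simp: f_def tens_def algebra_simps)
  have d: "(\<lambda>z. g z - r z) \<in> L2 l" by (intro L2.diff_mem gL IH)
  show ?case
  proof (rule exI[of _ ?\<psi>], rule exI[of _ ?r], intro conjI allI impI ballI)
    show "?\<psi> \<in> L2 l" "?r \<in> L2 l" by (intro L2.comb_mem IH TL)+
    show "hinged_x_deriv l ?\<psi> (\<lambda>z. (g z + tens \<alpha> \<beta> z) - ?r z)"
      unfolding split using bump_hinged[OF \<phi>(1) add(3)] \<phi>(2) by (intro hinged_comb IH) simp
    show "inner0 l w (\<lambda>z. (g z + tens \<alpha> \<beta> z) - ?r z) = - inner0 l q ?\<psi>" if wq: "x_deriv l w q" for w q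
    proof -
      have m: "w \<in> L2 l" "q \<in> L2 l" using wq by (auto simp: x_deriv_def)
      have "inner0 l w (tens f \<beta>) = - inner0 l q (tens \<phi> \<beta>)" using wq \<phi> add(3) by (auto simp: x_deriv_def)
      then show ?thesis unfolding split
        using L2.ip_comb_right[OF d TL(3) m(1), of 1 1] L2.ip_comb_right[OF IH(1) TL(4) m(2), of 1 1] IH(4)[OF wq] by simp
    qed
    fix k assume k: "k \<in> tensor_sums l"
    have kL: "k \<in> L2 l" "weight_x \<kappa> k \<in> L2 l"
      by (rule tensor_sums_L2[OF k], rule continuous_L2[OF weight_x_continuous[OF cont(3) k]])
    from k have "c * inner0 l (tens \<kappa> \<beta>) k = inner0 l (tens \<alpha> \<beta>) (weight_x \<kappa> k)"
    proof induction
      case zero then show ?case by (simp add: inner0_def weight_x_def)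
    next
      case (add k \<gamma> \<delta>)
      note cont' = bump_continuous[OF add(2)] bump_continuous[OF add(3)]
      have kL: "k \<in> L2 l" "weight_x \<kappa> k \<in> L2 l" "tens \<gamma> \<delta> \<in> L2 l" "weight_x \<kappa> (tens \<gamma> \<delta>) \<in> L2 l"
        using tensor_sums_L2[OF add(1)] continuous_L2[OF weight_x_continuous[OF cont(3) add(1)]] cont cont'
        by (auto simp: weight_x_tens intro!: tens_L2)
      have "c * inner0 l (tens \<kappa> \<beta>) (tens \<gamma> \<delta>) = inner0 l (tens \<alpha> \<beta>) (weight_x \<kappa> (tens \<gamma> \<delta>))"
        unfolding weight_x_tens using cont cont' by (subst (1 2) inner0_tens) (auto simp: c_def mult_ac)
      moreover have "weight_x \<kappa> (\<lambda>z. k z + tens \<gamma> \<delta> z) = (\<lambda>z. weight_x \<kappa> k z + weight_x \<kappa> (tens \<gamma> \<delta>) z)"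
        using add cont cont' by (intro weight_x_add tensor_sums_continuous tens_continuous) auto
      ultimately show ?case
        using L2.ip_comb_right[OF kL(1,3) TL(2), of 1 1] L2.ip_comb_right[OF kL(2,4) TL(1), of 1 1] add.IH
        by (simp add: distrib_left)
    qed
    then show "inner0 l ?r k = inner0 l (\<lambda>z. g z + tens \<alpha> \<beta> z) (weight_x \<kappa> k)"
      using L2.ip_comb[OF IH(2) TL(2) kL(1), of 1 c] L2.ip_comb[OF gL TL(1) kL(2), of 1 1] IH(5)[OF k] by simp
  qed
qed

text \<open>
  For functions \<open>w\<close> without boundary condition. Approximate \<open>p\<close> by a
  tensor sum \<open>g\<close> and decompose \<open>g\<close>. Taking \<open>\<alpha>\<close>
  constant in \<open>hinged_x_deriv\<close> shows that \<open>p\<close> has integral 0 over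
  horizontal lines, so \<open>r\<close> is small, and the Poincare inequality shows that
  \<open>\<psi>\<close> is close to \<open>v\<close>.
\<close>

theorem integration_by_parts:
  assumes l: "l > 0" and v: "hinged_x_deriv l v p" and w: "x_deriv l w q"
  shows "inner0 l w p = - inner0 l q v"
proof -
  obtain \<kappa> where \<kappa>: "\<kappa> \<in> bump 0 pi" "integral {0..pi} \<kappa> = 1"
  proof -
    obtain \<rho> where \<rho>: "smooth1 \<rho>" "\<And>x. x \<notin> {1..2} \<Longrightarrow> \<rho> x = 0" "integral {1..2} \<rho> = 1"
      using exists_unit_bump[of 1 2] by auto
    have "\<exists>p q. 0 < p \<and> q < pi \<and> (\<forall>x. x \<notin> {p..q} \<longrightarrow> \<rho> x = 0)"
      by (rule exI[of _ 1], rule exI[of _ 2]) (use \<rho> pi_gt3 in auto)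
    then have "\<rho> \<in> bump 0 pi" unfolding bump_def using \<rho> by blast
    moreover have "integral {0..pi} \<rho> = 1"
      using integral_support[of \<rho> 0 1 2 pi] \<rho> pi_gt3 smooth1_continuous by auto
    ultimately show ?thesis using that by blast
  qed
  have mem: "v \<in> L2 l" "p \<in> L2 l" "w \<in> L2 l" "q \<in> L2 l" using v w by (auto simp: hinged_x_deriv_def x_deriv_def)
  define C where "C = sqrt (ip1 0 pi \<kappa> \<kappa> * pi)"
  have C: "0 \<le> C" unfolding C_def using C1.ip_nonneg[of \<kappa> 0 pi] bump_continuous[OF \<kappa>(1)] by simp
  define K where "K = L2.nrm l w * (1 + C) + L2.nrm l q * (pi * (1 + C))"
  \<comment> \<open>\<open>weight_x \<kappa> k\<close> does not depend on \<open>x\<close>, and \<open>p\<close> has mean 0 in \<open>x\<close>\<close>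
  have p0: "inner0 l p (weight_x \<kappa> k) = 0" if "k \<in> tensor_sums l" for k
    using that
  proof induction
    case zero then show ?case by (simp add: inner0_def weight_x_def)
  next
    case (add k \<alpha> \<beta>)
    note cont = bump_continuous[OF add(2)] bump_continuous[OF add(3)] bump_continuous[OF \<kappa>(1)]
    have kL: "weight_x \<kappa> k \<in> L2 l" "weight_x \<kappa> (tens \<alpha> \<beta>) \<in> L2 l"
      using continuous_L2[OF weight_x_continuous[OF cont(3) add(1)]] cont by (auto simp: weight_x_tens intro!: tens_L2)
    have "inner0 l v (tens (deriv (\<lambda>_. c)) \<beta>) = - inner0 l p (tens (\<lambda>_. c) \<beta>)" for c
      using v smooth1_const add(3) unfolding hinged_x_deriv_def by blast
    then have "inner0 l p (weight_x \<kappa> (tens \<alpha> \<beta>)) = 0"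
      unfolding weight_x_tens by (simp add: tens_def inner0_def)
    moreover have "weight_x \<kappa> (\<lambda>z. k z + tens \<alpha> \<beta> z) = (\<lambda>z. weight_x \<kappa> k z + weight_x \<kappa> (tens \<alpha> \<beta>) z)"
      using add cont by (intro weight_x_add tensor_sums_continuous tens_continuous) auto
    ultimately show ?case using L2.ip_comb_right[OF kL mem(2), of 1 1] add.IH by simp
  qed
  have est: "\<bar>inner0 l w p + inner0 l q v\<bar> \<le> K * e" if e: "e > 0" for e
  proof -
    obtain g where g: "g \<in> tensor_sums l" "L2.nrm l (\<lambda>z. p z - g z) < e"
      using tensor_sums_dense[OF l mem(2) e] by blast
    obtain \<psi> r where dec: "\<psi> \<in> L2 l" "r \<in> L2 l" "hinged_x_deriv l \<psi> (\<lambda>z. g z - r z)"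
      "\<And>w q. x_deriv l w q \<Longrightarrow> inner0 l w (\<lambda>z. g z - r z) = - inner0 l q \<psi>"
      "\<And>k. k \<in> tensor_sums l \<Longrightarrow> inner0 l r k = inner0 l g (weight_x \<kappa> k)"
      using tensor_sums_decompose[OF \<kappa> g(1)] by blast
    have gL: "g \<in> L2 l" by (rule tensor_sums_L2[OF g(1)])
    let ?pg = "\<lambda>z. p z - g z"
    have pg: "?pg \<in> L2 l" by (intro L2.diff_mem mem gL)
    \<comment> \<open>\<open>r\<close> sees \<open>g\<close> only through the line integrals, where \<open>p\<close> vanishes, so \<open>g\<close> may be replaced by \<open>g - p\<close>\<close>
    have rn: "L2.nrm l r \<le> C * L2.nrm l ?pg"
    proof (rule nrm_le_by_duality[OF l dec(2)])
      show "0 \<le> C * L2.nrm l ?pg" using C pg by simp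
      fix k assume k: "k \<in> tensor_sums l"
      have wk: "weight_x \<kappa> k \<in> L2 l" by (rule continuous_L2[OF weight_x_continuous[OF bump_continuous[OF \<kappa>(1)] k]])
      have "inner0 l r k = - inner0 l ?pg (weight_x \<kappa> k)"
        using dec(5)[OF k] p0[OF k] by (simp add: L2.ip_diff mem gL wk)
      then have "\<bar>inner0 l r k\<bar> \<le> L2.nrm l ?pg * L2.nrm l (weight_x \<kappa> k)" using L2.cauchy_schwarz[OF pg wk] by simp
      also have "\<dots> \<le> L2.nrm l ?pg * (C * L2.nrm l k)"
        unfolding C_def by (intro mult_left_mono weight_x_norm k bump_continuous[OF \<kappa>(1)] L2.nrm_nonneg pg)
      finally show "\<bar>inner0 l r k\<bar> \<le> C * L2.nrm l ?pg * L2.nrm l k" by (simp add: mult_ac)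
    qed
    have r': "L2.nrm l r \<le> C * e" using rn g(2) C by (meson less_imp_le mult_left_mono order_trans)
    have "hinged_x_deriv l (\<lambda>z. 1 * v z + (-1) * \<psi> z) (\<lambda>z. 1 * p z + (-1) * (g z - r z))"
      by (intro hinged_comb v dec)
    then have "L2.nrm l (\<lambda>z. v z - \<psi> z) \<le> pi * L2.nrm l (\<lambda>z. p z - g z + r z)"
      using hinged_poincare[OF l] by (simp add: algebra_simps)
    also have "\<dots> \<le> pi * (e + C * e)"
      using L2.nrm_triangle[OF pg dec(2)] g(2) r' by (intro mult_left_mono) auto
    finally have vn: "L2.nrm l (\<lambda>z. v z - \<psi> z) \<le> pi * (e + C * e)" .
    have "inner0 l w p + inner0 l q v = inner0 l w ?pg + inner0 l w r + inner0 l q (\<lambda>z. v z - \<psi> z)"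
      using dec(4)[OF w] by (simp add: L2.ip_diff_right mem gL dec)
    moreover have "\<bar>inner0 l w ?pg\<bar> \<le> L2.nrm l w * e"
      by (rule order_trans[OF L2.cauchy_schwarz[OF mem(3) pg]]) (use g(2) mem in \<open>auto intro!: mult_left_mono\<close>)
    moreover have "\<bar>inner0 l w r\<bar> \<le> L2.nrm l w * (C * e)"
      by (rule order_trans[OF L2.cauchy_schwarz[OF mem(3) dec(2)]]) (use r' mem in \<open>auto intro!: mult_left_mono\<close>)
    moreover have "\<bar>inner0 l q (\<lambda>z. v z - \<psi> z)\<bar> \<le> L2.nrm l q * (pi * (e + C * e))"
      by (rule order_trans[OF L2.cauchy_schwarz[OF mem(4) L2.diff_mem[OF mem(1) dec(1)]]]) (use vn mem in \<open>auto intro!: mult_left_mono\<close>)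
    ultimately show ?thesis unfolding K_def by (simp add: algebra_simps abs_le_iff)
  qed
  have "((\<lambda>e. K * e) \<longlongrightarrow> K * 0) (at_right 0)" by (intro tendsto_intros)
  then have "\<bar>inner0 l w p + inner0 l q v\<bar> \<le> K * 0"
    by (rule tendsto_lowerbound) (auto simp: eventually_at_right_field intro!: exI[of _ 1] est)
  then show ?thesis by simp
qed

section \<open>Weak derivatives\<close>

lemma C_k_dir_deriv:
  assumes "\<forall>k. C_k k f"
  shows "\<forall>k. C_k k (dir_deriv (1, 0) f)" "\<forall>k. C_k k (dir_deriv (0, 1) f)"
  using assms C_k.simps(2) by blast+

lemma partial_deriv_C_k:
  assumes "\<forall>k. C_k k f"
  shows "\<forall>k. C_k k (partial_deriv a b f)"
proof -
  have "\<forall>k. C_k k ((dir_deriv (0, 1) ^^ b) f)" using assms by (induction b) (auto simp del: C_k.simps dest: C_k_dir_deriv)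
  then show ?thesis unfolding partial_deriv_def by (induction a) (auto simp del: C_k.simps dest: C_k_dir_deriv)
qed

lemma test_L2:
  assumes "\<psi> \<in> test_functions l"
  shows "\<psi> \<in> L2 l" "partial_deriv a b \<psi> \<in> L2 l"
proof -
  have C: "\<forall>k. C_k k \<psi>" using assms by (simp add: test_functions_def)
  then have "C_k 0 \<psi>" "C_k 0 (partial_deriv a b \<psi>)" using partial_deriv_C_k by blast+
  then show "\<psi> \<in> L2 l" "partial_deriv a b \<psi> \<in> L2 l" by (auto intro: continuous_L2)
qed

lemma weak_deriv_comb:
  assumes f: "f \<in> L2 l" "f' \<in> L2 l" and g: "is_weak_deriv l a b f g" "is_weak_deriv l a b f' g'"
  shows "is_weak_deriv l a b (\<lambda>z. c * f z + d * f' z) (\<lambda>z. c * g z + d * g' z)"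
  using assms unfolding is_weak_deriv_def
  by (auto simp: L2.comb_mem L2.ip_comb test_L2 algebra_simps)

lemma weak_deriv_tens:
  assumes "is_weak_deriv l a b f g" "\<alpha> \<in> bump 0 pi" "\<beta> \<in> bump (-l) l"
  shows "inner0 l f (tens ((deriv ^^ a) \<alpha>) ((deriv ^^ b) \<beta>)) = (-1) ^ (a + b) * inner0 l g (tens \<alpha> \<beta>)"
  using assms tens_test[OF assms(2,3)] partial_deriv_tens[of \<alpha> \<beta> a b] by (auto simp: is_weak_deriv_def bump_smooth)

lemma weak_deriv_unique:
  assumes l: "l > 0" and g: "is_weak_deriv l a b f g" "is_weak_deriv l a b f g'"
  shows "AE z in plate_measure l. g z = g' z"
proof -
  have m: "g \<in> L2 l" "g' \<in> L2 l" using g by (auto simp: is_weak_deriv_def)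
  have "AE z in plate_measure l. g z - g' z = 0"
  proof (rule fundamental_lemma[OF L2.diff_mem[OF m] l])
    fix \<alpha> \<beta> assume ab: "\<alpha> \<in> bump 0 pi" "\<beta> \<in> bump (-l) l"
    then have t: "tens \<alpha> \<beta> \<in> L2 l" by (intro tens_smooth_L2 bump_smooth)
    show "inner0 l (\<lambda>z. g z - g' z) (tens \<alpha> \<beta>) = 0"
      using weak_deriv_tens[OF g(1) ab] weak_deriv_tens[OF g(2) ab] by (simp add: L2.ip_diff m t)
  qed
  then show ?thesis by simp
qed

lemma H2_star_L2: "u \<in> H2_star l \<Longrightarrow> u \<in> L2 l"
  by (simp add: H2_star_def H2_def)

lemma H2_star_weak_deriv:
  assumes "u \<in> H2_star l" "a + b \<le> 2"
  shows "is_weak_deriv l a b u (weak_deriv l a b u)"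
proof -
  have "\<exists>g. is_weak_deriv l a b u g" using assms by (auto simp: H2_star_def H2_def)
  then show ?thesis unfolding weak_deriv_def by (rule someI_ex)
qed

lemma weak_deriv_L2: "u \<in> H2_star l \<Longrightarrow> a + b \<le> 2 \<Longrightarrow> weak_deriv l a b u \<in> L2 l"
  using H2_star_weak_deriv by (auto simp: is_weak_deriv_def)

definition boundary_rep :: "real \<Rightarrow> (real \<times> real \<Rightarrow> real) \<Rightarrow> (real \<times> real \<Rightarrow> real) \<Rightarrow> bool" where
  "boundary_rep l f u \<longleftrightarrow> continuous_on (closure (plate l)) u \<and>
     (AE z in plate_measure l. f z = u z) \<and> (\<forall>z \<in> {0, pi} \<times> {-l..l}. u z = 0)"

lemma H2_star_iff: "f \<in> H2_star l \<longleftrightarrow> f \<in> H2 l \<and> (\<exists>u. boundary_rep l f u)"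
  by (simp add: H2_star_def boundary_rep_def)

lemma boundary_rep_comb:
  assumes "boundary_rep l f u" "boundary_rep l g v"
  shows "boundary_rep l (\<lambda>z. a * f z + b * g z) (\<lambda>z. a * u z + b * v z)"
  using assms unfolding boundary_rep_def by (auto intro!: continuous_intros)

lemma H2_star_comb:
  assumes "f \<in> H2_star l" "g \<in> H2_star l"
  shows "(\<lambda>z. c * f z + d * g z) \<in> H2_star l"
proof -
  obtain u v where "boundary_rep l f u" "boundary_rep l g v" using assms by (auto simp: H2_star_iff)
  then have "\<exists>w. boundary_rep l (\<lambda>z. c * f z + d * g z) w" using boundary_rep_comb by blast
  moreover have "(\<lambda>z. c * f z + d * g z) \<in> H2 l"
    unfolding H2_def using weak_deriv_comb[OF assms[THEN H2_star_L2] assms[THEN H2_star_weak_deriv]]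
      L2.comb_mem[OF assms[THEN H2_star_L2]] by blast
  ultimately show ?thesis by (simp add: H2_star_iff)
qed

lemma H2_star_zero: "(\<lambda>_. 0) \<in> H2_star l"
proof -
  have "is_weak_deriv l a b (\<lambda>_. 0) (\<lambda>_. 0)" for a b by (simp add: is_weak_deriv_def L2.zero_mem inner0_def)
  then have "(\<lambda>_. 0) \<in> H2 l" unfolding H2_def using L2.zero_mem by blast
  moreover have "boundary_rep l (\<lambda>_. 0) (\<lambda>_. 0)" by (simp add: boundary_rep_def)
  ultimately show ?thesis unfolding H2_star_iff by blast
qed

text \<open>
  Representatives of weak derivatives are chosen arbitrarily, so linearity holds only almost
  everywhere.
\<close>

lemma weak_deriv_of_comb:
  assumes l: "l > 0" and u: "u \<in> H2_star l" and v: "v \<in> H2_star l" and ab: "a + b \<le> 2"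
  shows "AE z in plate_measure l. weak_deriv l a b (\<lambda>z. c * u z + d * v z) z = c * weak_deriv l a b u z + d * weak_deriv l a b v z"
  by (rule weak_deriv_unique[OF l H2_star_weak_deriv[OF H2_star_comb[OF u v] ab]
        weak_deriv_comb[OF u[THEN H2_star_L2] v[THEN H2_star_L2] H2_star_weak_deriv[OF u ab] H2_star_weak_deriv[OF v ab]]])

lemma inner0_weak_deriv_comb:
  assumes l: "l > 0" and u: "u \<in> H2_star l" and v: "v \<in> H2_star l" and ab: "a + b \<le> 2" and k: "k \<in> L2 l"
  shows "inner0 l (weak_deriv l a b (\<lambda>z. c * u z + d * v z)) k
     = c * inner0 l (weak_deriv l a b u) k + d * inner0 l (weak_deriv l a b v) k"
proof -
  note m = weak_deriv_L2[OF u ab] weak_deriv_L2[OF v ab]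
  have "inner0 l (weak_deriv l a b (\<lambda>z. c * u z + d * v z)) k
      = inner0 l (\<lambda>z. c * weak_deriv l a b u z + d * weak_deriv l a b v z) k"
    by (rule inner0_cong[OF _ k _ k weak_deriv_of_comb[OF l u v ab]])
       (auto intro!: weak_deriv_L2 H2_star_comb u v ab L2.comb_mem)
  then show ?thesis by (simp add: L2.ip_comb m k)
qed

lemma nrm_weak_deriv_diff:
  assumes l: "l > 0" and u: "u \<in> H2_star l" and v: "v \<in> H2_star l" and ab: "a + b \<le> 2"
  shows "L2.nrm l (weak_deriv l a b (\<lambda>z. u z - v z)) = L2.nrm l (\<lambda>z. weak_deriv l a b u z - weak_deriv l a b v z)"
proof -
  note m = weak_deriv_L2[OF u ab] weak_deriv_L2[OF v ab]
  have d: "weak_deriv l a b (\<lambda>z. u z - v z) \<in> L2 l"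
    using H2_star_comb[OF u v, of 1 "-1"] ab by (intro weak_deriv_L2) auto
  have "AE z in plate_measure l. weak_deriv l a b (\<lambda>z. u z - v z) z = weak_deriv l a b u z - weak_deriv l a b v z"
    using weak_deriv_of_comb[OF l u v ab, of 1 "-1"] by simp
  then show ?thesis unfolding L2.nrm_def using d L2.diff_mem[OF m] by (intro arg_cong[where f = sqrt] inner0_cong)
qed

section \<open>The inner products of the plate\<close>

lemma inner2_expand:
  assumes u: "u \<in> H2_star l" and v: "v \<in> H2_star l"
  shows "inner2 l \<sigma> u v = inner0 l (weak_deriv l 2 0 u) (weak_deriv l 2 0 v) + inner0 l (weak_deriv l 0 2 u) (weak_deriv l 0 2 v)
     + \<sigma> * (inner0 l (weak_deriv l 2 0 u) (weak_deriv l 0 2 v) + inner0 l (weak_deriv l 0 2 u) (weak_deriv l 2 0 v))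
     + 2 * (1 - \<sigma>) * inner0 l (weak_deriv l 1 1 u) (weak_deriv l 1 1 v)"
proof -
  have m: "weak_deriv l 2 0 w \<in> L2 l" "weak_deriv l 0 2 w \<in> L2 l" "weak_deriv l 1 1 w \<in> L2 l" if "w \<in> H2_star l" for w
    using that by (auto intro: weak_deriv_L2)
  have "inner2 l \<sigma> u v = (LINT z|plate_measure l. weak_deriv l 2 0 u z * weak_deriv l 2 0 v z + weak_deriv l 0 2 u z * weak_deriv l 0 2 v z
      + \<sigma> * (weak_deriv l 2 0 u z * weak_deriv l 0 2 v z + weak_deriv l 0 2 u z * weak_deriv l 2 0 v z)
      + 2 * (1 - \<sigma>) * (weak_deriv l 1 1 u z * weak_deriv l 1 1 v z))"
    unfolding inner2_def by (rule Bochner_Integration.integral_cong) (auto simp: algebra_simps)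
  then show ?thesis
    using m[OF u] m[OF v] by (simp add: inner0_def L2_integrable_mult)
qed

definition hessian_square :: "real \<Rightarrow> (real \<times> real \<Rightarrow> real) \<Rightarrow> real" where
  "hessian_square l u = inner0 l (weak_deriv l 2 0 u) (weak_deriv l 2 0 u) + inner0 l (weak_deriv l 0 2 u) (weak_deriv l 0 2 u)
     + 2 * inner0 l (weak_deriv l 1 1 u) (weak_deriv l 1 1 u)"

text \<open>
  The bending form is the sum of the squared second derivatives and \<open>2 \<sigma>\<close>
  times the product of the pure ones, which is at most \<open>\<sigma>\<close> times the sum of
  their squares.
\<close>

lemma inner2_coercive:
  assumes u: "u \<in> H2_star l" and \<sigma>: "0 < \<sigma>" "\<sigma> < 1 / 2"
  shows "(1 - \<sigma>) * hessian_square l u \<le> inner2 l \<sigma> u u" "inner2 l \<sigma> u u \<le> 2 * hessian_square l u"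
proof -
  have m: "weak_deriv l 2 0 u \<in> L2 l" "weak_deriv l 0 2 u \<in> L2 l" "weak_deriv l 1 1 u \<in> L2 l"
    using u by (auto intro: weak_deriv_L2)
  define p where "p = inner0 l (weak_deriv l 2 0 u) (weak_deriv l 2 0 u)"
  define q where "q = inner0 l (weak_deriv l 0 2 u) (weak_deriv l 0 2 u)"
  define r where "r = inner0 l (weak_deriv l 2 0 u) (weak_deriv l 0 2 u)"
  define n where "n = inner0 l (weak_deriv l 1 1 u) (weak_deriv l 1 1 u)"
  have e: "inner2 l \<sigma> u u = p + q + \<sigma> * (2 * r) + 2 * (1 - \<sigma>) * n"
    unfolding inner2_expand[OF u u] p_def q_def r_def n_def using L2.ip_sym[OF m(1,2)] by simp
  have n0: "0 \<le> n" "0 \<le> p" "0 \<le> q" unfolding n_def p_def q_def by (intro L2.ip_nonneg m)+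
  have "0 \<le> p + 2 * r + q" "0 \<le> p - 2 * r + q"
    using L2.ip_nonneg[OF L2.comb_mem[OF m(1,2), of 1 1]] L2.ip_square_comb[OF m(1,2), of 1 1]
      L2.ip_nonneg[OF L2.comb_mem[OF m(1,2), of 1 "-1"]] L2.ip_square_comb[OF m(1,2), of 1 "-1"]
    by (simp_all add: p_def q_def r_def)
  then have "\<sigma> * (- (p + q)) \<le> \<sigma> * (2 * r)" "\<sigma> * (2 * r) \<le> \<sigma> * (p + q)"
    using \<sigma> by (intro mult_left_mono; simp)+
  moreover have "\<sigma> * (p + q) \<le> 1 * (p + q)" by (rule mult_right_mono) (use \<sigma> n0 in auto)
  moreover have "0 \<le> \<sigma> * n" using \<sigma> n0 by simp
  moreover have "hessian_square l u = p + q + 2 * n" by (simp add: hessian_square_def p_def q_def n_def)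
  ultimately show "(1 - \<sigma>) * hessian_square l u \<le> inner2 l \<sigma> u u" "inner2 l \<sigma> u u \<le> 2 * hessian_square l u"
    unfolding e using n0 by (auto simp: algebra_simps)
qed

lemma semi_inner_inner2:
  assumes l: "l > 0" and \<sigma>: "0 < \<sigma>" "\<sigma> < 1 / 2"
  shows "semi_inner (H2_star l) (inner2 l \<sigma>)"
proof
  show "(\<lambda>_. 0) \<in> H2_star l" by (rule H2_star_zero)
  fix f g k a b assume f: "f \<in> H2_star l" and g: "g \<in> H2_star l"
  show fg: "(\<lambda>z. a * f z + b * g z) \<in> H2_star l" by (rule H2_star_comb[OF f g])
  have sym: "inner0 l (weak_deriv l i j f) (weak_deriv l m n g) = inner0 l (weak_deriv l m n g) (weak_deriv l i j f)"
    if "i + j \<le> 2" "m + n \<le> 2" for i j m n using that f g by (intro L2.ip_sym weak_deriv_L2)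
  show "inner2 l \<sigma> f g = inner2 l \<sigma> g f"
    using sym[of 2 0 2 0] sym[of 0 2 0 2] sym[of 2 0 0 2] sym[of 0 2 2 0] sym[of 1 1 1 1]
    by (simp add: inner2_expand f g)
  have "0 \<le> inner0 l (weak_deriv l i j f) (weak_deriv l i j f)" if "i + j \<le> 2" for i j
    using that f by (intro L2.ip_nonneg weak_deriv_L2)
  from this[of 2 0] this[of 0 2] this[of 1 1]
  have "0 \<le> (1 - \<sigma>) * hessian_square l f" unfolding hessian_square_def using \<sigma> by (intro mult_nonneg_nonneg) auto
  then show "0 \<le> inner2 l \<sigma> f f" using inner2_coercive(1)[OF f \<sigma>] by linarith
  assume k: "k \<in> H2_star l"
  show "inner2 l \<sigma> (\<lambda>z. a * f z + b * g z) k = a * inner2 l \<sigma> f k + b * inner2 l \<sigma> g k"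
    unfolding inner2_expand[OF fg k] inner2_expand[OF f k] inner2_expand[OF g k]
    by (simp add: inner0_weak_deriv_comb[OF l f g] weak_deriv_L2 k algebra_simps)
qed

lemma semi_inner_stretch:
  assumes l: "l > 0"
  shows "semi_inner (H2_star l) (\<lambda>u v. inner0 l (weak_deriv l 1 0 u) (weak_deriv l 1 0 v))"
proof
  show "(\<lambda>_. 0) \<in> H2_star l" by (rule H2_star_zero)
  fix f g k a b assume f: "f \<in> H2_star l" and g: "g \<in> H2_star l"
  show fg: "(\<lambda>z. a * f z + b * g z) \<in> H2_star l" by (rule H2_star_comb[OF f g])
  show "inner0 l (weak_deriv l 1 0 f) (weak_deriv l 1 0 g) = inner0 l (weak_deriv l 1 0 g) (weak_deriv l 1 0 f)"
    using f g by (intro L2.ip_sym weak_deriv_L2) auto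
  show "0 \<le> inner0 l (weak_deriv l 1 0 f) (weak_deriv l 1 0 f)" using f by (intro L2.ip_nonneg weak_deriv_L2) auto
  assume k: "k \<in> H2_star l"
  show "inner0 l (weak_deriv l 1 0 (\<lambda>z. a * f z + b * g z)) (weak_deriv l 1 0 k)
     = a * inner0 l (weak_deriv l 1 0 f) (weak_deriv l 1 0 k) + b * inner0 l (weak_deriv l 1 0 g) (weak_deriv l 1 0 k)"
    by (simp add: inner0_weak_deriv_comb[OF l f g] weak_deriv_L2 k)
qed

section \<open>Cutting off near the hinged sides\<close>

lemma exists_cutoffs:
  obtains \<eta> :: "nat \<Rightarrow> real \<Rightarrow> real" and e :: "nat \<Rightarrow> real"
  where "\<And>n. \<eta> n \<in> bump 0 pi" "\<And>n x. 0 \<le> \<eta> n x \<and> \<eta> n x \<le> 1" "\<And>x. 0 < x \<Longrightarrow> x < pi \<Longrightarrow> (\<lambda>n. \<eta> n x) \<longlonglongrightarrow> 1"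
    "\<And>n x. x \<in> {e n..pi - e n} \<Longrightarrow> deriv (\<eta> n) x = 0" "\<And>n. integral {0..pi} (\<lambda>x. \<bar>deriv (\<eta> n) x\<bar>) \<le> 2"
    "e \<longlonglongrightarrow> 0" "\<And>n. 0 < e n"
proof -
  define e where "e n = pi / (real n + 3)" for n :: nat
  have e: "0 < e n" "e n < pi - e n" for n
  proof -
    show "0 < e n" by (simp add: e_def)
    have "2 * pi < (real n + 3) * pi" by (intro mult_strict_right_mono) auto
    then have "2 * e n < pi" by (simp add: e_def divide_less_eq mult.commute)
    then show "e n < pi - e n" by simp
  qed
  have e0: "e \<longlonglongrightarrow> 0" unfolding e_def
    using filterlim_tendsto_add_at_top[OF tendsto_const[of 3] filterlim_real_sequentially]
    by (intro tendsto_divide_0[OF tendsto_const] filterlim_at_top_imp_at_infinity) (simp add: add.commute)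
  have "\<exists>\<alpha>\<in>bump 0 pi. (\<forall>x. 0 \<le> \<alpha> x \<and> \<alpha> x \<le> 1) \<and> (\<forall>x\<in>{e n..pi - e n}. \<alpha> x = 1 \<and> deriv \<alpha> x = 0) \<and>
     integral {0..pi} (\<lambda>x. \<bar>deriv \<alpha> x\<bar>) \<le> 2" for n
    using exists_plateau[of 0 "e n" "pi - e n" pi] e[of n] by auto
  then obtain \<eta> where \<eta>: "\<And>n. \<eta> n \<in> bump 0 pi" "\<And>n x. 0 \<le> \<eta> n x \<and> \<eta> n x \<le> 1"
    "\<And>n x. x \<in> {e n..pi - e n} \<Longrightarrow> \<eta> n x = 1 \<and> deriv (\<eta> n) x = 0" "\<And>n. integral {0..pi} (\<lambda>x. \<bar>deriv (\<eta> n) x\<bar>) \<le> 2"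
    by metis
  have "(\<lambda>n. \<eta> n x) \<longlonglongrightarrow> 1" if "0 < x" "x < pi" for x
  proof -
    have "\<forall>\<^sub>F n in sequentially. e n < min x (pi - x)" using e0 that by (intro order_tendstoD(2)[where y=0]) auto
    then have "\<forall>\<^sub>F n in sequentially. 1 = \<eta> n x"
      by eventually_elim (use \<eta>(3) in auto)
    then show ?thesis by (rule Lim_transform_eventually[OF tendsto_const])
  qed
  then show ?thesis using that \<eta> e e0 by blast
qed

lemma cutoff_limit:
  assumes f: "f \<in> L2 l" and c: "continuous_on UNIV \<gamma>" "continuous_on UNIV \<beta>"
    and \<eta>: "\<And>n. \<eta> n \<in> bump 0 pi" "\<And>n x. 0 \<le> \<eta> n x \<and> \<eta> n x \<le> 1" "\<And>x. 0 < x \<Longrightarrow> x < pi \<Longrightarrow> (\<lambda>n. \<eta> n x) \<longlonglongrightarrow> 1"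
  shows "(\<lambda>n::nat. inner0 l f (tens (\<lambda>x. \<gamma> x * \<eta> n x) \<beta>)) \<longlonglongrightarrow> inner0 l f (tens \<gamma> \<beta>)"
  unfolding inner0_def
proof (rule integral_dominated_convergence[where w = "\<lambda>z. \<bar>f z * tens \<gamma> \<beta> z\<bar>"])
  have tL: "tens \<gamma> \<beta> \<in> L2 l" "tens (\<lambda>x. \<gamma> x * \<eta> n x) \<beta> \<in> L2 l" for n
    by (intro tens_L2 continuous_on_mult c bump_continuous[OF \<eta>(1)])+
  show "(\<lambda>z. f z * tens \<gamma> \<beta> z) \<in> borel_measurable (plate_measure l)"
    "(\<lambda>z. f z * tens (\<lambda>x. \<gamma> x * \<eta> n x) \<beta> z) \<in> borel_measurable (plate_measure l)" for n
    by (intro borel_measurable_times L2_measurable f tL)+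
  show "integrable (plate_measure l) (\<lambda>z. \<bar>f z * tens \<gamma> \<beta> z\<bar>)" by (intro integrable_abs L2_integrable_mult f tL)
  show "AE z in plate_measure l. (\<lambda>n. f z * tens (\<lambda>x. \<gamma> x * \<eta> n x) \<beta> z) \<longlonglongrightarrow> f z * tens \<gamma> \<beta> z"
  proof (rule AE_I2)
    fix z assume "z \<in> space (plate_measure l)"
    then have "(\<lambda>n. \<eta> n (fst z)) \<longlonglongrightarrow> 1" by (intro \<eta>(3)) (auto simp: plate_def)
    then have "(\<lambda>n. f z * (\<gamma> (fst z) * \<eta> n (fst z) * \<beta> (snd z))) \<longlonglongrightarrow> f z * (\<gamma> (fst z) * 1 * \<beta> (snd z))"
      by (intro tendsto_intros)
    then show "(\<lambda>n. f z * tens (\<lambda>x. \<gamma> x * \<eta> n x) \<beta> z) \<longlonglongrightarrow> f z * tens \<gamma> \<beta> z" by (simp add: tens_def)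
  qed
  show "AE z in plate_measure l. norm (f z * tens (\<lambda>x. \<gamma> x * \<eta> n x) \<beta> z) \<le> \<bar>f z * tens \<gamma> \<beta> z\<bar>" for n
  proof (rule AE_I2)
    fix z
    have "\<bar>f z * tens (\<lambda>x. \<gamma> x * \<eta> n x) \<beta> z\<bar> = \<bar>f z * tens \<gamma> \<beta> z\<bar> * \<eta> n (fst z)"
      using \<eta>(2)[of n "fst z"] by (simp add: tens_def abs_mult)
    also have "\<dots> \<le> \<bar>f z * tens \<gamma> \<beta> z\<bar> * 1" using \<eta>(2)[of n "fst z"] by (intro mult_left_mono) auto
    finally show "norm (f z * tens (\<lambda>x. \<gamma> x * \<eta> n x) \<beta> z) \<le> \<bar>f z * tens \<gamma> \<beta> z\<bar>" by simp
  qed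
qed

text \<open>
  No derivative in \<open>x\<close> is taken here, so the test function need not vanish on the
  hinged sides.
\<close>

lemma y_deriv_extended:
  assumes f: "f \<in> L2 l" and g: "g \<in> L2 l"
    and w: "\<And>\<alpha> \<beta>. \<alpha> \<in> bump 0 pi \<Longrightarrow> \<beta> \<in> bump (-l) l \<Longrightarrow> inner0 l f (tens \<alpha> (deriv \<beta>)) = - inner0 l g (tens \<alpha> \<beta>)"
    and \<alpha>: "smooth1 \<alpha>" and \<beta>: "\<beta> \<in> bump (-l) l"
  shows "inner0 l f (tens \<alpha> (deriv \<beta>)) = - inner0 l g (tens \<alpha> \<beta>)"
proof -
  obtain \<eta> e where \<eta>: "\<And>n::nat. \<eta> n \<in> bump 0 pi" "\<And>n x. 0 \<le> \<eta> n x \<and> \<eta> n x \<le> 1" "\<And>x. 0 < x \<Longrightarrow> x < pi \<Longrightarrow> (\<lambda>n. \<eta> n x) \<longlonglongrightarrow> 1"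
    using exists_cutoffs by metis
  note c = smooth1_continuous[OF \<alpha>] bump_continuous[OF \<beta>] bump_continuous[OF bump_deriv[OF \<beta>]]
  have eq: "inner0 l f (tens (\<lambda>x. \<alpha> x * \<eta> n x) (deriv \<beta>)) = - inner0 l g (tens (\<lambda>x. \<alpha> x * \<eta> n x) \<beta>)" for n
    by (intro w bump_mult \<alpha> \<eta> \<beta>)
  have "(\<lambda>n. inner0 l f (tens (\<lambda>x. \<alpha> x * \<eta> n x) (deriv \<beta>))) \<longlonglongrightarrow> inner0 l f (tens \<alpha> (deriv \<beta>))"
    by (rule cutoff_limit[OF f c(1,3) \<eta>])
  moreover have "(\<lambda>n. - inner0 l g (tens (\<lambda>x. \<alpha> x * \<eta> n x) \<beta>)) \<longlonglongrightarrow> - inner0 l g (tens \<alpha> \<beta>)"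
    by (intro tendsto_minus cutoff_limit[OF g c(1,2) \<eta>])
  ultimately show ?thesis unfolding eq by (rule LIMSEQ_unique)
qed

lemma closure_plate: "l > 0 \<Longrightarrow> closure (plate l) = {0..pi} \<times> {-l..l}"
  by (simp add: plate_def closure_Times)

lemma compact_closure_plate: "compact (closure (plate l))"
  using bounded_plate by simp

text \<open>
  Cut the test function off near the hinged sides. The derivatives of the cut-offs have bounded
  mass, and where they do not vanish the continuous representative is uniformly small.
\<close>

theorem H2_star_hinged:
  assumes l: "l > 0" and u: "u \<in> H2_star l"
  shows "hinged_x_deriv l u (weak_deriv l 1 0 u)"
  unfolding hinged_x_deriv_def
proof (intro conjI allI impI)
  show uL: "u \<in> L2 l" by (rule H2_star_L2[OF u])
  show pL: "weak_deriv l 1 0 u \<in> L2 l" by (rule weak_deriv_L2[OF u]) simp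
  fix \<alpha> \<beta> assume \<alpha>: "smooth1 \<alpha>" and \<beta>: "\<beta> \<in> bump (-l) l"
  obtain c where c: "boundary_rep l u c" using u by (auto simp: H2_star_iff)
  have cc: "continuous_on ({0..pi} \<times> {-l..l}) c" using c closure_plate[OF l] by (simp add: boundary_rep_def)
  obtain \<eta> e where \<eta>: "\<And>n::nat. \<eta> n \<in> bump 0 pi" "\<And>n x. 0 \<le> \<eta> n x \<and> \<eta> n x \<le> 1" "\<And>x. 0 < x \<Longrightarrow> x < pi \<Longrightarrow> (\<lambda>n. \<eta> n x) \<longlonglongrightarrow> 1"
    and \<eta>': "\<And>n x. x \<in> {e n..pi - e n} \<Longrightarrow> deriv (\<eta> n) x = 0" "\<And>n. integral {0..pi} (\<lambda>x. \<bar>deriv (\<eta> n) x\<bar>) \<le> 2"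
    "e \<longlonglongrightarrow> 0" "\<And>n. 0 < e n"
    using exists_cutoffs by metis
  note cont = smooth1_continuous[OF \<alpha>] bump_continuous[OF \<beta>] smooth1_continuous[OF smooth1_deriv[OF \<alpha>]]
  have \<eta>c: "continuous_on UNIV (\<eta> n)" "continuous_on UNIV (deriv (\<eta> n))" for n
    by (rule bump_continuous[OF \<eta>(1)], rule bump_continuous[OF bump_deriv[OF \<eta>(1)]])
  let ?b = "\<lambda>n. inner0 l u (tens (\<lambda>x. \<alpha> x * deriv (\<eta> n) x) \<beta>)"
  have eq: "inner0 l u (tens (\<lambda>x. deriv \<alpha> x * \<eta> n x) \<beta>) + ?b n = - inner0 l (weak_deriv l 1 0 u) (tens (\<lambda>x. \<alpha> x * \<eta> n x) \<beta>)" for n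
  proof -
    have "inner0 l u (tens (deriv (\<lambda>x. \<alpha> x * \<eta> n x)) \<beta>) = - inner0 l (weak_deriv l 1 0 u) (tens (\<lambda>x. \<alpha> x * \<eta> n x) \<beta>)"
      using weak_deriv_tens[OF H2_star_weak_deriv[OF u, of 1 0] bump_mult[OF \<alpha> \<eta>(1)] \<beta>] by simp
    moreover have "tens (deriv (\<lambda>x. \<alpha> x * \<eta> n x)) \<beta> = (\<lambda>z. 1 * tens (\<lambda>x. deriv \<alpha> x * \<eta> n x) \<beta> z + 1 * tens (\<lambda>x. \<alpha> x * deriv (\<eta> n) x) \<beta> z)"
      unfolding deriv_mult1[OF \<alpha> bump_smooth[OF \<eta>(1)]] by (auto simp: tens_def algebra_simps)
    moreover have "inner0 l u (\<lambda>z. 1 * tens (\<lambda>x. deriv \<alpha> x * \<eta> n x) \<beta> z + 1 * tens (\<lambda>x. \<alpha> x * deriv (\<eta> n) x) \<beta> z)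
      = 1 * inner0 l u (tens (\<lambda>x. deriv \<alpha> x * \<eta> n x) \<beta>) + 1 * ?b n"
      by (intro L2.ip_comb_right tens_L2 continuous_on_mult cont \<eta>c uL)
    ultimately show ?thesis by simp
  qed
  \<comment> \<open>the only term with a derivative of the cut-off\<close>
  have b0: "?b \<longlonglongrightarrow> 0"
  proof (rule LIMSEQ_I)
    fix r :: real assume r: "0 < r"
    obtain A where A: "A > 0" "\<And>x. x \<in> {0..pi} \<Longrightarrow> \<bar>\<alpha> x\<bar> \<le> A"
    proof -
      have "bounded (\<alpha> ` {0..pi})" by (intro compact_imp_bounded compact_continuous_image continuous_on_subset[OF cont(1)]) auto
      then show ?thesis using that unfolding bounded_pos by auto
    qed
    obtain B where B: "B > 0" "\<And>y. y \<in> {-l..l} \<Longrightarrow> \<bar>\<beta> y\<bar> \<le> B"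
    proof -
      have "bounded (\<beta> ` {-l..l})" by (intro compact_imp_bounded compact_continuous_image continuous_on_subset[OF cont(2)]) auto
      then show ?thesis using that unfolding bounded_pos by auto
    qed
    define d where "d = r / (A * B * (2 * (2 * l)) + 1)"
    have K: "0 < A * B * (2 * (2 * l))" using A B l by simp
    have d: "d > 0" "d * (A * B * (2 * (2 * l))) < r" using r K by (auto simp: d_def field_simps)
    obtain \<rho> where \<rho>: "\<rho> > 0" "\<And>z z'. z \<in> {0..pi} \<times> {-l..l} \<Longrightarrow> z' \<in> {0..pi} \<times> {-l..l} \<Longrightarrow> dist z' z < \<rho> \<Longrightarrow> dist (c z') (c z) < d"
      using compact_uniformly_continuous[OF cc] d(1) unfolding uniformly_continuous_on_def by (metis compact_Times compact_Icc)
    have "\<forall>\<^sub>F n in sequentially. e n < \<rho>" using \<eta>'(3) \<rho>(1) by (intro order_tendstoD(2)[where y=0]) auto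
    then obtain N where N: "\<And>n. n \<ge> N \<Longrightarrow> e n < \<rho>" unfolding eventually_sequentially by blast
    have "norm (?b n - 0) < r" if n: "n \<ge> N" for n
    proof -
      have small: "\<bar>c (x, y)\<bar> \<le> d" if x: "x \<in> {0..pi}" "y \<in> {-l..l}" "deriv (\<eta> n) x \<noteq> 0" for x y
      proof -
        have "x < e n \<or> pi - x < e n" using x(3) \<eta>'(1)[of x n] by force
        then show ?thesis
        proof
          assume "x < e n"
          then have "dist (x, y) (0, y) < \<rho>" using N[OF n] x by (simp add: dist_Pair_Pair dist_real_def)
          then have "dist (c (x, y)) (c (0, y)) < d" using x by (intro \<rho>) auto
          then show ?thesis using c x by (simp add: boundary_rep_def dist_real_def)
        next
          assume "pi - x < e n"
          then have "dist (x, y) (pi, y) < \<rho>" using N[OF n] x by (simp add: dist_Pair_Pair dist_real_def)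
          then have "dist (c (x, y)) (c (pi, y)) < d" using x by (intro \<rho>) auto
          then show ?thesis using c x by (simp add: boundary_rep_def dist_real_def)
        qed
      qed
      let ?t = "tens (\<lambda>x. \<alpha> x * deriv (\<eta> n) x) \<beta>" and ?m = "tens (\<lambda>x. \<bar>deriv (\<eta> n) x\<bar>) (\<lambda>_. 1)"
      have tL: "?t \<in> L2 l" by (intro tens_L2 continuous_on_mult cont \<eta>c)
      have mL: "?m \<in> L2 l" by (intro tens_L2 continuous_on_rabs continuous_on_const \<eta>c)
      have "\<bar>?b n\<bar> \<le> (LINT z|plate_measure l. \<bar>u z * ?t z\<bar>)" unfolding inner0_def by (rule integral_abs_bound)
      also have "\<dots> \<le> (LINT z|plate_measure l. d * (A * B) * ?m z)"
      proof (rule integral_mono_AE)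
        show "integrable (plate_measure l) (\<lambda>z. \<bar>u z * ?t z\<bar>)" by (intro integrable_abs L2_integrable_mult uL tL)
        show "integrable (plate_measure l) (\<lambda>z. d * (A * B) * ?m z)" by (intro integrable_mult_right L2_integrable mL)
        have "AE z in plate_measure l. u z = c z" using c by (simp add: boundary_rep_def)
        then show "AE z in plate_measure l. \<bar>u z * ?t z\<bar> \<le> d * (A * B) * ?m z"
        proof (rule AE_mp, intro AE_I2 impI)
          fix z assume z: "z \<in> space (plate_measure l)" and uc: "u z = c z"
          obtain x y where zxy: "z = (x, y)" by (cases z)
          have xy: "x \<in> {0..pi}" "y \<in> {-l..l}" using z by (auto simp: plate_def zxy)
          have "\<bar>c (x, y)\<bar> * \<bar>deriv (\<eta> n) x\<bar> \<le> d * \<bar>deriv (\<eta> n) x\<bar>"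
            using small[OF xy] by (cases "deriv (\<eta> n) x = 0") (auto intro!: mult_right_mono)
          moreover have "\<bar>\<alpha> x\<bar> * \<bar>\<beta> y\<bar> \<le> A * B" using A B xy by (intro mult_mono) auto
          ultimately have "(\<bar>c (x, y)\<bar> * \<bar>deriv (\<eta> n) x\<bar>) * (\<bar>\<alpha> x\<bar> * \<bar>\<beta> y\<bar>) \<le> (d * \<bar>deriv (\<eta> n) x\<bar>) * (A * B)"
            by (rule mult_mono) (use d in auto)
          then show "\<bar>u z * ?t z\<bar> \<le> d * (A * B) * ?m z" unfolding uc by (simp add: zxy tens_def abs_mult mult_ac)
        qed
      qed
      also have "\<dots> = d * (A * B) * (integral {0..pi} (\<lambda>x. \<bar>deriv (\<eta> n) x\<bar>) * (2 * l))"
      proof -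
        have "(LINT z|plate_measure l. ?m z) = integral {0..pi} (\<lambda>x. \<bar>deriv (\<eta> n) x\<bar>) * integral {-l..l} (\<lambda>_. 1)"
          by (intro integral_tens continuous_on_rabs \<eta>c continuous_on_const)
        then show ?thesis using l by simp
      qed
      also have "\<dots> \<le> d * (A * B) * (2 * (2 * l))"
        using \<eta>'(2)[of n] A B d l by (intro mult_left_mono mult_right_mono) auto
      also have "\<dots> < r" using d(2) by (simp add: mult_ac)
      finally show ?thesis by simp
    qed
    then show "\<exists>no. \<forall>n\<ge>no. norm (?b n - 0) < r" by blast
  qed
  have "(\<lambda>n. inner0 l u (tens (\<lambda>x. deriv \<alpha> x * \<eta> n x) \<beta>) + ?b n) \<longlonglongrightarrow> inner0 l u (tens (deriv \<alpha>) \<beta>) + 0"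
    by (intro tendsto_add b0 cutoff_limit[OF uL cont(3,2) \<eta>])
  note lim1 = this[unfolded eq]
  have "(\<lambda>n. - inner0 l (weak_deriv l 1 0 u) (tens (\<lambda>x. \<alpha> x * \<eta> n x) \<beta>)) \<longlonglongrightarrow> - inner0 l (weak_deriv l 1 0 u) (tens \<alpha> \<beta>)"
    by (intro tendsto_minus cutoff_limit[OF pL cont(1,2) \<eta>])
  from LIMSEQ_unique[OF lim1 this]
  show "inner0 l u (tens (deriv \<alpha>) \<beta>) = - inner0 l (weak_deriv l 1 0 u) (tens \<alpha> \<beta>)" by simp
qed

lemma H2_star_mixed:
  assumes l: "l > 0" and u: "u \<in> H2_star l" and \<alpha>: "smooth1 \<alpha>" and \<beta>: "\<beta> \<in> bump (-l) l"
  shows "inner0 l u (tens \<alpha> (deriv \<beta>)) = - inner0 l (weak_deriv l 0 1 u) (tens \<alpha> \<beta>)"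
    "inner0 l (weak_deriv l 1 0 u) (tens \<alpha> (deriv \<beta>)) = - inner0 l (weak_deriv l 1 1 u) (tens \<alpha> \<beta>)"
proof -
  have m: "u \<in> L2 l" "weak_deriv l 0 1 u \<in> L2 l" "weak_deriv l 1 0 u \<in> L2 l" "weak_deriv l 1 1 u \<in> L2 l"
    using u by (auto intro: weak_deriv_L2 H2_star_L2)
  show "inner0 l u (tens \<alpha> (deriv \<beta>)) = - inner0 l (weak_deriv l 0 1 u) (tens \<alpha> \<beta>)"
    using weak_deriv_tens[OF H2_star_weak_deriv[OF u, of 0 1]] by (intro y_deriv_extended[OF m(1,2) _ \<alpha> \<beta>]) simp
  show "inner0 l (weak_deriv l 1 0 u) (tens \<alpha> (deriv \<beta>)) = - inner0 l (weak_deriv l 1 1 u) (tens \<alpha> \<beta>)"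
  proof (rule y_deriv_extended[OF m(3,4) _ \<alpha> \<beta>])
    fix \<alpha> \<beta> assume ab: "\<alpha> \<in> bump 0 pi" "\<beta> \<in> bump (-l) l"
    show "inner0 l (weak_deriv l 1 0 u) (tens \<alpha> (deriv \<beta>)) = - inner0 l (weak_deriv l 1 1 u) (tens \<alpha> \<beta>)"
      using weak_deriv_tens[OF H2_star_weak_deriv[OF u, of 1 0] ab(1) bump_deriv[OF ab(2)]]
        weak_deriv_tens[OF H2_star_weak_deriv[OF u, of 1 1] ab] by simp
  qed
qed

text \<open>
  The y-derivative need not have a continuous representative; exchanging the two derivatives
  reduces the claim to \<open>u\<close> itself.
\<close>

lemma H2_star_hinged_y:
  assumes l: "l > 0" and u: "u \<in> H2_star l"
  shows "hinged_x_deriv l (weak_deriv l 0 1 u) (weak_deriv l 1 1 u)"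
  unfolding hinged_x_deriv_def
proof (intro conjI allI impI)
  show "weak_deriv l 0 1 u \<in> L2 l" "weak_deriv l 1 1 u \<in> L2 l" using u by (auto intro: weak_deriv_L2)
  fix \<alpha> \<beta> assume ab: "smooth1 \<alpha>" "\<beta> \<in> bump (-l) l"
  show "inner0 l (weak_deriv l 0 1 u) (tens (deriv \<alpha>) \<beta>) = - inner0 l (weak_deriv l 1 1 u) (tens \<alpha> \<beta>)"
    using H2_star_mixed(1)[OF l u smooth1_deriv[OF ab(1)] ab(2)] H2_star_mixed(2)[OF l u ab]
      H2_star_hinged[OF l u] ab bump_deriv[OF ab(2)] by (auto simp: hinged_x_deriv_def)
qed

lemma H2_star_x_deriv:
  assumes "u \<in> H2_star l"
  shows "x_deriv l (weak_deriv l 1 0 u) (weak_deriv l 2 0 u)"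
  unfolding x_deriv_def
proof (intro conjI ballI)
  show "weak_deriv l 1 0 u \<in> L2 l" "weak_deriv l 2 0 u \<in> L2 l" using assms by (auto intro: weak_deriv_L2)
  fix \<alpha> \<beta> assume ab: "\<alpha> \<in> bump 0 pi" "\<beta> \<in> bump (-l) l"
  show "inner0 l (weak_deriv l 1 0 u) (tens (deriv \<alpha>) \<beta>) = - inner0 l (weak_deriv l 2 0 u) (tens \<alpha> \<beta>)"
    using weak_deriv_tens[OF H2_star_weak_deriv[OF assms, of 1 0] bump_deriv[OF ab(1)] ab(2)]
      weak_deriv_tens[OF H2_star_weak_deriv[OF assms, of 2 0] ab] by (simp add: numeral_2_eq_2)
qed

theorem stretch_by_parts:
  assumes "l > 0" "u \<in> H2_star l" "v \<in> H2_star l"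
  shows "inner0 l (weak_deriv l 1 0 u) (weak_deriv l 1 0 v) = - inner0 l (weak_deriv l 2 0 u) v"
  by (rule integration_by_parts[OF assms(1) H2_star_hinged[OF assms(1,3)] H2_star_x_deriv[OF assms(2)]])

text \<open>
  The second bound is the first one inserted into \<open>|u\<^sub>x|\<^sup>2 = -
  (u\<^sub>x\<^sub>x, u)\<^sub>0\<close>.
\<close>

lemma H2_star_norm_bounds:
  assumes l: "l > 0" and u: "u \<in> H2_star l"
  shows "L2.nrm l u \<le> pi * L2.nrm l (weak_deriv l 1 0 u)"
    "L2.nrm l (weak_deriv l 1 0 u) \<le> pi * L2.nrm l (weak_deriv l 2 0 u)"
    "L2.nrm l (weak_deriv l 0 1 u) \<le> pi * L2.nrm l (weak_deriv l 1 1 u)"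
proof -
  show 1: "L2.nrm l u \<le> pi * L2.nrm l (weak_deriv l 1 0 u)" by (rule hinged_poincare[OF l H2_star_hinged[OF l u]])
  show "L2.nrm l (weak_deriv l 0 1 u) \<le> pi * L2.nrm l (weak_deriv l 1 1 u)"
    by (rule hinged_poincare[OF l H2_star_hinged_y[OF l u]])
  let ?p = "L2.nrm l (weak_deriv l 1 0 u)" and ?q = "L2.nrm l (weak_deriv l 2 0 u)"
  have m: "weak_deriv l 1 0 u \<in> L2 l" "weak_deriv l 2 0 u \<in> L2 l" "u \<in> L2 l" using u by (auto intro: weak_deriv_L2 H2_star_L2)
  have "?p * ?p = - inner0 l (weak_deriv l 2 0 u) u"
    using L2.nrm_square[OF m(1)] stretch_by_parts[OF l u u] by (simp add: power2_eq_square)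
  also have "\<dots> \<le> ?q * L2.nrm l u" using L2.cauchy_schwarz[OF m(2,3)] by simp
  also have "\<dots> \<le> ?q * (pi * ?p)" by (intro mult_left_mono 1 L2.nrm_nonneg m)
  finally have "?p * ?p \<le> (pi * ?q) * ?p" by (simp add: mult_ac)
  then show "?p \<le> pi * ?q" using L2.nrm_nonneg[OF m(1)] L2.nrm_nonneg[OF m(2)]
    by (cases "?p = 0") auto
qed

lemma norm2_nonneg:
  assumes "l > 0" "0 < \<sigma>" "\<sigma> < 1 / 2" "u \<in> H2_star l"
  shows "0 \<le> norm2 l \<sigma> u"
proof -
  interpret A: semi_inner "H2_star l" "inner2 l \<sigma>" by (rule semi_inner_inner2[OF assms(1-3)])
  show ?thesis using A.ip_nonneg[OF assms(4)] by (simp add: norm2_def)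
qed

text \<open>
  The norm of the space is built from second derivatives only; the first ones follow from the
  hinged sides.
\<close>

lemma H2_star_derivs_bounded:
  assumes l: "l > 0" and \<sigma>: "0 < \<sigma>" "\<sigma> < 1 / 2"
  shows "\<exists>C\<ge>0. \<forall>u\<in>H2_star l. \<forall>a b. a + b \<le> 2 \<longrightarrow> 0 < a + b \<longrightarrow> L2.nrm l (weak_deriv l a b u) \<le> C * norm2 l \<sigma> u"
proof -
  define \<tau> where "\<tau> = sqrt (1 / (1 - \<sigma>))"
  have \<tau>: "0 \<le> \<tau>" using \<sigma> by (simp add: \<tau>_def)
  define C where "C = (1 + pi) * \<tau>"
  have "L2.nrm l (weak_deriv l a b u) \<le> C * norm2 l \<sigma> u" if u: "u \<in> H2_star l" and ab: "a + b \<le> 2" "0 < a + b" for u a b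
  proof -
    have n0: "0 \<le> inner0 l (weak_deriv l i j u) (weak_deriv l i j u)" if "i + j \<le> 2" for i j
      using u that by (intro L2.ip_nonneg weak_deriv_L2)
    have N: "0 \<le> norm2 l \<sigma> u" by (rule norm2_nonneg[OF l \<sigma> u])
    have second: "L2.nrm l (weak_deriv l i j u) \<le> \<tau> * norm2 l \<sigma> u" if "i + j = 2" for i j
    proof -
      have "(i = 2 \<and> j = 0) \<or> (i = 1 \<and> j = 1) \<or> (i = 0 \<and> j = 2)" using that by presburger
      then have "inner0 l (weak_deriv l i j u) (weak_deriv l i j u) \<le> hessian_square l u"
        unfolding hessian_square_def using n0[of 2 0] n0[of 0 2] n0[of 1 1] by auto
      then have "(1 - \<sigma>) * inner0 l (weak_deriv l i j u) (weak_deriv l i j u) \<le> (1 - \<sigma>) * hessian_square l u"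
        using \<sigma> by (intro mult_left_mono) auto
      also have "\<dots> \<le> inner2 l \<sigma> u u" by (rule inner2_coercive(1)[OF u \<sigma>])
      finally have "inner0 l (weak_deriv l i j u) (weak_deriv l i j u) \<le> 1 / (1 - \<sigma>) * inner2 l \<sigma> u u"
        using \<sigma> by (simp add: field_simps)
      then have "sqrt (inner0 l (weak_deriv l i j u) (weak_deriv l i j u)) \<le> sqrt (1 / (1 - \<sigma>) * inner2 l \<sigma> u u)"
        by (rule real_sqrt_le_mono)
      then show ?thesis unfolding \<tau>_def norm2_def L2.nrm_def real_sqrt_mult .
    qed
    have t0: "0 \<le> \<tau> * norm2 l \<sigma> u" using \<tau> N by simp
    have pit: "0 \<le> pi * (\<tau> * norm2 l \<sigma> u)" using t0 by simp
    have "L2.nrm l (weak_deriv l a b u) \<le> \<tau> * norm2 l \<sigma> u + pi * (\<tau> * norm2 l \<sigma> u)"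
    proof (cases "a + b = 2")
      case True then show ?thesis using second[OF True] pit by linarith
    next
      case False
      then have "(a = 1 \<and> b = 0) \<or> (a = 0 \<and> b = 1)" using ab by linarith
      then have "L2.nrm l (weak_deriv l a b u) \<le> pi * (\<tau> * norm2 l \<sigma> u)"
      proof
        assume "a = 1 \<and> b = 0"
        moreover have "pi * L2.nrm l (weak_deriv l 2 0 u) \<le> pi * (\<tau> * norm2 l \<sigma> u)" by (intro mult_left_mono second) auto
        ultimately show ?thesis using H2_star_norm_bounds(2)[OF l u] by (auto intro: order_trans)
      next
        assume "a = 0 \<and> b = 1"
        moreover have "pi * L2.nrm l (weak_deriv l 1 1 u) \<le> pi * (\<tau> * norm2 l \<sigma> u)" by (intro mult_left_mono second) auto
        ultimately show ?thesis using H2_star_norm_bounds(3)[OF l u] by (auto intro: order_trans)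
      qed
      then show ?thesis using t0 by linarith
    qed
    then show ?thesis by (simp add: C_def algebra_simps)
  qed
  moreover have "0 \<le> C" using \<tau> by (simp add: C_def)
  ultimately show ?thesis by blast
qed

section \<open>Hoelder continuity of the continuous representative\<close>

text \<open>
  A smooth approximation of the point mass at \<open>x\<close>.
\<close>

definition unit_bump :: "real \<Rightarrow> real \<Rightarrow> real \<Rightarrow> real \<Rightarrow> (real \<Rightarrow> real) \<Rightarrow> bool" where
  "unit_bump a b d x \<alpha> \<longleftrightarrow> \<alpha> \<in> bump a b \<and> (\<forall>s. 0 \<le> \<alpha> s) \<and> (\<forall>s. s \<notin> {x - d..x + d} \<longrightarrow> \<alpha> s = 0) \<and> integral {a..b} \<alpha> = 1"

lemma exists_unit_bump_at:
  assumes "a < x" "x < b" "0 < d"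
  shows "\<exists>\<alpha>. unit_bump a b d x \<alpha>"
proof -
  define r where "r = min d (min (x - a) (b - x)) / 2"
  have r: "0 < r" "r < d" "a < x - r" "x + r < b" proof -
    have "2 * r \<le> d" "2 * r \<le> x - a" "2 * r \<le> b - x" by (simp_all add: r_def)
    moreover show "0 < r" using assms by (simp add: r_def)
    ultimately show "r < d" "a < x - r" "x + r < b" using assms by linarith+
  qed
  obtain \<rho> where \<rho>: "smooth1 \<rho>" "\<And>s. 0 \<le> \<rho> s" "\<And>s. s \<notin> {x - r..x + r} \<Longrightarrow> \<rho> s = 0" "integral {x - r..x + r} \<rho> = 1"
    using exists_unit_bump[of "x - r" "x + r"] r by auto
  have "integral {a..b} \<rho> = 1"
    using integral_support[OF smooth1_continuous[OF \<rho>(1)], of a "x - r" "x + r" b] r \<rho>(3,4) by auto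
  moreover have "\<rho> \<in> bump a b" unfolding bump_def using \<rho>(1,3) r by blast
  moreover have "\<rho> s = 0" if "s \<notin> {x - d..x + d}" for s using that r \<rho>(3)[of s] by auto
  ultimately show ?thesis using \<rho>(2) unfolding unit_bump_def by blast
qed

lemma unit_bump_prim:
  assumes \<alpha>: "unit_bump a b d x \<alpha>" and ab: "a < b"
  shows "0 \<le> prim a \<alpha> s" "prim a \<alpha> s \<le> 1" "s \<le> x - d \<Longrightarrow> prim a \<alpha> s = 0" "x + d \<le> s \<Longrightarrow> prim a \<alpha> s = 1"
proof -
  have al: "\<alpha> \<in> bump a b" "\<And>s. 0 \<le> \<alpha> s" "\<And>s. s \<notin> {x - d..x + d} \<Longrightarrow> \<alpha> s = 0" "integral {a..b} \<alpha> = 1"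
    using \<alpha> by (auto simp: unit_bump_def)
  obtain p q where pq: "a < p" "p \<le> q" "q < b" "\<And>s. s \<notin> {p..q} \<Longrightarrow> \<alpha> s = 0" using bumpE[OF al(1) ab] by blast
  have c: "continuous_on UNIV \<alpha>" by (rule bump_continuous[OF al(1)])
  have int: "\<alpha> integrable_on {u..v}" for u v by (intro integrable_continuous_real continuous_on_subset[OF c]) auto
  show "0 \<le> prim a \<alpha> s" unfolding prim_def using int al(2) by (intro integral_nonneg) auto
  have one: "integral {a..t} \<alpha> = 1" if "b \<le> t" for t
    using integral_support[OF c, of a p q t] integral_support[OF c, of a p q b] pq that al(4) by auto
  have "integral {a..s} \<alpha> \<le> integral {a..max s b} \<alpha>" using int al(2) by (intro integral_subset_le) auto
  then show le1: "prim a \<alpha> s \<le> 1" unfolding prim_def using one[of "max s b"] by simp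
  show "prim a \<alpha> s = 0" if "s \<le> x - d"
  proof -
    have "integral {a..s} \<alpha> = integral {a<..<s} \<alpha>" by (simp add: integral_open_interval_real)
    also have "\<dots> = 0" using integral_cong[of "{a<..<s}" \<alpha> "\<lambda>_. 0"] al(3) that by simp
    finally show ?thesis by (simp add: prim_def)
  qed
  show "prim a \<alpha> s = 1" if s: "x + d \<le> s"
  proof (cases "a \<le> s")
    case True
    have "integral {a..s} \<alpha> + integral {s..max s b} \<alpha> = integral {a..max s b} \<alpha>"
      using True int by (intro Henstock_Kurzweil_Integration.integral_combine) auto
    moreover have "integral {s..max s b} \<alpha> = integral {s<..<max s b} \<alpha>" by (simp add: integral_open_interval_real)
    moreover have "integral {s<..<max s b} \<alpha> = 0" using integral_cong[of "{s<..<max s b}" \<alpha> "\<lambda>_. 0"] al(3) s by simp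
    ultimately show ?thesis using one[of "max s b"] by (simp add: prim_def)
  next
    case False
    then have "\<alpha> t = 0" if "t \<in> {a<..<b}" for t using al(3)[of t] s that by auto
    then have "integral {a<..<b} \<alpha> = 0" using integral_cong[of "{a<..<b}" \<alpha> "\<lambda>_. 0"] by simp
    then show ?thesis using al(4) by (simp add: integral_open_interval_real)
  qed
qed

lemma unit_bump_diff_prim:
  assumes \<alpha>: "unit_bump a b d x \<alpha>" and \<beta>: "unit_bump a b d y \<beta>" and ab: "a < b" and d: "0 < d"
  shows "\<exists>A\<in>bump a b. deriv A = (\<lambda>s. \<alpha> s - \<beta> s) \<and> (\<forall>s. \<bar>A s\<bar> \<le> 1) \<and> ip1 a b A A \<le> \<bar>x - y\<bar> + 2 * d"
proof -
  have m: "\<alpha> \<in> bump a b" "\<beta> \<in> bump a b" "integral {a..b} \<alpha> = 1" "integral {a..b} \<beta> = 1"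
    using \<alpha> \<beta> by (auto simp: unit_bump_def)
  define f where "f = (\<lambda>s. \<alpha> s - \<beta> s)"
  have f: "f \<in> bump a b" using bump_comb[OF m(1,2), of 1 "-1"] by (simp add: f_def)
  have int: "\<alpha> integrable_on {u..v}" "\<beta> integrable_on {u..v}" for u v
    using continuous_on_subset[OF bump_continuous[OF m(1)]] continuous_on_subset[OF bump_continuous[OF m(2)]]
    by (auto intro!: integrable_continuous_real)
  have If: "integral {u..v} f = integral {u..v} \<alpha> - integral {u..v} \<beta>" for u v
    unfolding f_def by (rule integral_diff[OF int])
  define A where "A = prim a f"
  have A: "A \<in> bump a b" "deriv A = f" unfolding A_def using bump_prim[OF f ab] If m by auto
  have Aeq: "A s = prim a \<alpha> s - prim a \<beta> s" for s unfolding A_def prim_def If by simp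
  have bnd: "\<bar>A s\<bar> \<le> 1" for s
    unfolding Aeq using unit_bump_prim(1,2)[OF \<alpha> ab, of s] unit_bump_prim(1,2)[OF \<beta> ab, of s] by auto
  define p where "p = min x y - d"
  define q where "q = max x y + d"
  have pq: "p \<le> q" "q - p = \<bar>x - y\<bar> + 2 * d" using d by (auto simp: p_def q_def)
  have zero: "A s = 0" if "s \<notin> {p..q}" for s
    unfolding Aeq using that unit_bump_prim(3,4)[OF \<alpha> ab, of s] unit_bump_prim(3,4)[OF \<beta> ab, of s]
    by (cases "s < p") (auto simp: p_def q_def)
  have c2: "continuous_on UNIV (\<lambda>s. A s * A s)" by (intro continuous_on_mult bump_continuous[OF A(1)])
  have i2: "(\<lambda>s. A s * A s) integrable_on {u..v}" for u v
    by (intro integrable_continuous_real continuous_on_subset[OF c2]) auto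
  have "ip1 a b A A \<le> integral {min a p..max b q} (\<lambda>s. A s * A s)"
    unfolding ip1_def using i2 by (intro integral_subset_le) auto
  also have "\<dots> = integral {p..q} (\<lambda>s. A s * A s)"
    by (rule integral_support[OF c2]) (use pq zero in auto)
  also have "\<dots> \<le> integral {p..q} (\<lambda>_. 1)"
  proof (rule integral_le[OF i2])
    fix s
    have "\<bar>A s\<bar> * \<bar>A s\<bar> \<le> 1 * 1" by (intro mult_mono bnd) auto
    then show "A s * A s \<le> 1" by (simp add: abs_mult[symmetric])
  qed (rule integrable_continuous_real, rule continuous_on_const)
  also have "\<dots> = \<bar>x - y\<bar> + 2 * d" using pq by simp
  finally show ?thesis using A bnd unfolding f_def by blast
qed

lemma nrm_tens:
  assumes "continuous_on UNIV A" "continuous_on UNIV B"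
  shows "L2.nrm l (tens A B) = sqrt (ip1 0 pi A A) * sqrt (ip1 (-l) l B B)"
  unfolding L2.nrm_def inner0_tens[OF assms assms] by (simp add: real_sqrt_mult ip1_def)

lemma ip1_le_length:
  assumes "continuous_on UNIV A" "\<And>s. \<bar>A s\<bar> \<le> 1" "a \<le> b"
  shows "ip1 a b A A \<le> b - a"
proof -
  have "ip1 a b A A \<le> integral {a..b} (\<lambda>_. 1)"
    unfolding ip1_def
  proof (rule integral_le)
    show "(\<lambda>s. A s * A s) integrable_on {a..b}"
      by (intro integrable_continuous_real continuous_on_mult continuous_on_subset[OF assms(1)]) auto
    fix s
    have "\<bar>A s\<bar> * \<bar>A s\<bar> \<le> 1 * 1" by (intro mult_mono assms) auto
    then show "A s * A s \<le> 1" by (simp add: abs_mult[symmetric])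
  qed (rule integrable_continuous_real, rule continuous_on_const)
  then show ?thesis using assms(3) by simp
qed

text \<open>
  Write \<open>\<alpha>1 - \<alpha>2 = A'\<close> with \<open>A\<close> supported between the two
  points up to \<open>d\<close>, so that the \<open>L\<^sup>2\<close>-norm of \<open>A\<close>
  is at most the square root of their distance plus \<open>2 d\<close>. Writing \<open>\<beta> =
  \<omega> + B'\<close> with a fixed \<open>\<omega>\<close> and bounded \<open>B\<close> moves
  the concentrating factor \<open>\<beta>\<close> onto the mixed derivative.
\<close>

lemma mollified_x_difference:
  assumes l: "l > 0" and u: "u \<in> H2_star l" and d: "d > 0"
    and \<alpha>: "unit_bump 0 pi d x1 \<alpha>1" "unit_bump 0 pi d x2 \<alpha>2" and \<beta>: "unit_bump (-l) l d y \<beta>"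
    and \<omega>: "unit_bump (-l) l l 0 \<omega>"
  shows "\<bar>inner0 l u (tens \<alpha>1 \<beta>) - inner0 l u (tens \<alpha>2 \<beta>)\<bar> \<le>
    sqrt (\<bar>x1 - x2\<bar> + 2 * d) * (sqrt (ip1 (-l) l \<omega> \<omega>) * L2.nrm l (weak_deriv l 1 0 u) + sqrt (2 * l) * L2.nrm l (weak_deriv l 1 1 u))"
proof -
  let ?p = "weak_deriv l 1 0 u" and ?q = "weak_deriv l 1 1 u" and ?s = "sqrt (\<bar>x1 - x2\<bar> + 2 * d)"
  have mem: "u \<in> L2 l" "?p \<in> L2 l" "?q \<in> L2 l" using u by (auto intro: H2_star_L2 weak_deriv_L2)
  obtain A where A: "A \<in> bump 0 pi" "deriv A = (\<lambda>s. \<alpha>1 s - \<alpha>2 s)" "ip1 0 pi A A \<le> \<bar>x1 - x2\<bar> + 2 * d"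
    using unit_bump_diff_prim[OF \<alpha> pi_gt_zero d] by blast
  define f where "f = (\<lambda>s. \<beta> s - \<omega> s)"
  have bm: "\<beta> \<in> bump (-l) l" "\<omega> \<in> bump (-l) l" "integral {-l..l} \<beta> = 1" "integral {-l..l} \<omega> = 1"
    using \<beta> \<omega> by (auto simp: unit_bump_def)
  have f: "f \<in> bump (-l) l" using bump_comb[OF bm(1,2), of 1 "-1"] by (simp add: f_def)
  have int: "\<beta> integrable_on {u..v}" "\<omega> integrable_on {u..v}" for u v
    using continuous_on_subset[OF bump_continuous[OF bm(1)]] continuous_on_subset[OF bump_continuous[OF bm(2)]]
    by (auto intro!: integrable_continuous_real)
  have If: "integral {u..v} f = integral {u..v} \<beta> - integral {u..v} \<omega>" for u v
    unfolding f_def by (rule integral_diff[OF int])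
  have ll: "-l < l" using l by simp
  define B where "B = prim (-l) f"
  have B: "B \<in> bump (-l) l" "deriv B = f" unfolding B_def using bump_prim[OF f ll] If bm by auto
  have Bb: "\<bar>B s\<bar> \<le> 1" for s
    using unit_bump_prim(1,2)[OF \<beta> ll, of s] unit_bump_prim(1,2)[OF \<omega> ll, of s]
    unfolding B_def prim_def If by auto
  have \<alpha>c: "continuous_on UNIV \<alpha>1" "continuous_on UNIV \<alpha>2" using \<alpha> by (auto simp: unit_bump_def intro: bump_continuous)
  note c = bump_continuous[OF A(1)] bump_continuous[OF B(1)] bump_continuous[OF bm(1)] bump_continuous[OF bm(2)] bump_continuous[OF f] \<alpha>c
  have "inner0 l u (tens \<alpha>1 \<beta>) - inner0 l u (tens \<alpha>2 \<beta>) = inner0 l u (tens (deriv A) \<beta>)"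
    using L2.ip_diff_right[OF tens_L2[OF c(6,3)] tens_L2[OF c(7,3)] mem(1)] by (simp add: A(2) tens_def algebra_simps)
  also have "\<dots> = - inner0 l ?p (tens A \<beta>)"
    using H2_star_hinged[OF l u] bm(1) bump_smooth[OF A(1)] by (auto simp: hinged_x_deriv_def)
  also have "tens A \<beta> = (\<lambda>z. 1 * tens A \<omega> z + 1 * tens A f z)" by (auto simp: tens_def f_def algebra_simps)
  also have "inner0 l ?p \<dots> = inner0 l ?p (tens A \<omega>) + inner0 l ?p (tens A f)"
    using L2.ip_comb_right[OF tens_L2[OF c(1,4)] tens_L2[OF c(1,5)] mem(2), of 1 1] by simp
  also have "inner0 l ?p (tens A f) = - inner0 l ?q (tens A B)"
    using H2_star_mixed(2)[OF l u bump_smooth[OF A(1)] B(1)] B(2) by simp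
  finally have "\<bar>inner0 l u (tens \<alpha>1 \<beta>) - inner0 l u (tens \<alpha>2 \<beta>)\<bar> \<le> \<bar>inner0 l ?p (tens A \<omega>)\<bar> + \<bar>inner0 l ?q (tens A B)\<bar>"
    by simp
  also have "\<dots> \<le> L2.nrm l ?p * (sqrt (ip1 0 pi A A) * sqrt (ip1 (-l) l \<omega> \<omega>)) + L2.nrm l ?q * (sqrt (ip1 0 pi A A) * sqrt (ip1 (-l) l B B))"
    using L2.cauchy_schwarz[OF mem(2) tens_L2[OF c(1,4)]] L2.cauchy_schwarz[OF mem(3) tens_L2[OF c(1,2)]]
    by (simp add: nrm_tens c)
  also have "\<dots> \<le> L2.nrm l ?p * (?s * sqrt (ip1 (-l) l \<omega> \<omega>)) + L2.nrm l ?q * (?s * sqrt (2 * l))"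
  proof -
    have 1: "sqrt (ip1 0 pi A A) \<le> ?s" using A(3) by simp
    have 2: "sqrt (ip1 (-l) l B B) \<le> sqrt (2 * l)" using ip1_le_length[OF c(2) Bb, of "-l" l] l by simp
    have 3: "0 \<le> ip1 (-l) l \<omega> \<omega>" "0 \<le> ip1 (-l) l B B" using c by (auto intro: C1.ip_nonneg)
    show ?thesis using 1 2 3 l d by (intro add_mono mult_left_mono mult_mono L2.nrm_nonneg mem) auto
  qed
  finally show ?thesis by (simp add: algebra_simps)
qed

text \<open>
  Here \<open>\<alpha>\<close> is integrated to a bounded function, which uses that
  \<open>u\<close> vanishes on the hinged sides, and the difference of the
  \<open>\<beta>\<close>s is integrated to a bump of small norm.
\<close>

lemma mollified_y_difference:
  assumes l: "l > 0" and u: "u \<in> H2_star l" and d: "d > 0"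
    and \<alpha>: "unit_bump 0 pi d x \<alpha>" and \<beta>: "unit_bump (-l) l d y1 \<beta>1" "unit_bump (-l) l d y2 \<beta>2"
  shows "\<bar>inner0 l u (tens \<alpha> \<beta>1) - inner0 l u (tens \<alpha> \<beta>2)\<bar> \<le>
    sqrt (\<bar>y1 - y2\<bar> + 2 * d) * (sqrt pi * L2.nrm l (weak_deriv l 1 1 u))"
proof -
  let ?p = "weak_deriv l 1 0 u" and ?q = "weak_deriv l 1 1 u" and ?s = "sqrt (\<bar>y1 - y2\<bar> + 2 * d)"
  have mem: "u \<in> L2 l" "?p \<in> L2 l" "?q \<in> L2 l" using u by (auto intro: H2_star_L2 weak_deriv_L2)
  have ll: "-l < l" using l by simp
  obtain B where B: "B \<in> bump (-l) l" "deriv B = (\<lambda>s. \<beta>1 s - \<beta>2 s)" "ip1 (-l) l B B \<le> \<bar>y1 - y2\<bar> + 2 * d"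
    using unit_bump_diff_prim[OF \<beta> ll d] by blast
  have am: "\<alpha> \<in> bump 0 pi" using \<alpha> by (simp add: unit_bump_def)
  define A where "A = prim 0 \<alpha>"
  have A: "smooth1 A" "deriv A = \<alpha>" unfolding A_def using prim_bump_smooth[OF am pi_gt_zero] by auto
  have Ab: "\<bar>A s\<bar> \<le> 1" for s using unit_bump_prim(1,2)[OF \<alpha> pi_gt_zero, of s] by (simp add: A_def)
  have \<beta>c: "continuous_on UNIV \<beta>1" "continuous_on UNIV \<beta>2" using \<beta> by (auto simp: unit_bump_def intro: bump_continuous)
  note c = smooth1_continuous[OF A(1)] bump_continuous[OF B(1)] bump_continuous[OF am] \<beta>c
  have "inner0 l u (tens \<alpha> \<beta>1) - inner0 l u (tens \<alpha> \<beta>2) = inner0 l u (tens (deriv A) (deriv B))"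
    using L2.ip_diff_right[OF tens_L2[OF c(3,4)] tens_L2[OF c(3,5)] mem(1)] by (simp add: A(2) B(2) tens_def algebra_simps)
  also have "\<dots> = - inner0 l ?p (tens A (deriv B))"
    using H2_star_hinged[OF l u] A(1) bump_deriv[OF B(1)] by (auto simp: hinged_x_deriv_def)
  also have "\<dots> = inner0 l ?q (tens A B)" using H2_star_mixed(2)[OF l u A(1) B(1)] by simp
  finally have "\<bar>inner0 l u (tens \<alpha> \<beta>1) - inner0 l u (tens \<alpha> \<beta>2)\<bar> \<le> L2.nrm l ?q * (sqrt (ip1 0 pi A A) * sqrt (ip1 (-l) l B B))"
    using L2.cauchy_schwarz[OF mem(3) tens_L2[OF c(1,2)]] by (simp add: nrm_tens c)
  also have "\<dots> \<le> L2.nrm l ?q * (sqrt pi * ?s)"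
  proof -
    have 1: "sqrt (ip1 0 pi A A) \<le> sqrt pi" using ip1_le_length[OF c(1) Ab, of 0 pi] by simp
    have 2: "sqrt (ip1 (-l) l B B) \<le> ?s" using B(3) by simp
    have 3: "0 \<le> ip1 (-l) l B B" using c by (auto intro: C1.ip_nonneg)
    show ?thesis using 1 2 3 by (intro mult_left_mono mult_mono L2.nrm_nonneg mem) auto
  qed
  finally show ?thesis by (simp add: algebra_simps)
qed

lemma mollification_limit:
  assumes l: "l > 0" and u: "u \<in> L2 l" and c: "boundary_rep l u c" and z: "(x, y) \<in> plate l" and e: "e > 0"
  shows "\<exists>r>0. \<forall>d \<alpha> \<beta>. d < r \<longrightarrow> unit_bump 0 pi d x \<alpha> \<longrightarrow> unit_bump (-l) l d y \<beta> \<longrightarrow> \<bar>inner0 l u (tens \<alpha> \<beta>) - c (x, y)\<bar> \<le> e"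
proof -
  have "(x, y) \<in> closure (plate l)" using z closure_subset by blast
  then obtain r0 where r0: "r0 > 0" "\<And>z'. z' \<in> closure (plate l) \<Longrightarrow> dist z' (x, y) < r0 \<Longrightarrow> dist (c z') (c (x, y)) < e"
    using c e unfolding boundary_rep_def continuous_on_iff by metis
  have "\<bar>inner0 l u (tens \<alpha> \<beta>) - c (x, y)\<bar> \<le> e"
    if d: "d < r0 / 2" and \<alpha>: "unit_bump 0 pi d x \<alpha>" and \<beta>: "unit_bump (-l) l d y \<beta>" for d \<alpha> \<beta>
  proof -
    let ?M = "plate_measure l" and ?t = "tens \<alpha> \<beta>"
    have m: "continuous_on UNIV \<alpha>" "continuous_on UNIV \<beta>" using \<alpha> \<beta> by (auto simp: unit_bump_def intro: bump_continuous)
    have tL: "?t \<in> L2 l" by (rule tens_L2[OF m])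
    have one: "(LINT z|?M. ?t z) = 1" using integral_tens[OF m, of l] \<alpha> \<beta> by (simp add: unit_bump_def)
    have t0: "0 \<le> ?t z" for z using \<alpha> \<beta> by (simp add: unit_bump_def tens_def)
    have cL: "(\<lambda>z. u z - c (x, y)) \<in> L2 l" by (intro L2.diff_mem u continuous_L2 continuous_on_const)
    have "inner0 l u ?t - c (x, y) = (LINT z|?M. (u z - c (x, y)) * ?t z)"
      using L2_integrable_mult[OF u tL] L2_integrable[OF tL] one by (simp add: inner0_def left_diff_distrib)
    then have "\<bar>inner0 l u ?t - c (x, y)\<bar> \<le> (LINT z|?M. \<bar>(u z - c (x, y)) * ?t z\<bar>)" by simp
    also have "\<dots> \<le> (LINT z|?M. e * ?t z)"
    proof (rule integral_mono_AE)
      show "integrable ?M (\<lambda>z. \<bar>(u z - c (x, y)) * ?t z\<bar>)" by (intro integrable_abs L2_integrable_mult cL tL)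
      show "integrable ?M (\<lambda>z. e * ?t z)" by (intro integrable_mult_right L2_integrable tL)
      have "AE z in ?M. u z = c z" using c by (simp add: boundary_rep_def)
      then show "AE z in ?M. \<bar>(u z - c (x, y)) * ?t z\<bar> \<le> e * ?t z"
      proof (rule AE_mp, intro AE_I2 impI)
        fix z' assume z': "z' \<in> space ?M" and uc: "u z' = c z'"
        show "\<bar>(u z' - c (x, y)) * ?t z'\<bar> \<le> e * ?t z'"
        proof (cases "?t z' = 0")
          case False
          then have "fst z' \<in> {x - d..x + d}" "snd z' \<in> {y - d..y + d}"
            using \<alpha> \<beta> by (auto simp: unit_bump_def tens_def)
          then have "\<bar>fst z' - x\<bar> + \<bar>snd z' - y\<bar> < r0" using d by auto
          moreover have "dist z' (x, y) \<le> \<bar>fst z' - x\<bar> + \<bar>snd z' - y\<bar>"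
            by (cases z') (simp add: dist_Pair_Pair dist_real_def sqrt_sum_squares_le_sum_abs)
          ultimately have "dist (c z') (c (x, y)) < e" using z' closure_subset by (intro r0) auto
          then have "\<bar>u z' - c (x, y)\<bar> \<le> e" by (simp add: uc dist_real_def)
          then show ?thesis using t0[of z'] by (simp add: abs_mult mult_right_mono)
        qed simp
      qed
    qed
    also have "\<dots> = e" using one by simp
    finally show ?thesis .
  qed
  then show ?thesis using r0(1) by (intro exI[of _ "r0 / 2"]) auto
qed

text \<open>
  The radius \<open>d\<close> of the mollifiers tends to 0 in the two preceding estimates.
\<close>

lemma hoelder_interior:
  assumes l: "l > 0" and \<omega>: "unit_bump (-l) l l 0 \<omega>" and u: "u \<in> H2_star l" and c: "boundary_rep l u c"
    and z: "(x1, y1) \<in> plate l" "(x2, y2) \<in> plate l"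
  shows "\<bar>c (x1, y1) - c (x2, y2)\<bar> \<le> (sqrt \<bar>x1 - x2\<bar> + sqrt \<bar>y1 - y2\<bar>) *
     ((sqrt (ip1 (-l) l \<omega> \<omega>) * L2.nrm l (weak_deriv l 1 0 u) + sqrt (2 * l) * L2.nrm l (weak_deriv l 1 1 u)) + sqrt pi * L2.nrm l (weak_deriv l 1 1 u))"
proof -
  define K1 where "K1 = sqrt (ip1 (-l) l \<omega> \<omega>) * L2.nrm l (weak_deriv l 1 0 u) + sqrt (2 * l) * L2.nrm l (weak_deriv l 1 1 u)"
  define K2 where "K2 = sqrt pi * L2.nrm l (weak_deriv l 1 1 u)"
  have mem: "weak_deriv l 1 0 u \<in> L2 l" "weak_deriv l 1 1 u \<in> L2 l" using u by (auto intro: weak_deriv_L2)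
  have \<omega>c: "\<omega> \<in> {f. continuous_on UNIV f}" using \<omega> by (auto simp: unit_bump_def intro: bump_continuous)
  have K: "0 \<le> K1" "0 \<le> K2" unfolding K1_def K2_def using l mem C1.ip_nonneg[OF \<omega>c, of "-l" l] by auto
  have "\<bar>c (x1, y1) - c (x2, y2)\<bar> \<le> (sqrt \<bar>x1 - x2\<bar> * K1 + sqrt \<bar>y1 - y2\<bar> * K2) + e" if e: "e > 0" for e
  proof -
    have e2: "e / 2 > 0" using e by simp
    obtain r1 where r1: "r1 > 0" "\<And>d \<alpha> \<beta>. d < r1 \<Longrightarrow> unit_bump 0 pi d x1 \<alpha> \<Longrightarrow> unit_bump (-l) l d y1 \<beta> \<Longrightarrow> \<bar>inner0 l u (tens \<alpha> \<beta>) - c (x1, y1)\<bar> \<le> e / 2"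
      using mollification_limit[OF l H2_star_L2[OF u] c z(1) e2] by blast
    obtain r2 where r2: "r2 > 0" "\<And>d \<alpha> \<beta>. d < r2 \<Longrightarrow> unit_bump 0 pi d x2 \<alpha> \<Longrightarrow> unit_bump (-l) l d y2 \<beta> \<Longrightarrow> \<bar>inner0 l u (tens \<alpha> \<beta>) - c (x2, y2)\<bar> \<le> e / 2"
      using mollification_limit[OF l H2_star_L2[OF u] c z(2) e2] by blast
    have zz: "0 < x1" "x1 < pi" "0 < x2" "x2 < pi" "-l < y1" "y1 < l" "-l < y2" "y2 < l" using z by (auto simp: plate_def)
    have est: "\<bar>c (x1, y1) - c (x2, y2)\<bar> \<le> (sqrt (\<bar>x1 - x2\<bar> + 2 * d) * K1 + sqrt (\<bar>y1 - y2\<bar> + 2 * d) * K2) + e"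
      if d: "0 < d" "d < min r1 r2" for d
    proof -
      obtain \<alpha>1 \<alpha>2 \<beta>1 \<beta>2 where b: "unit_bump 0 pi d x1 \<alpha>1" "unit_bump 0 pi d x2 \<alpha>2" "unit_bump (-l) l d y1 \<beta>1" "unit_bump (-l) l d y2 \<beta>2"
        using exists_unit_bump_at zz d(1) by metis
      have "\<bar>inner0 l u (tens \<alpha>1 \<beta>1) - inner0 l u (tens \<alpha>2 \<beta>1)\<bar> \<le> sqrt (\<bar>x1 - x2\<bar> + 2 * d) * K1"
        unfolding K1_def by (rule mollified_x_difference[OF l u d(1) b(1,2,3) \<omega>])
      moreover have "\<bar>inner0 l u (tens \<alpha>2 \<beta>1) - inner0 l u (tens \<alpha>2 \<beta>2)\<bar> \<le> sqrt (\<bar>y1 - y2\<bar> + 2 * d) * K2"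
        unfolding K2_def by (rule mollified_y_difference[OF l u d(1) b(2,3,4)])
      moreover have "\<bar>inner0 l u (tens \<alpha>1 \<beta>1) - c (x1, y1)\<bar> \<le> e / 2" using d by (intro r1(2)[OF _ b(1,3)]) auto
      moreover have "\<bar>inner0 l u (tens \<alpha>2 \<beta>2) - c (x2, y2)\<bar> \<le> e / 2" using d by (intro r2(2)[OF _ b(2,4)]) auto
      ultimately show ?thesis by linarith
    qed
    have "((\<lambda>d. (sqrt (\<bar>x1 - x2\<bar> + 2 * d) * K1 + sqrt (\<bar>y1 - y2\<bar> + 2 * d) * K2) + e) \<longlongrightarrow>
       (sqrt (\<bar>x1 - x2\<bar> + 2 * 0) * K1 + sqrt (\<bar>y1 - y2\<bar> + 2 * 0) * K2) + e) (at_right 0)"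
      by (intro tendsto_intros)
    then have "\<bar>c (x1, y1) - c (x2, y2)\<bar> \<le> (sqrt (\<bar>x1 - x2\<bar> + 2 * 0) * K1 + sqrt (\<bar>y1 - y2\<bar> + 2 * 0) * K2) + e"
    proof (rule tendsto_lowerbound)
      show "\<forall>\<^sub>F d in at_right 0. \<bar>c (x1, y1) - c (x2, y2)\<bar> \<le> (sqrt (\<bar>x1 - x2\<bar> + 2 * d) * K1 + sqrt (\<bar>y1 - y2\<bar> + 2 * d) * K2) + e"
        unfolding eventually_at_right_field using est r1(1) r2(1) by (intro exI[of _ "min r1 r2"]) auto
    qed simp
    then show ?thesis by simp
  qed
  then have "\<bar>c (x1, y1) - c (x2, y2)\<bar> \<le> sqrt \<bar>x1 - x2\<bar> * K1 + sqrt \<bar>y1 - y2\<bar> * K2" by (rule field_le_epsilon)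
  also have "\<dots> \<le> sqrt \<bar>x1 - x2\<bar> * (K1 + K2) + sqrt \<bar>y1 - y2\<bar> * (K1 + K2)"
    using K by (intro add_mono mult_left_mono) auto
  finally show ?thesis unfolding K1_def K2_def by (simp add: distrib_right)
qed

definition hoelder_constant :: "real \<Rightarrow> real \<Rightarrow> real \<Rightarrow> bool" where
  "hoelder_constant l \<sigma> H \<longleftrightarrow> 0 \<le> H \<and> (\<forall>u c. u \<in> H2_star l \<longrightarrow> boundary_rep l u c \<longrightarrow>
     (\<forall>z1\<in>closure (plate l). \<forall>z2\<in>closure (plate l).
        \<bar>c z1 - c z2\<bar> \<le> H * norm2 l \<sigma> u * (sqrt \<bar>fst z1 - fst z2\<bar> + sqrt \<bar>snd z1 - snd z2\<bar>)))"

theorem H2_star_hoelder: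
  assumes l: "l > 0" and \<sigma>: "0 < \<sigma>" "\<sigma> < 1 / 2"
  shows "\<exists>H. hoelder_constant l \<sigma> H"
proof -
  obtain \<omega> where \<omega>: "unit_bump (-l) l l 0 \<omega>" using exists_unit_bump_at[of "-l" 0 l l] l by auto
  have \<omega>c: "\<omega> \<in> {f. continuous_on UNIV f}" using \<omega> by (auto simp: unit_bump_def intro: bump_continuous)
  obtain C where C0: "0 \<le> C" and C: "\<And>u a b. u \<in> H2_star l \<Longrightarrow> a + b \<le> 2 \<Longrightarrow> 0 < a + b \<Longrightarrow> L2.nrm l (weak_deriv l a b u) \<le> C * norm2 l \<sigma> u"
    using H2_star_derivs_bounded[OF l \<sigma>] by blast
  define H where "H = (sqrt (ip1 (-l) l \<omega> \<omega>) + sqrt (2 * l) + sqrt pi) * C"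
  have wn: "0 \<le> sqrt (ip1 (-l) l \<omega> \<omega>)" using C1.ip_nonneg[OF \<omega>c, of "-l" l] by simp
  have H0: "0 \<le> H" unfolding H_def using wn l C0 by auto
  have "\<bar>c z1 - c z2\<bar> \<le> H * norm2 l \<sigma> u * (sqrt \<bar>fst z1 - fst z2\<bar> + sqrt \<bar>snd z1 - snd z2\<bar>)"
    if u: "u \<in> H2_star l" and c: "boundary_rep l u c" and z: "z1 \<in> closure (plate l)" "z2 \<in> closure (plate l)" for u c z1 z2
  proof -
    have n: "L2.nrm l (weak_deriv l 1 0 u) \<le> C * norm2 l \<sigma> u" "L2.nrm l (weak_deriv l 1 1 u) \<le> C * norm2 l \<sigma> u"
      by (rule C[OF u]; simp)+
    define K where "K = (sqrt (ip1 (-l) l \<omega> \<omega>) * L2.nrm l (weak_deriv l 1 0 u) + sqrt (2 * l) * L2.nrm l (weak_deriv l 1 1 u)) + sqrt pi * L2.nrm l (weak_deriv l 1 1 u)"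
    have "K \<le> (sqrt (ip1 (-l) l \<omega> \<omega>) * (C * norm2 l \<sigma> u) + sqrt (2 * l) * (C * norm2 l \<sigma> u)) + sqrt pi * (C * norm2 l \<sigma> u)"
      unfolding K_def using wn l by (intro add_mono mult_left_mono n) auto
    then have KH: "K \<le> H * norm2 l \<sigma> u" unfolding H_def by (simp add: algebra_simps)
    have cont: "continuous_on (closure (plate l)) c" using c by (simp add: boundary_rep_def)
    obtain a where a: "\<And>n::nat. a n \<in> plate l" "a \<longlonglongrightarrow> z1" using z(1) unfolding closure_sequential by blast
    obtain b where b: "\<And>n::nat. b n \<in> plate l" "b \<longlonglongrightarrow> z2" using z(2) unfolding closure_sequential by blast
    have ca: "(\<lambda>n. c (a n)) \<longlonglongrightarrow> c z1"
      using cont[unfolded continuous_on_sequentially, rule_format, of z1 a] z(1) a subsetD[OF closure_subset a(1)] by (simp add: o_def)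
    have cb: "(\<lambda>n. c (b n)) \<longlonglongrightarrow> c z2"
      using cont[unfolded continuous_on_sequentially, rule_format, of z2 b] z(2) b subsetD[OF closure_subset b(1)] by (simp add: o_def)
    have le: "\<bar>c (a n) - c (b n)\<bar> \<le> (sqrt \<bar>fst (a n) - fst (b n)\<bar> + sqrt \<bar>snd (a n) - snd (b n)\<bar>) * K" for n
      using hoelder_interior[OF l \<omega> u c, of "fst (a n)" "snd (a n)" "fst (b n)" "snd (b n)"] a(1)[of n] b(1)[of n] by (simp add: K_def)
    have "\<bar>c z1 - c z2\<bar> \<le> (sqrt \<bar>fst z1 - fst z2\<bar> + sqrt \<bar>snd z1 - snd z2\<bar>) * K"
    proof (rule LIMSEQ_le)
      show "(\<lambda>n. \<bar>c (a n) - c (b n)\<bar>) \<longlonglongrightarrow> \<bar>c z1 - c z2\<bar>" by (intro tendsto_intros ca cb)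
      show "(\<lambda>n. (sqrt \<bar>fst (a n) - fst (b n)\<bar> + sqrt \<bar>snd (a n) - snd (b n)\<bar>) * K) \<longlonglongrightarrow> (sqrt \<bar>fst z1 - fst z2\<bar> + sqrt \<bar>snd z1 - snd z2\<bar>) * K"
        by (intro tendsto_intros a b)
    qed (use le in auto)
    also have "\<dots> \<le> (sqrt \<bar>fst z1 - fst z2\<bar> + sqrt \<bar>snd z1 - snd z2\<bar>) * (H * norm2 l \<sigma> u)"
      by (intro mult_left_mono KH) auto
    finally show ?thesis by (simp add: mult.commute)
  qed
  then have "hoelder_constant l \<sigma> H" using H0 unfolding hoelder_constant_def by blast
  then show ?thesis by blast
qed

lemma hoelder_constantD:
  assumes "hoelder_constant l \<sigma> H" "u \<in> H2_star l" "boundary_rep l u c" "z1 \<in> closure (plate l)" "z2 \<in> closure (plate l)"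
  shows "\<bar>c z1 - c z2\<bar> \<le> H * norm2 l \<sigma> u * (sqrt \<bar>fst z1 - fst z2\<bar> + sqrt \<bar>snd z1 - snd z2\<bar>)"
  using assms unfolding hoelder_constant_def by blast

section \<open>Completeness and compactness\<close>

lemma L2_nrm_le_sup:
  assumes l: "l > 0" and f: "f \<in> L2 l" and B: "AE z in plate_measure l. \<bar>f z\<bar> \<le> B" "0 \<le> B"
  shows "L2.nrm l f \<le> B * L2.nrm l (\<lambda>_. 1)"
proof -
  have one: "(\<lambda>_. 1) \<in> L2 l" by (intro continuous_L2 continuous_on_const)
  have "inner0 l f f \<le> (LINT z|plate_measure l. B\<^sup>2 * (1 * 1))"
    unfolding inner0_def
  proof (rule integral_mono_AE)
    show "integrable (plate_measure l) (\<lambda>z. f z * f z)" by (rule L2_integrable_mult[OF f f])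
    show "integrable (plate_measure l) (\<lambda>z. B\<^sup>2 * (1 * 1))" by (intro integrable_mult_right L2_integrable_mult one)
    show "AE z in plate_measure l. f z * f z \<le> B\<^sup>2 * (1 * 1)"
      using B(1)
    proof eventually_elim
      case (elim z)
      then have "\<bar>f z\<bar> * \<bar>f z\<bar> \<le> B * B" by (intro mult_mono) (use B(2) in auto)
      then show ?case by (simp add: power2_eq_square abs_mult[symmetric])
    qed
  qed
  also have "\<dots> = B\<^sup>2 * inner0 l (\<lambda>_. 1) (\<lambda>_. 1)" by (simp add: inner0_def)
  finally have "sqrt (inner0 l f f) \<le> sqrt (B\<^sup>2 * inner0 l (\<lambda>_. 1) (\<lambda>_. 1))" by (rule real_sqrt_le_mono)
  then show ?thesis using B(2) by (simp add: L2.nrm_def real_sqrt_mult)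
qed

lemma H2_star_sup_bound:
  assumes H: "hoelder_constant l \<sigma> H" and l: "l > 0" and \<sigma>: "0 < \<sigma>" "\<sigma> < 1 / 2"
    and u: "u \<in> H2_star l" and c: "boundary_rep l u c" and z: "z \<in> closure (plate l)"
  shows "\<bar>c z\<bar> \<le> H * sqrt pi * norm2 l \<sigma> u"
proof -
  obtain x y where zxy: "z = (x, y)" "0 \<le> x" "x \<le> pi" "y \<in> {-l..l}" using z closure_plate[OF l] by auto
  have z0: "(0, y) \<in> closure (plate l)" using zxy closure_plate[OF l] by simp
  have H0: "0 \<le> H" using H by (simp add: hoelder_constant_def)
  have "c (0, y) = 0" using c zxy by (auto simp: boundary_rep_def)
  then have "\<bar>c z\<bar> \<le> H * norm2 l \<sigma> u * sqrt x"
    using hoelder_constantD[OF H u c z z0] zxy by simp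
  also have "\<dots> \<le> H * norm2 l \<sigma> u * sqrt pi"
    using zxy H0 norm2_nonneg[OF l \<sigma> u] by (intro mult_left_mono) auto
  finally show ?thesis by (simp add: mult_ac)
qed

lemma boundary_rep_diff:
  "boundary_rep l u c \<Longrightarrow> boundary_rep l v d \<Longrightarrow> boundary_rep l (\<lambda>z. u z - v z) (\<lambda>z. c z - d z)"
  using boundary_rep_comb[of l u c v d 1 "-1"] by simp

text \<open>
  The Hoelder estimate, applied to differences, makes the continuous representatives uniformly
  Cauchy, so the limit keeps the boundary values; the weak derivatives converge in
  \<open>L\<^sup>2\<close>, and weak derivatives are closed under such limits.
\<close>

theorem H2_star_complete:
  assumes l: "l > 0" and \<sigma>: "0 < \<sigma>" "\<sigma> < 1 / 2"
  shows "semi_inner.complete (H2_star l) (inner2 l \<sigma>)"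
proof -
  interpret A: semi_inner "H2_star l" "inner2 l \<sigma>" by (rule semi_inner_inner2[OF l \<sigma>])
  have nA: "A.nrm = norm2 l \<sigma>" by (simp add: fun_eq_iff A.nrm_def norm2_def)
  obtain H where H: "hoelder_constant l \<sigma> H" using H2_star_hoelder[OF l \<sigma>] by blast
  have H0: "0 \<le> H" using H by (simp add: hoelder_constant_def)
  obtain C where C0: "0 \<le> C" and C: "\<And>u a b. u \<in> H2_star l \<Longrightarrow> a + b \<le> 2 \<Longrightarrow> 0 < a + b \<Longrightarrow> L2.nrm l (weak_deriv l a b u) \<le> C * norm2 l \<sigma> u"
    using H2_star_derivs_bounded[OF l \<sigma>] by blast
  show ?thesis
    unfolding A.complete_def nA
  proof (intro allI impI)
    fix s assume s': "\<forall>n::nat. s n \<in> H2_star l" and Cau: "\<forall>e>0. \<exists>N. \<forall>m\<ge>N. \<forall>n\<ge>N. norm2 l \<sigma> (\<lambda>z. s m z - s n z) < e"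
    then have s: "s n \<in> H2_star l" for n by simp
    have scaled: "\<exists>N. \<forall>m\<ge>N. \<forall>n\<ge>N. K * norm2 l \<sigma> (\<lambda>z. s m z - s n z) < e" if e: "e > 0" and K: "0 \<le> K" for e K :: real
    proof -
      have p: "e / (K + 1) > 0" using e K by simp
      then obtain N where N: "\<And>m n. m \<ge> N \<Longrightarrow> n \<ge> N \<Longrightarrow> norm2 l \<sigma> (\<lambda>z. s m z - s n z) < e / (K + 1)" using Cau by blast
      have "K * norm2 l \<sigma> (\<lambda>z. s m z - s n z) < e" if "m \<ge> N" "n \<ge> N" for m n
      proof -
        have "K * norm2 l \<sigma> (\<lambda>z. s m z - s n z) \<le> (K + 1) * norm2 l \<sigma> (\<lambda>z. s m z - s n z)"
          by (intro mult_right_mono norm2_nonneg l \<sigma> A.diff_mem s) simp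
        also have "\<dots> < e" using N[OF that] K by (simp add: pos_less_divide_eq mult.commute)
        finally show ?thesis .
      qed
      then show ?thesis by blast
    qed
    obtain c where c: "\<And>n. boundary_rep l (s n) (c n)" using s unfolding H2_star_iff by metis
    have cd: "\<bar>c m z - c n z\<bar> \<le> H * sqrt pi * norm2 l \<sigma> (\<lambda>z. s m z - s n z)" if "z \<in> closure (plate l)" for m n z
      by (rule H2_star_sup_bound[OF H l \<sigma> A.diff_mem[OF s s] boundary_rep_diff[OF c c] that])
    have HK: "0 \<le> H * sqrt pi" using H0 by simp
    have "uniformly_convergent_on (closure (plate l)) c"
      unfolding uniformly_convergent_eq_Cauchy uniformly_Cauchy_on_def
    proof (intro allI impI)
      fix e :: real assume "e > 0"
      from scaled[OF this HK] obtain N where "\<And>m n. m \<ge> N \<Longrightarrow> n \<ge> N \<Longrightarrow> H * sqrt pi * norm2 l \<sigma> (\<lambda>z. s m z - s n z) < e" by blast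
      then show "\<exists>M. \<forall>z\<in>closure (plate l). \<forall>m\<ge>M. \<forall>n\<ge>M. dist (c m z) (c n z) < e"
        unfolding dist_real_def using cd by (meson le_less_trans)
    qed
    then obtain w where w: "uniform_limit (closure (plate l)) c w sequentially" by (auto simp: uniformly_convergent_on_def)
    have wc: "continuous_on (closure (plate l)) w"
      by (rule uniform_limit_theorem[OF _ w]) (use c in \<open>auto simp: boundary_rep_def\<close>)
    have pw: "(\<lambda>n. c n z) \<longlonglongrightarrow> w z" if "z \<in> closure (plate l)" for z using tendsto_uniform_limitI[OF w that] .
    have w0: "w z = 0" if "z \<in> {0, pi} \<times> {-l..l}" for z
    proof -
      have "z \<in> closure (plate l)" using that closure_plate[OF l] by auto
      from pw[OF this] have "(\<lambda>n. 0) \<longlonglongrightarrow> w z" using c that unfolding boundary_rep_def by simp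
      then show ?thesis by (simp add: LIMSEQ_const_iff)
    qed
    have wL: "w \<in> L2 l"
    proof -
      have "w \<in> borel_measurable (plate_measure l)"
        using plate_lebesgue(1) continuous_on_subset[OF wc closure_subset]
        by (rule continuous_imp_measurable_on_sets_lebesgue[rotated])
      moreover have "bounded (w ` closure (plate l))"
        by (intro compact_imp_bounded compact_continuous_image wc compact_closure_plate)
      then obtain B where B: "\<And>z. z \<in> closure (plate l) \<Longrightarrow> \<bar>w z\<bar> \<le> B"
        unfolding bounded_iff by auto
      have "integrable (plate_measure l) (\<lambda>z. (w z)\<^sup>2)"
      proof (rule finite_measure.integrable_const_bound[OF finite_plate_measure])
        show "AE z in plate_measure l. norm ((w z)\<^sup>2) \<le> B\<^sup>2"
        proof (rule AE_I2)
          fix z assume "z \<in> space (plate_measure l)"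
          then have "z \<in> closure (plate l)" using closure_subset by auto
          then have "\<bar>w z\<bar> \<le> B" by (rule B)
          then have "\<bar>w z\<bar>\<^sup>2 \<le> B\<^sup>2" by (intro power_mono) auto
          then show "norm ((w z)\<^sup>2) \<le> B\<^sup>2" by simp
        qed
      qed (use \<open>w \<in> borel_measurable (plate_measure l)\<close> in measurable)
      ultimately show ?thesis by (simp add: L2_def)
    qed
    have one: "0 \<le> L2.nrm l (\<lambda>_. 1)" by (intro L2.nrm_nonneg continuous_L2 continuous_on_const)
    have sw: "(\<lambda>n. L2.nrm l (\<lambda>z. s n z - w z)) \<longlonglongrightarrow> 0"
    proof (rule LIMSEQ_I)
      fix e :: real assume e: "e > 0"
      define e' where "e' = e / (L2.nrm l (\<lambda>_. 1) + 1)"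
      have e': "e' > 0" "e' * L2.nrm l (\<lambda>_. 1) < e" using e one by (auto simp: e'_def field_simps add_nonneg_pos)
      from uniform_limitD[OF w e'(1)] obtain N where N: "\<And>n z. n \<ge> N \<Longrightarrow> z \<in> closure (plate l) \<Longrightarrow> dist (c n z) (w z) < e'"
        unfolding eventually_sequentially by blast
      have "norm (L2.nrm l (\<lambda>z. s n z - w z) - 0) < e" if n: "n \<ge> N" for n
      proof -
        have d: "(\<lambda>z. s n z - w z) \<in> L2 l" by (intro L2.diff_mem H2_star_L2 s wL)
        have "AE z in plate_measure l. s n z = c n z" using c by (simp add: boundary_rep_def)
        then have "AE z in plate_measure l. \<bar>s n z - w z\<bar> \<le> e'"
        proof (rule AE_mp, intro AE_I2 impI)
          fix z assume z: "z \<in> space (plate_measure l)" "s n z = c n z"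
          then have "z \<in> closure (plate l)" using closure_subset by auto
          from N[OF n this] show "\<bar>s n z - w z\<bar> \<le> e'" by (simp add: z(2) dist_real_def)
        qed
        then have "L2.nrm l (\<lambda>z. s n z - w z) \<le> e' * L2.nrm l (\<lambda>_. 1)" using e' by (intro L2_nrm_le_sup l d) auto
        then show ?thesis using e'(2) L2.nrm_nonneg[OF d] by simp
      qed
      then show "\<exists>no. \<forall>n\<ge>no. norm (L2.nrm l (\<lambda>z. s n z - w z) - 0) < e" by blast
    qed
    have lim: "\<exists>g. g \<in> L2 l \<and> (\<lambda>n. L2.nrm l (\<lambda>z. weak_deriv l a b (s n) z - g z)) \<longlonglongrightarrow> 0"
      if ab: "a + b \<le> 2" "0 < a + b" for a b
    proof -
      have "\<exists>N. \<forall>m\<ge>N. \<forall>n\<ge>N. L2.nrm l (\<lambda>z. weak_deriv l a b (s m) z - weak_deriv l a b (s n) z) < e" if e: "e > 0" for e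
      proof -
        from scaled[OF e C0] obtain N where N: "\<And>m n. m \<ge> N \<Longrightarrow> n \<ge> N \<Longrightarrow> C * norm2 l \<sigma> (\<lambda>z. s m z - s n z) < e" by blast
        have "L2.nrm l (\<lambda>z. weak_deriv l a b (s m) z - weak_deriv l a b (s n) z) < e" if "m \<ge> N" "n \<ge> N" for m n
          using le_less_trans[OF C[OF A.diff_mem[OF s s] ab] N[OF that]]
          unfolding nrm_weak_deriv_diff[OF l s s ab(1)] .
        then show ?thesis by blast
      qed
      then show ?thesis
        using L2_complete[of l, unfolded L2.complete_def, rule_format, of "\<lambda>n. weak_deriv l a b (s n)"] weak_deriv_L2[OF s ab(1)] by blast
    qed
    \<comment> \<open>for order 0 the limit is that of the functions themselves\<close>
    define g where "g = (\<lambda>a b. if a + b = 0 then w else SOME g. g \<in> L2 l \<and> (\<lambda>n. L2.nrm l (\<lambda>z. weak_deriv l a b (s n) z - g z)) \<longlonglongrightarrow> 0)"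
    have g: "g a b \<in> L2 l" "(\<lambda>n. L2.nrm l (\<lambda>z. weak_deriv l a b (s n) z - g a b z)) \<longlonglongrightarrow> 0" if "a + b \<le> 2" "0 < a + b" for a b
      using someI_ex[OF lim[OF that]] that by (auto simp: g_def)
    have wk: "is_weak_deriv l a b w (g a b)" if ab: "a + b \<le> 2" for a b
    proof (cases "a + b = 0")
      case True
      then show ?thesis using wL by (simp add: is_weak_deriv_def g_def partial_deriv_def)
    next
      case False
      then have ab': "0 < a + b" by simp
      show ?thesis unfolding is_weak_deriv_def
      proof (intro conjI ballI g ab ab')
        fix \<psi> assume \<psi>: "\<psi> \<in> test_functions l"
        note t = test_L2[OF \<psi>]
        have l1: "(\<lambda>n. inner0 l (s n) (partial_deriv a b \<psi>)) \<longlonglongrightarrow> inner0 l w (partial_deriv a b \<psi>)"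
          by (intro L2.ip_tendsto sw L2.tendsto_const_curve t wL) (simp_all add: H2_star_L2 s t)
        have "(\<lambda>n. inner0 l (weak_deriv l a b (s n)) \<psi>) \<longlonglongrightarrow> inner0 l (g a b) \<psi>"
          by (intro L2.ip_tendsto L2.tendsto_const_curve t g ab ab') (simp_all add: weak_deriv_L2 s ab t)
        then have l2: "(\<lambda>n. (-1) ^ (a + b) * inner0 l (weak_deriv l a b (s n)) \<psi>) \<longlonglongrightarrow> (-1) ^ (a + b) * inner0 l (g a b) \<psi>"
          by (intro tendsto_intros)
        have eq: "inner0 l (s n) (partial_deriv a b \<psi>) = (-1) ^ (a + b) * inner0 l (weak_deriv l a b (s n)) \<psi>" for n
          using H2_star_weak_deriv[OF s ab, of n] \<psi> by (simp add: is_weak_deriv_def)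
        show "inner0 l w (partial_deriv a b \<psi>) = (-1) ^ (a + b) * inner0 l (g a b) \<psi>"
          by (rule LIMSEQ_unique[OF l1[unfolded eq] l2])
      qed
    qed
    have wH: "w \<in> H2_star l"
    proof -
      have "w \<in> H2 l" using wL wk unfolding H2_def by blast
      moreover have "boundary_rep l w w" using wc w0 by (simp add: boundary_rep_def)
      ultimately show ?thesis unfolding H2_star_iff by blast
    qed
    have dlim: "(\<lambda>n. inner0 l (weak_deriv l a b (\<lambda>z. s n z - w z)) (weak_deriv l a b (\<lambda>z. s n z - w z))) \<longlonglongrightarrow> 0"
      if ab: "a + b \<le> 2" "0 < a + b" for a b
    proof -
      have wdL: "weak_deriv l a b (\<lambda>z. s n z - w z) \<in> L2 l" for n by (rule weak_deriv_L2[OF A.diff_mem[OF s wH] ab(1)])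
      have ae: "AE z in plate_measure l. weak_deriv l a b w z = g a b z"
        by (rule weak_deriv_unique[OF l H2_star_weak_deriv[OF wH ab(1)] wk[OF ab(1)]])
      have "L2.nrm l (weak_deriv l a b (\<lambda>z. s n z - w z)) = L2.nrm l (\<lambda>z. weak_deriv l a b (s n) z - g a b z)" for n
        unfolding nrm_weak_deriv_diff[OF l s wH ab(1)]
        unfolding L2.nrm_def using ae by (intro arg_cong[where f = sqrt] inner0_cong L2.diff_mem weak_deriv_L2 s wH ab g) (auto elim: eventually_mono)
      then have "(\<lambda>n. (L2.nrm l (weak_deriv l a b (\<lambda>z. s n z - w z)))\<^sup>2) \<longlonglongrightarrow> 0\<^sup>2"
        using g(2)[OF ab] by (intro tendsto_power) simp
      then show ?thesis by (simp add: L2.nrm_square wdL)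
    qed
    have "(\<lambda>n. inner2 l \<sigma> (\<lambda>z. s n z - w z) (\<lambda>z. s n z - w z)) \<longlonglongrightarrow> 0"
    proof (rule Lim_null_comparison)
      have "(\<lambda>n. 2 * hessian_square l (\<lambda>z. s n z - w z)) \<longlonglongrightarrow> 2 * (0 + 0 + 2 * 0)"
        unfolding hessian_square_def by (intro tendsto_intros dlim) auto
      then show "(\<lambda>n. 2 * hessian_square l (\<lambda>z. s n z - w z)) \<longlonglongrightarrow> 0" by simp
      show "\<forall>\<^sub>F n in sequentially. norm (inner2 l \<sigma> (\<lambda>z. s n z - w z) (\<lambda>z. s n z - w z)) \<le> 2 * hessian_square l (\<lambda>z. s n z - w z)"
        using inner2_coercive(2)[OF A.diff_mem[OF s wH] \<sigma>] A.ip_nonneg[OF A.diff_mem[OF s wH]]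
        by (intro always_eventually allI) simp
    qed
    then have "(\<lambda>n. sqrt (inner2 l \<sigma> (\<lambda>z. s n z - w z) (\<lambda>z. s n z - w z))) \<longlonglongrightarrow> sqrt 0" by (intro tendsto_intros)
    then show "\<exists>f\<in>H2_star l. (\<lambda>n. norm2 l \<sigma> (\<lambda>z. s n z - f z)) \<longlonglongrightarrow> 0" using wH by (auto simp: norm2_def)
  qed
qed

text \<open>
  The continuous representatives are bounded and equicontinuous, so a subsequence converges
  uniformly, hence in \<open>L\<^sup>2\<close>. Since \<open>|u\<^sub>x|\<^sup>2 = -
  (u\<^sub>x\<^sub>x, u)\<^sub>0\<close> and the second derivatives are bounded, the
  x-derivatives are Cauchy as well.
\<close>

theorem H2_star_compact:
  assumes l: "l > 0" and \<sigma>: "0 < \<sigma>" "\<sigma> < 1 / 2"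
    and s: "\<And>n::nat. s n \<in> H2_star l" and M: "\<And>n. inner2 l \<sigma> (s n) (s n) \<le> M"
  shows "\<exists>r::nat \<Rightarrow> nat. strict_mono r \<and> (\<forall>e>0. \<exists>N. \<forall>m\<ge>N. \<forall>n\<ge>N. 
     L2.nrm l (weak_deriv l 1 0 (\<lambda>z. s (r m) z - s (r n) z)) < e)"
proof -
  interpret A: semi_inner "H2_star l" "inner2 l \<sigma>" by (rule semi_inner_inner2[OF l \<sigma>])
  have nA: "A.nrm = norm2 l \<sigma>" by (simp add: fun_eq_iff A.nrm_def norm2_def)
  obtain H where H: "hoelder_constant l \<sigma> H" using H2_star_hoelder[OF l \<sigma>] by blast
  have H0: "0 \<le> H" using H by (simp add: hoelder_constant_def)
  obtain C where C0: "0 \<le> C" and C: "\<And>u a b. u \<in> H2_star l \<Longrightarrow> a + b \<le> 2 \<Longrightarrow> 0 < a + b \<Longrightarrow> L2.nrm l (weak_deriv l a b u) \<le> C * norm2 l \<sigma> u"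
    using H2_star_derivs_bounded[OF l \<sigma>] by blast
  define R where "R = sqrt (max M 0)"
  have R: "0 \<le> R" "norm2 l \<sigma> (s n) \<le> R" for n
    unfolding R_def norm2_def using M[of n] by auto
  obtain c where c: "\<And>n. boundary_rep l (s n) (c n)" using s unfolding H2_star_iff by metis
  have cb: "\<bar>c n z\<bar> \<le> H * sqrt pi * R" if "z \<in> closure (plate l)" for n z
    using H2_star_sup_bound[OF H l \<sigma> s c that, of n] R H0 by (smt (verit) mult_left_mono mult_nonneg_nonneg real_sqrt_ge_zero pi_ge_zero)
  have equi: "\<exists>d. 0 < d \<and> (\<forall>n z'. z' \<in> closure (plate l) \<and> norm (z - z') < d \<longrightarrow> norm (c n z - c n z') < e)"
    if z: "z \<in> closure (plate l)" and e: "0 < e" for z e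
  proof -
    define K where "K = 2 * (H * R) + 1"
    have K: "0 < K" using H0 R by (simp add: K_def add_nonneg_pos)
    have "norm (c n z - c n z') < e" if z': "z' \<in> closure (plate l)" "norm (z - z') < (e / K)\<^sup>2" for n z'
    proof -
      have "\<bar>fst z - fst z'\<bar> \<le> norm (z - z')" "\<bar>snd z - snd z'\<bar> \<le> norm (z - z')"
        using dist_fst_le[of z z'] dist_snd_le[of z z'] by (simp_all add: dist_norm)
      then have "sqrt \<bar>fst z - fst z'\<bar> \<le> sqrt (norm (z - z'))" "sqrt \<bar>snd z - snd z'\<bar> \<le> sqrt (norm (z - z'))" by simp_all
      moreover have sq: "sqrt (norm (z - z')) < e / K" using z'(2) e K by (metis divide_pos_pos real_sqrt_less_mono real_sqrt_abs abs_of_pos)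
      ultimately have s2: "sqrt \<bar>fst z - fst z'\<bar> + sqrt \<bar>snd z - snd z'\<bar> \<le> 2 * sqrt (norm (z - z'))" by linarith
      have "norm (c n z - c n z') \<le> H * norm2 l \<sigma> (s n) * (sqrt \<bar>fst z - fst z'\<bar> + sqrt \<bar>snd z - snd z'\<bar>)"
        using hoelder_constantD[OF H s c z z'(1)] by simp
      also have "\<dots> \<le> H * R * (2 * sqrt (norm (z - z')))"
        using R H0 s2 norm2_nonneg[OF l \<sigma> s] by (intro mult_mono mult_left_mono) auto
      also have "\<dots> \<le> K * sqrt (norm (z - z'))" by (simp add: K_def algebra_simps)
      also have "\<dots> < e" using sq K by (simp add: pos_less_divide_eq mult.commute)
      finally show ?thesis .
    qed
    moreover have "0 < (e / K)\<^sup>2" using e K by simp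
    ultimately show ?thesis by blast
  qed
  obtain g k where k: "strict_mono (k :: nat \<Rightarrow> nat)"
    and unif: "\<And>e. 0 < e \<Longrightarrow> \<exists>N. \<forall>n x. n \<ge> N \<and> x \<in> closure (plate l) \<longrightarrow> norm (c (k n) x - g x) < e"
    using Arzela_Ascoli[OF compact_closure_plate[of l], of c "H * sqrt pi * R"] cb equi by (metis real_norm_def)
  have one: "0 \<le> L2.nrm l (\<lambda>_. 1)" by (intro L2.nrm_nonneg continuous_L2 continuous_on_const)
  have "\<exists>N. \<forall>m\<ge>N. \<forall>n\<ge>N. L2.nrm l (weak_deriv l 1 0 (\<lambda>z. s (k m) z - s (k n) z)) < e" if e: "e > 0" for e
  proof -
    define Q where "Q = C * (2 * R) * (2 * L2.nrm l (\<lambda>_. 1)) + 1"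
    have Q: "0 < Q" using C0 R one by (simp add: Q_def add_nonneg_pos)
    define e' where "e' = e\<^sup>2 / Q"
    have e': "0 < e'" using e Q by (simp add: e'_def)
    then obtain N where N: "\<And>n x. n \<ge> N \<Longrightarrow> x \<in> closure (plate l) \<Longrightarrow> norm (c (k n) x - g x) < e'" using unif by blast
    have "L2.nrm l (weak_deriv l 1 0 (\<lambda>z. s (k m) z - s (k n) z)) < e" if mn: "m \<ge> N" "n \<ge> N" for m n
    proof -
      let ?d = "\<lambda>z. s (k m) z - s (k n) z"
      have d: "?d \<in> H2_star l" by (intro A.diff_mem s)
      have dL: "?d \<in> L2 l" "weak_deriv l 1 0 ?d \<in> L2 l" "weak_deriv l 2 0 ?d \<in> L2 l" using d by (auto intro: weak_deriv_L2 H2_star_L2)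
      have rep: "boundary_rep l ?d (\<lambda>z. c (k m) z - c (k n) z)" by (rule boundary_rep_diff[OF c c])
      then have "AE z in plate_measure l. ?d z = c (k m) z - c (k n) z" by (simp add: boundary_rep_def)
      then have "AE z in plate_measure l. \<bar>?d z\<bar> \<le> 2 * e'"
      proof (rule AE_mp, intro AE_I2 impI)
        fix z assume z: "z \<in> space (plate_measure l)" "?d z = c (k m) z - c (k n) z"
        then have "z \<in> closure (plate l)" using closure_subset by auto
        from N[OF mn(1) this] N[OF mn(2) this] show "\<bar>?d z\<bar> \<le> 2 * e'" unfolding z(2) by (simp add: abs_if split: if_splits)
      qed
      then have n0: "L2.nrm l ?d \<le> 2 * e' * L2.nrm l (\<lambda>_. 1)" using e' by (intro L2_nrm_le_sup l dL) auto
      have n2: "L2.nrm l (weak_deriv l 2 0 ?d) \<le> C * (2 * R)"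
      proof -
        have "norm2 l \<sigma> ?d \<le> norm2 l \<sigma> (s (k m)) + norm2 l \<sigma> (s (k n))"
          using A.nrm_triangle[OF s A.scale_mem[OF s, of "-1"], of "k m" "k n"] A.ip_square_comb[OF s s, of 0 "k n" "-1" "k n"] unfolding nA by (simp add: norm2_def)
        then have "C * norm2 l \<sigma> ?d \<le> C * (2 * R)" using R(2)[of "k m"] R(2)[of "k n"] C0 by (intro mult_left_mono) auto
        then show ?thesis using C[OF d, of 2 0] by simp
      qed
      have "(L2.nrm l (weak_deriv l 1 0 ?d))\<^sup>2 = - inner0 l (weak_deriv l 2 0 ?d) ?d"
        unfolding L2.nrm_square[OF dL(2)] by (rule stretch_by_parts[OF l d d])
      also have "\<dots> \<le> L2.nrm l (weak_deriv l 2 0 ?d) * L2.nrm l ?d" using L2.cauchy_schwarz[OF dL(3,1)] by simp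
      also have "\<dots> \<le> (C * (2 * R)) * (2 * e' * L2.nrm l (\<lambda>_. 1))"
        using n0 n2 C0 R(1) dL by (intro mult_mono) auto
      also have "\<dots> = (Q - 1) * e'" by (simp add: Q_def algebra_simps)
      also have "\<dots> < Q * e'" using e' by simp
      also have "\<dots> = e\<^sup>2" using Q by (simp add: e'_def)
      finally show ?thesis using e by (simp add: power2_less_imp_less)
    qed
    then show ?thesis by blast
  qed
  then show ?thesis using k by blast
qed

section \<open>The plate as an abstract form\<close>

theorem plate_forms_H2_star:
  assumes l: "l > 0" and \<sigma>: "0 < \<sigma>" "\<sigma> < 1 / 2"
  shows "\<exists>Cb Ch Cd. plate_forms (H2_star l) (inner2 l \<sigma>) (\<lambda>u v. inner0 l (weak_deriv l 1 0 u) (weak_deriv l 1 0 v))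
     (L2 l) (inner0 l) (weak_deriv l 2 0) Cb Ch Cd"
proof -
  let ?b = "\<lambda>u v. inner0 l (weak_deriv l 1 0 u) (weak_deriv l 1 0 v)"
  interpret A: semi_inner "H2_star l" "inner2 l \<sigma>" by (rule semi_inner_inner2[OF l \<sigma>])
  interpret B: semi_inner "H2_star l" ?b by (rule semi_inner_stretch[OF l])
  obtain C where C0: "0 \<le> C" and C: "\<And>u a b. u \<in> H2_star l \<Longrightarrow> a + b \<le> 2 \<Longrightarrow> 0 < a + b \<Longrightarrow> L2.nrm l (weak_deriv l a b u) \<le> C * norm2 l \<sigma> u"
    using H2_star_derivs_bounded[OF l \<sigma>] by blast
  have nB: "B.nrm = (\<lambda>u. L2.nrm l (weak_deriv l 1 0 u))" by (rule ext) (simp only: B.nrm_def L2.nrm_def)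
  have sq: "(L2.nrm l (weak_deriv l a b u))\<^sup>2 \<le> C\<^sup>2 * inner2 l \<sigma> u u" if "u \<in> H2_star l" "a + b \<le> 2" "0 < a + b" for u a b
  proof -
    have "(L2.nrm l (weak_deriv l a b u))\<^sup>2 \<le> (C * norm2 l \<sigma> u)\<^sup>2"
      using C[OF that] that by (intro power_mono) (auto intro!: L2.nrm_nonneg weak_deriv_L2)
    also have "\<dots> = C\<^sup>2 * inner2 l \<sigma> u u" using A.ip_nonneg[OF that(1)] by (simp add: norm2_def power_mult_distrib)
    finally show ?thesis .
  qed
  have "plate_forms (H2_star l) (inner2 l \<sigma>) ?b (L2 l) (inner0 l) (weak_deriv l 2 0) (C\<^sup>2) (pi\<^sup>2) (C\<^sup>2)"
  proof unfold_locales
    show "H2_star l \<subseteq> L2 l" using H2_star_L2 by blast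
    show "0 \<le> C\<^sup>2" "0 \<le> pi\<^sup>2" by simp_all
    show "A.complete" by (rule H2_star_complete[OF l \<sigma>])
    show "\<exists>r::nat \<Rightarrow> nat. strict_mono r \<and> (\<forall>e>0. \<exists>N. \<forall>m\<ge>N. \<forall>n\<ge>N. B.nrm (\<lambda>z. s (r m) z - s (r n) z) < e)"
      if "\<And>n::nat. s n \<in> H2_star l" "\<And>n. inner2 l \<sigma> (s n) (s n) \<le> M" for s M
      unfolding nB by (rule H2_star_compact[OF l \<sigma> that])
    fix u assume u: "u \<in> H2_star l"
    show "weak_deriv l 2 0 u \<in> L2 l" by (rule weak_deriv_L2[OF u]) simp
    have m: "weak_deriv l 1 0 u \<in> L2 l" by (rule weak_deriv_L2[OF u]) simp
    show "inner0 l (weak_deriv l 1 0 u) (weak_deriv l 1 0 u) \<le> C\<^sup>2 * inner2 l \<sigma> u u"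
      using sq[OF u, of 1 0] L2.nrm_square[OF m] by simp
    have "(L2.nrm l u)\<^sup>2 \<le> (pi * L2.nrm l (weak_deriv l 1 0 u))\<^sup>2"
      using H2_star_norm_bounds(1)[OF l u] H2_star_L2[OF u] by (intro power_mono) auto
    then show "inner0 l u u \<le> pi\<^sup>2 * inner0 l (weak_deriv l 1 0 u) (weak_deriv l 1 0 u)"
      unfolding power_mult_distrib L2.nrm_square[OF m] L2.nrm_square[OF H2_star_L2[OF u]] .
    fix v assume v: "v \<in> H2_star l"
    show "inner0 l (weak_deriv l 1 0 u) (weak_deriv l 1 0 v) = - inner0 l (weak_deriv l 2 0 u) v"
      by (rule stretch_by_parts[OF l u v])
    have "(\<lambda>z. weak_deriv l 2 0 u z - weak_deriv l 2 0 v z) \<in> L2 l" by (intro L2.diff_mem weak_deriv_L2 u v) simp_all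
    from L2.nrm_square[OF this]
    show "inner0 l (\<lambda>z. weak_deriv l 2 0 u z - weak_deriv l 2 0 v z) (\<lambda>z. weak_deriv l 2 0 u z - weak_deriv l 2 0 v z)
       \<le> C\<^sup>2 * inner2 l \<sigma> (\<lambda>z. u z - v z) (\<lambda>z. u z - v z)"
      using sq[OF A.diff_mem[OF u v], of 2 0] nrm_weak_deriv_diff[OF l u v, of 2 0] by simp
  qed
  then show ?thesis by blast
qed

text \<open>
  If \<open>u\<^sub>x\<close> is not null, the Rayleigh quotient has a minimiser, which is a
  buckling mode; its quotient is the least eigenvalue because every eigenvalue is the quotient
  of its mode.
\<close>

lemma Lambda1_bound:
  assumes l: "l > 0" and \<sigma>: "0 < \<sigma>" "\<sigma> < 1 / 2" and P: "P \<le> Lambda1 l \<sigma>" and u: "u \<in> H2_star l"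
  shows "P * inner0 l (weak_deriv l 1 0 u) (weak_deriv l 1 0 u) \<le> inner2 l \<sigma> u u"
proof -
  let ?b = "\<lambda>u v. inner0 l (weak_deriv l 1 0 u) (weak_deriv l 1 0 v)"
  obtain Cb Ch Cd where "plate_forms (H2_star l) (inner2 l \<sigma>) ?b (L2 l) (inner0 l) (weak_deriv l 2 0) Cb Ch Cd"
    using plate_forms_H2_star[OF l \<sigma>] by blast
  then interpret PF: plate_forms "H2_star l" "inner2 l \<sigma>" ?b "L2 l" "inner0 l" "weak_deriv l 2 0" Cb Ch Cd .
  show ?thesis
  proof (cases "?b u u = 0")
    case True
    then show ?thesis using PF.A.ip_nonneg[OF u] by simp
  next
    case False
    obtain K w where w: "w \<in> H2_star l" "?b w w = 1" "\<forall>v\<in>H2_star l. inner2 l \<sigma> w v = K * ?b w v"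
      and K: "\<And>v. v \<in> H2_star l \<Longrightarrow> K * ?b v v \<le> inner2 l \<sigma> v v"
      using PF.rayleigh_minimiser[OF u False] by blast
    have "Lambda1 l \<sigma> = K"
      unfolding Lambda1_def
    proof (rule Least_equality)
      \<comment> \<open>an eigenfunction must not be null, and \<open>b w w = 1\<close> excludes this through \<open>b w w = - (w\<^sub>x\<^sub>x, w)\<^sub>0\<close>\<close>
      have "\<not> (AE z in plate_measure l. w z = 0)"
      proof
        assume "AE z in plate_measure l. w z = 0"
        then have "L2.nrm l w = 0" using inner0_self_eq_0_iff[OF H2_star_L2[OF w(1)]] by (simp add: L2.nrm_def)
        then have "inner0 l (weak_deriv l 2 0 w) w = 0"
          using L2.nrm_eq_0_ip[OF H2_star_L2[OF w(1)] PF.D_mem[OF w(1)]] L2.ip_sym[OF H2_star_L2[OF w(1)] PF.D_mem[OF w(1)]] by simp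
        then show False using PF.b_D[OF w(1) w(1)] w(2) by simp
      qed
      then show "buckling_eigenvalue l \<sigma> K" unfolding buckling_eigenvalue_def using w by blast
      fix L assume "buckling_eigenvalue l \<sigma> L"
      then obtain v where v: "v \<in> H2_star l" "\<not> (AE z in plate_measure l. v z = 0)" "inner2 l \<sigma> v v = L * ?b v v"
        unfolding buckling_eigenvalue_def by blast
      have "?b v v \<noteq> 0"
        using PF.b_zero_imp_h_zero[OF v(1)] inner0_self_eq_0_iff[OF H2_star_L2[OF v(1)]] v(2) by blast
      then have "0 < ?b v v" using PF.B.ip_nonneg[OF v(1)] by linarith
      then show "K \<le> L" using K[OF v(1)] v(3) by simp
    qed
    then have "P * ?b u u \<le> K * ?b u u" using P PF.B.ip_nonneg[OF u] by (intro mult_right_mono) auto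
    then show ?thesis using K[OF u] by linarith
  qed
qed

text \<open>
  The supremum in \<open>dual_norm\<close> is taken in the reals, so the boundedness of the
  functional is used first to see that it is an upper bound.
\<close>

lemma dual_norm_bound:
  assumes l: "l > 0" and \<sigma>: "0 < \<sigma>" "\<sigma> < 1 / 2" and \<Phi>: "\<Phi> \<in> dual_space l \<sigma>" and y: "y \<in> H2_star l"
  shows "\<bar>\<Phi> y\<bar> \<le> dual_norm l \<sigma> \<Phi> * norm2 l \<sigma> y"
proof -
  interpret A: semi_inner "H2_star l" "inner2 l \<sigma>" by (rule semi_inner_inner2[OF l \<sigma>])
  obtain C where C: "\<And>f. f \<in> H2_star l \<Longrightarrow> \<bar>\<Phi> f\<bar> \<le> C * norm2 l \<sigma> f" using \<Phi> unfolding dual_space_def by blast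
  have lin: "\<Phi> (\<lambda>z. a * y z + b * y z) = a * \<Phi> y + b * \<Phi> y" for a b using \<Phi> y by (simp add: dual_space_def)
  have bdd: "bdd_above ((\<lambda>f. \<bar>\<Phi> f\<bar>) ` {f \<in> H2_star l. norm2 l \<sigma> f \<le> 1})"
  proof (rule bdd_aboveI2)
    fix f assume f: "f \<in> {f \<in> H2_star l. norm2 l \<sigma> f \<le> 1}"
    have n: "0 \<le> norm2 l \<sigma> f" using f by (intro norm2_nonneg l \<sigma>) simp
    have "\<bar>\<Phi> f\<bar> \<le> C * norm2 l \<sigma> f" using C f by simp
    also have "\<dots> \<le> \<bar>C\<bar> * norm2 l \<sigma> f" using n by (intro mult_right_mono) auto
    also have "\<dots> \<le> \<bar>C\<bar> * 1" using f by (intro mult_left_mono) auto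
    finally show "\<bar>\<Phi> f\<bar> \<le> \<bar>C\<bar> * 1" .
  qed
  show ?thesis
  proof (cases "norm2 l \<sigma> y = 0")
    case True then show ?thesis using C[OF y] by simp
  next
    case False
    then have n: "0 < norm2 l \<sigma> y" using norm2_nonneg[OF l \<sigma> y] by simp
    let ?c = "1 / norm2 l \<sigma> y"
    have "norm2 l \<sigma> (\<lambda>z. c * y z) = \<bar>c\<bar> * norm2 l \<sigma> y" for c
      by (simp add: norm2_def A.ip_scale A.ip_scale_right A.scale_mem y real_sqrt_mult mult.assoc[symmetric])
    from this[of ?c] have "norm2 l \<sigma> (\<lambda>z. ?c * y z) = 1" using n by simp
    then have "\<bar>\<Phi> (\<lambda>z. ?c * y z)\<bar> \<le> dual_norm l \<sigma> \<Phi>"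
      unfolding dual_norm_def by (intro cSUP_upper bdd) (simp only: mem_Collect_eq A.scale_mem[OF y] order_refl)
    moreover have "\<Phi> (\<lambda>z. ?c * y z) = ?c * \<Phi> y" using lin[of ?c 0] by simp
    ultimately show ?thesis using n by (simp add: abs_mult divide_le_eq)
  qed
qed

lemma dual_space_comb:
  assumes l: "l > 0" and \<sigma>: "0 < \<sigma>" "\<sigma> < 1 / 2" and "\<Phi> \<in> dual_space l \<sigma>" "\<Psi> \<in> dual_space l \<sigma>"
  shows "(\<lambda>f. a * \<Phi> f + b * \<Psi> f) \<in> dual_space l \<sigma>"
proof -
  obtain C where C: "\<And>f. f \<in> H2_star l \<Longrightarrow> \<bar>\<Phi> f\<bar> \<le> C * norm2 l \<sigma> f" using assms(4,5) unfolding dual_space_def by blast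
  obtain E where E: "\<And>f. f \<in> H2_star l \<Longrightarrow> \<bar>\<Psi> f\<bar> \<le> E * norm2 l \<sigma> f" using assms(4,5) unfolding dual_space_def by blast
  have "\<bar>a * \<Phi> f + b * \<Psi> f\<bar> \<le> (\<bar>a\<bar> * C + \<bar>b\<bar> * E) * norm2 l \<sigma> f" if "f \<in> H2_star l" for f
  proof -
    have "\<bar>a * \<Phi> f + b * \<Psi> f\<bar> \<le> \<bar>a\<bar> * \<bar>\<Phi> f\<bar> + \<bar>b\<bar> * \<bar>\<Psi> f\<bar>" by (metis abs_mult abs_triangle_ineq)
    also have "\<dots> \<le> \<bar>a\<bar> * (C * norm2 l \<sigma> f) + \<bar>b\<bar> * (E * norm2 l \<sigma> f)"
      by (intro add_mono mult_left_mono C E that) auto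
    finally show ?thesis by (simp add: algebra_simps)
  qed
  moreover have "a * \<Phi> (\<lambda>z. c * f z + d * g z) + b * \<Psi> (\<lambda>z. c * f z + d * g z) = c * (a * \<Phi> f + b * \<Psi> f) + d * (a * \<Phi> g + b * \<Psi> g)"
    if "f \<in> H2_star l" "g \<in> H2_star l" for f g c d
    using assms(4,5) that by (simp add: dual_space_def algebra_simps)
  ultimately show ?thesis unfolding dual_space_def by blast
qed

lemma critical_iff_stationary:
  assumes "plate_forms (H2_star l) (inner2 l \<sigma>) (\<lambda>u v. inner0 l (weak_deriv l 1 0 u) (weak_deriv l 1 0 v))
     (L2 l) (inner0 l) (weak_deriv l 2 0) Cb Ch Cd"
  shows "plate_forms.critical (H2_star l) (inner2 l \<sigma>) (\<lambda>u v. inner0 l (weak_deriv l 1 0 u) (weak_deriv l 1 0 v))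
      (inner0 l) S P F W \<longleftrightarrow> stationary_solution l \<sigma> S P F W"
proof -
  interpret PF: plate_forms "H2_star l" "inner2 l \<sigma>" "\<lambda>u v. inner0 l (weak_deriv l 1 0 u) (weak_deriv l 1 0 v)"
     "L2 l" "inner0 l" "weak_deriv l 2 0" Cb Ch Cd by (rule assms)
  have "nonlocal_coeff l S P W = - P + S * inner0 l (weak_deriv l 1 0 W) (weak_deriv l 1 0 W)"
    by (simp add: nonlocal_coeff_def inner0_def power2_eq_square)
  then show ?thesis unfolding PF.critical_def PF.residual_def stationary_solution_def by auto
qed

section \<open>Weak solutions as trajectories\<close>

lemma continuous_curveD:
  assumes "continuous_curve X N I c" "t \<in> I"
  shows "c t \<in> X" "((\<lambda>s. N (\<lambda>z. c s z - c t z)) \<longlongrightarrow> 0) (at t within I)"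
  using assms by (simp_all add: continuous_curve_def)

lemma curve_derivativeD:
  assumes "curve_derivative X N I c c'" "t \<in> I"
  shows "c t \<in> X" "c' t \<in> X" "((\<lambda>s. N (\<lambda>z. (c s z - c t z) / (s - t) - c' t z)) \<longlongrightarrow> 0) (at t within I)"
  using assms by (simp_all add: curve_derivative_def)

text \<open>
  The velocity \<open>U'\<close> on the half-line and the velocities on bounded intervals are
  representatives of the same classes, so the equations on bounded intervals hold for
  \<open>U'\<close>.
\<close>

lemma weak_solution_trajectory:
  assumes l: "l > 0" and \<sigma>: "0 < \<sigma>" "\<sigma> < 1 / 2" and F: "F \<in> L2 l"
    and forms: "plate_forms (H2_star l) (inner2 l \<sigma>) (\<lambda>u v. inner0 l (weak_deriv l 1 0 u) (weak_deriv l 1 0 v))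
     (L2 l) (inner0 l) (weak_deriv l 2 0) Cb Ch Cd"
    and sol: "weak_solution l \<sigma> \<delta> S P F U0 V0 U"
    and U': "curve_derivative (L2 l) (norm0 l) {0..} U U'"
  shows "trajectory (H2_star l) (inner2 l \<sigma>) (\<lambda>u v. inner0 l (weak_deriv l 1 0 u) (weak_deriv l 1 0 v))
     (L2 l) (inner0 l) (weak_deriv l 2 0) Cb Ch Cd U U'
     (\<lambda>t x. F x - \<delta> * U' t x + (- P + S * inner0 l (weak_deriv l 1 0 (U t)) (weak_deriv l 1 0 (U t))) * weak_deriv l 2 0 (U t) x)"
proof -
  let ?b = "\<lambda>u v. inner0 l (weak_deriv l 1 0 u) (weak_deriv l 1 0 v)"
  interpret PF: plate_forms "H2_star l" "inner2 l \<sigma>" ?b "L2 l" "inner0 l" "weak_deriv l 2 0" Cb Ch Cd by (rule forms)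
  have nA: "norm2 l \<sigma> = PF.A.nrm" by (simp add: fun_eq_iff PF.A.nrm_def norm2_def)
  define \<phi> where "\<phi> = (\<lambda>t. - P + S * ?b (U t) (U t))"
  define g where "g = (\<lambda>t x. F x - \<delta> * U' t x + \<phi> t * weak_deriv l 2 0 (U t) x)"
  have upto: "weak_solution_upto l \<sigma> \<delta> S P F U0 V0 (t + 1) U" if "0 < t" for t
    using sol that by (simp add: weak_solution_def)
  \<comment> \<open>near a positive time \<open>t\<close> the interval \<open>[0, t + 1]\<close> is as good as the half-line\<close>
  have at: "at t within {0..t + 1} = at t" if "0 < t" for t :: real
    using that by (intro at_within_Icc_at) auto
  have at': "at t within {0..} = at t" if "0 < t" for t :: real
    by (rule at_within_interior) (use that in \<open>simp add: interior_real_atLeast\<close>)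
  have Uc: "continuous_curve (H2_star l) (norm2 l \<sigma>) {0..t + 1} U" if "0 < t" for t
    using upto[OF that] by (simp add: weak_solution_upto_def)
  have u_mem: "U t \<in> H2_star l" and u_cont: "((\<lambda>s. PF.A.nrm (\<lambda>x. U s x - U t x)) \<longlongrightarrow> 0) (at t)" if t: "0 < t" for t
    using continuous_curveD[OF Uc[OF t], of t] t unfolding at[OF t] nA by simp_all
  have v_mem: "U' t \<in> L2 l" and u_deriv: "((\<lambda>s. L2.nrm l (\<lambda>x. (U s x - U t x) / (s - t) - U' t x)) \<longlongrightarrow> 0) (at t)" if t: "0 < t" for t
    using curve_derivativeD[OF U', of t] t unfolding at'[OF t] norm0_eq by simp_all
  have ev_u: "\<forall>\<^sub>F s in at t. U s \<in> H2_star l" and ev_v: "\<forall>\<^sub>F s in at t. U' s \<in> L2 l" if t: "0 < t" for t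
    using eventually_at_pos[OF t] by (auto elim!: eventually_mono intro: u_mem v_mem)
  have g_mem: "g t \<in> L2 l" if t: "0 < t" for t
  proof -
    have "(\<lambda>x. F x - \<delta> * U' t x) \<in> L2 l" by (intro L2.diff_mem L2.scale_mem F v_mem t)
    from L2.comb_mem[OF this PF.D_mem[OF u_mem[OF t]], of 1 "\<phi> t"] show ?thesis by (simp add: g_def)
  qed
  have local: "\<exists>V' V''. curve_derivative (L2 l) (norm0 l) {0..t + 1} U V' \<and> continuous_curve (L2 l) (norm0 l) {0..t + 1} V' \<and>
      curve_derivative (dual_space l \<sigma>) (dual_norm l \<sigma>) {0..t + 1} (\<lambda>t. inner0 l (V' t)) V'' \<and>
      (\<forall>r\<in>{0..t + 1}. \<forall>y\<in>H2_star l. V'' r y + \<delta> * inner0 l (V' r) y + inner2 l \<sigma> (U r) y + \<phi> r * ?b (U r) y = inner0 l F y)"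
    if t: "0 < t" for t
  proof -
    have "nonlocal_coeff l S P (U r) = \<phi> r" for r by (simp add: nonlocal_coeff_def \<phi>_def inner0_def power2_eq_square)
    then show ?thesis using upto[OF t] unfolding weak_solution_upto_def by auto
  qed
  \<comment> \<open>two derivatives of the same curve are at distance zero\<close>
  have same: "L2.nrm l (\<lambda>x. U' r x - V' r x) = 0"
    if V': "curve_derivative (L2 l) (norm0 l) {0..t + 1} U V'" and r: "0 < r" "r < t + 1" for t r V'
  proof -
    let ?q = "\<lambda>s x. (U s x - U r x) / (s - r)"
    have atr: "at r within {0..t + 1} = at r" using r by (intro at_within_Icc_at) auto
    have m: "V' r \<in> L2 l" and d: "((\<lambda>s. L2.nrm l (\<lambda>x. ?q s x - V' r x)) \<longlongrightarrow> 0) (at r)"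
      using curve_derivativeD[OF V', of r] r unfolding atr norm0_eq by simp_all
    have lim: "((\<lambda>s. L2.nrm l (\<lambda>x. ?q s x - U' r x) + L2.nrm l (\<lambda>x. ?q s x - V' r x)) \<longlongrightarrow> 0 + 0) (at r)"
      by (intro tendsto_add u_deriv r d)
    have "L2.nrm l (\<lambda>x. U' r x - V' r x) \<le> 0 + 0"
    proof (rule tendsto_lowerbound[OF lim])
      show "\<forall>\<^sub>F s in at r. L2.nrm l (\<lambda>x. U' r x - V' r x) \<le> L2.nrm l (\<lambda>x. ?q s x - U' r x) + L2.nrm l (\<lambda>x. ?q s x - V' r x)"
        using ev_u[OF r(1)]
      proof eventually_elim
        case (elim s)
        have q: "?q s \<in> L2 l"
          using L2.scale_mem[OF L2.diff_mem[OF H2_star_L2[OF elim] H2_star_L2[OF u_mem[OF r(1)]]], of "1 / (s - r)"] by simp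
        show ?case using L2.nrm_triangle_diff[OF v_mem[OF r(1)] q m] L2.nrm_diff_commute[OF v_mem[OF r(1)] q] by simp
      qed
    qed simp
    moreover have "0 \<le> L2.nrm l (\<lambda>x. U' r x - V' r x)" by (intro L2.nrm_nonneg L2.diff_mem v_mem r m)
    ultimately show ?thesis by simp
  qed
  have v_cont: "((\<lambda>s. L2.nrm l (\<lambda>x. U' s x - U' t x)) \<longlongrightarrow> 0) (at t)" if t: "0 < t" for t
  proof -
    obtain V' where V': "curve_derivative (L2 l) (norm0 l) {0..t + 1} U V'" and c: "continuous_curve (L2 l) (norm0 l) {0..t + 1} V'"
      using local[OF t] by blast
    have m: "V' r \<in> L2 l" if "r \<in> {0..t + 1}" for r by (rule continuous_curveD(1)[OF c that])
    have lim: "((\<lambda>s. L2.nrm l (\<lambda>x. V' s x - V' t x)) \<longlongrightarrow> 0) (at t)"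
      using continuous_curveD(2)[OF c, of t] t unfolding at[OF t] norm0_eq by simp
    have ev: "\<forall>\<^sub>F s in at t. s < t + 1" by (rule order_tendstoD(2)[OF tendsto_ident_at]) simp
    show ?thesis
    proof (rule Lim_null_comparison[OF _ lim])
      show "\<forall>\<^sub>F s in at t. norm (L2.nrm l (\<lambda>x. U' s x - U' t x)) \<le> L2.nrm l (\<lambda>x. V' s x - V' t x)"
        using eventually_at_pos[OF t] ev
      proof eventually_elim
        case (elim s)
        note mem = v_mem[OF elim(1)] v_mem[OF t] m[of s] m[of t]
        have ms: "V' s \<in> L2 l" "V' t \<in> L2 l" using elim t by (auto intro: m)
        have "L2.nrm l (\<lambda>x. U' s x - U' t x) \<le> L2.nrm l (\<lambda>x. U' s x - V' s x) + (L2.nrm l (\<lambda>x. V' s x - V' t x) + L2.nrm l (\<lambda>x. V' t x - U' t x))"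
          using L2.nrm_triangle_diff[OF mem(1) ms(1) mem(2)] L2.nrm_triangle_diff[OF ms mem(2)] by simp
        also have "\<dots> = L2.nrm l (\<lambda>x. V' s x - V' t x)"
          using same[OF V' elim] same[OF V' t] L2.nrm_diff_commute[OF ms(2) mem(2)] by simp
        finally show ?case using L2.nrm_nonneg[OF L2.diff_mem[OF mem(1,2)]] by simp
      qed
    qed
  qed
  have \<phi>_cont: "(\<phi> \<longlongrightarrow> \<phi> t) (at t)" if t: "0 < t" for t
    unfolding \<phi>_def by (intro tendsto_intros PF.B.ip_tendsto PF.B_lim ev_u u_mem u_cont t)
  have g_cont: "((\<lambda>s. L2.nrm l (\<lambda>x. g s x - g t x)) \<longlongrightarrow> 0) (at t)" if t: "0 < t" for t
  proof -
    have evD: "\<forall>\<^sub>F s in at t. weak_deriv l 2 0 (U s) \<in> L2 l" using ev_u[OF t] by eventually_elim (rule PF.D_mem)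
    have evp: "\<forall>\<^sub>F s in at t. (\<lambda>x. F x + (- \<delta>) * U' s x) \<in> L2 l"
      using ev_v[OF t] by eventually_elim (use L2.comb_mem[OF F, of _ 1 "- \<delta>"] in simp)
    have pt: "(\<lambda>x. F x + (- \<delta>) * U' t x) \<in> L2 l" using L2.comb_mem[OF F v_mem[OF t], of 1 "- \<delta>"] by simp
    have p: "((\<lambda>s. L2.nrm l (\<lambda>x. (F x + (- \<delta>) * U' s x) - (F x + (- \<delta>) * U' t x))) \<longlongrightarrow> 0) (at t)"
      by (rule L2.comb_tendsto[OF always_eventually ev_v[OF t] F v_mem[OF t] L2.tendsto_const_curve[OF F] v_cont[OF t] tendsto_const]) (simp add: F)
    have "((\<lambda>s. L2.nrm l (\<lambda>x. ((F x + (- \<delta>) * U' s x) + \<phi> s * weak_deriv l 2 0 (U s) x) - ((F x + (- \<delta>) * U' t x) + \<phi> t * weak_deriv l 2 0 (U t) x))) \<longlongrightarrow> 0) (at t)"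
      by (rule L2.comb_tendsto[OF evp evD pt PF.D_mem[OF u_mem[OF t]] p PF.D_lim[OF ev_u[OF t] u_mem[OF t] u_cont[OF t]] \<phi>_cont[OF t]])
    then show ?thesis by (simp add: g_def)
  qed
  have weak: "\<exists>m. (m \<longlongrightarrow> 0) (at t) \<and> (\<forall>\<^sub>F s in at t. \<forall>y\<in>H2_star l.
      \<bar>(inner0 l (U' s) y - inner0 l (U' t) y) / (s - t) - (inner0 l (g t) y - inner2 l \<sigma> (U t) y)\<bar> \<le> m s * PF.A.nrm y)" if t: "0 < t" for t
  proof -
    obtain V' V'' where V': "curve_derivative (L2 l) (norm0 l) {0..t + 1} U V'" and c: "continuous_curve (L2 l) (norm0 l) {0..t + 1} V'"
      and V'': "curve_derivative (dual_space l \<sigma>) (dual_norm l \<sigma>) {0..t + 1} (\<lambda>t. inner0 l (V' t)) V''"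
      and eq: "\<And>r y. r \<in> {0..t + 1} \<Longrightarrow> y \<in> H2_star l \<Longrightarrow> V'' r y + \<delta> * inner0 l (V' r) y + inner2 l \<sigma> (U r) y + \<phi> r * ?b (U r) y = inner0 l F y"
      using local[OF t] by blast
    have m: "V' r \<in> L2 l" if "r \<in> {0..t + 1}" for r by (rule continuous_curveD(1)[OF c that])
    have same_inner: "inner0 l (V' r) y = inner0 l (U' r) y" if r: "0 < r" "r < t + 1" and y: "y \<in> L2 l" for r y
    proof -
      have mr: "V' r \<in> L2 l" using r by (auto intro: m)
      have "inner0 l (\<lambda>x. U' r x - V' r x) y = 0"
        by (rule L2.nrm_eq_0_ip[OF L2.diff_mem[OF v_mem[OF r(1)] mr] y same[OF V' r]])
      then show ?thesis using L2.ip_diff[OF v_mem[OF r(1)] mr y] by simp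
    qed
    let ?\<Phi> = "\<lambda>s f. (inner0 l (V' s) f - inner0 l (V' t) f) / (s - t) - V'' t f"
    let ?m = "\<lambda>s. dual_norm l \<sigma> (?\<Phi> s)"
    have lim: "(?m \<longlongrightarrow> 0) (at t)" using curve_derivativeD(3)[OF V'', of t] t unfolding at[OF t] by simp
    have dual: "inner0 l (V' r) \<in> dual_space l \<sigma>" "V'' r \<in> dual_space l \<sigma>" if "r \<in> {0..t + 1}" for r
      using curve_derivativeD(1,2)[OF V'' that] by simp_all
    have ev: "\<forall>\<^sub>F s in at t. s < t + 1" by (rule order_tendstoD(2)[OF tendsto_ident_at]) simp
    have "\<forall>\<^sub>F s in at t. \<forall>y\<in>H2_star l.
      \<bar>(inner0 l (U' s) y - inner0 l (U' t) y) / (s - t) - (inner0 l (g t) y - inner2 l \<sigma> (U t) y)\<bar> \<le> ?m s * PF.A.nrm y"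
      using eventually_at_pos[OF t] ev
    proof eventually_elim
      case (elim s)
      have st: "s \<in> {0..t + 1}" "t \<in> {0..t + 1}" using elim t by auto
      have "(\<lambda>f. 1 * (1 / (s - t) * inner0 l (V' s) f + (- 1 / (s - t)) * inner0 l (V' t) f) + (-1) * V'' t f) \<in> dual_space l \<sigma>"
        by (rule dual_space_comb[OF l \<sigma> dual_space_comb[OF l \<sigma> dual(1)[OF st(1)] dual(1)[OF st(2)]] dual(2)[OF st(2)]])
      then have \<Phi>: "?\<Phi> s \<in> dual_space l \<sigma>" by (simp add: diff_divide_distrib)
      show ?case
      proof
        fix y assume y: "y \<in> H2_star l"
        have yL: "y \<in> L2 l" by (rule H2_star_L2[OF y])
        have fv: "(\<lambda>x. 1 * F x + (- \<delta>) * U' t x) \<in> L2 l" by (intro L2.comb_mem F v_mem t)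
        have "inner0 l (g t) y = inner0 l (\<lambda>x. 1 * F x + (- \<delta>) * U' t x) y + \<phi> t * inner0 l (weak_deriv l 2 0 (U t)) y"
          using L2.ip_comb[OF fv PF.D_mem[OF u_mem[OF t]] yL, of 1 "\<phi> t"] by (simp add: g_def)
        then have "inner0 l (g t) y = inner0 l F y - \<delta> * inner0 l (U' t) y - \<phi> t * ?b (U t) y"
          using L2.ip_comb[OF F v_mem[OF t] yL, of 1 "- \<delta>"] PF.b_D[OF u_mem[OF t] y] by simp
        then have "V'' t y = inner0 l (g t) y - inner2 l \<sigma> (U t) y"
          using eq[OF st(2) y] same_inner[OF t _ yL] by simp
        then show "\<bar>(inner0 l (U' s) y - inner0 l (U' t) y) / (s - t) - (inner0 l (g t) y - inner2 l \<sigma> (U t) y)\<bar> \<le> ?m s * PF.A.nrm y"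
          using dual_norm_bound[OF l \<sigma> \<Phi> y] same_inner[OF elim yL] same_inner[OF t _ yL] unfolding nA by simp
      qed
    qed
    then show ?thesis using lim by blast
  qed
  have "trajectory (H2_star l) (inner2 l \<sigma>) ?b (L2 l) (inner0 l) (weak_deriv l 2 0) Cb Ch Cd U U' g"
    by unfold_locales (fact u_mem v_mem g_mem u_cont u_deriv v_cont g_cont weak)+
  then show ?thesis by (simp only: g_def \<phi>_def)
qed

theorem theorem4:
  fixes l \<sigma> \<delta> S P :: real
    and F U0 V0 :: "real \<times> real \<Rightarrow> real"
    and U U' :: "real \<Rightarrow> real \<times> real \<Rightarrow> real"
  assumes "0 < \<sigma>" and "\<sigma> < 1 / 2" and "l > 0"
    and "\<delta> > 0" and "S > 0"
    and "U0 \<in> H2_star l" and "V0 \<in> L2 l" and "F \<in> L2 l"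
    and "0 \<le> P" and "P \<le> Lambda1 l \<sigma>"
    and "weak_solution l \<sigma> \<delta> S P F U0 V0 U"
    and "curve_derivative (L2 l) (norm0 l) {0..} U U'"
  shows "\<exists>Ubar. stationary_solution l \<sigma> S P F Ubar \<and>
           (\<forall>W. stationary_solution l \<sigma> S P F W \<longrightarrow>
                (AE z in lebesgue_on (plate l). W z = Ubar z)) \<and>
           ((\<lambda>t. norm2 l \<sigma> (\<lambda>z. U t z - Ubar z)) \<longlongrightarrow> 0) at_top \<and>
           ((\<lambda>t. norm0 l (U' t)) \<longlongrightarrow> 0) at_top"
proof -
  let ?b = "\<lambda>u v. inner0 l (weak_deriv l 1 0 u) (weak_deriv l 1 0 v)"
  note \<sigma> = assms(1,2) and l = assms(3) and \<delta> = assms(4) and S = assms(5) and F = assms(8) and P = assms(9)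
  obtain Cb Ch Cd where forms: "plate_forms (H2_star l) (inner2 l \<sigma>) ?b (L2 l) (inner0 l) (weak_deriv l 2 0) Cb Ch Cd"
    using plate_forms_H2_star[OF l \<sigma>] by blast
  interpret T: trajectory "H2_star l" "inner2 l \<sigma>" ?b "L2 l" "inner0 l" "weak_deriv l 2 0" Cb Ch Cd U U'
    "\<lambda>t x. F x - \<delta> * U' t x + (- P + S * ?b (U t) (U t)) * weak_deriv l 2 0 (U t) x"
    by (rule weak_solution_trajectory[OF l \<sigma> F forms assms(11,12)])
  have nA: "norm2 l \<sigma> = T.A.nrm" by (simp add: fun_eq_iff T.A.nrm_def norm2_def)
  note P_le = Lambda1_bound[OF l \<sigma> assms(10)]
  obtain W where W: "T.critical S P F W" using T.exists_critical[OF S P F P_le] by blast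
  have crit: "T.critical S P F X \<longleftrightarrow> stationary_solution l \<sigma> S P F X" for X
    by (rule critical_iff_stationary[OF forms])
  have unique: "AE z in plate_measure l. X z = W z" if "stationary_solution l \<sigma> S P F X" for X
  proof -
    have X: "T.critical S P F X" using that crit by blast
    have m: "X \<in> H2_star l" "W \<in> H2_star l" using X W unfolding T.critical_def by blast+
    have d: "(\<lambda>z. X z - W z) \<in> H2_star l" by (rule T.A.diff_mem[OF m])
    have "T.A.nrm (\<lambda>z. X z - W z) = 0" by (rule T.critical_unique[OF S P F P_le W X])
    then have "T.B.nrm (\<lambda>z. X z - W z) = 0"
      using T.B_nrm_le[OF d] T.B.nrm_nonneg[OF d] by (intro order_antisym) simp_all
    then have "L2.nrm l (\<lambda>z. X z - W z) = 0"
      using T.H_nrm_le[OF d] L2.nrm_nonneg[OF H2_star_L2[OF d]] by (intro order_antisym) simp_all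
    then show ?thesis using inner0_self_eq_0_iff[OF H2_star_L2[OF d]] by (simp add: L2.nrm_def)
  qed
  note conv = T.damped_trajectory_converges[OF S P F \<delta> P_le W refl]
  show ?thesis
  proof (intro exI[of _ W] conjI allI impI)
    show "stationary_solution l \<sigma> S P F W" using W crit by blast
    show "AE z in plate_measure l. X z = W z" if "stationary_solution l \<sigma> S P F X" for X
      by (rule unique[OF that])
    show "((\<lambda>t. norm2 l \<sigma> (\<lambda>z. U t z - W z)) \<longlongrightarrow> 0) at_top" unfolding nA by (rule conv(1))
    show "((\<lambda>t. norm0 l (U' t)) \<longlongrightarrow> 0) at_top" unfolding norm0_eq by (rule conv(2))
  qed
qed

end
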